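(* Let $\Omega$ be a periodic domain in $\mathbb R^3$, $u_0\in\mathbb H^2\cap\mathbb V$, $\kappa>0$, and let $r=1$ or $r\ge2$. For $r>2$ there is a constant $C_r>0$ depending only on $r$ such that the following holds (for $r=1$ and $r=2$ no such constant is needed). Let $\widetilde U\in\mathcal U_{ad}$ be any control which, with its adjoint state $\varphi_{\widetilde U}$, satisfies the variational inequality $$\int_{\Omega_T}(\varphi_{\widetilde U}+\lambda\widetilde U)\cdot(U-\widetilde U)\,dx\,dt\ge0\qquad\text{for all }U\in\mathcal U_{ad}.$$ In addition, assume $$\frac\kappa2\ \ge\ \begin{cases} C\big(\|\varphi_{\widetilde U}\|_{L^\infty(0,T;\mathbb V)}+2\beta C_r\,\widetilde C_2^{\,r-2}\,\|\varphi_{\widetilde U}\|_{L^\infty(0,T;\mathbb H)}\big) & \text{if } r>2,\\[1mm] C\big(\|\varphi_{\widetilde U}\|_{L^\infty(0,T;\mathbb V)}+4\beta\|\varphi_{\widetilde U}\|_{L^\infty(0,T;\mathbb H)}\big) & \text{if } r=2,\\[1mm] C\,\|\varphi_{\widetilde U}\|_{L^\infty(0,T;\mathbb V)} & \text{if } r=1.\end{cases}$$ Then $\widetilde U$ is a global optimal control, i.e. $\mathfrak J(\widetilde U)\le\mathfrak J(U)$ for all $U\in\mathcal U_{ad}$. Furthermore, if the strict inequality $$\frac\kappa2\ >\ \begin{cases} C\big(\|\varphi_{\widetilde U}\|_{L^\infty(0,T;\mathbb V)}+2\beta C_r\,\widetilde C_2^{\,r-2}\,\|\varphi_{\widetilde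 U}\|_{L^\infty(0,T;\mathbb H)}\big) & \text{if } r>2,\\[1mm] C\big(\|\varphi_{\widetilde U}\|_{L^\infty(0,T;\mathbb V)}+4\beta\|\varphi_{\widetilde U}\|_{L^\infty(0,T;\mathbb H)}\big) & \text{if } r=2,\\[1mm] C\,\|\varphi_{\widetilde U}\|_{L^\infty(0,T;\mathbb V)} & \text{if } r=1\end{cases}$$ holds, then the global optimal control $\widetilde U$ is unique.
   Context: Periodic setting: $\Omega=[0,\mathrm L]^3$ with period $\mathrm L>0$ in each direction, $0<T<\infty$, $\Omega_T=\Omega\times(0,T]$. $\mathbb H,\mathbb V,\mathbb H^2,\mathbb L^p$ denote the spaces of $\Omega$-periodic, divergence-free vector fields on $\mathbb R^3$ with zero mean over $\Omega$ which are locally in $L^2,H^1,H^2,L^p$, respectively; $\|v\|_{\mathbb H}=\|v\|_{L^2(\Omega)}$, $\|v\|_{\mathbb V}=\|\nabla v\|_{L^2(\Omega)}$. $(\cdot,\cdot)$ is the $L^2(\Omega)$ inner product, $\mathrm b(u,v,w)=\int_\Omega(u\cdot\nabla)v\cdot w\,dx$. State system ($\mu,\nu,\alpha,\beta>0$): $u_t-\mu\Delta u_t-\nu\Delta u+(u\cdot\nabla)u+\nabla p+\alpha u+\beta|u|^{r-1}u=U$, $\nabla\cdot u=0$ in $\Omega_T$, $u(x,0)=u_0$. Strong solution: $u\in H^1(0,T;\mathbb H^2)\cap L^\infty(0,T;\mathbb L^{r+1})$ with $u(0)=u_0$ and, for all $v\in\mathbb V\cap\mathbb L^{r+1}$, a.e.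 $t$, $(u_t,v)+\mu(\nabla u_t,\nabla v)+\nu(\nabla u,\nabla v)+\mathrm b(u,u,v)+\alpha(u,v)+\beta\langle|u|^{r-1}u,v\rangle=(U,v)$. Controls: $\mathcal U_{ad}=\{U\in L^2(0,T;\mathbb H):U_{\min}\le U\le U_{\max}\text{ a.e. in }\Omega_T\}$ (componentwise), where $U_{\min}\le U_{\max}$ are given in $L^\infty(\Omega_T)$; $\mathcal U$ is a non-empty open bounded subset of $L^2(0,T;\mathbb H)$ containing $\mathcal U_{ad}$. For $U\in\mathcal U$, $u_U$ is the unique strong solution with control $U$. With given $u_d\in L^2(0,T;\mathbb V)$ and $\lambda\ge0$, $$\mathfrak J(U)=\frac\kappa2\int_0^T\|\nabla(u_U-u_d)\|_{\mathbb H}^2dt+\frac\lambda2\int_0^T\|U\|_{\mathbb H}^2dt .$$ Derivative of $f(u)=|u|^{r-1}u$: $f'(z)w=(r-1)|z|^{r-3}(z\cdot w)z+|z|^{r-1}w$ for $r\ge3$, and for $1<r<3$, $z\ne0$; $f'(0)w=0$ for $1<r<3$; $f'(z)w=w$ for $r=1$. Adjoint state: for $U\in\mathcal U$, $\varphi_U\in H^1(0,T;\mathbb V)$ is the unique function such that for all $v\in\mathbb V$, a.e. $t$, $$-(\varphi_t,v)-\mu(\nabla\varphi_t,\nabla v)+\nu(\nabla\varphi,\nabla v)+\mathrm b(v,u_U,\varphi)-\mathrm b(u_U,\varphi,v)+\alpha(\varphi,v)+\beta(f'(u_U)\varphi,v)=\kappa(\nabla(u_U-u_d),\nabla v)$$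 and $(\varphi(T),v)+\mu(\nabla\varphi(T),\nabla v)=0$ for all $v\in\mathbb V$. Constants: $C>0$ is the constant with $\|v\|_{\mathbb L^4}\le\sqrt C\,\|v\|_{\mathbb V}$ for all $v\in\mathbb V$, so that $|\mathrm b(u,v,w)|\le\|u\|_{\mathbb L^4}\|\nabla v\|_{\mathbb H}\|w\|_{\mathbb L^4}\le C\|u\|_{\mathbb V}\|v\|_{\mathbb V}\|w\|_{\mathbb V}$ for $u,v,w\in\mathbb V$. $\widetilde C_2:=C_*\sqrt{C_2}$, where $C_*$ is such that $\|v\|_{L^\infty}\le C_*\|v\|_{\mathbb H^2}$ and $C_2>0$ is the constant of the a priori estimate for strong solutions; in particular $\sup_{t\in(0,T]}\|u_U(t)\|_{\mathbb H^2}^2\le C_2$ for all $U\in\mathcal U$. *)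

theory Defs
  imports "HOL-Analysis.Analysis" "HOL-Probability.Essential_Supremum"
begin

text \<open>
  Elements of Lebesgue and Sobolev spaces are represented by Borel measurable functions
  (every class has a Borel representative); statements about them are invariant under changes on
  null sets. A time dependent field is a function \<^typ>\<open>real \<Rightarrow> real^3 \<Rightarrow> real^3\<close>.
\<close>

type_synonym field = "real^3 \<Rightarrow> real^3"
type_synonym tfield = "real \<Rightarrow> field"


section \<open>Weak derivatives\<close>

primrec Ck :: "nat \<Rightarrow> ('a::euclidean_space \<Rightarrow> real) \<Rightarrow> bool" where
  "Ck 0 = (\<lambda>f. continuous_on UNIV f)"
| "Ck (Suc k) = (\<lambda>f. (\<forall>x. f differentiable (at x)) \<and>
      (\<forall>b\<in>Basis. Ck k (\<lambda>x. frechet_derivative f (at x) b)))"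

definition test_function :: "'a::euclidean_space set \<Rightarrow> ('a \<Rightarrow> real) \<Rightarrow> bool" where
  "test_function S \<psi> \<longleftrightarrow> (\<forall>k. Ck k \<psi>) \<and>
     compact (closure {x. \<psi> x \<noteq> 0}) \<and> closure {x. \<psi> x \<noteq> 0} \<subseteq> S"

definition locally_Lp :: "real \<Rightarrow> ('a::euclidean_space \<Rightarrow> 'b::euclidean_space) \<Rightarrow> bool" where
  "locally_Lp p f \<longleftrightarrow> f \<in> borel_measurable borel \<and>
     (\<forall>K. compact K \<longrightarrow> set_integrable lborel K (\<lambda>x. norm (f x) powr p))"

definition weak_partial :: "3 \<Rightarrow> field \<Rightarrow> field \<Rightarrow> bool" where
  "weak_partial j f g \<longleftrightarrow> locally_Lp 1 f \<and> locally_Lp 1 g \<and>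
     (\<forall>\<psi>. test_function UNIV \<psi> \<longrightarrow>
        (LINT x|lborel. frechet_derivative \<psi> (at x) (axis j 1) *\<^sub>R f x)
          = - (LINT x|lborel. \<psi> x *\<^sub>R g x))"

text \<open>A representative of the weak partial derivative, which is unique up to null sets;
  only meaningful if a weak partial derivative exists.\<close>

definition wD :: "3 \<Rightarrow> field \<Rightarrow> field" where
  "wD j f = (SOME g. weak_partial j f g)"

primrec locally_Hk :: "nat \<Rightarrow> field \<Rightarrow> bool" where
  "locally_Hk 0 = locally_Lp 2"
| "locally_Hk (Suc k) = (\<lambda>v. locally_Lp 2 v \<and>
      (\<forall>j. (\<exists>g. weak_partial j v g) \<and> locally_Hk k (wD j v)))"


section \<open>Spaces of periodic divergence-free fields with zero mean\<close>

definition cell :: "real \<Rightarrow> (real^3) set" where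
  "cell L = cbox 0 (\<chi> i. L)"

text \<open>The second conjunct is the vanishing of the weak divergence, \<open>\<integral> v \<bullet> \<nabla>\<psi> = 0\<close>.\<close>

definition solenoidal :: "real \<Rightarrow> field \<Rightarrow> bool" where
  "solenoidal L v \<longleftrightarrow>
     (\<forall>x i. v (x + L *\<^sub>R axis i 1) = v x) \<and>
     (\<forall>\<psi>. test_function UNIV \<psi> \<longrightarrow> (LINT x|lborel. frechet_derivative \<psi> (at x) (v x)) = 0) \<and>
     (LINT x:cell L|lborel. v x) = 0"

definition H_space :: "real \<Rightarrow> field set" where
  "H_space L = {v. solenoidal L v \<and> locally_Hk 0 v}"

definition V_space :: "real \<Rightarrow> field set" where
  "V_space L = {v. solenoidal L v \<and> locally_Hk 1 v}"

definition H2_space :: "real \<Rightarrow> field set" where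
  "H2_space L = {v. solenoidal L v \<and> locally_Hk 2 v}"

definition Lp_space :: "real \<Rightarrow> real \<Rightarrow> field set" where
  "Lp_space L p = {v. solenoidal L v \<and> locally_Lp p v}"

definition ip :: "real \<Rightarrow> field \<Rightarrow> field \<Rightarrow> real" where
  "ip L u v = (LINT x:cell L|lborel. u x \<bullet> v x)"

definition grad_ip :: "real \<Rightarrow> field \<Rightarrow> field \<Rightarrow> real" where
  "grad_ip L u v = (\<Sum>j\<in>UNIV. ip L (wD j u) (wD j v))"

definition H_norm :: "real \<Rightarrow> field \<Rightarrow> real" where
  "H_norm L v = sqrt (ip L v v)"

definition V_norm :: "real \<Rightarrow> field \<Rightarrow> real" where
  "V_norm L v = sqrt (grad_ip L v v)"

text \<open>The full Sobolev norm of second order.\<close>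

definition H2_norm :: "real \<Rightarrow> field \<Rightarrow> real" where
  "H2_norm L v = sqrt (ip L v v + grad_ip L v v + (\<Sum>j\<in>UNIV. grad_ip L (wD j v) (wD j v)))"

definition Lp_norm :: "real \<Rightarrow> real \<Rightarrow> field \<Rightarrow> real" where
  "Lp_norm L p v = (LINT x:cell L|lborel. norm (v x) powr p) powr (1 / p)"

definition Linf_norm :: "real \<Rightarrow> field \<Rightarrow> ereal" where
  "Linf_norm L v = esssup (lebesgue_on (cell L)) (\<lambda>x. ereal (norm (v x)))"

definition trilinear :: "real \<Rightarrow> field \<Rightarrow> field \<Rightarrow> field \<Rightarrow> real" where
  "trilinear L u v w = ip L (\<lambda>x. \<Sum>j\<in>UNIV. (u x $ j) *\<^sub>R wD j v x) w"


section \<open>Spaces of time dependent fields\<close>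

text \<open>
  \<^term>\<open>L2_time T k X N\<close> is \<open>L\<^sup>2(0,T;X)\<close> for a space \<^term>\<open>X\<close> of order \<^term>\<open>k\<close> with norm
  \<^term>\<open>N\<close>. Strong measurability into \<^term>\<open>X\<close> is expressed by \<open>L\<^sup>2(0,T;L\<^sup>2(\<Omega>)) = L\<^sup>2(\<Omega>\<^sub>T)\<close>:
  the field and its spatial weak derivatives up to order \<^term>\<open>k\<close> have jointly measurable
  versions. Integrals of functions of time only are taken with respect to the completed measure,
  since a norm \<^term>\<open>N (u t)\<close> is specified only for almost every \<^term>\<open>t\<close>.
\<close>

definition jointly_measurable :: "real \<Rightarrow> tfield \<Rightarrow> bool" where
  "jointly_measurable T u \<longleftrightarrow>
     set_borel_measurable lborel ({0..T} \<times> (UNIV :: (real^3) set)) (\<lambda>(t, x). u t x)"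

primrec meas_Hk :: "real \<Rightarrow> nat \<Rightarrow> tfield \<Rightarrow> bool" where
  "meas_Hk T 0 = jointly_measurable T"
| "meas_Hk T (Suc k) = (\<lambda>u. jointly_measurable T u \<and>
     (\<forall>j. \<exists>g. meas_Hk T k g \<and> (AE t\<in>{0<..<T} in lebesgue. weak_partial j (u t) (g t))))"

definition L2_time :: "real \<Rightarrow> nat \<Rightarrow> field set \<Rightarrow> (field \<Rightarrow> real) \<Rightarrow> tfield set" where
  "L2_time T k X N = {u. meas_Hk T k u \<and> (AE t\<in>{0<..<T} in lebesgue. u t \<in> X) \<and>
     set_integrable lebesgue {0..T} (\<lambda>t. (N (u t))\<^sup>2)}"

definition L2H :: "real \<Rightarrow> real \<Rightarrow> tfield set" where
  "L2H L T = L2_time T 0 (H_space L) (H_norm L)"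

definition L2V :: "real \<Rightarrow> real \<Rightarrow> tfield set" where
  "L2V L T = L2_time T 1 (V_space L) (V_norm L)"

definition L2H_norm :: "real \<Rightarrow> real \<Rightarrow> tfield \<Rightarrow> real" where
  "L2H_norm L T U = sqrt (LINT t:{0..T}|lebesgue. (H_norm L (U t))\<^sup>2)"

text \<open>
  \<^term>\<open>H1_time T k X N u ut\<close>: \<^term>\<open>u\<close> is the representative of an element of \<open>H\<^sup>1(0,T;X)\<close>
  that is continuous from \<open>[0,T]\<close> to \<^term>\<open>X\<close>, so that its values at all times are meaningful,
  and \<^term>\<open>ut\<close> is its weak time derivative. By Fubini, the Bochner integrals in the definition
  of the weak time derivative can be evaluated at almost every point.
\<close>

definition H1_time ::
  "real \<Rightarrow> nat \<Rightarrow> field set \<Rightarrow> (field \<Rightarrow> real) \<Rightarrow> tfield \<Rightarrow> tfield \<Rightarrow> bool" where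
  "H1_time T k X N u ut \<longleftrightarrow> u \<in> L2_time T k X N \<and> ut \<in> L2_time T k X N \<and>
     (\<forall>t\<in>{0..T}. u t \<in> X) \<and>
     (\<forall>s\<in>{0..T}. ((\<lambda>t. N (\<lambda>x. u t x - u s x)) \<longlongrightarrow> 0) (at s within {0..T})) \<and>
     (\<forall>\<psi>. test_function {0<..<T} \<psi> \<longrightarrow>
        (AE x in lborel. (LINT t:{0..T}|lborel. deriv \<psi> t *\<^sub>R u t x)
                         = - (LINT t:{0..T}|lborel. \<psi> t *\<^sub>R ut t x)))"

definition Linf_time_Lp :: "real \<Rightarrow> real \<Rightarrow> real \<Rightarrow> tfield set" where
  "Linf_time_Lp L T p = {u. jointly_measurable T u \<and>
     (AE t\<in>{0<..<T} in lebesgue. u t \<in> Lp_space L p) \<and>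
     (\<exists>M. AE t\<in>{0<..<T} in lebesgue. Lp_norm L p (u t) \<le> M)}"

definition Linf_time_norm :: "real \<Rightarrow> (field \<Rightarrow> real) \<Rightarrow> tfield \<Rightarrow> ereal" where
  "Linf_time_norm T N u = esssup (lebesgue_on {0<..<T}) (\<lambda>t. ereal (N (u t)))"

definition OmegaT :: "real \<Rightarrow> real \<Rightarrow> (real \<times> (real^3)) set" where
  "OmegaT L T = {0<..T} \<times> cell L"

definition Linf_OmegaT :: "real \<Rightarrow> real \<Rightarrow> tfield set" where
  "Linf_OmegaT L T = {w. set_borel_measurable lborel (OmegaT L T) (\<lambda>(t, x). w t x) \<and>
     (\<exists>M. AE z\<in>OmegaT L T in lborel. norm (w (fst z) (snd z)) \<le> M)}"


section \<open>State system, adjoint system and control problem\<close>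

definition damping :: "real \<Rightarrow> real^3 \<Rightarrow> real^3" where
  "damping r z = (norm z powr (r - 1)) *\<^sub>R z"

definition damping_deriv :: "real \<Rightarrow> real^3 \<Rightarrow> real^3 \<Rightarrow> real^3" where
  "damping_deriv r z w =
     (if r = 1 then w
      else if r < 3 \<and> z = 0 then 0
      else ((r - 1) * norm z powr (r - 3) * (z \<bullet> w)) *\<^sub>R z + (norm z powr (r - 1)) *\<^sub>R w)"

definition strong_solution ::
  "real \<Rightarrow> real \<Rightarrow> real \<Rightarrow> real \<Rightarrow> real \<Rightarrow> real \<Rightarrow> real \<Rightarrow> field \<Rightarrow> tfield \<Rightarrow> tfield \<Rightarrow> bool" where
  "strong_solution L T \<mu> \<nu> \<alpha> \<beta> r u0 U u \<longleftrightarrow>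
     (\<exists>ut. H1_time T 2 (H2_space L) (H2_norm L) u ut \<and>
       u \<in> Linf_time_Lp L T (r + 1) \<and>
       (AE x in lborel. u 0 x = u0 x) \<and>
       (\<forall>v \<in> V_space L \<inter> Lp_space L (r + 1). AE t\<in>{0<..<T} in lebesgue.
          ip L (ut t) v + \<mu> * grad_ip L (ut t) v + \<nu> * grad_ip L (u t) v
          + trilinear L (u t) (u t) v + \<alpha> * ip L (u t) v
          + \<beta> * ip L (\<lambda>x. damping r (u t x)) v
          = ip L (U t) v))"

definition adjoint_state ::
  "real \<Rightarrow> real \<Rightarrow> real \<Rightarrow> real \<Rightarrow> real \<Rightarrow> real \<Rightarrow> real \<Rightarrow> real \<Rightarrow> tfield \<Rightarrow> tfield \<Rightarrow> tfield \<Rightarrow> bool" where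
  "adjoint_state L T \<mu> \<nu> \<alpha> \<beta> r \<kappa> ud u \<phi> \<longleftrightarrow>
     (\<exists>\<phi>t. H1_time T 1 (V_space L) (V_norm L) \<phi> \<phi>t \<and>
       (\<forall>v \<in> V_space L. AE t\<in>{0<..<T} in lebesgue.
          - ip L (\<phi>t t) v - \<mu> * grad_ip L (\<phi>t t) v + \<nu> * grad_ip L (\<phi> t) v
          + trilinear L v (u t) (\<phi> t) - trilinear L (u t) (\<phi> t) v
          + \<alpha> * ip L (\<phi> t) v + \<beta> * ip L (\<lambda>x. damping_deriv r (u t x) (\<phi> t x)) v
          = \<kappa> * grad_ip L (\<lambda>x. u t x - ud t x) v) \<and>
       (\<forall>v \<in> V_space L. ip L (\<phi> T) v + \<mu> * grad_ip L (\<phi> T) v = 0))"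

definition admissible_controls :: "real \<Rightarrow> real \<Rightarrow> tfield \<Rightarrow> tfield \<Rightarrow> tfield set" where
  "admissible_controls L T Umin Umax = {U \<in> L2H L T. AE z\<in>OmegaT L T in lborel. \<forall>i.
      Umin (fst z) (snd z) $ i \<le> U (fst z) (snd z) $ i \<and>
      U (fst z) (snd z) $ i \<le> Umax (fst z) (snd z) $ i}"

definition open_in_L2H :: "real \<Rightarrow> real \<Rightarrow> tfield set \<Rightarrow> bool" where
  "open_in_L2H L T W \<longleftrightarrow> W \<subseteq> L2H L T \<and>
     (\<forall>U\<in>W. \<exists>e>0. \<forall>V\<in>L2H L T. L2H_norm L T (\<lambda>t x. V t x - U t x) < e \<longrightarrow> V \<in> W)"

definition bounded_in_L2H :: "real \<Rightarrow> real \<Rightarrow> tfield set \<Rightarrow> bool" where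
  "bounded_in_L2H L T W \<longleftrightarrow> W \<subseteq> L2H L T \<and> (\<exists>M. \<forall>U\<in>W. L2H_norm L T U \<le> M)"

text \<open>The argument \<^term>\<open>S\<close> is the control-to-state map \<open>U \<mapsto> u\<^sub>U\<close>.\<close>

definition cost ::
  "real \<Rightarrow> real \<Rightarrow> real \<Rightarrow> real \<Rightarrow> tfield \<Rightarrow> (tfield \<Rightarrow> tfield) \<Rightarrow> tfield \<Rightarrow> real" where
  "cost L T \<kappa> lam ud S U =
     \<kappa> / 2 * (LINT t:{0..T}|lebesgue. (V_norm L (\<lambda>x. S U t x - ud t x))\<^sup>2)
     + lam / 2 * (LINT t:{0..T}|lebesgue. (H_norm L (U t))\<^sup>2)"

definition variational_inequality ::
  "real \<Rightarrow> real \<Rightarrow> real \<Rightarrow> tfield set \<Rightarrow> tfield \<Rightarrow> tfield \<Rightarrow> bool" where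
  "variational_inequality L T lam Uad Ut \<phi> \<longleftrightarrow>
     (\<forall>U\<in>Uad. 0 \<le> (LINT z:OmegaT L T|lborel.
        (\<phi> (fst z) (snd z) + lam *\<^sub>R Ut (fst z) (snd z))
          \<bullet> (U (fst z) (snd z) - Ut (fst z) (snd z))))"

definition global_optimal :: "tfield set \<Rightarrow> (tfield \<Rightarrow> real) \<Rightarrow> tfield \<Rightarrow> bool" where
  "global_optimal Uad J Ut \<longleftrightarrow> Ut \<in> Uad \<and> (\<forall>U\<in>Uad. J Ut \<le> J U)"

definition threshold ::
  "real \<Rightarrow> real \<Rightarrow> real \<Rightarrow> real \<Rightarrow> real \<Rightarrow> real \<Rightarrow> real \<Rightarrow> tfield \<Rightarrow> ereal" where
  "threshold L T r \<beta> C Cr C2' \<phi> =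
     (if r > 2 then
        ereal C * (Linf_time_norm T (V_norm L) \<phi>
          + ereal (2 * \<beta> * Cr * C2' powr (r - 2)) * Linf_time_norm T (H_norm L) \<phi>)
      else if r = 2 then
        ereal C * (Linf_time_norm T (V_norm L) \<phi> + ereal (4 * \<beta>) * Linf_time_norm T (H_norm L) \<phi>)
      else ereal C * Linf_time_norm T (V_norm L) \<phi>)"

end

theory Submission
  imports Defs
begin

text \<open>
  The cost along a second admissible control \<open>U\<close> with state \<open>u\<close> is expanded around the candidate
  \<open>U'\<close> with state \<open>v\<close> and adjoint state \<open>\<phi>\<close>. With \<open>w = u - v\<close>, the gradient part of the cost changes by
  \<open>\<kappa> \<integral>(\<nabla>(v - u\<^sub>d), \<nabla>w) + \<kappa>/2 \<integral>|\<nabla>w|^2\<close>, and the control part likewise. Testing the adjoint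
  equation with \<open>u\<close> and with \<open>v\<close> and the two state equations with \<open>\<phi>\<close> turns the linear term into
  \<open>\<integral>(U - U', \<phi>)\<close>, up to two remainders: the convective one, \<open>b(w, w, \<phi>)\<close>, and the damping one,
  \<open>\<beta>(f(u) - f(v) - f'(v) w, \<phi>)\<close> (lemma \<open>cost_derivative_identity\<close>). Both are quadratic in \<open>w\<close>. The embedding
  of \<open>V\<close> into \<open>L\<^sup>4\<close> bounds the first by \<open>C |\<nabla>w|^2 |\<nabla>\<phi>|\<close>; for the second, \<open>f\<close> has a second order Taylor
  remainder at most \<open>(p^2 + 3 p) M\<^bsup>r-2\<^esup> |w|^2\<close> with \<open>p = r - 1\<close> on the ball of radius \<open>M\<close>, and \<open>M\<close> bounds the states
  pointwise (\<open>damping_remainder\<close>, \<open>remainder_estimate\<close>). The linear terms are non-negative by the variational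
  inequality, so that
  \<open>J(U) \<ge> J(U') + (\<kappa>/2 - q) \<integral>|\<nabla>w|^2\<close> whenever \<open>q\<close> bounds the weight of \<open>\<phi>\<close> in the threshold (\<open>cost_growth\<close>).
  This is the optimality of \<open>U'\<close>. The threshold carries the factor \<open>2 Cr\<close> in place of \<open>p^2 + 3 p\<close> for \<open>r > 2\<close>, which gives the
  witness for \<open>Cr\<close>, and the factor 4 for \<open>r = 2\<close>, which is \<open>p^2 + 3 p\<close> for \<open>p = 1\<close>.

  If the inequality is strict and \<open>U\<close> is optimal too, then \<open>w = 0\<close>. The difference \<open>D\<close> of the controls is then
  orthogonal, at almost every time, to every fixed divergence-free test field. A time average of \<open>D\<close> is itself
  divergence-free, so its mollification is such a test field; hence all time averages of \<open>D\<close> vanish, and so does \<open>D\<close>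
  (\<open>time_orthogonal_imp_zero\<close>).

  Most of the text supplies the calculus that these few lines take for granted, for weak derivatives given by test
  functions: smooth mollifiers, the product rule, the divergence theorem on a periodicity cell, and the antisymmetry
  of \<open>b\<close> that follows from it; for time dependent fields, the interchange of weak differentiation and time
  integration, continuity of \<open>t \<mapsto> (u t, v)\<close> with its fundamental theorem of calculus, and the product formula
  \<open>evolution_product\<close>. Two points need care. The state equation is given only for test fields in
  \<open>V \<inter> L\<^bsup>r+1\<^esup>\<close> and is extended to \<open>V\<close> by mollification. And all equations hold for each fixed test field at almost
  every time, whereas they are used with test fields that depend on time; continuity in time reduces this to
  countably many test fields (\<open>AE_test_swap\<close>).
\<close>

section \<open>Smooth functions and mollifiers\<close>

abbreviation lborel2 :: "('a::euclidean_space \<times> 'b::euclidean_space) measure" where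
  "lborel2 \<equiv> lborel \<Otimes>\<^sub>M lborel"

lemmas integrable_dominated = Bochner_Integration.integrable_bound

lemma Ck_Suc_imp_Ck: "Ck (Suc k) f ==> Ck k f"
proof (induction k arbitrary: f)
  case 0
  then show ?case by (auto simp: continuous_on_eq_continuous_at differentiable_imp_continuous_within)
next
  case (Suc k)
  then show ?case by (auto simp del: Ck.simps simp: Ck.simps(2))
qed

lemma Ck_const: "Ck k (%x. c)"
  by (induction k arbitrary: c) (auto simp: frechet_derivative_const)

lemma Ck_SucI:
  assumes "\<And>x. (f has_derivative f' x) (at x)" "\<And>b. b \<in> Basis ==> Ck k (%x. f' x b)"
  shows "Ck (Suc k) f"
proof -
  have "frechet_derivative f (at x) = f' x" for x using frechet_derivative_at[OF assms(1)] by metis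
  then show ?thesis using assms by (auto simp: differentiable_def)
qed

lemma Ck_SucD:
  assumes "Ck (Suc k) f"
  shows "(f has_derivative frechet_derivative f (at x)) (at x)"
    "b \<in> Basis ==> Ck k (%x. frechet_derivative f (at x) b)"
  using assms by (auto simp: frechet_derivative_works)

lemma Ck_add: "Ck k f ==> Ck k g ==> Ck k (%x. f x + g x)"
proof (induction k arbitrary: f g)
  case 0
  then show ?case by (auto intro: continuous_intros)
next
  case (Suc k)
  show ?case by (rule Ck_SucI[OF has_derivative_add[OF Ck_SucD(1)[OF Suc.prems(1)] Ck_SucD(1)[OF Suc.prems(2)]]])
      (intro Suc.IH Ck_SucD(2)[OF Suc.prems(1)] Ck_SucD(2)[OF Suc.prems(2)])
qed

lemma Ck_mult: "Ck k f ==> Ck k g ==> Ck k (%x. f x * g x)"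
proof (induction k arbitrary: f g)
  case 0
  then show ?case by (auto intro: continuous_intros)
next
  case (Suc k)
  show ?case by (rule Ck_SucI[OF has_derivative_mult[OF Ck_SucD(1)[OF Suc.prems(1)] Ck_SucD(1)[OF Suc.prems(2)]]])
      (intro Ck_add Suc.IH Ck_SucD(2)[OF Suc.prems(1)] Ck_SucD(2)[OF Suc.prems(2)]
        Ck_Suc_imp_Ck[OF Suc.prems(1)] Ck_Suc_imp_Ck[OF Suc.prems(2)])
qed

lemma Ck_cmult: "Ck k f ==> Ck k (%x. c * f x)"
  by (intro Ck_mult Ck_const)

lemma Ck_minus: "Ck k f ==> Ck k (%x. - f x)"
  using Ck_cmult[of k f "-1"] by simp

lemma Ck_diff: "Ck k f ==> Ck k g ==> Ck k (%x. f x - g x)"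
  using Ck_add[of k f "%x. - g x"] Ck_minus[of k g] by simp

lemma Ck_prod: "(\<And>i. i \<in> I ==> Ck k (f i)) ==> Ck k (%x. \<Prod>i\<in>I. f i x)"
  by (induction I rule: infinite_finite_induct) (auto intro: Ck_const Ck_mult)

lemma Ck_affine: "Ck k f ==> Ck k (%x. f (c *\<^sub>R x + d))"
proof (induction k arbitrary: f)
  case 0
  then show ?case by (auto intro!: continuous_intros continuous_on_compose2[of UNIV f])
next
  case (Suc k)
  have 1: "((%x. f (c *\<^sub>R x + d)) has_derivative (%h. frechet_derivative f (at (c *\<^sub>R x + d)) (c *\<^sub>R h))) (at x)" for x
    by (rule has_derivative_compose[OF _ Ck_SucD(1)[OF Suc.prems], of "%x. c *\<^sub>R x + d" "%h. c *\<^sub>R h"])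
      (auto intro!: derivative_eq_intros)
  have 2: "frechet_derivative f (at y) (c *\<^sub>R h) = c * frechet_derivative f (at y) h" for y h
    using linear_scale[OF has_derivative_linear[OF Ck_SucD(1)[OF Suc.prems]]] by simp
  show ?case by (rule Ck_SucI[OF 1]) (unfold 2, intro Ck_cmult Suc.IH Ck_SucD(2)[OF Suc.prems])
qed

text \<open>
  Smoothness of functions of several variables is reduced to one variable: all cut-offs used here are products of
  functions of the single coordinates \<open>x \<bullet> a\<close>.
\<close>

lemma Ck_ridge:
  fixes h :: "real => real" and a :: "'a::euclidean_space"
  shows "Ck k h ==> Ck k (%x. h (x \<bullet> a))"
proof (induction k arbitrary: h)
  case 0
  then show ?case by (auto intro!: continuous_intros continuous_on_compose2[of UNIV h])
next
  case (Suc k)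
  have 1: "((%x. h (x \<bullet> a)) has_derivative (%v. frechet_derivative h (at (x \<bullet> a)) (v \<bullet> a))) (at x)" for x
    by (rule has_derivative_compose[OF _ Ck_SucD(1)[OF Suc.prems], of "%x. x \<bullet> a" "%v. v \<bullet> a"])
      (auto intro!: derivative_eq_intros)
  have 2: "frechet_derivative h (at y) c = c * frechet_derivative h (at y) 1" for y c
    using linear_scale[OF has_derivative_linear[OF Ck_SucD(1)[OF Suc.prems]], of y c 1] unfolding real_scaleR_def mult_1_right .
  show ?case by (rule Ck_SucI[OF 1], subst 2) (intro Ck_cmult Suc.IH Ck_SucD(2)[OF Suc.prems], simp)
qed

lemma Ck_real_Suc:
  fixes f :: "real => real"
  assumes "\<And>x. (f has_real_derivative f' x) (at x)" "Ck k f'"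
  shows "Ck (Suc k) f"
  by (rule Ck_SucI[of f "%x. (*) (f' x)"]) (use assms in \<open>auto simp: has_field_derivative_def\<close>)

text \<open>
  The family \<open>p(1/t) exp(-1/t)\<close>, extended by 0 to \<open>t \<le> 0\<close>, is closed under differentiation. With the polynomial
  as a parameter, smoothness of \<open>exp(-1/t)\<close> becomes a one-line induction.
\<close>

definition flat :: "real poly => real => real" where
  "flat p t = (if t > 0 then poly p (1 / t) * exp (- (1 / t)) else 0)"

lemma poly_exp_tendsto_0: "((%s. poly p s * exp (- s)) \<longlongrightarrow> 0) (at_top :: real filter)"
proof (induction p)
  case 0
  then show ?case by simp
next
  case (pCons a p)
  have "((%s::real. s * poly p s * exp (- s)) \<longlongrightarrow> 0) at_top" for p :: "real poly"
  proof -
    have "((%s::real. \<Sum>i\<le>degree p. coeff p i * (s ^ Suc i / exp s)) \<longlongrightarrow> (\<Sum>i\<le>degree p. coeff p i * 0)) at_top"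
      by (intro tendsto_intros tendsto_power_div_exp_0)
    moreover have "(\<Sum>i\<le>degree p. coeff p i * (s ^ Suc i / exp s)) = s * poly p s * exp (- s)" for s :: real
      by (simp add: poly_altdef sum_distrib_left sum_distrib_right exp_minus field_simps sum_divide_distrib)
    ultimately show ?thesis by simp
  qed
  moreover have "((%s::real. a * exp (- s)) \<longlongrightarrow> a * 0) at_top"
    using tendsto_power_div_exp_0[of 0] by (intro tendsto_intros) (simp add: exp_minus field_simps)
  ultimately have "((%s::real. a * exp (- s) + s * poly p s * exp (- s)) \<longlongrightarrow> 0 + 0) at_top" by (intro tendsto_add) auto
  then show ?case by (simp add: algebra_simps)
qed

lemma flat_tendsto_0: "((%t. poly p (1 / t) * exp (- (1 / t))) \<longlongrightarrow> 0) (at_right (0::real))"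
  using filterlim_compose[OF poly_exp_tendsto_0[of p] filterlim_inverse_at_top_right] by (simp add: field_simps)

text \<open>
  At \<open>t = 0\<close> the difference quotient is again of the form \<open>p(1/t) exp(-1/t)\<close>, which tends to 0; elsewhere this is
  the chain rule.
\<close>

lemma flat_deriv: "(flat p has_real_derivative flat ([:0,0,1:] * (p - pderiv p)) t) (at t)"
proof -
  consider "t < 0" | "t = 0" | "t > 0" by linarith
  then show ?thesis
  proof cases
    case 1
    have "((%_. 0) has_real_derivative 0) (at t)" by simp
    then have "(flat p has_real_derivative 0) (at t)" by (rule has_field_derivative_transform_within_open[of _ _ _ "{..<0}"])
        (use 1 in \<open>auto simp: flat_def\<close>)
    then show ?thesis using 1 by (simp add: flat_def)
  next
    case 2
    have "((%h. (flat p (0 + h) - flat p 0) / h) \<longlongrightarrow> 0) (at 0)"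
    proof (rule filterlim_split_at)
      show "((%h. (flat p (0 + h) - flat p 0) / h) \<longlongrightarrow> 0) (at_left 0)"
        by (rule tendsto_eventually) (auto simp: flat_def eventually_at_filter)
      show "((%h. (flat p (0 + h) - flat p 0) / h) \<longlongrightarrow> 0) (at_right 0)"
        by (rule Lim_transform_eventually[OF flat_tendsto_0[of "[:0,1:] * p"]])
          (auto simp: flat_def eventually_at_filter)
    qed
    then show ?thesis using 2 by (simp add: DERIV_def flat_def)
  next
    case 3
    have "((%t. poly p (1 / t) * exp (- (1 / t))) has_real_derivative flat ([:0,0,1:] * (p - pderiv p)) t) (at t)"
      using 3 by (auto intro!: derivative_eq_intros simp: flat_def field_simps power2_eq_square)
    then show ?thesis by (rule has_field_derivative_transform_within_open[of _ _ _ "{0<..}"])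
        (use 3 in \<open>auto simp: flat_def\<close>)
  qed
qed

lemma Ck_flat: "Ck k (flat p)"
proof (induction k arbitrary: p)
  case 0
  then show ?case using flat_deriv by (auto simp: continuous_on_eq_continuous_at intro: DERIV_isCont)
next
  case (Suc k)
  then show ?case by (intro Ck_real_Suc[OF flat_deriv])
qed

definition bump :: "real => real" where
  "bump t = flat 1 t * flat 1 (1 - t)"

lemma Ck_bump: "Ck k bump"
  using Ck_mult[OF Ck_flat[of k 1] Ck_affine[OF Ck_flat[of k 1], of "-1" 1]] by (simp add: bump_def[abs_def])

lemma bump_nonneg: "0 \<le> bump t" and bump_pos: "0 < t ==> t < 1 ==> 0 < bump t"
  and bump_eq_0: "t \<le> 0 \<or> 1 \<le> t ==> bump t = 0"
  by (auto simp: bump_def flat_def)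

lemma continuous_on_Ck: "Ck k f ==> continuous_on UNIV f"
  by (cases k) (auto simp: continuous_on_eq_continuous_at differentiable_imp_continuous_within)

lemma integrable_continuous_support:
  fixes f :: "'a::euclidean_space => 'b::euclidean_space"
  assumes "continuous_on UNIV f" "compact K" "\<And>x. x \<notin> K ==> f x = 0"
  shows "integrable lborel f"
proof -
  have "set_integrable lborel K f" unfolding set_integrable_def
    by (rule borel_integrable_compact) (use assms continuous_on_subset[OF assms(1) subset_UNIV] in auto)
  moreover have "(%x. indicator K x *\<^sub>R f x) = f" using assms(3) by (auto simp: indicator_def fun_eq_iff)
  ultimately show ?thesis by (simp add: set_integrable_def)
qed

text \<open>
  A smooth function supported in the unit cube. The cube rather than a ball is the natural support: a product over
  coordinates factorises on product spaces, and fits into a periodicity cell.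
\<close>

definition box_bump :: "'a::euclidean_space => real" where
  "box_bump x = (\<Prod>b\<in>Basis. bump (x \<bullet> b))"

lemma Ck_box_bump: "Ck k box_bump"
  unfolding box_bump_def[abs_def] by (intro Ck_prod Ck_ridge Ck_bump)

lemma box_bump_nonneg: "0 \<le> box_bump x"
  by (auto simp: box_bump_def bump_nonneg intro!: prod_nonneg)

lemma box_bump_eq_0: "x \<notin> cbox 0 One ==> box_bump x = 0"
proof -
  assume "x \<notin> cbox 0 One"
  then obtain b where "b \<in> Basis" "x \<bullet> b \<le> 0 \<or> 1 \<le> x \<bullet> b" by (force simp: mem_box)
  then show ?thesis by (auto simp: box_bump_def intro!: prod_zero bexI[of _ b] bump_eq_0)
qed

lemma integrable_box_bump: "integrable lborel (box_bump :: 'a::euclidean_space => real)"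
  by (rule integrable_continuous_support[OF continuous_on_Ck[OF Ck_box_bump[of 0]] compact_cbox box_bump_eq_0])

text \<open>
  A non-negative integrand with vanishing integral is null, but this one is positive on the open cube.
\<close>

lemma integral_box_bump_pos: "0 < (LINT x|lborel. box_bump (x :: 'a::euclidean_space))"
proof -
  have "(LINT x|lborel. box_bump (x :: 'a)) \<noteq> 0"
  proof
    assume "(LINT x|lborel. box_bump (x :: 'a)) = 0"
    then have "AE x in lborel. box_bump (x :: 'a) = 0"
      by (subst (asm) integral_nonneg_eq_0_iff_AE[OF integrable_box_bump]) (auto simp: box_bump_nonneg)
    moreover have "box_bump x \<noteq> 0" if "x \<in> box 0 One" for x :: 'a
      using that bump_pos by (auto simp: box_bump_def box_def) (metis less_irrefl)
    ultimately have "AE x in lborel. x \<notin> box 0 (One :: 'a)" by (auto elim: eventually_mono)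
    then have "emeasure lborel (box 0 (One :: 'a)) = 0" by (subst (asm) AE_iff_measurable[of "box 0 One"]) auto
    then show False by (simp add: emeasure_lborel_box_eq inner_diff_left)
  qed
  moreover have "0 \<le> (LINT x|lborel. box_bump (x :: 'a))" by (rule integral_nonneg_AE) (simp add: box_bump_nonneg)
  ultimately show ?thesis by simp
qed

text \<open>
  A smooth density supported in the cube with vertices 0 and \<open>e One\<close>, hence one-sided and not symmetric.
\<close>

definition mollifier :: "real => 'a::euclidean_space => real" where
  "mollifier e x = box_bump (x /\<^sub>R e) / (e ^ DIM('a) * (LINT y|lborel. box_bump (y :: 'a)))"

lemma Ck_mollifier: "Ck k (mollifier e)"
  using Ck_cmult[OF Ck_affine[OF Ck_box_bump, of k "inverse e" 0], of "1 / (e ^ DIM('a) * (LINT y|lborel. box_bump (y :: 'a::euclidean_space)))"]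
  by (simp add: mollifier_def[abs_def])

lemma mollifier_nonneg: "0 < e ==> 0 \<le> mollifier e x"
  using integral_box_bump_pos by (auto simp: mollifier_def box_bump_nonneg less_imp_le intro!: divide_nonneg_nonneg mult_nonneg_nonneg)

lemma mollifier_eq_0: "0 < e ==> x \<notin> cbox 0 (e *\<^sub>R One) ==> mollifier e x = 0"
proof -
  assume e: "0 < e" and x: "x \<notin> cbox 0 (e *\<^sub>R One)"
  then have "x /\<^sub>R e \<notin> cbox 0 One" by (auto simp: cbox_def field_simps)
  then show ?thesis by (simp add: mollifier_def box_bump_eq_0)
qed

lemma lborel_integral_affine:
  fixes f :: "'a::euclidean_space => 'b::euclidean_space"
  assumes c: "c \<noteq> 0"
  shows "(LINT x|lborel. f x) = \<bar>c\<bar> ^ DIM('a) *\<^sub>R (LINT x|lborel. f (t + c *\<^sub>R x))" (is ?A)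
    and "integrable lborel (%x. f (t + c *\<^sub>R x)) \<longleftrightarrow> integrable lborel f" (is ?B)
proof -
  have 1: "integrable lborel (%x. g (t + c *\<^sub>R x))" "(LINT x|lborel. g x) = \<bar>c\<bar> ^ DIM('a) *\<^sub>R (LINT x|lborel. g (t + c *\<^sub>R x))"
    if g: "integrable lborel g" and c: "c \<noteq> 0" for g :: "'a => 'b" and c t
  proof -
    have [measurable]: "g \<in> borel_measurable borel" using g by auto
    have integrable_scaleR_cancel: "integrable lborel (%x. k *\<^sub>R h x) \<longleftrightarrow> integrable lborel h" if "k \<noteq> 0" for k and h :: "'a => 'b"
      using integrable_scaleR_right[of "1/k" lborel "%x. k *\<^sub>R h x"] that by auto
    show "integrable lborel (%x. g (t + c *\<^sub>R x))"
      using g c by (subst (asm) lborel_affine[OF c, of t]) (simp add: integrable_density integrable_distr_eq integrable_scaleR_cancel)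
    show "(LINT x|lborel. g x) = \<bar>c\<bar> ^ DIM('a) *\<^sub>R (LINT x|lborel. g (t + c *\<^sub>R x))"
      by (subst lborel_affine[OF c, of t]) (simp add: integral_density integral_distr)
  qed
  show ?B
  proof
    assume *: "integrable lborel (%x. f (t + c *\<^sub>R x))"
    show "integrable lborel f" using 1(1)[OF *, of "1/c" "- t /\<^sub>R c"] c by (simp add: algebra_simps)
  qed (use 1(1)[OF _ c] in blast)
  then show ?A using 1(2)[OF _ c, of f t] by (cases "integrable lborel f") (auto simp: not_integrable_integral_eq)
qed

lemma integrable_mollifier: "0 < e ==> integrable lborel (mollifier e)"
  by (rule integrable_continuous_support[OF continuous_on_Ck[OF Ck_mollifier[of 0]] compact_cbox mollifier_eq_0])

lemma integral_mollifier: "0 < e ==> (LINT x|lborel. mollifier e (x :: 'a::euclidean_space)) = 1"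
  using integral_box_bump_pos[where 'a='a] by (subst lborel_integral_affine(1)[of e _ 0]) (auto simp: mollifier_def[abs_def])

lemma test_functionI:
  assumes "\<And>k. Ck k f" "compact K" "\<And>x. x \<notin> K ==> f x = 0" "K \<subseteq> S"
  shows "test_function S f"
proof -
  have "closure {x. f x \<noteq> 0} \<subseteq> K" using assms by (intro closure_minimal compact_imp_closed) auto
  moreover from this have "compact (closure {x. f x \<noteq> 0})" using compact_Int_closed[OF assms(2) closed_closure] by (metis inf.absorb_iff2)
  ultimately show ?thesis using assms by (auto simp: test_function_def)
qed

section \<open>Local integrability and convergence of mollifications\<close>

definition loc_int :: "('a::euclidean_space => 'b::euclidean_space) => bool" where
  "loc_int f \<longleftrightarrow> f \<in> borel_measurable borel \<and> (\<forall>K. compact K \<longrightarrow> set_integrable lborel K f)"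

text \<open>
  This is \<^term>\<open>locally_Lp 2\<close> with an ordinary square instead of a real power; likewise \<^term>\<open>loc_int\<close> for
  exponent 1.
\<close>

definition loc_sq :: "('a::euclidean_space => 'b::euclidean_space) => bool" where
  "loc_sq f \<longleftrightarrow> f \<in> borel_measurable borel \<and>
     (\<forall>K. compact K \<longrightarrow> set_integrable lborel K (%x. (norm (f x))^2))"

lemma locally_Lp_1_iff: "locally_Lp 1 f \<longleftrightarrow> loc_int f"
proof -
  have "set_integrable lborel K (%x. norm (f x)) \<longleftrightarrow> set_integrable lborel K f"
    if [measurable]: "f \<in> borel_measurable borel" and "compact K" for K
  proof -
    have [measurable]: "K \<in> sets borel" using that by (simp add: borel_compact)
    have "(%x. norm (indicator K x *\<^sub>R f x)) = (%x. indicator K x *\<^sub>R norm (f x))" by (auto simp: fun_eq_iff)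
    then show ?thesis using integrable_norm_iff[of "%x. indicator K x *\<^sub>R f x" lborel] by (simp add: set_integrable_def)
  qed
  then show ?thesis by (auto simp: locally_Lp_def loc_int_def)
qed

lemma locally_Lp_2_iff: "locally_Lp 2 f \<longleftrightarrow> loc_sq f"
  by (simp add: locally_Lp_def loc_sq_def)

text \<open>
  Lebesgue measure is outer regular, and its restriction to a set of finite measure is inner regular.
\<close>

lemma finite_measure_between_compact_open:
  fixes A :: "'a::euclidean_space set"
  assumes A: "A \<in> sets borel" "emeasure lborel A < \<infinity>" and e: "0 < e"
  obtains K U where "compact K" "open U" "K \<subseteq> A" "A \<subseteq> U" "emeasure lborel (U - K) < ennreal e"
proof -
  let ?M = "density lborel (indicator A)"
  have M: "emeasure ?M B = emeasure lborel (A \<inter> B)" if "B \<in> sets borel" for B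
    using A that by (simp add: emeasure_density indicator_inter_arith[symmetric])
  obtain U where U: "open U" "A \<subseteq> U" "emeasure lborel (U - A) < ennreal (e/2)" using outer_regular_lborel[OF A(1), of "e/2"] e by auto
  have "emeasure ?M A = (SUP K \<in> {K. K \<subseteq> A \<and> compact K}. emeasure ?M K)" using A by (intro inner_regular) (auto simp: M)
  moreover have "emeasure ?M A = emeasure lborel A" using A M[of A] by simp
  ultimately have eq: "emeasure lborel A = (SUP K \<in> {K. K \<subseteq> A \<and> compact K}. emeasure ?M K)" by simp
  have "\<exists>K. K \<subseteq> A \<and> compact K \<and> emeasure lborel (A - K) < ennreal (e/2)"
  proof (cases "emeasure lborel A = 0")
    case True
    then show ?thesis using e by (intro exI[of _ "{}"]) auto
  next
    case False
    have "emeasure lborel A - ennreal (e/2) < (SUP K \<in> {K. K \<subseteq> A \<and> compact K}. emeasure ?M K)"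
      unfolding eq[symmetric] using A(2) False e by (intro ennreal_between) (auto simp: zero_less_iff_neq_zero)
    then obtain K where K: "K \<subseteq> A" "compact K" "emeasure lborel A - ennreal (e/2) < emeasure ?M K" by (auto simp: less_SUP_iff)
    have KB: "K \<in> sets borel" using K by (simp add: borel_compact)
    have "emeasure ?M K = emeasure lborel K" using M[OF KB] K by (simp add: Int_absorb1)
    then have *: "emeasure lborel A - ennreal (e/2) < emeasure lborel K" using K by simp
    have fin: "emeasure lborel K < \<infinity>" using emeasure_mono[of K A lborel] K A by (auto simp: less_top[symmetric] top_unique)
    have "emeasure lborel (A - K) = emeasure lborel A - emeasure lborel K" using fin K A KB by (intro emeasure_Diff) auto
    also have "... < ennreal (e/2)"
    proof -
      obtain a where a: "emeasure lborel A = ennreal a" "0 \<le> a" using A(2) by (cases "emeasure lborel A") auto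
      obtain k where k: "emeasure lborel K = ennreal k" "0 \<le> k" using fin by (cases "emeasure lborel K") auto
      have "a - e / 2 < k" using * a k e by (auto simp: ennreal_minus not_le[symmetric] simp del: not_le intro: ennreal_leI)
      then show ?thesis using a k e by (auto simp: ennreal_minus intro!: ennreal_lessI)
    qed
    finally show ?thesis using K by blast
  qed
  then obtain K where K: "K \<subseteq> A" "compact K" "emeasure lborel (A - K) < ennreal (e/2)" by blast
  have KB: "K \<in> sets borel" using K by (simp add: borel_compact)
  have "U - K = (U - A) \<union> (A - K)" using K U by blast
  then have "emeasure lborel (U - K) \<le> emeasure lborel (U - A) + emeasure lborel (A - K)" using A U KB by (auto intro!: emeasure_subadditive)
  also have "... < ennreal (e/2) + ennreal (e/2)" using U K by (intro add_strict_mono)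
  also have "... = ennreal e" using e by (simp flip: ennreal_plus)
  finally show ?thesis using that K U by blast
qed

lemma integral_translate:
  fixes f :: "'a::euclidean_space => 'b::euclidean_space"
  shows "(LINT x|lborel. f (x - y)) = (LINT x|lborel. f x)"
    "integrable lborel (%x. f (x - y)) \<longleftrightarrow> integrable lborel f"
  using lborel_integral_affine[of 1 f "- y"] by (simp_all add: add.commute)

text \<open>
  For indicators, regularity of the measure leaves only a shell between a compact and an open set to be compared, which has
  small measure; simple functions and limits in \<open>L\<^sup>1\<close> follow by linearity and translation invariance.
\<close>

lemma translation_continuous_L1:
  fixes f :: "'a::euclidean_space => 'b::euclidean_space"
  assumes "integrable lborel f" "0 < e"
  shows "\<exists>d>0. \<forall>y. norm y < d \<longrightarrow> (LINT x|lborel. norm (f (x - y) - f x)) < e"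
  using assms
proof (induction arbitrary: e rule: integrable_induct)
  case (base A c)
  \<comment> \<open>the shell enters twice, once translated, each time with the factor of the norm of c\<close>
  define e' where "e' = e / (4 * (norm c + 1))"
  have e': "0 < e'" using base by (simp add: e'_def add_nonneg_pos)
  obtain K U where KU: "compact K" "open U" "K \<subseteq> A" "A \<subseteq> U" "emeasure lborel (U - K) < ennreal e'"
    using finite_measure_between_compact_open[of A e'] base e' by auto
  obtain d where d: "0 < d" "(\<Union>x\<in>K. ball x d) \<subseteq> U" using compact_subset_open_imp_ball_epsilon_subset[OF KU(1,2)] KU by auto
  have [measurable]: "K \<in> sets borel" "U \<in> sets borel" using KU by (auto simp: borel_compact)
  have iUK: "integrable lborel (indicator (U - K) :: 'a => real)" using KU(5) by (intro integrable_real_indicator) (auto intro: order_less_trans)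
  have mUK: "(LINT x|lborel. indicator (U - K) x) < e'"
    using KU(5) e' by (simp add: measure_def) (metis enn2real_less_iff ennreal_less_top order_less_trans less_top)
  show ?case
  proof (intro exI[of _ d] conjI allI impI d)
    fix y :: 'a assume y: "norm y < d"
    have le: "norm (indicator A (x - y) *\<^sub>R c - indicator A x *\<^sub>R c)
        \<le> (indicator (U - K) x + indicator (U - K) (x - y)) * norm c" for x
    proof -
      have 1: "x \<in> U" if "x - y \<in> K" using d(2) that y by (force simp: dist_norm norm_minus_commute)
      have 2: "x - y \<in> U" if "x \<in> K" using d(2) that y by (force simp: dist_norm norm_minus_commute)
      show ?thesis using 1 2 KU(3,4) by (auto simp: indicator_def)
    qed
    have "(LINT x|lborel. norm (indicator A (x - y) *\<^sub>R c - indicator A x *\<^sub>R c))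
      \<le> (LINT x|lborel. (indicator (U - K) x + indicator (U - K) (x - y)) * norm c)"
    proof (rule integral_mono_AE')
      show "integrable lborel (%x. (indicator (U - K) x + indicator (U - K) (x - y)) * norm c)"
        using iUK integral_translate(2)[of "indicator (U - K) :: 'a => real" y] by auto
    qed (use le in auto)
    also have "... = 2 * (LINT x|lborel. indicator (U - K) x) * norm c"
      using iUK integral_translate[of "indicator (U - K) :: 'a => real" y] by (simp add: algebra_simps)
    also have "... \<le> 2 * e' * norm c" using mUK by (intro mult_right_mono mult_left_mono) auto
    also have "... \<le> 2 * e' * (norm c + 1)" using e' by (intro mult_left_mono) auto
    also have "... = e / 2"
    proof -
      have "norm c + 1 \<noteq> 0" using norm_ge_zero[of c] by linarith
      then show ?thesis unfolding e'_def by (simp add: divide_simps)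
    qed
    also have "... < e" using base by simp
    finally show "(LINT x|lborel. norm (indicator A (x - y) *\<^sub>R c - indicator A x *\<^sub>R c)) < e" .
  qed
next
  case (add f g)
  obtain d1 where d1: "0 < d1" "\<And>y. norm y < d1 ==> (LINT x|lborel. norm (f (x - y) - f x)) < e/2" using add.IH(1)[of "e/2"] add.prems by auto
  obtain d2 where d2: "0 < d2" "\<And>y. norm y < d2 ==> (LINT x|lborel. norm (g (x - y) - g x)) < e/2" using add.IH(2)[of "e/2"] add.prems by auto
  show ?case
  proof (intro exI[of _ "min d1 d2"] conjI allI impI)
    fix y :: 'a assume y: "norm y < min d1 d2"
    have "integrable lborel (%x. f (x - y))" "integrable lborel (%x. g (x - y))" using add by (simp_all add: integral_translate(2))
    note i = this add.hyps
    have "(LINT x|lborel. norm (f (x - y) + g (x - y) - (f x + g x)))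
      \<le> (LINT x|lborel. norm (f (x - y) - f x) + norm (g (x - y) - g x))"
      using i by (intro integral_mono) (auto simp: add_diff_add intro!: norm_triangle_ineq)
    also have "... = (LINT x|lborel. norm (f (x - y) - f x)) + (LINT x|lborel. norm (g (x - y) - g x))"
      using i by (intro Bochner_Integration.integral_add) auto
    also have "... < e" using d1(2)[of y] d2(2)[of y] y by simp
    finally show "(LINT x|lborel. norm (f (x - y) + g (x - y) - (f x + g x))) < e" .
  qed (use d1 d2 in auto)
next
  case (lim f s)
  have [measurable]: "f \<in> borel_measurable borel" "\<And>i. s i \<in> borel_measurable borel" using lim.hyps by auto
  have "(%i. LINT x|lborel. norm (s i x - f x)) \<longlonglongrightarrow> (LINT x::'a|lborel. (0::real))"
  proof (rule integral_dominated_convergence)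
    show "integrable lborel (%x. 3 * norm (f x))" using lim.hyps by auto
    show "AE x in lborel. (%i. norm (s i x - f x)) \<longlonglongrightarrow> 0"
      using lim.hyps(2) by (auto intro!: tendsto_eq_intros simp: tendsto_norm_zero_iff LIM_zero_iff)
    show "AE x in lborel. norm (norm (s i x - f x)) \<le> 3 * norm (f x)" for i
    proof (rule AE_I2)
      fix x
      have "norm (s i x - f x) \<le> norm (s i x) + norm (f x)" by (rule norm_triangle_ineq4)
      also have "... \<le> 3 * norm (f x)" using lim.hyps(3)[of x i] by simp
      finally show "norm (norm (s i x - f x)) \<le> 3 * norm (f x)" by simp
    qed
  qed auto
  then obtain i where i: "(LINT x|lborel. norm (s i x - f x)) < e/4"
    using order_tendstoD(2)[of _ 0 sequentially "e/4"] lim.prems by (auto simp: eventually_sequentially)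
  obtain d where d: "0 < d" "\<And>y. norm y < d ==> (LINT x|lborel. norm (s i (x - y) - s i x)) < e/4" using lim.IH[of "e/4" i] lim.prems by auto
  show ?case
  proof (intro exI[of _ d] conjI allI impI d)
    fix y :: 'a assume y: "norm y < d"
    have "integrable lborel (%x. f (x - y))" "integrable lborel (%x. s i (x - y))" using lim by (simp_all add: integral_translate(2))
    note ii = this lim.hyps(1)[of i] lim.hyps(4)
    have tr: "norm (f (x - y) - f x) \<le> norm (s i (x - y) - f (x - y)) + norm (s i (x - y) - s i x) + norm (s i x - f x)" for x by norm
    have "(LINT x|lborel. norm (f (x - y) - f x))
      \<le> (LINT x|lborel. norm (s i (x - y) - f (x - y)) + norm (s i (x - y) - s i x) + norm (s i x - f x))"
      using ii by (intro integral_mono tr) auto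
    also have "... = (LINT x|lborel. norm (s i (x - y) - f (x - y))) + (LINT x|lborel. norm (s i (x - y) - s i x)) + (LINT x|lborel. norm (s i x - f x))"
      using ii by simp
    also have "(LINT x|lborel. norm (s i (x - y) - f (x - y))) = (LINT x|lborel. norm (s i x - f x))" by (rule integral_translate)
    finally show "(LINT x|lborel. norm (f (x - y) - f x)) < e" using i d(2)[OF y] lim.prems by simp
  qed
qed

definition mollify :: "real => ('a::euclidean_space => 'b::euclidean_space) => 'a => 'b" where
  "mollify e g x = (LINT y|lborel. mollifier e (x - y) *\<^sub>R g y)"

lemma measurable_mollifier[measurable]: "mollifier e \<in> borel_measurable borel"
  by (rule borel_measurable_continuous_onI[OF continuous_on_Ck[OF Ck_mollifier[of 0]]])

lemma mollifier_bounded: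
  obtains B where "0 < B" "\<And>x::'a::euclidean_space. mollifier e x \<le> B"
proof (cases "0 < e")
  case True
  have "compact (mollifier e ` cbox 0 (e *\<^sub>R One :: 'a))"
    by (intro compact_continuous_image continuous_on_subset[OF continuous_on_Ck[OF Ck_mollifier[of 0]]]) auto
  then obtain B where B: "\<And>x. x \<in> cbox 0 (e *\<^sub>R One :: 'a) ==> norm (mollifier e x) \<le> B"
    by (force simp: bounded_iff dest!: compact_imp_bounded)
  show ?thesis
  proof (rule that[of "max B 1"])
    fix x :: 'a
    show "mollifier e x \<le> max B 1" using B[of x] mollifier_eq_0[OF True, of x] by (cases "x \<in> cbox 0 (e *\<^sub>R One)") auto
  qed auto
next
  case False
  have "bounded (range (box_bump :: 'a => real))"
  proof -
    have "compact (box_bump ` cbox 0 (One :: 'a))"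
      by (intro compact_continuous_image continuous_on_subset[OF continuous_on_Ck[OF Ck_box_bump[of 0]]]) auto
    then have "bounded (insert 0 (box_bump ` cbox 0 (One :: 'a)))" by (auto dest: compact_imp_bounded)
    then show ?thesis by (rule bounded_subset) (use box_bump_eq_0 in auto)
  qed
  then obtain B where B: "\<And>x. norm (box_bump (x::'a)) \<le> B" by (auto simp: bounded_iff)
  define D where "D = \<bar>e ^ DIM('a) * (LINT y|lborel. box_bump (y :: 'a))\<bar>"
  show ?thesis
  proof (rule that[of "max (B / D) 1"])
    fix x :: 'a
    have "mollifier e x \<le> \<bar>mollifier e x\<bar>" by simp
    also have "... \<le> B / D" unfolding mollifier_def D_def abs_divide using B[of "x /\<^sub>R e"] by (intro divide_right_mono) auto
    finally show "mollifier e x \<le> max (B / D) 1" by simp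
  qed auto
qed

lemma loc_intD: "loc_int f ==> f \<in> borel_measurable borel" "loc_int f ==> compact K ==> set_integrable lborel K f"
  by (auto simp: loc_int_def)

lemma loc_sqD: "loc_sq f ==> f \<in> borel_measurable borel"
  "loc_sq f ==> compact K ==> set_integrable lborel K (%x. (norm (f x))^2)"
  by (auto simp: loc_sq_def)

lemma integrable_bounded_support_mult:
  fixes g :: "'a::euclidean_space => 'b::euclidean_space"
  assumes g: "loc_int g" and [measurable]: "k \<in> borel_measurable borel"
    and "compact K" "\<And>x. x \<notin> K ==> k x = 0" "\<And>x. \<bar>k x\<bar> \<le> (B::real)"
  shows "integrable lborel (%x. k x *\<^sub>R g x)"
proof -
  have [measurable]: "g \<in> borel_measurable borel" using loc_intD[OF g] by auto
  have B: "0 \<le> B" using assms(5)[of 0] by linarith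
  have "integrable lborel (%x. B *\<^sub>R (indicator K x *\<^sub>R g x))"
    using loc_intD(2)[OF g assms(3)] unfolding set_integrable_def by (intro integrable_scaleR_right)
  then show ?thesis
  proof (rule integrable_dominated)
    show "AE x in lborel. norm (k x *\<^sub>R g x) \<le> norm (B *\<^sub>R indicator K x *\<^sub>R g x)"
      using assms(4,5) B by (intro AE_I2) (auto simp: indicator_def intro!: mult_right_mono)
  qed auto
qed

lemma compact_reflect_translate: "compact K ==> compact ((%z. (x::'a::euclidean_space) - z) ` K)"
  by (intro compact_continuous_image continuous_intros)

lemma integrable_mollifier_mult:
  fixes g :: "'a::euclidean_space => 'b::euclidean_space"
  assumes "loc_int g" "0 < e"
  shows "integrable lborel (%y. mollifier e (x - y) *\<^sub>R g y)"
proof -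
  obtain B where B: "0 < B" "\<And>x::'a. mollifier e x \<le> B" using mollifier_bounded by blast
  show ?thesis
  proof (rule integrable_bounded_support_mult[OF assms(1)])
    show "compact ((%z. x - z) ` cbox 0 (e *\<^sub>R One))" by (intro compact_reflect_translate compact_cbox)
    show "mollifier e (x - y) = 0" if "y \<notin> (%z. x - z) ` cbox 0 (e *\<^sub>R One)" for y
    proof (rule mollifier_eq_0[OF assms(2)], rule)
      assume "x - y \<in> cbox 0 (e *\<^sub>R One)"
      then have "x - (x - y) \<in> (%z. x - z) ` cbox 0 (e *\<^sub>R One)" by (rule imageI)
      with that show False by simp
    qed
    show "\<bar>mollifier e (x - y)\<bar> \<le> B" for y using B mollifier_nonneg[OF assms(2), of "x - y"] by (metis abs_of_nonneg)
  qed simp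
qed

lemma measurable_mollify[measurable]:
  fixes g :: "'a::euclidean_space => 'b::euclidean_space"
  assumes [measurable]: "g \<in> borel_measurable borel"
  shows "mollify e g \<in> borel_measurable borel"
  unfolding mollify_def[abs_def] by measurable

lemma mollify_shifted:
  fixes g :: "'a::euclidean_space => 'b::euclidean_space"
  shows "mollify e g x = (LINT z|lborel. mollifier e z *\<^sub>R g (x - z))"
  unfolding mollify_def using lborel_integral_affine(1)[of "-1" "%y. mollifier e (x - y) *\<^sub>R g y" x] by simp

lemma mollifier_support_norm:
  assumes "0 < e" "mollifier e (z::'a::euclidean_space) \<noteq> 0"
  shows "norm z \<le> e * norm (One :: 'a)"
proof -
  have "z \<in> cbox 0 (e *\<^sub>R One)" using mollifier_eq_0 assms by blast
  then have "norm z \<le> norm (e *\<^sub>R One :: 'a)" by (intro norm_le_componentwise) (auto simp: mem_box abs_if)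
  then show ?thesis using assms by simp
qed

lemma eventually_mollifier_support:
  assumes "0 < d"
  shows "eventually (%e. 0 < e \<and> (\<forall>z::'a::euclidean_space. mollifier e z \<noteq> 0 \<longrightarrow> norm z < d)) (at_right 0)"
proof -
  have pos: "0 < d / (norm (One :: 'a) + 1)" using assms by (intro divide_pos_pos add_nonneg_pos) auto
  show ?thesis unfolding eventually_at_right_field
  proof (intro exI[of _ "d / (norm (One :: 'a) + 1)"] conjI pos allI impI)
    fix e z assume e: "0 < e" "e < d / (norm (One :: 'a) + 1)" and z: "mollifier e (z :: 'a) \<noteq> 0"
    have "norm z \<le> e * norm (One :: 'a)" by (rule mollifier_support_norm[OF e(1) z])
    also have "... < e * (norm (One :: 'a) + 1)" using e by simp
    also have "... < d" using e pos_less_divide_eq[of "norm (One :: 'a) + 1" e d] by (simp add: add_nonneg_pos)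
    finally show "norm z < d" .
  qed
qed

text \<open>
  The difference \<open>mollify e g - g\<close> averages \<open>g(x - z) - g(x)\<close> over small \<open>z\<close> with the weight of a probability
  density. By Tonelli it is enough that the pairing of \<open>|F|\<close> with \<open>|g(x - z) - g(x)|\<close> is small uniformly for small
  \<open>z\<close>, which is the hypothesis in the form common to the two cases below.
\<close>

lemma mollify_weak_limit:
  fixes F g :: "'a::euclidean_space => 'b::euclidean_space"
  assumes g: "loc_int g" and F[measurable]: "F \<in> borel_measurable borel"
    and small: "\<And>\<delta>. 0 < \<delta> ==> \<exists>d>0. \<forall>z. norm z < d \<longrightarrow>
      (\<integral>\<^sup>+x. ennreal (norm (F x) * norm (g (x - z) - g x)) \<partial>lborel) \<le> ennreal \<delta>"
    and Fg: "integrable lborel (%x. F x \<bullet> g x)"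
  shows "eventually (%e. integrable lborel (%x. F x \<bullet> mollify e g x)) (at_right 0)"
    and "((%e. LINT x|lborel. F x \<bullet> mollify e g x) \<longlongrightarrow> (LINT x|lborel. F x \<bullet> g x)) (at_right 0)"
proof -
  have gm[measurable]: "g \<in> borel_measurable borel" using loc_intD[OF g] by auto
  have key: "eventually (%e. integrable lborel (%x. F x \<bullet> (mollify e g x - g x)) \<and>
      \<bar>LINT x|lborel. F x \<bullet> (mollify e g x - g x)\<bar> \<le> \<delta>) (at_right 0)" if \<delta>: "0 < \<delta>" for \<delta>
  proof -
    obtain d where d: "0 < d" "\<And>z. norm z < d ==>
      (\<integral>\<^sup>+x. ennreal (norm (F x) * norm (g (x - z) - g x)) \<partial>lborel) \<le> ennreal \<delta>" using small[OF \<delta>] by blast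
    show ?thesis using eventually_mollifier_support[OF d(1), where 'a='a]
    proof eventually_elim
      case (elim e)
      then have e: "0 < e" and supp: "\<And>z::'a. mollifier e z \<noteq> 0 ==> norm z < d" by auto
      have pw: "ennreal (norm (F x \<bullet> (mollify e g x - g x)))
          \<le> (\<integral>\<^sup>+z. ennreal (mollifier e z) * ennreal (norm (F x) * norm (g (x - z) - g x)) \<partial>lborel)" for x
      proof -
        have i1: "integrable lborel (%z. mollifier e z *\<^sub>R g (x - z))"
          using lborel_integral_affine(2)[of "-1" "%y. mollifier e (x - y) *\<^sub>R g y" x]
            integrable_mollifier_mult[OF g e, of x] by simp
        have i2: "integrable lborel (%z. mollifier e z *\<^sub>R g x)" using integrable_mollifier[OF e] by auto
        have eq: "mollify e g x - g x = (LINT z|lborel. mollifier e z *\<^sub>R (g (x - z) - g x))"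
          unfolding scaleR_diff_right Bochner_Integration.integral_diff[OF i1 i2]
          by (simp add: mollify_shifted integral_mollifier[OF e] integrable_mollifier[OF e])
        have i3: "integrable lborel (%z. mollifier e z *\<^sub>R (g (x - z) - g x))"
          unfolding scaleR_diff_right by (rule Bochner_Integration.integrable_diff[OF i1 i2])
        have "ennreal (norm (F x \<bullet> (mollify e g x - g x))) \<le> ennreal (norm (F x)) * ennreal (norm (mollify e g x - g x))"
          by (simp add: ennreal_mult[symmetric] Cauchy_Schwarz_ineq2 del: real_norm_def) (simp add: Cauchy_Schwarz_ineq2 ennreal_leI)
        also have "... \<le> ennreal (norm (F x)) * (\<integral>\<^sup>+z. norm (mollifier e z *\<^sub>R (g (x - z) - g x)) \<partial>lborel)"
          unfolding eq by (intro mult_left_mono integral_norm_bound_ennreal i3) auto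
        also have "... = (\<integral>\<^sup>+z. ennreal (norm (F x)) * norm (mollifier e z *\<^sub>R (g (x - z) - g x)) \<partial>lborel)"
          by (rule nn_integral_cmult[symmetric]) measurable
        also have "... = (\<integral>\<^sup>+z. ennreal (mollifier e z) * ennreal (norm (F x) * norm (g (x - z) - g x)) \<partial>lborel)"
          using mollifier_nonneg[OF e, where 'a='a] by (intro nn_integral_cong) (simp add: ennreal_mult[symmetric] mult_ac)
        finally show ?thesis .
      qed
      have "(\<integral>\<^sup>+x. ennreal (norm (F x \<bullet> (mollify e g x - g x))) \<partial>lborel)
        \<le> (\<integral>\<^sup>+x. (\<integral>\<^sup>+z. ennreal (mollifier e z) * ennreal (norm (F x) * norm (g (x - z) - g x)) \<partial>lborel) \<partial>lborel)"
        by (intro nn_integral_mono pw)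
      also have "... = (\<integral>\<^sup>+z. (\<integral>\<^sup>+x. ennreal (mollifier e z) * ennreal (norm (F x) * norm (g (x - z) - g x)) \<partial>lborel) \<partial>lborel)"
        by (rule lborel_pair.Fubini') measurable
      also have "... = (\<integral>\<^sup>+z. ennreal (mollifier e z) * (\<integral>\<^sup>+x. ennreal (norm (F x) * norm (g (x - z) - g x)) \<partial>lborel) \<partial>lborel)"
        by (intro nn_integral_cong nn_integral_cmult) measurable
      also have "... \<le> (\<integral>\<^sup>+z. ennreal (mollifier e z) * ennreal \<delta> \<partial>(lborel :: 'a measure))"
      proof (rule nn_integral_mono)
        fix z :: 'a
        show "ennreal (mollifier e z) * (\<integral>\<^sup>+x. ennreal (norm (F x) * norm (g (x - z) - g x)) \<partial>lborel) \<le> ennreal (mollifier e z) * ennreal \<delta>"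
          using d(2)[OF supp, of z] by (cases "mollifier e z = 0") (auto intro: mult_left_mono)
      qed
      also have "... = ennreal \<delta>" using integrable_mollifier[OF e, where 'a='a] mollifier_nonneg[OF e, where 'a='a] \<delta>
        by (simp add: nn_integral_multc nn_integral_eq_integral integral_mollifier[OF e])
      finally have le: "(\<integral>\<^sup>+x. ennreal (norm (F x \<bullet> (mollify e g x - g x))) \<partial>lborel) \<le> ennreal \<delta>" .
      have int: "integrable lborel (%x. F x \<bullet> (mollify e g x - g x))"
        by (rule integrableI_bounded) (use le in \<open>auto intro: le_less_trans\<close>)
      have "ennreal (norm (LINT x|lborel. F x \<bullet> (mollify e g x - g x))) \<le> ennreal \<delta>"
        using integral_norm_bound_ennreal[OF int] le by (rule order_trans)
      then show ?case using int \<delta> by (simp add: ennreal_le_iff)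
    qed
  qed
  show ev: "eventually (%e. integrable lborel (%x. F x \<bullet> mollify e g x)) (at_right 0)" using key[of 1, simplified]
  proof eventually_elim
    case (elim e)
    then have "integrable lborel (%x. F x \<bullet> (mollify e g x - g x) + F x \<bullet> g x)"
      using Fg by (intro Bochner_Integration.integrable_add) auto
    then show ?case by (simp add: inner_diff_right)
  qed
  show "((%e. LINT x|lborel. F x \<bullet> mollify e g x) \<longlongrightarrow> (LINT x|lborel. F x \<bullet> g x)) (at_right 0)"
  proof (rule tendstoI)
    fix \<delta> :: real assume \<delta>: "0 < \<delta>"
    then have "0 < \<delta> / 2" by simp
    from key[OF this] ev show "\<forall>\<^sub>F e in at_right 0. dist (LINT x|lborel. F x \<bullet> mollify e g x) (LINT x|lborel. F x \<bullet> g x) < \<delta>"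
    proof eventually_elim
      case (elim e)
      then have "\<bar>LINT x|lborel. F x \<bullet> mollify e g x - F x \<bullet> g x\<bar> \<le> \<delta> / 2" by (simp add: inner_diff_right)
      then show ?case using elim Fg \<delta> by (simp add: dist_norm)
    qed
  qed
qed

text \<open>
  On a compact set, and for translations of length below 1, a locally integrable function coincides with an integrable
  one, to which the continuity of translations applies.
\<close>

lemma loc_int_local_translation:
  fixes g :: "'a::euclidean_space => 'b::euclidean_space"
  assumes g: "loc_int g" and K: "compact K"
  obtains G where "integrable lborel G" "\<And>x z. x \<in> K ==> norm z < 1 ==> G (x - z) = g (x - z)"
    "\<And>x. norm (G x) \<le> norm (g x)"
    "loc_sq g ==> integrable lborel (%x. (norm (G x))^2)"
proof -
  define K1 where "K1 = {x - y | x y. x \<in> K \<and> y \<in> cball 0 (1::real)}"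
  have K1: "compact K1" unfolding K1_def by (rule compact_differences[OF K compact_cball])
  then have [measurable]: "K1 \<in> sets borel" by (simp add: borel_compact)
  show ?thesis
  proof (rule that[of "%x. indicator K1 x *\<^sub>R g x"])
    show "integrable lborel (%x. indicator K1 x *\<^sub>R g x)" using loc_intD(2)[OF g K1] by (simp add: set_integrable_def)
    show "indicator K1 (x - z) *\<^sub>R g (x - z) = g (x - z)" if "x \<in> K" "norm z < 1" for x z
    proof -
      have "x - z \<in> K1" unfolding K1_def using that by force
      then show ?thesis by simp
    qed
    show "integrable lborel (%x. (norm (indicator K1 x *\<^sub>R g x))^2)" if "loc_sq g" using loc_sqD(2)[OF that K1] unfolding set_integrable_def
      by (rule back_subst[of "integrable lborel"]) (auto simp: fun_eq_iff indicator_def)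
  qed (auto simp: indicator_def)
qed

lemma mollify_weak_limit_bounded:
  fixes F g :: "'a::euclidean_space => 'b::euclidean_space"
  assumes g: "loc_int g" and F[measurable]: "F \<in> borel_measurable borel"
    and K: "compact K" "\<And>x. x \<notin> K ==> F x = 0" and B: "\<And>x. norm (F x) \<le> B"
  shows "((%e. LINT x|lborel. F x \<bullet> mollify e g x) \<longlongrightarrow> (LINT x|lborel. F x \<bullet> g x)) (at_right 0)"
proof (rule mollify_weak_limit(2)[OF g F])
  have gm[measurable]: "g \<in> borel_measurable borel" using loc_intD[OF g] by auto
  have B0: "0 \<le> B" using B[of 0] norm_ge_zero order_trans by blast
  obtain G where G: "integrable lborel G" "\<And>x z. x \<in> K ==> norm z < 1 ==> G (x - z) = g (x - z)"
    using loc_int_local_translation[OF g K(1)] by metis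
  have G0: "G x = g x" if "x \<in> K" for x using G(2)[OF that, of 0] by simp
  show "integrable lborel (%x. F x \<bullet> g x)"
  proof (rule integrable_dominated)
    show "integrable lborel (%x. B * norm (G x))" using G by auto
    show "AE x in lborel. norm (F x \<bullet> g x) \<le> norm (B * norm (G x))"
    proof (rule AE_I2)
      fix x
      have "norm (F x \<bullet> g x) \<le> norm (F x) * norm (g x)" by (simp add: Cauchy_Schwarz_ineq2)
      also have "... \<le> B * norm (G x)" using K(2)[of x] G0[of x] B[of x] B0 by (cases "x \<in> K") (auto intro: mult_right_mono)
      finally show "norm (F x \<bullet> g x) \<le> norm (B * norm (G x))" using B0 by simp
    qed
  qed measurable
  fix \<delta> :: real assume \<delta>: "0 < \<delta>"
  obtain d where d: "0 < d" "\<And>z. norm z < d ==> (LINT x|lborel. norm (G (x - z) - G x)) < \<delta> / (B + 1)"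
    using translation_continuous_L1[OF G(1), of "\<delta> / (B + 1)"] \<delta> B0 by auto
  show "\<exists>d>0. \<forall>z. norm z < d \<longrightarrow> (\<integral>\<^sup>+x. ennreal (norm (F x) * norm (g (x - z) - g x)) \<partial>lborel) \<le> ennreal \<delta>"
  proof (intro exI[of _ "min 1 d"] conjI allI impI)
    fix z :: 'a assume z: "norm z < min 1 d"
    have iG: "integrable lborel (%x. B * norm (G (x - z) - G x))" using G(1) by (auto simp: integral_translate(2))
    have "(\<integral>\<^sup>+x. ennreal (norm (F x) * norm (g (x - z) - g x)) \<partial>lborel) \<le> (\<integral>\<^sup>+x. ennreal (B * norm (G (x - z) - G x)) \<partial>lborel)"
    proof (intro nn_integral_mono ennreal_leI)
      fix x show "norm (F x) * norm (g (x - z) - g x) \<le> B * norm (G (x - z) - G x)"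
        using K(2)[of x] G0[of x] G(2)[of x z] z B[of x] B0 by (cases "x \<in> K") (auto intro: mult_right_mono)
    qed
    also have "... = ennreal (LINT x|lborel. B * norm (G (x - z) - G x))" using iG B0 by (intro nn_integral_eq_integral) auto
    also have "... \<le> ennreal \<delta>"
    proof (rule ennreal_leI)
      have "(LINT x|lborel. B * norm (G (x - z) - G x)) \<le> B * (\<delta> / (B + 1))"
        using mult_left_mono[OF less_imp_le[OF d(2)] B0, of z] z by simp
      also have "... \<le> \<delta>" using B0 \<delta> by (simp add: field_simps)
      finally show "(LINT x|lborel. B * norm (G (x - z) - G x)) \<le> \<delta>" .
    qed
    finally show "(\<integral>\<^sup>+x. ennreal (norm (F x) * norm (g (x - z) - g x)) \<partial>lborel) \<le> ennreal \<delta>" .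
  qed (use d in auto)
qed

lemma compact_finite_lborel: "compact K ==> emeasure lborel (K :: 'a::euclidean_space set) < \<infinity>"
  using emeasure_compact_finite by auto

lemma loc_sq_imp_loc_int:
  fixes g :: "'a::euclidean_space => 'b::euclidean_space"
  assumes "loc_sq g" shows "loc_int g"
  unfolding loc_int_def
proof (intro conjI allI impI)
  show gm[measurable]: "g \<in> borel_measurable borel" using loc_sqD[OF assms] by auto
  fix K :: "'a set" assume K: "compact K"
  then have [measurable]: "K \<in> sets borel" by (simp add: borel_compact)
  show "set_integrable lborel K g" unfolding set_integrable_def
  proof (rule integrable_dominated)
    show "integrable lborel (%x. indicator K x + indicator K x *\<^sub>R (norm (g x))^2)" using loc_sqD(2)[OF assms K] compact_finite_lborel[OF K]
      by (intro Bochner_Integration.integrable_add) (auto simp: set_integrable_def)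
    have "norm (g x) \<le> 1 + (norm (g x))^2" for x using sum_squares_bound[of "norm (g x)" 1] norm_ge_zero[of "g x"] unfolding power_one by linarith
    then show "AE x in lborel. norm (indicator K x *\<^sub>R g x) \<le> norm (indicator K x + indicator K x *\<^sub>R (norm (g x))^2)"
      by (auto simp: indicator_def intro!: AE_I2 order_trans[OF _ abs_ge_self])
  qed measurable
qed

lemma norm_diff_sq_le: "(norm (a - b))^2 \<le> 2 * (norm a)^2 + 2 * (norm (b :: 'a::real_normed_vector))^2"
proof -
  have "(norm (a - b))^2 \<le> (norm a + norm b)^2" by (intro power_mono norm_triangle_ineq4) auto
  also have "... \<le> 2 * (norm a)^2 + 2 * (norm b)^2" using sum_squares_bound[of "norm a" "norm b"] by (simp add: power2_sum)
  finally show ?thesis .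
qed

text \<open>
  The free weight \<open>c\<close> lets one factor be small in exchange for a large bound of the other.
\<close>

lemma mult_le_weighted_squares: "0 < (c::real) ==> a * b \<le> c * a^2 + b^2 / c"
proof -
  assume c: "0 < c"
  have "0 \<le> (c * a - b)^2 + c^2 * a^2 + b^2" by simp
  then have "2 * (c * a * b) \<le> 2 * (c^2 * a^2 + b^2)" by (simp add: power2_eq_square algebra_simps)
  then have "(c * a * b) / c \<le> (c^2 * a^2 + b^2) / c" using c by (intro divide_right_mono) auto
  then show ?thesis using c by (simp add: add_divide_distrib power2_eq_square)
qed

lemma integrable_inner_sq:
  fixes f g :: "'c => 'b::euclidean_space"
  assumes [measurable]: "f \<in> borel_measurable M" "g \<in> borel_measurable M"
    and "integrable M (%x. (norm (f x))^2)" "integrable M (%x. (norm (g x))^2)"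
  shows "integrable M (%x. f x \<bullet> g x)" "integrable M (%x. norm (f x) * norm (g x))"
proof -
  show "integrable M (%x. norm (f x) * norm (g x))"
  proof (rule integrable_dominated)
    show "integrable M (%x. (norm (f x))^2 + (norm (g x))^2)" using assms by auto
    show "AE x in M. norm (norm (f x) * norm (g x)) \<le> norm ((norm (f x))^2 + (norm (g x))^2)"
      using mult_le_weighted_squares[of 1] by (intro AE_I2) simp
  qed measurable
  then show "integrable M (%x. f x \<bullet> g x)" by (rule integrable_dominated) (auto simp: Cauchy_Schwarz_ineq2)
qed

text \<open>
  The part of \<open>F\<close> below a level \<open>k\<close> is paired with the \<open>L\<^sup>1\<close> continuity of translations; the part above has small
  \<open>L\<^sup>2\<close> norm and is paired with the bounded \<open>L\<^sup>2\<close> norm of \<open>g(x - z) - g(x)\<close>.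
\<close>

lemma mollify_weak_limit_sq:
  fixes F g :: "'a::euclidean_space => 'b::euclidean_space"
  assumes g: "loc_sq g" and F[measurable]: "F \<in> borel_measurable borel"
    and F2: "integrable lborel (%x. (norm (F x))^2)"
    and K: "compact K" "\<And>x. x \<notin> K ==> F x = 0"
  shows "((%e. LINT x|lborel. F x \<bullet> mollify e g x) \<longlongrightarrow> (LINT x|lborel. F x \<bullet> g x)) (at_right 0)"
proof (rule mollify_weak_limit(2)[OF loc_sq_imp_loc_int[OF g] F])
  have gm[measurable]: "g \<in> borel_measurable borel" using loc_sqD[OF g] by auto
  obtain G where G: "integrable lborel G" "\<And>x z. x \<in> K ==> norm z < 1 ==> G (x - z) = g (x - z)"
    "integrable lborel (%x. (norm (G x))^2)"
    using loc_int_local_translation[OF loc_sq_imp_loc_int[OF g] K(1)] g by metis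
  have Gm[measurable]: "G \<in> borel_measurable borel" using G(1) by auto
  have G0: "G x = g x" if "x \<in> K" for x using G(2)[OF that, of 0] by simp
  have eq0: "F x \<bullet> g x = F x \<bullet> G x" for x using G0[of x] K(2)[of x] by (cases "x \<in> K") auto
  show "integrable lborel (%x. F x \<bullet> g x)" unfolding eq0 by (rule integrable_inner_sq) (use F2 G in auto)
  fix \<delta> :: real assume \<delta>: "0 < \<delta>"
  define I where "I = (LINT x|lborel. (norm (G x))^2)"
  have I0: "0 \<le> I" unfolding I_def by (rule integral_nonneg_AE) simp
  \<comment> \<open>with this weight the translated and the original square of G contribute at most a quarter of the tolerance\<close>
  define c where "c = 16 * (I + 1) / \<delta>"
  have c: "0 < c" using I0 \<delta> by (simp add: c_def)
  define Fk where "Fk k x = (if norm (F x) > real k then F x else 0)" for k x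
  have Fkm[measurable]: "Fk k \<in> borel_measurable borel" for k unfolding Fk_def[abs_def] by measurable
  have "(%k. LINT x|lborel. (norm (Fk k x))^2) \<longlonglongrightarrow> (LINT x::'a|lborel. (0::real))"
  proof (rule integral_dominated_convergence)
    show "integrable lborel (%x. (norm (F x))^2)" by fact
    show "AE x in lborel. (%k. (norm (Fk k x))^2) \<longlonglongrightarrow> 0"
    proof (rule AE_I2)
      fix x :: 'a
      obtain n where n: "norm (F x) < real n" using reals_Archimedean2 by blast
      show "(%k. (norm (Fk k x))^2) \<longlonglongrightarrow> 0"
        by (rule tendsto_eventually, rule eventually_sequentiallyI[of n]) (use n in \<open>auto simp: Fk_def\<close>)
    qed
  qed (auto simp: Fk_def)
  then have "\<forall>\<^sub>F k in sequentially. (LINT x|lborel. (norm (Fk k x))^2) < \<delta> / (4 * c)"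
    using \<delta> c by (intro order_tendstoD(2)) auto
  then obtain k where k: "(LINT x|lborel. (norm (Fk k x))^2) < \<delta> / (4 * c)" by (auto simp: eventually_sequentially)
  have iFk: "integrable lborel (%x. (norm (Fk k x))^2)" by (rule integrable_dominated[OF F2]) (auto simp: Fk_def)
  have pos: "0 < \<delta> / (4 * (real k + 1))" using \<delta> by simp
  obtain d where d: "0 < d" "\<And>z. norm z < d ==> (LINT x|lborel. norm (G (x - z) - G x)) < \<delta> / (4 * (real k + 1))"
    using translation_continuous_L1[OF G(1) pos] by auto
  show "\<exists>d>0. \<forall>z. norm z < d \<longrightarrow> (\<integral>\<^sup>+x. ennreal (norm (F x) * norm (g (x - z) - g x)) \<partial>lborel) \<le> ennreal \<delta>"
  proof (intro exI[of _ "min 1 d"] conjI allI impI)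
    fix z :: 'a assume z: "norm z < min 1 d"
    let ?D = "%x. norm (G (x - z) - G x)"
    \<comment> \<open>an integrable majorant: large values of F by weighted squares, the others by the level k\<close>
    let ?R = "%x. c * (norm (Fk k x))^2 + (2 * (norm (G (x - z)))^2 + 2 * (norm (G x))^2) / c + real k * ?D x"
    have iz: "integrable lborel (%x. (norm (G (x - z)))^2)" "(LINT x|lborel. (norm (G (x - z)))^2) = I"
      using G(3) integral_translate[of "%x. (norm (G x))^2" z] by (simp_all add: I_def)
    have iD: "integrable lborel ?D" using G(1) by (auto simp: integral_translate(2))
    have iR: "integrable lborel ?R" using iFk iz G(3) iD by auto
    have "(\<integral>\<^sup>+x. ennreal (norm (F x) * norm (g (x - z) - g x)) \<partial>lborel) \<le> (\<integral>\<^sup>+x. ennreal (?R x) \<partial>lborel)"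
    proof (intro nn_integral_mono ennreal_leI)
      fix x
      have "norm (F x) * norm (g (x - z) - g x) \<le> norm (F x) * ?D x" using K(2)[of x] G0[of x] G(2)[of x z] z by (cases "x \<in> K") auto
      also have "... \<le> norm (Fk k x) * ?D x + real k * ?D x" by (auto simp: Fk_def intro: mult_right_mono)
      also have "norm (Fk k x) * ?D x \<le> c * (norm (Fk k x))^2 + (?D x)^2 / c" by (rule mult_le_weighted_squares[OF c])
      also have "(?D x)^2 / c \<le> (2 * (norm (G (x - z)))^2 + 2 * (norm (G x))^2) / c" using c by (intro divide_right_mono norm_diff_sq_le) auto
      finally show "norm (F x) * norm (g (x - z) - g x) \<le> ?R x" by simp
    qed
    also have "... = ennreal (LINT x|lborel. ?R x)" using iR c by (intro nn_integral_eq_integral) auto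
    also have "... \<le> ennreal \<delta>"
    proof (rule ennreal_leI)
      have "(LINT x|lborel. ?R x) = c * (LINT x|lborel. (norm (Fk k x))^2) + (2 * I + 2 * I) / c + real k * (LINT x|lborel. ?D x)"
        using iFk iz G(3) iD by (simp add: I_def)
      also have "c * (LINT x|lborel. (norm (Fk k x))^2) \<le> c * (\<delta> / (4 * c))" using k c by (intro mult_left_mono) auto
      also have "c * (\<delta> / (4 * c)) = \<delta> / 4" using c by simp
      also have "(2 * I + 2 * I) / c \<le> \<delta> / 4"
      proof -
        have "(2 * I + 2 * I) * 4 \<le> \<delta> * c" using I0 \<delta> by (simp add: c_def)
        then show ?thesis using c by (simp add: field_simps)
      qed
      also have "real k * (LINT x|lborel. ?D x) \<le> real k * (\<delta> / (4 * (real k + 1)))" using d(2)[of z] z by (intro mult_left_mono) auto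
      also have "real k * (\<delta> / (4 * (real k + 1))) \<le> \<delta> / 4" using \<delta> by (simp add: field_simps)
      finally show "(LINT x|lborel. ?R x) \<le> \<delta>" using \<delta> by simp
    qed
    finally show "(\<integral>\<^sup>+x. ennreal (norm (F x) * norm (g (x - z) - g x)) \<partial>lborel) \<le> ennreal \<delta>" .
  qed (use d in auto)
qed

lemma test_function_mollifier:
  assumes "0 < e"
  shows "test_function UNIV (%y. mollifier e (x - y))"
proof (rule test_functionI)
  show "Ck k (%y. mollifier e (x - y))" for k using Ck_affine[OF Ck_mollifier, of k e "-1" x] by simp
  show "compact ((%z. x - z) ` cbox 0 (e *\<^sub>R One))" by (intro compact_reflect_translate compact_cbox)
  show "mollifier e (x - y) = 0" if "y \<notin> (%z. x - z) ` cbox 0 (e *\<^sub>R One)" for y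
  proof (rule mollifier_eq_0[OF assms], rule)
    assume "x - y \<in> cbox 0 (e *\<^sub>R One)"
    then have "x - (x - y) \<in> (%z. x - z) ` cbox 0 (e *\<^sub>R One)" by (rule imageI)
    with that show False by simp
  qed
qed auto

text \<open>
  Testing with the sign of \<open>g\<close> on a ball gives in the limit the integral of \<open>|g|\<close> over that ball. The hypothesis
  concerns the kernels alone, because on a product space these are in separated variables.
\<close>

lemma mollify_zero_imp_AE_zero:
  fixes g :: "'a::euclidean_space => 'b::euclidean_space"
  assumes g: "loc_int g" and z: "\<And>e x. 0 < e ==> mollify e g x = 0"
  shows "AE x in lborel. g x = 0"
proof -
  have gm[measurable]: "g \<in> borel_measurable borel" using loc_intD[OF g] by auto
  have "AE x in lborel. x \<in> cball 0 (real n) \<longrightarrow> g x = 0" for n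
  proof -
    let ?K = "cball 0 (real n) :: 'a set"
    define F where "F x = (indicator ?K x / norm (g x)) *\<^sub>R g x" for x
    have [measurable]: "?K \<in> sets borel" by simp
    have [measurable]: "F \<in> borel_measurable borel" unfolding F_def[abs_def] by measurable
    have Fg: "F x \<bullet> g x = indicator ?K x *\<^sub>R norm (g x)" for x
      by (cases "g x = 0") (auto simp: F_def power2_norm_eq_inner[symmetric] power2_eq_square indicator_def)
    have "((%e. LINT x|lborel. F x \<bullet> mollify e g x) \<longlongrightarrow> (LINT x|lborel. F x \<bullet> g x)) (at_right 0)"
    proof (rule mollify_weak_limit_bounded[OF g _ compact_cball[of 0 "real n"]])
      show "norm (F x) \<le> 1" for x by (auto simp: F_def indicator_def)
    qed (auto simp: F_def)
    moreover have "((%e. LINT x|lborel. F x \<bullet> mollify e g x) \<longlongrightarrow> 0) (at_right 0)"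
      by (rule tendsto_eventually) (auto simp: eventually_at_filter z)
    ultimately have "(LINT x|lborel. indicator ?K x *\<^sub>R norm (g x)) = 0" unfolding Fg by (rule tendsto_unique[OF trivial_limit_at_right_real])
    moreover have "integrable lborel (%x. indicator ?K x *\<^sub>R norm (g x))"
    proof -
      have "integrable lborel (%x. norm (indicator ?K x *\<^sub>R g x))"
        using loc_intD(2)[OF g compact_cball[of 0 "real n"]] by (intro integrable_norm) (simp add: set_integrable_def)
      then show ?thesis by simp
    qed
    ultimately have "AE x in lborel. indicator ?K x *\<^sub>R norm (g x) = 0" by (subst (asm) integral_nonneg_eq_0_iff_AE) auto
    then show ?thesis by eventually_elim (auto simp: indicator_def split: if_splits)
  qed
  then have "AE x in lborel. \<forall>n. x \<in> cball 0 (real n) \<longrightarrow> g x = 0" unfolding AE_all_countable by blast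
  then show ?thesis by eventually_elim (use real_arch_simple in \<open>auto simp: mem_cball\<close>)
qed

lemma fundamental_lemma_AE_zero:
  fixes g :: "'a::euclidean_space => 'b::euclidean_space"
  assumes g: "loc_int g" and z: "\<And>psi. test_function UNIV psi ==> (LINT x|lborel. psi x *\<^sub>R g x) = 0"
  shows "AE x in lborel. g x = 0"
  by (rule mollify_zero_imp_AE_zero[OF g]) (simp add: mollify_def z[OF test_function_mollifier])

section \<open>Gradients, convolutions and the product rule\<close>

definition grad :: "('a::euclidean_space => real) => 'a => 'a" where
  "grad f x = (\<Sum>b\<in>Basis. frechet_derivative f (at x) b *\<^sub>R b)"

text \<open>
  The gradient represents the derivative, so that statements about \<^const>\<open>frechet_derivative\<close> become statements
  about an inner product.
\<close>

lemma grad_inner: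
  assumes "f differentiable (at x)"
  shows "frechet_derivative f (at x) v = grad f x \<bullet> v"
proof -
  have lin: "linear (frechet_derivative f (at x))" by (rule linear_frechet_derivative[OF assms])
  have "frechet_derivative f (at x) v = frechet_derivative f (at x) (\<Sum>b\<in>Basis. (v \<bullet> b) *\<^sub>R b)"
    by (simp add: euclidean_representation)
  also have "... = (\<Sum>b\<in>Basis. (v \<bullet> b) * frechet_derivative f (at x) b)" using lin by (simp add: linear_sum linear_scale)
  also have "... = grad f x \<bullet> v" unfolding grad_def inner_sum_left by (intro sum.cong) (simp_all add: inner_commute mult.commute)
  finally show ?thesis .
qed

lemma grad_eqI:
  assumes "(f has_derivative (%v. g \<bullet> v)) (at x)"
  shows "grad f x = g"
proof -
  have "frechet_derivative f (at x) = (%v. g \<bullet> v)" using frechet_derivative_at[OF assms] by simp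
  then show ?thesis by (simp add: grad_def euclidean_representation)
qed

lemma has_derivative_grad:
  assumes "f differentiable (at x)"
  shows "(f has_derivative (%v. grad f x \<bullet> v)) (at x)"
  using assms unfolding frechet_derivative_works by (simp add: grad_inner[OF assms, symmetric])

lemma test_functionD:
  assumes "test_function S psi"
  shows "Ck k psi" "psi differentiable (at x)" "continuous_on UNIV psi"
    "continuous_on UNIV (grad psi)" "psi \<in> borel_measurable borel" "grad psi \<in> borel_measurable borel"
    "test_function UNIV psi"
proof -
  show C: "Ck k psi" for k using assms by (simp add: test_function_def)
  show "psi differentiable (at x)" using C[of 1] by simp
  show 1: "continuous_on UNIV psi" by (rule continuous_on_Ck[OF C])
  have "continuous_on UNIV (%x. frechet_derivative psi (at x) b)" if "b \<in> Basis" for b using continuous_on_Ck[OF Ck_SucD(2)[OF C that]] .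
  then show 2: "continuous_on UNIV (grad psi)" unfolding grad_def by (auto intro!: continuous_intros)
  show "psi \<in> borel_measurable borel" "grad psi \<in> borel_measurable borel" using 1 2 by (auto intro: borel_measurable_continuous_onI)
  show "test_function UNIV psi" using assms by (simp add: test_function_def)
qed

lemma test_function_bounds:
  assumes "test_function S (psi :: 'a::euclidean_space => real)"
  obtains K B where "compact K" "\<And>x. x \<notin> K ==> psi x = 0" "\<And>x. x \<notin> K ==> grad psi x = 0"
    "0 \<le> B" "\<And>x. \<bar>psi x\<bar> \<le> B" "\<And>x. norm (grad psi x) \<le> B" "K \<subseteq> S"
proof -
  define K where "K = closure {x. psi x \<noteq> 0}"
  have K: "compact K" "K \<subseteq> S" using assms by (auto simp: test_function_def K_def)
  have z: "psi x = 0" if "x \<notin> K" for x using that closure_subset[of "{x. psi x \<noteq> 0}"] unfolding K_def by blast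
  have gz: "grad psi x = 0" if "x \<notin> K" for x
  proof (rule grad_eqI)
    have "((%_. 0) has_derivative (%_. 0)) (at x)" by simp
    then have "(psi has_derivative (%_. 0)) (at x)"
    proof (rule has_derivative_transform_within_open)
      show "open (- K)" by (rule open_Compl[OF compact_imp_closed[OF K(1)]])
      show "x \<in> - K" using that by blast
      show "0 = psi y" if "y \<in> - K" for y using z[of y] that by (metis ComplD)
    qed
    then show "(psi has_derivative (%v. 0 \<bullet> v)) (at x)" by simp
  qed
  have "bounded (psi ` K)" "bounded (grad psi ` K)"
    using K(1) test_functionD(3,4)[OF assms] by (auto intro!: compact_imp_bounded compact_continuous_image intro: continuous_on_subset)
  then obtain B1 B2 where B: "\<And>x. x \<in> K ==> \<bar>psi x\<bar> \<le> B1" "\<And>x. x \<in> K ==> norm (grad psi x) \<le> B2"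
    unfolding bounded_iff by force
  show ?thesis
  proof (rule that[of K "max 0 (max B1 B2)"])
    show "\<bar>psi x\<bar> \<le> max 0 (max B1 B2)" for x using z[of x] B(1)[of x] by (cases "x \<in> K") auto
    show "norm (grad psi x) \<le> max 0 (max B1 B2)" for x using gz[of x] B(2)[of x] by (cases "x \<in> K") auto
  qed (use K z gz in auto)
qed

lemma test_function_mult:
  assumes "test_function S f" "\<And>k. Ck k g"
  shows "test_function S (%x. f x * g x)"
    "grad (%x. f x * g x) x = g x *\<^sub>R grad f x + f x *\<^sub>R grad g x"
proof -
  obtain K where K: "compact K" "\<And>x. x \<notin> K ==> f x = 0" "K \<subseteq> S" using test_function_bounds[OF assms(1)] by metis
  show "test_function S (%x. f x * g x)" by (rule test_functionI[OF _ K(1)]) (use assms K in \<open>auto intro: Ck_mult test_functionD\<close>)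
  have "g differentiable (at x)" using assms(2)[of 1] by simp
  then have "((%x. f x * g x) has_derivative (%v. f x * (grad g x \<bullet> v) + (grad f x \<bullet> v) * g x)) (at x)"
    by (intro has_derivative_mult has_derivative_grad test_functionD[OF assms(1)])
  then show "grad (%x. f x * g x) x = g x *\<^sub>R grad f x + f x *\<^sub>R grad g x"
    by (intro grad_eqI, elim has_derivative_eq_rhs) (auto simp: inner_add_left algebra_simps)
qed

lemma grad_affine:
  assumes "f differentiable (at (c *\<^sub>R x + d))"
  shows "grad (%x. f (c *\<^sub>R x + d)) x = c *\<^sub>R grad f (c *\<^sub>R x + d)"
proof (rule grad_eqI)
  have "((%x. f (c *\<^sub>R x + d)) has_derivative (%v. grad f (c *\<^sub>R x + d) \<bullet> (c *\<^sub>R v))) (at x)"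
  proof -
    have 1: "((%x. c *\<^sub>R x + d) has_derivative (%v. c *\<^sub>R v)) (at x)" by (auto intro!: derivative_eq_intros)
    show ?thesis by (rule has_derivative_compose[OF 1, of f "%v. grad f (c *\<^sub>R x + d) \<bullet> v", OF has_derivative_grad[OF assms]])
  qed
  then show "((%x. f (c *\<^sub>R x + d)) has_derivative (%v. (c *\<^sub>R grad f (c *\<^sub>R x + d)) \<bullet> v)) (at x)" by simp
qed

lemma test_function_mollifier_self:
  assumes "0 < e" shows "test_function UNIV (mollifier e)"
  by (rule test_functionI[OF Ck_mollifier compact_cbox mollifier_eq_0[OF assms]]) auto

lemma grad_mollifier_reflect:
  assumes "0 < e"
  shows "grad (%y. mollifier e (x - y)) y = - grad (mollifier e) (x - y)"
    "grad (%x. mollifier e (x - y)) x = grad (mollifier e) (x - y)"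
  using grad_affine[of "mollifier e" "-1" y x] grad_affine[of "mollifier e" 1 x "-y"]
    test_functionD(2)[OF test_function_mollifier_self[OF assms]] by auto

lemma integrable_pair_mult:
  fixes f :: "'a::euclidean_space => real" and g :: "'b::euclidean_space => real"
  assumes f: "integrable lborel f" and g: "integrable lborel g"
  shows "integrable lborel2 (%(x, y). f x * g y)"
proof -
  have [measurable]: "f \<in> borel_measurable borel" "g \<in> borel_measurable borel" using f g by auto
  show ?thesis
  proof (rule lborel_pair.Fubini_integrable)
    show "integrable lborel (%x. LINT y|lborel. norm (case (x, y) of (x, y) => f x * g y))" using f by (simp add: abs_mult)
    show "AE x in lborel. integrable lborel (%y. case (x, y) of (x, y) => f x * g y)" using g by simp
  qed measurable
qed

definition weak_div :: "('a::euclidean_space => 'a) => ('a => real) => bool" where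
  "weak_div u h \<longleftrightarrow> (\<forall>psi. test_function UNIV psi \<longrightarrow>
     (LINT x|lborel. grad psi x \<bullet> u x) = - (LINT x|lborel. psi x * h x))"

definition weak_grad :: "('a::euclidean_space => real) => ('a => 'a) => bool" where
  "weak_grad w D \<longleftrightarrow> (\<forall>psi. test_function UNIV psi \<longrightarrow>
     (LINT x|lborel. w x *\<^sub>R grad psi x) = - (LINT x|lborel. psi x *\<^sub>R D x))"

lemma integrable_test_mult:
  fixes g :: "'a::euclidean_space => 'b::euclidean_space"
  assumes "test_function S psi" "loc_int g"
  shows "integrable lborel (%x. psi x *\<^sub>R g x)"
  using test_function_bounds[OF assms(1)] integrable_bounded_support_mult[OF assms(2) test_functionD(5)[OF assms(1)]] by metis

lemma loc_int_inner:
  fixes f g :: "'a::euclidean_space => 'b::euclidean_space"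
  assumes "loc_sq f" "loc_sq g"
  shows "loc_int (%x. f x \<bullet> g x)"
  unfolding loc_int_def
proof (intro conjI allI impI)
  have [measurable]: "f \<in> borel_measurable borel" "g \<in> borel_measurable borel" using assms loc_sqD by auto
  show "(%x. f x \<bullet> g x) \<in> borel_measurable borel" by measurable
  fix K :: "'a set" assume K: "compact K"
  then have [measurable]: "K \<in> sets borel" by (simp add: borel_compact)
  have sq: "(%x. (norm (indicator K x *\<^sub>R f x))^2) = (%x. indicator K x *\<^sub>R (norm (f x))^2)" for f :: "'a => 'b"
    by (auto simp: fun_eq_iff indicator_def)
  have "integrable lborel (%x. (indicator K x *\<^sub>R f x) \<bullet> (indicator K x *\<^sub>R g x))"
    using loc_sqD(2)[OF assms(1) K] loc_sqD(2)[OF assms(2) K] unfolding set_integrable_def sq[symmetric] by (intro integrable_inner_sq) measurable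
  then show "set_integrable lborel K (%x. f x \<bullet> g x)"
    unfolding set_integrable_def by (rule back_subst[of "integrable lborel"]) (auto simp: fun_eq_iff indicator_def)
qed

lemma loc_int_mult:
  fixes f g :: "'a::euclidean_space => real"
  shows "loc_sq f ==> loc_sq g ==> loc_int (%x. f x * g x)"
  using loc_int_inner[of f g] by simp

text \<open>
  A multiple of \<open>u\<close> by a bounded function with compact support.
\<close>

lemma integrable_sq_bounded_support:
  fixes u :: "'a::euclidean_space => 'b::euclidean_space" and F :: "'a => 'c::euclidean_space"
  assumes u: "loc_sq u" and [measurable]: "F \<in> borel_measurable borel" and K: "compact K"
    and "\<And>x. x \<notin> K ==> F x = 0" "\<And>x. norm (F x) \<le> B * norm (u x)"
  shows "integrable lborel (%x. (norm (F x))^2)"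
proof (rule integrable_dominated)
  show "integrable lborel (%x. B^2 * (indicator K x *\<^sub>R (norm (u x))^2))"
    using loc_sqD(2)[OF u K] unfolding set_integrable_def by (intro integrable_mult_right)
  show "AE x in lborel. norm ((norm (F x))^2) \<le> norm (B^2 * (indicator K x *\<^sub>R (norm (u x))^2))"
  proof (rule AE_I2)
    fix x
    have "(norm (F x))^2 \<le> (B * norm (u x))^2" by (intro power_mono assms) auto
    then show "norm ((norm (F x))^2) \<le> norm (B^2 * (indicator K x *\<^sub>R (norm (u x))^2))"
      using assms(4)[of x] by (cases "x \<in> K") (auto simp: power_mult_distrib)
  qed
qed measurable

lemma convolution_locally_bounded:
  fixes f :: "'a::euclidean_space => 'b::euclidean_space" and \<kappa> :: "'a => real"
  assumes k[measurable]: "\<kappa> \<in> borel_measurable borel" and C: "compact C" "\<And>x. x \<notin> C ==> \<kappa> x = 0" "\<And>x. \<bar>\<kappa> x\<bar> \<le> M"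
    and f: "loc_int f" and K: "compact K"
  shows "\<exists>B. \<forall>x\<in>K. norm (LINT y|lborel. \<kappa> (x - y) *\<^sub>R f y) \<le> B"
    and "(%x. LINT y|lborel. \<kappa> (x - y) *\<^sub>R f y) \<in> borel_measurable borel"
proof -
  note [measurable] = loc_intD(1)[OF f]
  show "(%x. LINT y|lborel. \<kappa> (x - y) *\<^sub>R f y) \<in> borel_measurable borel" by measurable
  define K' where "K' = {x - y | x y. x \<in> K \<and> y \<in> C}"
  have K': "compact K'" unfolding K'_def by (rule compact_differences[OF K C(1)])
  have K'z: "y \<in> K'" if "x \<in> K" "x - y \<in> C" for x y
    unfolding K'_def mem_Collect_eq by (rule exI[of _ x], rule exI[of _ "x - y"]) (use that in auto)
  have M: "0 \<le> M" using C(3)[of 0] by linarith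
  have iw: "integrable lborel (%y. M * norm (indicator K' y *\<^sub>R f y))"
    using loc_intD(2)[OF f K'] unfolding set_integrable_def by (intro integrable_mult_right integrable_norm)
  show "\<exists>B. \<forall>x\<in>K. norm (LINT y|lborel. \<kappa> (x - y) *\<^sub>R f y) \<le> B"
  proof (intro exI ballI)
    fix x assume x: "x \<in> K"
    show "norm (LINT y|lborel. \<kappa> (x - y) *\<^sub>R f y) \<le> (LINT y|lborel. M * norm (indicator K' y *\<^sub>R f y))"
    proof (rule Bochner_Integration.integral_norm_bound_integral)
      have b: "norm (\<kappa> (x - y) *\<^sub>R f y) \<le> M * norm (indicator K' y *\<^sub>R f y)" for y
      proof (cases "x - y \<in> C")
        case True
        then show ?thesis using K'z[OF x True] C(3)[of "x - y"] by (simp add: mult_right_mono)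
      next
        case False
        then show ?thesis using C(2) M by simp
      qed
      then show "norm (\<kappa> (x - y) *\<^sub>R f y) \<le> M * norm (indicator K' y *\<^sub>R f y)" for y .
      show "integrable lborel (%y. \<kappa> (x - y) *\<^sub>R f y)"
        by (rule integrable_dominated[OF iw]) (use b in \<open>auto intro!: AE_I2 intro: order_trans[OF _ abs_ge_self]\<close>)
    qed fact
  qed
qed

lemma locally_bounded_locally_Lp:
  fixes g :: "'a::euclidean_space => 'b::euclidean_space"
  assumes [measurable]: "g \<in> borel_measurable borel" and B: "\<And>K. compact K ==> \<exists>B. \<forall>x\<in>K. norm (g x) \<le> B" and p: "0 < p"
  shows "locally_Lp p g"
  unfolding locally_Lp_def
proof (intro conjI allI impI)
  fix K :: "'a set" assume K: "compact K"
  then have [measurable]: "K \<in> sets borel" by (simp add: borel_compact)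
  obtain B where B: "\<And>x. x \<in> K ==> norm (g x) \<le> B" using B[OF K] by blast
  show "set_integrable lborel K (%x. norm (g x) powr p)" unfolding set_integrable_def
  proof (rule integrable_dominated)
    show "integrable lborel (%x. B powr p * indicator K x)"
      using compact_finite_lborel[OF K] by (intro integrable_mult_right integrable_real_indicator) auto
    show "AE x in lborel. norm (indicator K x *\<^sub>R norm (g x) powr p) \<le> norm (B powr p * indicator K x)"
      using B p by (intro AE_I2) (auto simp: indicator_def intro!: powr_mono2)
  qed measurable
qed fact

lemma loc_int_mollify:
  fixes f :: "'a::euclidean_space => 'b::euclidean_space"
  assumes "loc_int f" "0 < e"
  shows "0 < p ==> locally_Lp p (mollify e f)" "loc_sq (mollify e f)" "loc_int (mollify e f)"
proof -
  obtain C M where C: "compact C" "\<And>x::'a. x \<notin> C ==> mollifier e x = 0" "\<And>x::'a. \<bar>mollifier e x\<bar> \<le> M"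
    using test_function_bounds[OF test_function_mollifier_self[OF assms(2), where 'a='a]] by metis
  have [measurable]: "mollify e f \<in> borel_measurable borel" using loc_intD(1)[OF assms(1)] by simp
  note c = convolution_locally_bounded(1)[OF measurable_mollifier C assms(1)]
  have "locally_Lp p (mollify e f)" if "0 < p" for p
    by (rule locally_bounded_locally_Lp[OF _ _ that]) (use c in \<open>simp_all add: mollify_def\<close>)
  from this[of p] this[of 2] show "0 < p ==> locally_Lp p (mollify e f)" "loc_sq (mollify e f)" by (auto simp: locally_Lp_2_iff)
  then show "loc_int (mollify e f)" by (rule_tac loc_sq_imp_loc_int)
qed

lemma integrable_convolution:
  fixes f :: "'a::euclidean_space => 'b::euclidean_space"
  assumes k: "k \<in> borel_measurable borel" and K: "compact K" "\<And>x. x \<notin> K ==> k x = 0" "\<And>x. \<bar>k x\<bar> \<le> (B::real)" and f: "loc_int f"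
  shows "integrable lborel (%y. k (x - y) *\<^sub>R f y)"
proof (rule integrable_bounded_support_mult[OF f])
  show "(%y. k (x - y)) \<in> borel_measurable borel" using k by measurable
  show "compact ((%z. x - z) ` K)" by (rule compact_reflect_translate[OF K(1)])
  show "k (x - y) = 0" if "y \<notin> (%z. x - z) ` K" for y using that image_eqI[of y "%z. x - z" "x - y" K] by (intro K(2)) auto
qed (rule K(3))

text \<open>
  The gradient is continuous and vanishes off a compact set, whose unit neighbourhood is still compact.
\<close>

lemma grad_uniformly_continuous:
  assumes t: "test_function S psi" and e: "0 < e"
  shows "\<exists>d>0. \<forall>x h. norm h < d \<longrightarrow> norm (grad psi (x + h) - grad psi x) \<le> e"
proof -
  obtain K where K: "compact K" "\<And>x. x \<notin> K ==> grad psi x = 0" by (rule test_function_bounds[OF t]) (rule that)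
  obtain R where R: "\<And>x. x \<in> K ==> norm x \<le> R" using compact_imp_bounded[OF K(1)] unfolding bounded_iff by blast
  have "uniformly_continuous_on (cball 0 (R + 1)) (grad psi)"
    using test_functionD(4)[OF t] by (intro compact_uniformly_continuous) (auto intro: continuous_on_subset)
  then obtain d where d: "0 < d" "\<And>x y. x \<in> cball 0 (R + 1) ==> y \<in> cball 0 (R + 1) ==> dist y x < d ==> dist (grad psi y) (grad psi x) < e"
    using e unfolding uniformly_continuous_on_def by metis
  have "norm (grad psi (x + h) - grad psi x) \<le> e" if h: "norm h < min d 1" for x h
  proof (cases "x \<in> K \<or> x + h \<in> K")
    case True
    then have "norm x \<le> R \<or> norm (x + h) \<le> R" using R by auto
    then have "norm x \<le> R + 1" "norm (x + h) \<le> R + 1" using h norm_triangle_ineq[of x h] norm_triangle_ineq4[of "x + h" h] by auto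
    then have "dist (grad psi (x + h)) (grad psi x) < e" using h by (intro d(2)) (simp_all only: mem_cball_0, simp_all add: dist_norm)
    then show ?thesis by (simp add: dist_norm)
  qed (use K e in auto)
  then show ?thesis using d(1) by (intro exI[of _ "min d 1"]) auto
qed

text \<open>
  The linearisation error of the kernel is at most \<open>\<epsilon> |h|\<close> uniformly, because its gradient is uniformly continuous, and
  it is supported in a fixed compact set, over which \<open>f\<close> is integrable.
\<close>

lemma convolution_has_derivative:
  fixes f :: "'a::euclidean_space => real"
  assumes t: "test_function UNIV k" and f: "loc_int f"
  shows "((%x. LINT y|lborel. k (x - y) * f y) has_derivative (%v. LINT y|lborel. (grad k (x - y) \<bullet> v) * f y)) (at x)"
  unfolding has_derivative_at_alt
proof (intro conjI allI impI)
  note [measurable] = test_functionD(5,6)[OF t]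
  obtain K B where K: "compact K" "\<And>x. x \<notin> K ==> k x = 0" "\<And>x. x \<notin> K ==> grad k x = 0"
    and B: "\<And>x. \<bar>k x\<bar> \<le> B" "\<And>x. norm (grad k x) \<le> B" by (rule test_function_bounds[OF t]) (rule that)
  have ik: "integrable lborel (%y. k (x - y) * f y)" for x using integrable_convolution[OF test_functionD(5)[OF t] K(1,2) B(1) f, where x=x] by simp
  have ig: "integrable lborel (%y. (grad k (x - y) \<bullet> v) * f y)" for v
  proof -
    have m: "(%z. grad k z \<bullet> v) \<in> borel_measurable borel" by measurable
    have "\<bar>grad k z \<bullet> v\<bar> \<le> B * norm v" for z by (rule order_trans[OF Cauchy_Schwarz_ineq2 mult_right_mono[OF B(2) norm_ge_zero]])
    from integrable_convolution[OF m K(1) _ this f, where x=x] show ?thesis using K(3) by simp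
  qed
  show "bounded_linear (%v. LINT y|lborel. (grad k (x - y) \<bullet> v) * f y)" unfolding linear_conv_bounded_linear[symmetric]
  proof (rule linearI)
    fix a b :: 'a and c :: real
    show "(LINT y|lborel. (grad k (x - y) \<bullet> (a + b)) * f y) = (LINT y|lborel. (grad k (x - y) \<bullet> a) * f y) + (LINT y|lborel. (grad k (x - y) \<bullet> b) * f y)"
      unfolding Bochner_Integration.integral_add[OF ig ig, symmetric] by (simp add: inner_add_right distrib_right)
    show "(LINT y|lborel. (grad k (x - y) \<bullet> (c *\<^sub>R a)) * f y) = c *\<^sub>R (LINT y|lborel. (grad k (x - y) \<bullet> a) * f y)"
      by (simp add: mult.assoc)
  qed
  fix e :: real assume e: "0 < e"
  \<comment> \<open>outside this set neither x - y nor a unit perturbation of it meets the support of the kernel\<close>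
  define Q where "Q = (%z. x - z) ` {a + b | a b. a \<in> K \<and> b \<in> cball 0 1}"
  have "compact Q" unfolding Q_def by (intro compact_reflect_translate compact_sums K compact_cball)
  then have iQ: "integrable lborel (%y. norm (indicator Q y *\<^sub>R f y))"
    using loc_intD(2)[OF f] unfolding set_integrable_def by (intro integrable_norm)
  define A where "A = (LINT y|lborel. norm (indicator Q y *\<^sub>R f y))"
  have A: "0 \<le> A" unfolding A_def by simp
  have "0 < e / (A + 1)" using A e by simp
  from grad_uniformly_continuous[OF t this] obtain d where d: "0 < d" "\<And>x h. norm h < d ==> norm (grad k (x + h) - grad k x) \<le> e / (A + 1)" by blast
  show "\<exists>d>0. \<forall>x'. norm (x' - x) < d \<longrightarrow> norm ((LINT y|lborel. k (x' - y) * f y) - (LINT y|lborel. k (x - y) * f y)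
      - (LINT y|lborel. (grad k (x - y) \<bullet> (x' - x)) * f y)) \<le> e * norm (x' - x)"
  proof (intro exI[of _ "min d 1"] conjI allI impI)
    fix x' assume x': "norm (x' - x) < min d 1"
    let ?h = "x' - x"
    have pw: "norm ((k (x' - y) - k (x - y) - grad k (x - y) \<bullet> ?h) * f y) \<le> (norm ?h * (e / (A + 1))) * norm (indicator Q y *\<^sub>R f y)" for y
    proof (cases "y \<in> Q")
      case True
      have "norm (k (x' - y) - k (x - y) - grad k (x - y) \<bullet> ((x' - y) - (x - y))) \<le> norm ((x' - y) - (x - y)) * (e / (A + 1))"
      proof (rule differentiable_bound_linearization[where f'="%z v. grad k z \<bullet> v" and S="{z. norm (z - (x - y)) \<le> norm ?h}"])
        show "(k has_derivative (%v. grad k z \<bullet> v)) (at z within S)" for z S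
          by (rule has_derivative_at_withinI[OF has_derivative_grad[OF test_functionD(2)[OF t]]])
        fix z assume "z \<in> {z. norm (z - (x - y)) \<le> norm ?h}"
        then have g: "norm (grad k z - grad k (x - y)) \<le> e / (A + 1)" using x' d(2)[of "z - (x - y)" "x - y"] by simp
        show "onorm ((%v. grad k z \<bullet> v) - (%v. grad k (x - y) \<bullet> v)) \<le> e / (A + 1)"
        proof (rule onorm_le)
          fix v
          show "norm (((%v. grad k z \<bullet> v) - (%v. grad k (x - y) \<bullet> v)) v) \<le> e / (A + 1) * norm v"
            unfolding minus_apply inner_diff_left[symmetric] real_norm_def by (rule order_trans[OF Cauchy_Schwarz_ineq2 mult_right_mono[OF g norm_ge_zero]])
        qed
      qed (auto intro: mult_left_le_one_le)
      from mult_right_mono[OF this, of "norm (f y)"] show ?thesis using True by (simp add: abs_mult)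
    next
      case False
      have "y \<in> Q" if z: "z - y \<in> K" "norm (x - z) \<le> 1" for z
      proof -
        have "(z - y) + (x - z) \<in> {a + b | a b. a \<in> K \<and> b \<in> cball 0 1}" using z by (intro CollectI exI[of _ "z - y"] exI[of _ "x - z"]) auto
        from imageI[OF this, of "%z. x - z"] show ?thesis by (simp add: Q_def)
      qed
      from this[of x] this[of x'] have "x - y \<notin> K" "x' - y \<notin> K" using False x' by (auto simp: norm_minus_commute)
      then show ?thesis using K False by simp
    qed
    have "norm (LINT y|lborel. (k (x' - y) - k (x - y) - grad k (x - y) \<bullet> ?h) * f y) \<le> (LINT y|lborel. (norm ?h * (e / (A + 1))) * norm (indicator Q y *\<^sub>R f y))"
      by (rule Bochner_Integration.integral_norm_bound_integral) (use ik ig iQ pw in \<open>auto simp: left_diff_distrib\<close>)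
    also have "... = norm ?h * ((e / (A + 1)) * A)" unfolding A_def by simp
    also have "... \<le> norm ?h * e" using A e by (intro mult_left_mono) (auto simp: field_simps)
    finally show "norm ((LINT y|lborel. k (x' - y) * f y) - (LINT y|lborel. k (x - y) * f y)
      - (LINT y|lborel. (grad k (x - y) \<bullet> ?h) * f y)) \<le> e * norm ?h"
      unfolding Bochner_Integration.integral_diff[OF ik ik, symmetric] Bochner_Integration.integral_diff[OF Bochner_Integration.integrable_diff[OF ik ik] ig, symmetric]
      unfolding left_diff_distrib[symmetric] mult.commute[of e] .
  qed (use d in auto)
qed

lemma test_function_directional_derivative:
  assumes t: "test_function UNIV k" and b: "b \<in> Basis"
  shows "test_function UNIV (%x. grad k x \<bullet> b)"
proof -
  obtain K where K: "compact K" "\<And>x. x \<notin> K ==> grad k x = 0" by (rule test_function_bounds[OF t]) (rule that)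
  have "Ck j (%x. grad k x \<bullet> b)" for j using Ck_SucD(2)[OF test_functionD(1)[OF t] b] unfolding grad_inner[OF test_functionD(2)[OF t]] .
  then show ?thesis by (rule test_functionI[OF _ K(1)]) (use K in auto)
qed

text \<open>
  Directional derivatives of a test function are test functions, so the derivative of a convolution is again a convolution.
\<close>

lemma Ck_convolution:
  fixes f :: "'a::euclidean_space => real"
  assumes "test_function UNIV k" and f: "loc_int f"
  shows "Ck n (%x. LINT y|lborel. k (x - y) * f y)"
  using assms(1)
proof (induction n arbitrary: k)
  case 0
  show ?case using has_derivative_continuous[OF convolution_has_derivative[OF 0 f]] by (simp add: continuous_on_eq_continuous_at)
next
  case (Suc n)
  note d = convolution_has_derivative[OF Suc.prems f]
  show ?case using d Suc.IH[OF test_function_directional_derivative[OF Suc.prems]]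
    by (auto simp: frechet_derivative_at[OF d, symmetric] intro: differentiableI)
qed

lemma mollify_smooth:
  fixes f :: "'a::euclidean_space => real"
  assumes f: "loc_int f" and e: "0 < e"
  shows "Ck n (mollify e f)" "grad (mollify e f) x \<bullet> v = (LINT y|lborel. (grad (mollifier e) (x - y) \<bullet> v) * f y)"
proof -
  note t = test_function_mollifier_self[OF e, where 'a='a]
  have m: "mollify e f = (%x. LINT y|lborel. mollifier e (x - y) * f y)" by (simp add: mollify_def fun_eq_iff)
  show "Ck n (mollify e f)" unfolding m by (rule Ck_convolution[OF t f])
  note d = convolution_has_derivative[OF t f, folded m]
  show "grad (mollify e f) x \<bullet> v = (LINT y|lborel. (grad (mollifier e) (x - y) \<bullet> v) * f y)"
    using grad_inner[OF differentiableI[OF d[of x]], of v] unfolding frechet_derivative_at[OF d[of x], symmetric] by simp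
qed

text \<open>
  The convolution of \<open>psi\<close> with the constant 1 is constant; its derivative is the integral of the gradient.
\<close>

lemma test_function_integral_grad_zero:
  fixes psi :: "'a::euclidean_space => real"
  assumes t: "test_function UNIV psi"
  shows "(LINT x|lborel. grad psi x \<bullet> v) = 0"
proof -
  have reflect: "(LINT y|lborel. g (x - y)) = (LINT y|lborel. g y)" for g :: "'a => real" and x
    using lborel_integral_affine(1)[of "-1" "%y. g (x - y)" x] by simp
  have "loc_int (%_::'a. 1::real)"
    unfolding loc_int_def set_integrable_def using compact_finite_lborel by (auto intro!: integrable_real_indicator borel_compact)
  from convolution_has_derivative[OF t this, of 0]
  have "((%x. LINT y|lborel. psi y) has_derivative (%v. LINT y|lborel. grad psi y \<bullet> v)) (at 0)"
    using reflect[of psi] reflect[of "%z. grad psi z \<bullet> _" 0] by simp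
  from has_derivative_unique[OF this has_derivative_const] show ?thesis by (simp add: fun_eq_iff)
qed

text \<open>
  The definition of the weak gradient, applied to the kernel as a test function.
\<close>

lemma grad_mollify:
  fixes w :: "'a::euclidean_space => real"
  assumes w: "weak_grad w D" "loc_int w" and e: "0 < e"
  shows "grad (mollify e w) x = mollify e D x"
proof -
  note t = test_function_mollifier_self[OF e, where 'a='a]
  obtain K B where K: "compact K" "\<And>x::'a. x \<notin> K ==> grad (mollifier e) x = 0" "\<And>x::'a. norm (grad (mollifier e) x) \<le> B"
    by (rule test_function_bounds[OF t]) (rule that)
  note [measurable] = test_functionD(6)[OF t]
  have i: "integrable lborel (%y. (grad (mollifier e) (x - y) \<bullet> b) *\<^sub>R w y)" if "b \<in> Basis" for b
    by (rule integrable_convolution[OF _ K(1) _ _ w(2), where B=B])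
      (use K that Basis_le_norm in \<open>auto intro: order_trans[OF Basis_le_norm[OF that]]\<close>)
  have I: "integrable lborel (%y. w y *\<^sub>R grad (mollifier e) (x - y))"
  proof -
    have "integrable lborel (%y. \<Sum>b\<in>Basis. ((grad (mollifier e) (x - y) \<bullet> b) *\<^sub>R w y) *\<^sub>R b)"
      by (intro Bochner_Integration.integrable_sum integrable_scaleR_left i)
    moreover have "(\<Sum>b\<in>Basis. ((grad (mollifier e) (x - y) \<bullet> b) *\<^sub>R w y) *\<^sub>R b) = w y *\<^sub>R grad (mollifier e) (x - y)" for y
      by (subst (2) euclidean_representation[symmetric]) (simp add: scaleR_sum_right mult.commute)
    ultimately show ?thesis by simp
  qed
  have "(LINT y|lborel. w y *\<^sub>R grad (%y. mollifier e (x - y)) y) = - (LINT y|lborel. mollifier e (x - y) *\<^sub>R D y)"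
    using w(1) test_function_mollifier[OF e] unfolding weak_grad_def by blast
  then have eq: "(LINT y|lborel. w y *\<^sub>R grad (mollifier e) (x - y)) = mollify e D x" by (simp add: grad_mollifier_reflect(1)[OF e] mollify_def)
  show ?thesis
  proof (rule euclidean_eqI)
    fix b :: 'a
    show "grad (mollify e w) x \<bullet> b = mollify e D x \<bullet> b"
      unfolding mollify_smooth(2)[OF w(2) e] eq[symmetric] using integral_inner_left[OF I, of b] by (simp add: mult.commute)
  qed
qed

text \<open>
  If \<open>w\<close> is smooth, \<open>eta w\<close> is a test function and the claim is the definition of the weak divergence of \<open>u\<close>. In general
  the mollification of \<open>w\<close> takes this role; since \<open>u\<close>, \<open>h\<close> and the gradient of \<open>w\<close> are locally square
  integrable, all three integrals converge.
\<close>

lemma weak_div_mult: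
  fixes u D :: "'a::euclidean_space => 'a" and h w :: "'a => real"
  assumes uh: "weak_div u h" and wD: "weak_grad w D"
    and sq: "loc_sq u" "loc_sq h" "loc_sq w" "loc_sq D"
  shows "weak_div (%x. w x *\<^sub>R u x) (%x. w x * h x + u x \<bullet> D x)"
  unfolding weak_div_def
proof (intro allI impI)
  fix eta :: "'a => real" assume eta: "test_function UNIV eta"
  obtain K B where K: "compact K" "\<And>x. x \<notin> K ==> eta x = 0" "\<And>x. x \<notin> K ==> grad eta x = 0"
    and B: "0 \<le> B" "\<And>x. \<bar>eta x\<bar> \<le> B" "\<And>x. norm (grad eta x) \<le> B"
    using test_function_bounds[OF eta] by metis
  note meas[measurable] = sq[THEN loc_sqD(1)] test_functionD(5,6)[OF eta]
  note li = sq[THEN loc_sq_imp_loc_int]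
  have Kb[measurable]: "K \<in> sets borel" using K by (simp add: borel_compact)
  have i1: "integrable lborel (%x. (norm (grad eta x \<bullet> u x))^2)"
  proof (rule integrable_sq_bounded_support[OF sq(1) _ K(1), where B=B])
    show "norm (grad eta x \<bullet> u x) \<le> B * norm (u x)" for x
      using order_trans[OF Cauchy_Schwarz_ineq2 mult_right_mono[OF B(3) norm_ge_zero], of x "u x"] by simp
  qed (use K in auto)
  have i2: "integrable lborel (%x. (norm (eta x *\<^sub>R u x))^2)"
    by (rule integrable_sq_bounded_support[OF sq(1) _ K(1), where B=B]) (use K B in \<open>auto intro: mult_right_mono\<close>)
  have i3: "integrable lborel (%x. (norm (eta x * h x))^2)"
    by (rule integrable_sq_bounded_support[OF sq(2) _ K(1), where B=B]) (use K B in \<open>auto simp: abs_mult intro: mult_right_mono\<close>)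
  have main: "(LINT x|lborel. (grad eta x \<bullet> u x) \<bullet> mollify e w x) + (LINT x|lborel. (eta x *\<^sub>R u x) \<bullet> mollify e D x)
      = - (LINT x|lborel. (eta x * h x) \<bullet> mollify e w x)" if e: "0 < e" for e
  proof -
    note m = loc_int_mollify(2)[OF li(3) e] loc_int_mollify(2)[OF li(4) e]
    note [measurable] = m[THEN loc_sqD(1)]
    have on_K: "integrable lborel (%x. F x \<bullet> g x)"
      if F: "integrable lborel (%x. (norm (F x))^2)" "\<And>x. x \<notin> K ==> F x = 0" and g: "loc_sq g" and [measurable]: "F \<in> borel_measurable borel"
      for F g :: "'a => 'c::euclidean_space"
    proof -
      have [measurable]: "g \<in> borel_measurable borel" by (rule loc_sqD(1)[OF g])
      have "integrable lborel (%x. (norm (indicator K x *\<^sub>R g x))^2)"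
        by (rule integrable_sq_bounded_support[OF g _ K(1), where B=1]) (auto simp: indicator_def)
      then have "integrable lborel (%x. F x \<bullet> (indicator K x *\<^sub>R g x))" by (intro integrable_inner_sq(1) F) measurable
      moreover have "(%x. F x \<bullet> (indicator K x *\<^sub>R g x)) = (%x. F x \<bullet> g x)" using F(2) by (force simp: indicator_def)
      ultimately show ?thesis by (simp only:)
    qed
    have j1: "integrable lborel (%x. (grad eta x \<bullet> u x) \<bullet> mollify e w x)" by (rule on_K[OF i1 _ m(1)]) (use K in auto)
    have j2: "integrable lborel (%x. (eta x *\<^sub>R u x) \<bullet> mollify e D x)" by (rule on_K[OF i2 _ m(2)]) (use K in auto)
    note tm = test_function_mult[OF eta mollify_smooth(1)[OF li(3) e]]
    have "(LINT x|lborel. grad (%x. eta x * mollify e w x) x \<bullet> u x) = - (LINT x|lborel. (eta x * mollify e w x) * h x)"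
      using uh tm(1) unfolding weak_div_def by blast
    then show ?thesis
      unfolding Bochner_Integration.integral_add[OF j1 j2, symmetric] tm(2) grad_mollify[OF wD li(3) e] by (simp add: inner_add_left inner_add_right mult_ac inner_commute)
  qed
  have l1: "((%e. LINT x|lborel. (grad eta x \<bullet> u x) \<bullet> mollify e w x) \<longlongrightarrow> (LINT x|lborel. (grad eta x \<bullet> u x) \<bullet> w x)) (at_right 0)"
    by (rule mollify_weak_limit_sq[OF sq(3) _ i1 K(1)]) (use K in auto)
  have l2: "((%e. LINT x|lborel. (eta x *\<^sub>R u x) \<bullet> mollify e D x) \<longlongrightarrow> (LINT x|lborel. (eta x *\<^sub>R u x) \<bullet> D x)) (at_right 0)"
    by (rule mollify_weak_limit_sq[OF sq(4) _ i2 K(1)]) (use K in auto)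
  have l3: "((%e. LINT x|lborel. (eta x * h x) \<bullet> mollify e w x) \<longlongrightarrow> (LINT x|lborel. (eta x * h x) \<bullet> w x)) (at_right 0)"
    by (rule mollify_weak_limit_sq[OF sq(3) _ i3 K(1)]) (use K in auto)
  have "((%e. - (LINT x|lborel. (eta x * h x) \<bullet> mollify e w x)) \<longlongrightarrow> (LINT x|lborel. (grad eta x \<bullet> u x) \<bullet> w x) + (LINT x|lborel. (eta x *\<^sub>R u x) \<bullet> D x)) (at_right 0)"
    by (rule Lim_transform_eventually[OF tendsto_add[OF l1 l2] eventually_mono[OF eventually_at_right_less]]) (rule main)
  then have eq: "(LINT x|lborel. (grad eta x \<bullet> u x) \<bullet> w x) + (LINT x|lborel. (eta x *\<^sub>R u x) \<bullet> D x) = - (LINT x|lborel. (eta x * h x) \<bullet> w x)"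
    using tendsto_unique[OF trivial_limit_at_right_real _ tendsto_minus[OF l3]] by blast
  have j1: "integrable lborel (%x. eta x * (w x * h x))" using integrable_test_mult[OF eta loc_int_mult[OF sq(3,2)]] by simp
  have j2: "integrable lborel (%x. eta x * (u x \<bullet> D x))" using integrable_test_mult[OF eta loc_int_inner[OF sq(1,4)]] by simp
  have "(LINT x|lborel. eta x * (w x * h x + u x \<bullet> D x)) = (LINT x|lborel. eta x * (w x * h x)) + (LINT x|lborel. eta x * (u x \<bullet> D x))"
    using Bochner_Integration.integral_add[OF j1 j2] by (simp add: distrib_left)
  then show "(LINT x|lborel. grad eta x \<bullet> w x *\<^sub>R u x) = - (LINT x|lborel. eta x * (w x * h x + u x \<bullet> D x))"
    using eq by (simp add: mult_ac)
qed

section \<open>Periodic functions\<close>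

lemma AE_translate:
  fixes a :: "'a::euclidean_space"
  assumes "AE x in lborel. P x"
  shows "AE x in lborel. P (x + a)"
proof -
  obtain N where N: "N \<in> null_sets lborel" "{x. \<not> P x} \<subseteq> N" using assms by (auto simp: eventually_ae_filter)
  then have [measurable]: "N \<in> sets borel" by auto
  have "AE x in distr lborel borel ((+) a). x \<notin> N" unfolding lborel_distr_plus using N(1) by (rule AE_not_in)
  then have "AE x in lborel. a + x \<notin> N" by (subst (asm) AE_distr_iff) auto
  then show ?thesis by eventually_elim (use N in \<open>auto simp: add.commute\<close>)
qed

text \<open>
  The periods up to null sets form a group. Weak derivatives are defined up to null sets only, hence periodicity of a
  derivative can be claimed only almost everywhere.
\<close>

definition AE_periods :: "('a::euclidean_space => 'b) => 'a set" where
  "AE_periods f = {a. AE x in lborel. f (x + a) = f x}"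

lemma AE_periods_0: "0 \<in> AE_periods f"
  by (simp add: AE_periods_def)

lemma AE_periods_add:
  assumes "a \<in> AE_periods f" "b \<in> AE_periods f" shows "a + b \<in> AE_periods f"
proof -
  have a: "AE x in lborel. f (x + a) = f x" and b: "AE x in lborel. f (x + b) = f x" using assms by (auto simp: AE_periods_def)
  have "AE x in lborel. f (x + (a + b)) = f x" using a AE_translate[OF b, of a] by eventually_elim (simp add: add.assoc)
  then show ?thesis by (simp add: AE_periods_def)
qed

lemma AE_periods_neg:
  assumes "a \<in> AE_periods f" shows "- a \<in> AE_periods f"
proof -
  have a: "AE x in lborel. f (x + a) = f x" using assms by (auto simp: AE_periods_def)
  have "AE x in lborel. f (x + (- a)) = f x" using AE_translate[OF a, of "- a"] by eventually_elim simp
  then show ?thesis by (simp add: AE_periods_def)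
qed

lemma AE_periods_int_multiple:
  assumes "a \<in> AE_periods f" shows "of_int n *\<^sub>R a \<in> AE_periods f"
proof -
  have nat: "of_nat n *\<^sub>R a \<in> AE_periods f" for n
  proof (induction n)
    case 0
    then show ?case by (simp add: AE_periods_def)
  next
    case (Suc n)
    then show ?case using AE_periods_add[OF assms Suc] by (simp add: scaleR_left_distrib)
  qed
  show ?thesis
  proof (cases "0 \<le> n")
    case True
    then show ?thesis using nat[of "nat n"] by simp
  next
    case False
    then show ?thesis using AE_periods_neg[OF nat[of "nat (- n)"]] by simp
  qed
qed

lemma AE_periods_sum:
  "finite I ==> (\<And>i. i \<in> I ==> a i \<in> AE_periods f) ==> sum a I \<in> AE_periods f"
  by (induction I rule: finite_induct) (auto intro: AE_periods_add AE_periods_0)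

definition AE_periodic :: "real => (real^3 => 'b) => bool" where
  "AE_periodic L f \<longleftrightarrow> (\<forall>i. L *\<^sub>R axis i 1 \<in> AE_periods f)"

definition lattice :: "real => (3 => int) => real^3" where
  "lattice L k = (\<chi> i. L * of_int (k i))"

lemma AE_periodic_lattice:
  assumes "AE_periodic L f"
  shows "AE x in lborel. f (x + lattice L k) = f x"
proof -
  have "(\<Sum>i\<in>UNIV. of_int (k i) *\<^sub>R (L *\<^sub>R axis i 1)) \<in> AE_periods f"
    using assms by (intro AE_periods_sum AE_periods_int_multiple) (auto simp: AE_periodic_def)
  moreover have "(\<Sum>i\<in>UNIV. of_int (k i) *\<^sub>R (L *\<^sub>R axis i 1)) = lattice L k"
    by (simp add: vec_eq_iff lattice_def axis_def if_distrib[of "%x. _ * x"] cong: if_cong)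
  ultimately show ?thesis by (simp add: AE_periods_def)
qed

lemma AE_periodicI: "(\<And>x i. f (x + L *\<^sub>R axis i 1) = f x) ==> AE_periodic L f"
  by (auto simp: AE_periodic_def AE_periods_def)

lemma AE_periodic_comp2:
  assumes "AE_periodic L f" "AE_periodic L g"
  shows "AE_periodic L (%x. F (f x) (g x))"
proof -
  have "AE x in lborel. F (f (x + L *\<^sub>R axis i 1)) (g (x + L *\<^sub>R axis i 1)) = F (f x) (g x)" for i
  proof -
    have "AE x in lborel. f (x + L *\<^sub>R axis i 1) = f x" "AE x in lborel. g (x + L *\<^sub>R axis i 1) = g x"
      using assms by (auto simp: AE_periodic_def AE_periods_def)
    then show ?thesis by eventually_elim simp
  qed
  then show ?thesis by (auto simp: AE_periodic_def AE_periods_def)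
qed

lemma AE_periodic_comp: "AE_periodic L f ==> AE_periodic L (%x. F (f x))"
  using AE_periodic_comp2[of L f f "%y _. F y"] .

text \<open>
  The half-open cell, whose lattice translates are disjoint and cover; it differs from the closed cell by a null set.
\<close>

definition hcell :: "real => (real^3) set" where
  "hcell L = {x. \<forall>i. 0 \<le> x $ i \<and> x $ i < L}"

lemma measurable_vec_nth[measurable]: "(%x::real^'n. x $ i) \<in> borel_measurable borel"
  by (intro borel_measurable_continuous_onI continuous_intros)

lemma hcell_measurable[measurable]: "hcell L \<in> sets borel"
  unfolding hcell_def by measurable

lemma cell_measurable[measurable]: "cell L \<in> sets borel" and compact_cell: "compact (cell L)"
  by (auto simp: cell_def compact_cbox)

lemma hcell_subset: "hcell L \<subseteq> cell L"
  by (auto simp: hcell_def cell_def mem_box_cart) (metis less_imp_le)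

lemma AE_hcell_cell: "AE x in lborel. x \<in> hcell L \<longleftrightarrow> x \<in> cell L"
proof -
  have "cbox 0 (\<chi> i. L) - box 0 (\<chi> i. L) \<in> null_sets (lborel :: (real^3) measure)" unfolding null_sets_def
    by (auto simp: emeasure_Diff emeasure_lborel_box_eq emeasure_lborel_cbox_eq box_subset_cbox box_eq_empty)
  then have "AE x in lborel. x \<notin> cbox 0 (\<chi> i. L) - box 0 (\<chi> i. L :: real^3)" by (rule AE_not_in)
  then show ?thesis
  proof eventually_elim
    case (elim x)
    then have "x \<in> cell L ==> x \<in> box 0 (\<chi> i. L)" by (auto simp: cell_def)
    then show ?case using hcell_subset[of L] by (auto simp: hcell_def mem_box_cart less_imp_le)
  qed
qed

lemma indicator_hcell: "indicator (hcell L) x = (\<Prod>i\<in>UNIV. indicator {0..<L} (x $ i) :: real)"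
  by (auto simp: hcell_def indicator_def)

lemma sum_indicator_shifts:
  assumes L: "0 < L" and s: "- real m * L \<le> s" "s < real m * L"
  shows "(\<Sum>j\<in>{- int m..<int m}. indicator {0..<L} (s - L * of_int j) :: real) = 1"
proof -
  have "indicator {0..<L} (s - L * of_int j) = (if j = \<lfloor>s / L\<rfloor> then 1 else 0 :: real)" for j
  proof -
    have "\<lfloor>s / L\<rfloor> = j \<longleftrightarrow> 0 \<le> s - L * of_int j \<and> s - L * of_int j < L"
      using L by (auto simp: floor_eq_iff pos_le_divide_eq pos_divide_less_eq algebra_simps)
    then show ?thesis by (auto simp: indicator_def)
  qed
  moreover have "\<lfloor>s / L\<rfloor> \<in> {- int m..<int m}" using s L by (auto simp: le_floor_iff floor_less_iff field_simps)
  ultimately show ?thesis by simp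
qed

lemma sum_hcell_shifts:
  assumes L: "0 < L" and s: "\<And>i. - real m * L \<le> x $ i \<and> x $ i < real m * L"
  shows "(\<Sum>k\<in>PiE UNIV (%_. {- int m..<int m}). indicator (hcell L) (x - lattice L k) :: real) = 1"
proof -
  have "(\<Sum>k\<in>PiE UNIV (%_. {- int m..<int m}). indicator (hcell L) (x - lattice L k) :: real)
      = (\<Prod>i\<in>UNIV. \<Sum>j\<in>{- int m..<int m}. indicator {0..<L} (x $ i - L * of_int j))"
    by (subst prod_sum_PiE) (auto simp: indicator_hcell lattice_def)
  also have "... = 1" using s by (intro prod.neutral ballI sum_indicator_shifts L) auto
  finally show ?thesis .
qed

text \<open>
  The support of the weight is cut into lattice translates of the half-open cell. Translating each piece back, periodicity of \<open>h\<close>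
  leaves the sum of the shifted weights, which factorises over the coordinates and is constant.
\<close>

lemma unfold_product:
  fixes h :: "real^3 => 'b::euclidean_space" and f :: "3 => real => real"
  assumes L: "0 < L" and h: "loc_int h" "AE_periodic L h"
    and f[measurable]: "\<And>i. f i \<in> borel_measurable borel" and fB: "\<And>i s. \<bar>f i s\<bar> \<le> B"
    and f0: "\<And>i s. s < - real m * L \<or> real m * L \<le> s ==> f i s = 0"
    and c: "\<And>i s. 0 \<le> s ==> s < L ==> (\<Sum>j\<in>{- int m..<int m}. f i (s + L * of_int j)) = c i"
  shows "integrable lborel (%x. (\<Prod>i\<in>UNIV. f i (x $ i)) *\<^sub>R h x)"
    and "(LINT x|lborel. (\<Prod>i\<in>UNIV. f i (x $ i)) *\<^sub>R h x) = (\<Prod>i\<in>UNIV. c i) *\<^sub>R (LINT x:cell L|lborel. h x)"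
proof -
  let ?F = "%x::real^3. \<Prod>i\<in>UNIV. f i (x $ i)"
  let ?K = "PiE UNIV (%_::3. {- int m..<int m})"
  have finK: "finite ?K" by (intro finite_PiE) auto
  have hm[measurable]: "h \<in> borel_measurable borel" using loc_intD h by blast
  have B: "0 \<le> B" using fB[of undefined 0] by linarith
  let ?C = "cbox (\<chi> i. - real m * L) (\<chi> i. real m * L) :: (real^3) set"
  have F0: "?F x = 0" if "\<not> (\<forall>i. - real m * L \<le> x $ i \<and> x $ i < real m * L)" for x
    using that f0 by (intro prod_zero) (auto simp: not_le not_less)
  have FB: "\<bar>?F x\<bar> \<le> B ^ 3" for x unfolding abs_prod using prod_mono[of UNIV "%i. \<bar>f i (x $ i)\<bar>" "%_. B"] fB by simp
  have iF: "integrable lborel (%x. (?F x * p x) *\<^sub>R h x)" if p[measurable]: "p \<in> borel_measurable borel" "\<And>x. 0 \<le> p x" "\<And>x. p x \<le> 1" for p :: "real^3 => real"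
  proof (rule integrable_bounded_support_mult[OF h(1) _ compact_cbox])
    show "?F x * p x = 0" if "x \<notin> ?C" for x
    proof -
      have "?F x = 0" by (rule F0) (use that in \<open>auto simp: mem_box_cart intro: less_imp_le\<close>)
      then show ?thesis by simp
    qed
    show "\<bar>?F x * p x\<bar> \<le> B ^ 3" for x using mult_mono[OF FB[of x] that(3)[of x]] B that(2)[of x] by (simp add: abs_mult)
  qed measurable
  show "integrable lborel (%x. ?F x *\<^sub>R h x)" using iF[of "%_. 1"] by simp
  have split: "?F x *\<^sub>R h x = (\<Sum>k\<in>?K. (?F x * indicator (hcell L) (x - lattice L k)) *\<^sub>R h x)" for x
  proof (cases "\<forall>i. - real m * L \<le> x $ i \<and> x $ i < real m * L")
    case True
    then have "?F x * (\<Sum>k\<in>?K. indicator (hcell L) (x - lattice L k)) = ?F x" by (subst sum_hcell_shifts[OF L]) auto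
    then show ?thesis by (simp add: sum_distrib_left flip: scaleR_left.sum)
  next
    case False
    show ?thesis unfolding F0[OF False] by simp
  qed
  have step: "(LINT x|lborel. (?F x * indicator (hcell L) (x - lattice L k)) *\<^sub>R h x)
      = (LINT x|lborel. (?F (x + lattice L k) * indicator (hcell L) x) *\<^sub>R h x)" for k
  proof -
    have "(LINT x|lborel. (?F x * indicator (hcell L) (x - lattice L k)) *\<^sub>R h x)
      = (LINT x|lborel. (?F (x + lattice L k) * indicator (hcell L) x) *\<^sub>R h (x + lattice L k))"
      using integral_translate(1)[of "%x. (?F x * indicator (hcell L) (x - lattice L k)) *\<^sub>R h x" "- lattice L k"] by simp
    also have "... = (LINT x|lborel. (?F (x + lattice L k) * indicator (hcell L) x) *\<^sub>R h x)"
    proof (rule integral_cong_AE)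
      show "AE x in lborel. (?F (x + lattice L k) * indicator (hcell L) x) *\<^sub>R h (x + lattice L k) = (?F (x + lattice L k) * indicator (hcell L) x) *\<^sub>R h x"
        using AE_periodic_lattice[OF h(2), of k] by eventually_elim simp
    qed measurable
    finally show ?thesis .
  qed
  have i2: "integrable lborel (%x. (?F (x + lattice L k) * indicator (hcell L) x) *\<^sub>R h x)" for k
  proof (rule integrable_bounded_support_mult[OF h(1) _ compact_cell[of L]])
    show "?F (x + lattice L k) * indicator (hcell L) x = 0" if "x \<notin> cell L" for x using that hcell_subset by (auto simp: indicator_def)
    show "\<bar>?F (x + lattice L k) * indicator (hcell L) x\<bar> \<le> B ^ 3" for x using FB[of "x + lattice L k"] B by (auto simp: indicator_def)
  qed measurable
  have "(LINT x|lborel. ?F x *\<^sub>R h x) = (\<Sum>k\<in>?K. LINT x|lborel. (?F x * indicator (hcell L) (x - lattice L k)) *\<^sub>R h x)"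
    unfolding split by (intro Bochner_Integration.integral_sum iF) auto
  also have "... = (\<Sum>k\<in>?K. LINT x|lborel. (?F (x + lattice L k) * indicator (hcell L) x) *\<^sub>R h x)" unfolding step ..
  also have "... = (LINT x|lborel. (\<Sum>k\<in>?K. (?F (x + lattice L k) * indicator (hcell L) x) *\<^sub>R h x))"
    by (intro Bochner_Integration.integral_sum[symmetric] i2)
  also have "... = (LINT x|lborel. (\<Prod>i\<in>UNIV. c i) *\<^sub>R (indicator (cell L) x *\<^sub>R h x))"
  proof (rule integral_cong_AE)
    show "AE x in lborel. (\<Sum>k\<in>?K. (?F (x + lattice L k) * indicator (hcell L) x) *\<^sub>R h x) = (\<Prod>i\<in>UNIV. c i) *\<^sub>R (indicator (cell L) x *\<^sub>R h x)"
      using AE_hcell_cell[of L]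
    proof eventually_elim
      case (elim x)
      have "(\<Sum>k\<in>?K. ?F (x + lattice L k)) = (\<Prod>i\<in>UNIV. c i)" if "x \<in> hcell L"
      proof -
        have "(\<Sum>k\<in>?K. ?F (x + lattice L k)) = (\<Prod>i\<in>UNIV. \<Sum>j\<in>{- int m..<int m}. f i (x $ i + L * of_int j))"
          by (subst prod_sum_PiE) (auto simp: lattice_def)
        also have "... = (\<Prod>i\<in>UNIV. c i)" using that by (intro prod.cong refl c) (auto simp: hcell_def)
        finally show ?thesis .
      qed
      then show ?case using elim by (cases "x \<in> hcell L") (simp_all flip: scaleR_left.sum)
    qed
  qed measurable
  also have "... = (\<Prod>i\<in>UNIV. c i) *\<^sub>R (LINT x:cell L|lborel. h x)" unfolding set_lebesgue_integral_def by (rule integral_scaleR_right)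
  finally show "(LINT x|lborel. ?F x *\<^sub>R h x) = (\<Prod>i\<in>UNIV. c i) *\<^sub>R (LINT x:cell L|lborel. h x)" .
qed

lemma nn_integral_translate:
  fixes f :: "'a::euclidean_space => ennreal"
  assumes [measurable]: "f \<in> borel_measurable borel"
  shows "(\<integral>\<^sup>+x. f (x + a) \<partial>lborel) = (\<integral>\<^sup>+x. f x \<partial>lborel)"
proof -
  have "(\<integral>\<^sup>+x. f x \<partial>lborel) = (\<integral>\<^sup>+x. f x \<partial>(distr lborel borel ((+) a)))"
    by (simp add: lborel_distr_plus)
  also have "... = (\<integral>\<^sup>+x. f (x + a) \<partial>lborel)" by (subst nn_integral_distr) (auto simp: add.commute)
  finally show ?thesis ..
qed

text \<open>
  A compact set is covered by finitely many translates of the cell, and their number does not depend on the function.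
\<close>

lemma nn_integral_periodic_compact:
  assumes L: "0 < L" and K: "compact K"
  shows "\<exists>N::nat. \<forall>h::real^3 => ennreal. h \<in> borel_measurable borel \<longrightarrow> AE_periodic L h \<longrightarrow>
    (\<integral>\<^sup>+x\<in>K. h x \<partial>lborel) \<le> of_nat N * (\<integral>\<^sup>+x\<in>cell L. h x \<partial>lborel)"
proof -
  obtain B where B: "\<And>x. x \<in> K ==> norm x \<le> B" using compact_imp_bounded[OF K] by (auto simp: bounded_iff)
  obtain m :: nat where m: "B / L < real m" using reals_Archimedean2 by blast
  let ?K = "PiE UNIV (%_::3. {- int m..<int m})"
  have finK: "finite ?K" by (intro finite_PiE) auto
  have mL: "- real m * L \<le> x $ i \<and> x $ i < real m * L" if "x \<in> K" for x i
  proof -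
    have "\<bar>x $ i\<bar> \<le> B" using B[OF that] component_le_norm_cart[of x i] by linarith
    moreover have "B < real m * L" using m L by (simp add: field_simps)
    ultimately show ?thesis by auto
  qed
  show ?thesis
  proof (intro exI[of _ "card ?K"] allI impI)
    fix h :: "real^3 => ennreal" assume hm[measurable]: "h \<in> borel_measurable borel" and per: "AE_periodic L h"
    have "(\<integral>\<^sup>+x\<in>K. h x \<partial>lborel) \<le> (\<integral>\<^sup>+x. (\<Sum>k\<in>?K. h x * indicator (hcell L) (x - lattice L k)) \<partial>lborel)"
    proof (rule nn_integral_mono)
      fix x
      show "h x * indicator K x \<le> (\<Sum>k\<in>?K. h x * indicator (hcell L) (x - lattice L k))"
      proof (cases "x \<in> K")
        case True
        have "(\<Sum>k\<in>?K. indicator (hcell L) (x - lattice L k) :: ennreal) = ennreal (\<Sum>k\<in>?K. indicator (hcell L) (x - lattice L k))"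
          by (subst sum_ennreal[symmetric]) (auto simp: ennreal_indicator)
        also have "... = 1" using sum_hcell_shifts[OF L, of m x] mL[OF True] by simp
        finally show ?thesis using True by (simp add: sum_distrib_left[symmetric])
      qed simp
    qed
    also have "... = (\<Sum>k\<in>?K. (\<integral>\<^sup>+x. h x * indicator (hcell L) (x - lattice L k) \<partial>lborel))"
      by (intro nn_integral_sum) measurable
    also have "... = (\<Sum>k\<in>?K. (\<integral>\<^sup>+x\<in>hcell L. h x \<partial>lborel))"
    proof (intro sum.cong refl)
      fix k
      have "(\<integral>\<^sup>+x. h x * indicator (hcell L) (x - lattice L k) \<partial>lborel) = (\<integral>\<^sup>+x. h (x + lattice L k) * indicator (hcell L) x \<partial>lborel)"
        using nn_integral_translate[of "%x. h x * indicator (hcell L) (x - lattice L k)" "lattice L k"] by simp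
      also have "... = (\<integral>\<^sup>+x\<in>hcell L. h x \<partial>lborel)"
        using AE_periodic_lattice[OF per, of k] by (intro nn_integral_cong_AE) auto
      finally show "(\<integral>\<^sup>+x. h x * indicator (hcell L) (x - lattice L k) \<partial>lborel) = (\<integral>\<^sup>+x\<in>hcell L. h x \<partial>lborel)" .
    qed
    also have "... = of_nat (card ?K) * (\<integral>\<^sup>+x\<in>hcell L. h x \<partial>lborel)" by simp
    also have "(\<integral>\<^sup>+x\<in>hcell L. h x \<partial>lborel) \<le> (\<integral>\<^sup>+x\<in>cell L. h x \<partial>lborel)"
      using hcell_subset by (intro nn_integral_mono) (auto simp: indicator_def)
    finally show "(\<integral>\<^sup>+x\<in>K. h x \<partial>lborel) \<le> of_nat (card ?K) * (\<integral>\<^sup>+x\<in>cell L. h x \<partial>lborel)"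
      by (simp add: mult_left_mono)
  qed
qed

text \<open>
  The exceptional set within the cell is carried over to all of space by countably many translations.
\<close>

lemma AE_periodic_bound:
  assumes L: "0 < L" and per: "AE_periodic L u" and u[measurable]: "u \<in> borel_measurable borel"
    and b: "AE x in lborel. x \<in> cell L \<longrightarrow> norm (u x :: 'b::euclidean_space) \<le> B"
  shows "AE x in lborel. norm (u x) \<le> B"
proof -
  let ?h = "%x. indicator {x. B < norm (u x)} x :: ennreal"
  have perh: "AE_periodic L ?h" using AE_periodic_comp[OF per, of "%y. indicator {y. B < norm y} y :: ennreal"] by (simp add: indicator_def)
  have hm: "?h \<in> borel_measurable borel" by measurable
  have z: "(\<integral>\<^sup>+x\<in>cell L. ?h x \<partial>lborel) = 0"
    using b by (subst nn_integral_0_iff_AE) (auto elim!: eventually_mono simp: indicator_def)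
  have "AE x in lborel. x \<in> cball 0 (real n) \<longrightarrow> norm (u x) \<le> B" for n
  proof -
    obtain N :: nat where "(\<integral>\<^sup>+x\<in>cball 0 (real n). ?h x \<partial>lborel) \<le> of_nat N * (\<integral>\<^sup>+x\<in>cell L. ?h x \<partial>lborel)"
      using nn_integral_periodic_compact[OF L compact_cball[of 0 "real n"]] perh hm by blast
    then have "(\<integral>\<^sup>+x\<in>cball 0 (real n). ?h x \<partial>lborel) = 0" unfolding z by simp
    then have "AE x in lborel. ?h x * indicator (cball 0 (real n)) x = 0"
    proof (subst (asm) nn_integral_0_iff_AE)
      have [measurable]: "(cball 0 (real n) :: (real^3) set) \<in> sets borel" by simp
      show "(%x. ?h x * indicator (cball 0 (real n)) x) \<in> borel_measurable lborel" by measurable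
    qed
    then show ?thesis by eventually_elim (auto simp: indicator_def not_less split: if_splits)
  qed
  then have "AE x in lborel. \<forall>n. x \<in> cball 0 (real n) \<longrightarrow> norm (u x) \<le> B" unfolding AE_all_countable by blast
  then show ?thesis by eventually_elim (use real_arch_simple in \<open>auto simp: mem_cball\<close>)
qed

section \<open>Weak partial derivatives and solenoidal fields\<close>

lemma weak_partialD:
  assumes "weak_partial j f g"
  shows "loc_int f" "loc_int g"
    "test_function UNIV psi ==> (LINT x|lborel. (grad psi x $ j) *\<^sub>R f x) = - (LINT x|lborel. psi x *\<^sub>R g x)"
proof -
  show "loc_int f" "loc_int g" using assms by (auto simp: weak_partial_def locally_Lp_1_iff)
  assume t: "test_function UNIV psi"
  have "frechet_derivative psi (at x) (axis j 1) = grad psi x $ j" for x by (simp add: grad_inner[OF test_functionD(2)[OF t]] inner_axis)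
  moreover have "(LINT x|lborel. frechet_derivative psi (at x) (axis j 1) *\<^sub>R f x) = - (LINT x|lborel. psi x *\<^sub>R g x)"
    using assms t unfolding weak_partial_def by blast
  ultimately show "(LINT x|lborel. (grad psi x $ j) *\<^sub>R f x) = - (LINT x|lborel. psi x *\<^sub>R g x)" by simp
qed

lemma weak_partialI:
  assumes "loc_int f" "loc_int g"
    "\<And>psi. test_function UNIV psi ==> (LINT x|lborel. (grad psi x $ j) *\<^sub>R f x) = - (LINT x|lborel. psi x *\<^sub>R g x)"
  shows "weak_partial j f g"
proof -
  have "frechet_derivative psi (at x) (axis j 1) = grad psi x $ j" if "test_function UNIV psi" for x psi
    by (simp add: grad_inner[OF test_functionD(2)[OF that]] inner_axis)
  then show ?thesis using assms by (simp add: weak_partial_def locally_Lp_1_iff)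
qed

lemma loc_int_diff: "loc_int f ==> loc_int g ==> loc_int (%x. f x - g x)"
  by (auto simp: loc_int_def intro: set_integral_diff)

lemma loc_sq_diff:
  fixes f g :: "'a::euclidean_space => 'b::euclidean_space"
  assumes "loc_sq f" "loc_sq g" shows "loc_sq (%x. f x - g x)"
  unfolding loc_sq_def
proof (intro conjI allI impI)
  have [measurable]: "f \<in> borel_measurable borel" "g \<in> borel_measurable borel" using assms loc_sqD by auto
  show "(%x. f x - g x) \<in> borel_measurable borel" by measurable
  fix K :: "'a set" assume K: "compact K"
  then have [measurable]: "K \<in> sets borel" by (simp add: borel_compact)
  show "set_integrable lborel K (%x. (norm (f x - g x))^2)" unfolding set_integrable_def
  proof (rule integrable_dominated)
    show "integrable lborel (%x. 2 * (indicator K x *\<^sub>R (norm (f x))^2) + 2 * (indicator K x *\<^sub>R (norm (g x))^2))"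
      using loc_sqD(2)[OF assms(1) K] loc_sqD(2)[OF assms(2) K] unfolding set_integrable_def
      by (intro Bochner_Integration.integrable_add integrable_mult_right)
    show "AE x in lborel. norm (indicator K x *\<^sub>R (norm (f x - g x))^2)
      \<le> norm (2 * (indicator K x *\<^sub>R (norm (f x))^2) + 2 * (indicator K x *\<^sub>R (norm (g x))^2))"
      using norm_diff_sq_le by (intro AE_I2) (auto simp: indicator_def)
  qed measurable
qed

lemma loc_int_cong_AE:
  fixes f g :: "'a::euclidean_space => 'b::euclidean_space"
  assumes "loc_int f" and [measurable]: "g \<in> borel_measurable borel" and "AE x in lborel. f x = g x"
  shows "loc_int g"
  unfolding loc_int_def
proof (intro conjI allI impI)
  have [measurable]: "f \<in> borel_measurable borel" using assms loc_intD by auto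
  fix K :: "'a set" assume K: "compact K"
  then have [measurable]: "K \<in> sets borel" by (simp add: borel_compact)
  show "set_integrable lborel K g" using loc_intD(2)[OF assms(1) K] unfolding set_integrable_def
    by (rule integrable_cong_AE_imp) (use assms(3) in \<open>auto elim: eventually_mono\<close>)
qed fact

lemma loc_sq_cong_AE:
  fixes f g :: "'a::euclidean_space => 'b::euclidean_space"
  assumes "loc_sq f" and [measurable]: "g \<in> borel_measurable borel" and "AE x in lborel. f x = g x"
  shows "loc_sq g"
  unfolding loc_sq_def
proof (intro conjI allI impI)
  have [measurable]: "f \<in> borel_measurable borel" using assms loc_sqD by auto
  fix K :: "'a set" assume K: "compact K"
  then have [measurable]: "K \<in> sets borel" by (simp add: borel_compact)
  show "set_integrable lborel K (%x. (norm (g x))^2)" using loc_sqD(2)[OF assms(1) K] unfolding set_integrable_def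
    by (rule integrable_cong_AE_imp) (use assms(3) in \<open>auto elim: eventually_mono\<close>)
qed fact

lemma test_mult_integrable:
  fixes g :: "real^3 => 'b::euclidean_space"
  assumes "test_function S psi" "loc_int g"
  shows "integrable lborel (%x. psi x *\<^sub>R g x)" "integrable lborel (%x. (grad psi x $ j) *\<^sub>R g x)"
proof -
  show "integrable lborel (%x. psi x *\<^sub>R g x)" by (rule integrable_test_mult[OF assms])
  obtain K B where K: "compact K" "\<And>x. x \<notin> K ==> grad psi x = 0" "\<And>x. norm (grad psi x) \<le> B"
    using test_function_bounds[OF assms(1)] by metis
  note [measurable] = test_functionD(6)[OF assms(1)]
  show "integrable lborel (%x. (grad psi x $ j) *\<^sub>R g x)"
  proof (rule integrable_bounded_support_mult[OF assms(2) _ K(1)])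
    show "\<bar>grad psi x $ j\<bar> \<le> B" for x using component_le_norm_cart[of "grad psi x" j] K(3)[of x] by linarith
  qed (use K in auto)
qed

lemma weak_partial_diff:
  assumes "weak_partial j f1 g1" "weak_partial j f2 g2"
  shows "weak_partial j (%x. f1 x - f2 x) (%x. g1 x - g2 x)"
proof (rule weak_partialI)
  note D = weak_partialD[OF assms(1)] weak_partialD[OF assms(2)]
  show "loc_int (%x. f1 x - f2 x)" "loc_int (%x. g1 x - g2 x)" using D by (auto intro: loc_int_diff)
  fix psi :: "real^3 => real" assume t: "test_function UNIV psi"
  show "(LINT x|lborel. (grad psi x $ j) *\<^sub>R (f1 x - f2 x)) = - (LINT x|lborel. psi x *\<^sub>R (g1 x - g2 x))" unfolding scaleR_diff_right
    using D(3)[OF t] D(6)[OF t] test_mult_integrable[OF t D(1)] test_mult_integrable[OF t D(2)]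
      test_mult_integrable[OF t D(4)] test_mult_integrable[OF t D(5)] by (simp add: Bochner_Integration.integral_diff)
qed

text \<open>
  Two weak derivatives have the same integral against every test function.
\<close>

lemma weak_partial_unique:
  assumes "weak_partial j f g" "weak_partial j f g'"
  shows "AE x in lborel. g x = g' x"
proof -
  have "weak_partial j (%x. 0) (%x. g x - g' x)" using weak_partial_diff[OF assms] by simp
  note D = weak_partialD[OF this]
  have "AE x in lborel. g x - g' x = 0" by (rule fundamental_lemma_AE_zero[OF D(2)]) (use D(3) in auto)
  then show ?thesis by simp
qed

lemma weak_partial_cong_AE:
  assumes "weak_partial j f g" "AE x in lborel. f x = f' x" "AE x in lborel. g x = g' x"
    "f' \<in> borel_measurable borel" "g' \<in> borel_measurable borel"
  shows "weak_partial j f' g'"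
proof (rule weak_partialI)
  note D = weak_partialD[OF assms(1)]
  note m[measurable] = loc_intD(1)[OF D(1)] loc_intD(1)[OF D(2)] assms(4,5)
  show "loc_int f'" "loc_int g'" using D assms by (auto intro: loc_int_cong_AE)
  fix psi :: "real^3 => real" assume t: "test_function UNIV psi"
  note [measurable] = test_functionD(5,6)[OF t]
  have "(LINT x|lborel. (grad psi x $ j) *\<^sub>R f' x) = (LINT x|lborel. (grad psi x $ j) *\<^sub>R f x)"
    by (rule integral_cong_AE) (use assms(2) in \<open>auto elim: eventually_mono\<close>)
  moreover have "(LINT x|lborel. psi x *\<^sub>R g' x) = (LINT x|lborel. psi x *\<^sub>R g x)"
    by (rule integral_cong_AE) (use assms(3) in \<open>auto elim: eventually_mono\<close>)
  ultimately show "(LINT x|lborel. (grad psi x $ j) *\<^sub>R f' x) = - (LINT x|lborel. psi x *\<^sub>R g' x)" using D(3)[OF t] by simp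
qed

lemma wD_eq:
  assumes "weak_partial j f g"
  shows "weak_partial j f (wD j f)" "AE x in lborel. wD j f x = g x"
proof -
  show "weak_partial j f (wD j f)" unfolding wD_def by (rule someI[of "weak_partial j f", OF assms])
  then show "AE x in lborel. wD j f x = g x" using assms by (rule weak_partial_unique)
qed

lemma loc_int_translate:
  fixes h :: "'a::euclidean_space => 'b::euclidean_space"
  assumes h: "loc_int h" shows "loc_int (%x. h (x + a))"
  unfolding loc_int_def set_integrable_def
proof (intro conjI allI impI)
  have [measurable]: "h \<in> borel_measurable borel" using loc_intD[OF h] by simp
  show "(%x. h (x + a)) \<in> borel_measurable borel" by measurable
  fix K :: "'a set" assume K: "compact K"
  have "integrable lborel (%x. indicator ((%x. x + a) ` K) x *\<^sub>R h x)"
  proof -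
    have "compact ((%x. x + a) ` K)" using K by (auto intro!: compact_continuous_image continuous_intros)
    from loc_intD(2)[OF h this] show ?thesis by (simp add: set_integrable_def)
  qed
  from integral_translate(2)[of "%x. indicator ((%x. x + a) ` K) x *\<^sub>R h x" "- a"] this
  have "integrable lborel (%x. indicator ((%x. x + a) ` K) (x + a) *\<^sub>R h (x + a))" by simp
  then show "integrable lborel (%x. indicator K x *\<^sub>R h (x + a))"
    by (rule back_subst[of "integrable lborel", OF _ ext]) (auto simp: indicator_def)
qed

lemma test_function_translate:
  assumes t: "test_function UNIV psi"
  shows "test_function UNIV (%x. psi (x + a))" "grad (%x. psi (x + a)) x = grad psi (x + a)"
proof -
  obtain K where K: "compact K" "\<And>x. x \<notin> K ==> psi x = 0" using test_function_bounds[OF t] by metis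
  show "test_function UNIV (%x. psi (x + a))"
  proof (rule test_functionI)
    show "compact ((%x. x - a) ` K)" using K by (auto intro!: compact_continuous_image continuous_intros)
    show "psi (x + a) = 0" if "x \<notin> (%x. x - a) ` K" for x using that image_eqI[of x "%x. x - a" "x + a" K] by (intro K) auto
    show "Ck k (%x. psi (x + a))" for k using Ck_affine[OF test_functionD(1)[OF t], of k 1 a] by simp
  qed auto
  show "grad (%x. psi (x + a)) x = grad psi (x + a)" using grad_affine[of psi 1 x a] test_functionD(2)[OF t] by simp
qed

lemma weak_partial_translate:
  assumes "weak_partial j f g"
  shows "weak_partial j (%x. f (x + a)) (%x. g (x + a))"
proof (rule weak_partialI)
  note D = weak_partialD[OF assms]
  show "loc_int (%x. f (x + a))" "loc_int (%x. g (x + a))" using D by (auto intro: loc_int_translate)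
  fix psi :: "real^3 => real" assume t: "test_function UNIV psi"
  note t' = test_function_translate[OF t, of "- a"]
  have "(LINT x|lborel. (grad psi x $ j) *\<^sub>R f (x + a)) = (LINT x|lborel. (grad psi (x - a) $ j) *\<^sub>R f x)"
    using integral_translate(1)[of "%x. (grad psi (x - a) $ j) *\<^sub>R f x" "- a"] by simp
  also have "... = - (LINT x|lborel. psi (x - a) *\<^sub>R g x)" using D(3)[OF t'(1)] unfolding t'(2) by simp
  also have "(LINT x|lborel. psi (x - a) *\<^sub>R g x) = (LINT x|lborel. psi x *\<^sub>R g (x + a))"
    using integral_translate(1)[of "%x. psi (x - a) *\<^sub>R g x" "- a"] by simp
  finally show "(LINT x|lborel. (grad psi x $ j) *\<^sub>R f (x + a)) = - (LINT x|lborel. psi x *\<^sub>R g (x + a))" .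
qed

text \<open>
  The translated derivative is a weak derivative of the translated field, which is the field itself.
\<close>

lemma weak_partial_AE_periodic:
  assumes "weak_partial j f g" "AE_periodic L f"
  shows "AE_periodic L g"
  unfolding AE_periodic_def
proof
  fix i
  let ?a = "L *\<^sub>R axis i 1 :: real^3"
  note D = weak_partialD[OF assms(1)]
  note m[measurable] = loc_intD(1)[OF D(1)] loc_intD(1)[OF D(2)]
  have "AE x in lborel. f (x + ?a) = f x" using assms(2) by (auto simp: AE_periodic_def AE_periods_def)
  with weak_partial_translate[OF assms(1), of ?a] have "weak_partial j f (%x. g (x + ?a))" by (rule weak_partial_cong_AE) auto
  from weak_partial_unique[OF this assms(1)] show "?a \<in> AE_periods g" by (simp add: AE_periods_def)
qed

lemma solenoidalD:
  assumes "solenoidal L v"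
  shows "v (x + L *\<^sub>R axis i 1) = v x" "AE_periodic L v" "weak_div v (%_. 0)" "(LINT x:cell L|lborel. v x) = 0"
proof -
  show "v (x + L *\<^sub>R axis i 1) = v x" "(LINT x:cell L|lborel. v x) = 0" using assms by (auto simp: solenoidal_def)
  show "AE_periodic L v" by (rule AE_periodicI) (use assms in \<open>auto simp: solenoidal_def\<close>)
  show "weak_div v (%_. 0)" unfolding weak_div_def
  proof (intro allI impI)
    fix psi :: "real^3 => real" assume t: "test_function UNIV psi"
    then have "(LINT x|lborel. frechet_derivative psi (at x) (v x)) = 0" using assms by (simp add: solenoidal_def)
    then show "(LINT x|lborel. grad psi x \<bullet> v x) = - (LINT x|lborel. psi x * 0)" by (simp add: grad_inner[OF test_functionD(2)[OF t]])
  qed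
qed

lemma solenoidalI:
  assumes "\<And>x i. v (x + L *\<^sub>R axis i 1) = v x" "weak_div v (%_. 0)" "(LINT x:cell L|lborel. v x) = 0"
  shows "solenoidal L v"
  using assms by (auto simp: solenoidal_def weak_div_def grad_inner[OF test_functionD(2)])

lemma integrable_grad_inner:
  fixes v :: "'a::euclidean_space => 'a"
  assumes t: "test_function S psi" and v: "loc_int v"
  shows "integrable lborel (%x. grad psi x \<bullet> v x)"
proof -
  obtain K B where K: "compact K" "\<And>x. x \<notin> K ==> grad psi x = 0" "0 \<le> B" "\<And>x. norm (grad psi x) \<le> B"
    using test_function_bounds[OF t] by metis
  note [measurable] = test_functionD(6)[OF t] loc_intD(1)[OF v]
  have [measurable]: "K \<in> sets borel" using K by (simp add: borel_compact)
  show ?thesis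
  proof (rule integrable_dominated)
    show "integrable lborel (%x. B * norm (indicator K x *\<^sub>R v x))"
      using loc_intD(2)[OF v K(1)] unfolding set_integrable_def by (intro integrable_mult_right integrable_norm)
    show "AE x in lborel. norm (grad psi x \<bullet> v x) \<le> norm (B * norm (indicator K x *\<^sub>R v x))"
    proof (rule AE_I2)
      fix x
      have "norm (grad psi x \<bullet> v x) \<le> norm (grad psi x) * norm (v x)" unfolding real_norm_def by (rule Cauchy_Schwarz_ineq2)
      also have "... \<le> B * norm (indicator K x *\<^sub>R v x)"
        using K(2)[of x] K(3) K(4)[of x] by (cases "x \<in> K") (auto intro: mult_right_mono)
      finally show "norm (grad psi x \<bullet> v x) \<le> norm (B * norm (indicator K x *\<^sub>R v x))" using K(3) by simp
    qed
  qed measurable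
qed

lemma solenoidal_diff:
  assumes "solenoidal L u" "solenoidal L v" "loc_int u" "loc_int v"
  shows "solenoidal L (%x. u x - v x)"
proof (rule solenoidalI)
  show "u (x + L *\<^sub>R axis i 1) - v (x + L *\<^sub>R axis i 1) = u x - v x" for x i using assms by (simp add: solenoidalD)
  show "weak_div (%x. u x - v x) (%_. 0)" unfolding weak_div_def
  proof (intro allI impI)
    fix psi :: "real^3 => real" assume t: "test_function UNIV psi"
    have "(LINT x|lborel. grad psi x \<bullet> u x) = 0" "(LINT x|lborel. grad psi x \<bullet> v x) = 0"
      using solenoidalD(3)[OF assms(1)] solenoidalD(3)[OF assms(2)] t by (auto simp: weak_div_def)
    then show "(LINT x|lborel. grad psi x \<bullet> (u x - v x)) = - (LINT x|lborel. psi x * 0)"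
      using integrable_grad_inner[OF t assms(3)] integrable_grad_inner[OF t assms(4)] by (simp add: inner_diff_right)
  qed
  show "(LINT x:cell L|lborel. u x - v x) = 0" using assms loc_intD(2)[OF assms(3) compact_cell[of L]] loc_intD(2)[OF assms(4) compact_cell[of L]]
    by (simp add: solenoidalD set_integral_diff)
qed

lemma V_spaceD:
  assumes "v \<in> V_space L"
  shows "solenoidal L v" "loc_sq v" "weak_partial j v (wD j v)" "loc_sq (wD j v)" "AE_periodic L (wD j v)"
proof -
  show s: "solenoidal L v" "loc_sq v" "loc_sq (wD j v)" using assms by (auto simp: V_space_def locally_Lp_2_iff)
  show w: "weak_partial j v (wD j v)" using assms by (auto simp: V_space_def dest: wD_eq)
  show "AE_periodic L (wD j v)" by (rule weak_partial_AE_periodic[OF w solenoidalD(2)[OF s(1)]])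
qed

text \<open>
  A representative of the weak derivative chosen by \<^const>\<open>wD\<close> may differ from the given \<open>g\<close> on a null set, and local
  square integrability does not see this.
\<close>

lemma V_spaceI:
  assumes "solenoidal L v" "loc_sq v" "\<And>j. weak_partial j v (g j)" "\<And>j. loc_sq (g j)"
  shows "v \<in> V_space L"
proof -
  have "loc_sq (wD j v)" for j using wD_eq[OF assms(3)[of j]] loc_sq_cong_AE[OF assms(4)[of j]] loc_intD(1)[OF weak_partialD(2)]
    by (metis (mono_tags, lifting) AE_mp AE_I2)
  then show ?thesis using assms by (auto simp: V_space_def locally_Lp_2_iff)
qed

lemma V_space_diff:
  assumes "u \<in> V_space L" "v \<in> V_space L"
  shows "(%x. u x - v x) \<in> V_space L" "AE x in lborel. wD j (%x. u x - v x) x = wD j u x - wD j v x"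
proof -
  note U = V_spaceD[OF assms(1)] and V = V_spaceD[OF assms(2)]
  note w = weak_partial_diff[OF U(3) V(3)]
  show "(%x. u x - v x) \<in> V_space L"
    by (rule V_spaceI[OF solenoidal_diff loc_sq_diff w loc_sq_diff]) (use U V in \<open>auto intro: loc_sq_imp_loc_int\<close>)
  show "AE x in lborel. wD j (%x. u x - v x) x = wD j u x - wD j v x" by (rule wD_eq(2)[OF w])
qed

lemma H2_space_subset_V_space: "H2_space L \<subseteq> V_space L"
  by (auto simp: H2_space_def V_space_def numeral_2_eq_2)

lemma weak_grad_component:
  assumes "v \<in> V_space L"
  shows "weak_grad (%x. v x $ i) (%x. \<chi> j. wD j v x $ i)" "loc_sq (%x. v x $ i)" "loc_sq (%x. \<chi> j. wD j v x $ i)"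
proof -
  note V = V_spaceD[OF assms]
  note m[measurable] = loc_sqD(1)[OF V(2)] loc_sqD(1)[OF V(4)]
  have m'[measurable]: "(%x. \<chi> j. wD j v x $ i) \<in> borel_measurable borel"
  proof -
    have "(%x. \<chi> j. wD j v x $ i) = (%x. \<Sum>j\<in>UNIV. (wD j v x $ i) *\<^sub>R axis j 1)"
      by (auto simp: fun_eq_iff vec_eq_iff axis_def if_distrib[of "%x. _ * x"] cong: if_cong)
    then show ?thesis by simp
  qed
  have c: "loc_sq (%x. f x $ i)" if f: "loc_sq f" for f :: field unfolding loc_sq_def
  proof (intro conjI allI impI)
    note [measurable] = loc_sqD(1)[OF f]
    show "(%x. f x $ i) \<in> borel_measurable borel" by measurable
    fix K :: "(real^3) set" assume K: "compact K"
    then have [measurable]: "K \<in> sets borel" by (simp add: borel_compact)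
    show "set_integrable lborel K (%x. (norm (f x $ i))^2)" using loc_sqD(2)[OF f K] unfolding set_integrable_def by (rule integrable_dominated)
        (auto simp: indicator_def abs_le_square_iff[symmetric] component_le_norm_cart intro!: AE_I2)
  qed
  show "loc_sq (%x. v x $ i)" by (rule c[OF V(2)])
  show "loc_sq (%x. \<chi> j. wD j v x $ i)" unfolding loc_sq_def
  proof (intro conjI allI impI)
    fix K :: "(real^3) set" assume K: "compact K"
    have eq: "(%x. indicator K x *\<^sub>R (norm (\<chi> j. wD j v x $ i))^2) = (%x. \<Sum>j\<in>UNIV. indicator K x *\<^sub>R (norm (wD j v x $ i))^2)"
      by (simp add: power2_norm_eq_inner inner_vec_def sum_distrib_left fun_eq_iff) (simp add: power2_eq_square)
    show "set_integrable lborel K (%x. (norm (\<chi> j. wD j v x $ i))^2)" unfolding set_integrable_def eq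
      by (intro Bochner_Integration.integrable_sum) (rule loc_sqD(2)[OF c[OF V(4)] K, unfolded set_integrable_def])
  qed fact
  show "weak_grad (%x. v x $ i) (%x. \<chi> j. wD j v x $ i)" unfolding weak_grad_def
  proof (intro allI impI)
    fix psi :: "real^3 => real" assume t: "test_function UNIV psi"
    note vi = loc_sq_imp_loc_int[OF c[OF V(2)]]
    have i1: "integrable lborel (%x. (v x $ i) *\<^sub>R grad psi x)"
    proof -
      have "(%x. (v x $ i) *\<^sub>R grad psi x) = (%x. \<Sum>j\<in>UNIV. ((grad psi x $ j) *\<^sub>R (v x $ i)) *\<^sub>R axis j 1)"
        by (auto simp: fun_eq_iff vec_eq_iff axis_def if_distrib[of "%x. _ * x"] cong: if_cong)
      then show ?thesis using test_mult_integrable(2)[OF t vi] by simp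
    qed
    have i2: "integrable lborel (%x. psi x *\<^sub>R (\<chi> j. wD j v x $ i))"
    proof -
      have "(%x. psi x *\<^sub>R (\<chi> j. wD j v x $ i)) = (%x. \<Sum>j\<in>UNIV. (psi x *\<^sub>R (wD j v x $ i)) *\<^sub>R axis j 1)"
        by (auto simp: fun_eq_iff vec_eq_iff axis_def if_distrib[of "%x. _ * x"] cong: if_cong)
      then show ?thesis using test_mult_integrable(1)[OF t loc_sq_imp_loc_int[OF c[OF V(4)]]] by simp
    qed
    have c: "(LINT x|lborel. (v x $ i) * (grad psi x $ j)) = - (LINT x|lborel. psi x * (wD j v x $ i))" for j
    proof -
      have "(LINT x|lborel. (grad psi x $ j) *\<^sub>R v x) $ i = - (LINT x|lborel. psi x *\<^sub>R wD j v x) $ i"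
        using weak_partialD(3)[OF V(3) t] by simp
      moreover have "(LINT x|lborel. (grad psi x $ j) *\<^sub>R v x) $ i = (LINT x|lborel. (grad psi x $ j) * (v x $ i))"
        using integral_inner_left[OF test_mult_integrable(2)[OF t loc_sq_imp_loc_int[OF V(2)], of j], of "axis i 1"] by (simp add: inner_axis)
      moreover have "(LINT x|lborel. psi x *\<^sub>R wD j v x) $ i = (LINT x|lborel. psi x * (wD j v x $ i))"
        using integral_inner_left[OF test_mult_integrable(1)[OF t loc_sq_imp_loc_int[OF V(4)], of j], of "axis i 1"] by (simp add: inner_axis)
      ultimately show ?thesis by (simp add: mult.commute)
    qed
    have l1: "(LINT x|lborel. (v x $ i) *\<^sub>R grad psi x) $ j = (LINT x|lborel. (v x $ i) * (grad psi x $ j))" for j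
      using integral_inner_left[of "axis j 1", OF i1] by (simp add: inner_axis)
    have l2: "(LINT x|lborel. psi x *\<^sub>R (\<chi> j. wD j v x $ i)) $ j = (LINT x|lborel. psi x * (wD j v x $ i))" for j
      using integral_inner_left[of "axis j 1", OF i2] by (simp add: inner_axis)
    show "(LINT x|lborel. (v x $ i) *\<^sub>R grad psi x) = - (LINT x|lborel. psi x *\<^sub>R (\<chi> j. wD j v x $ i))"
      unfolding vec_eq_iff vector_uminus_component l1 l2 c by simp
  qed
qed

section \<open>Divergence theorem on a cell and antisymmetry of the trilinear form\<close>

lemma mollifier_real_eq_0: "t \<le> 0 \<or> 1 \<le> t ==> mollifier 1 (t::real) = 0"
  by (simp add: mollifier_def box_bump_def bump_eq_0)

lemma smooth_step_exists:
  "\<exists>H :: real => real. (\<forall>t. (H has_real_derivative mollifier 1 t) (at t)) \<and> (\<forall>t\<le>0. H t = 0) \<and> (\<forall>t\<ge>1. H t = 1)"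
proof -
  have cont: "isCont (mollifier 1 :: real => real) x" for x
    using continuous_on_Ck[OF Ck_mollifier[of 0 1]] by (auto simp: continuous_on_eq_continuous_at)
  then obtain F where F: "\<And>x::real. (F has_vector_derivative mollifier 1 x) (at x)"
    using einterval_antiderivative[of "-\<infinity>" "\<infinity>" "mollifier 1 :: real => real"] by auto
  then have F': "(F has_real_derivative mollifier 1 x) (at x)" for x by (simp add: has_real_derivative_iff_has_vector_derivative)
  have c: "F x = F y" if "(\<forall>z\<in>S. z \<le> 0) \<or> (\<forall>z\<in>S. 1 \<le> z)" "x \<in> S" "y \<in> S" "convex S" for S x y
  proof -
    have "\<exists>c. \<forall>x\<in>S. F x = c"
    proof (rule has_field_derivative_zero_constant[OF that(4)])
      fix x assume x: "x \<in> S"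
      have "(F has_real_derivative mollifier 1 x) (at x within S)" using F' by (rule DERIV_subset) simp
      moreover have "mollifier 1 x = 0" using that(1) x by (intro mollifier_real_eq_0) auto
      ultimately show "(F has_real_derivative 0) (at x within S)" by simp
    qed
    then show ?thesis using that by metis
  qed
  have "F 1 - F 0 = (LINT x::real|lborel. mollifier 1 x * indicator {0..1} x)" by (rule integral_FTC_Icc_real[symmetric]) (use F' cont in auto)
  also have "... = (LINT x|lborel. mollifier 1 (x::real))"
  proof (rule Bochner_Integration.integral_cong)
    show "mollifier 1 x * indicator {0..1} x = mollifier 1 x" for x :: real using mollifier_real_eq_0[of x] by (cases "x \<in> {0..1}") auto
  qed simp
  also have "... = 1" by (rule integral_mollifier) simp
  finally have F1: "F 1 - F 0 = 1" .
  show ?thesis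
  proof (intro exI[of _ "%t. F t - F 0"] conjI allI impI)
    show "((%t. F t - F 0) has_real_derivative mollifier 1 t) (at t)" for t using F'[of t] by (auto intro!: derivative_eq_intros)
    show "F t - F 0 = 0" if "t \<le> 0" for t using c[of "{..0}" t 0] that by auto
    show "F t - F 0 = 1" if "1 \<le> t" for t using c[of "{1..}" t 1] that F1 by auto
  qed
qed

text \<open>
  The antiderivative of a mollifier: a smooth function that rises from 0 to 1 on the unit interval.
\<close>

definition smooth_step :: "real => real" where
  "smooth_step = (SOME H. (\<forall>t. (H has_real_derivative mollifier 1 t) (at t)) \<and> (\<forall>t\<le>0. H t = 0) \<and> (\<forall>t\<ge>1. H t = 1))"

lemma smooth_step: "(smooth_step has_real_derivative mollifier 1 t) (at t)"
  "t \<le> 0 ==> smooth_step t = 0" "1 \<le> t ==> smooth_step t = 1"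
  using someI_ex[OF smooth_step_exists] unfolding smooth_step_def[symmetric] by auto

lemma Ck_smooth_step: "Ck k smooth_step"
  by (rule Ck_Suc_imp_Ck[OF Ck_real_Suc[OF smooth_step(1) Ck_mollifier]])

lemma smooth_step_bounds: "0 \<le> smooth_step t" "smooth_step t \<le> 1"
proof -
  have mono: "smooth_step s \<le> smooth_step t" if "s \<le> t" for s t
  proof (rule DERIV_nonneg_imp_nondecreasing[OF that])
    show "\<exists>y. (smooth_step has_real_derivative y) (at x) \<and> 0 \<le> y" for x using smooth_step(1)[of x] mollifier_nonneg[of 1 x] by auto
  qed
  show "0 \<le> smooth_step t" using mono[of 0 t] smooth_step(2)[of t] smooth_step(2)[of 0] by (cases "t \<le> 0") auto
  show "smooth_step t \<le> 1" using mono[of t 1] smooth_step(3)[of t] smooth_step(3)[of 1] by (cases "1 \<le> t") auto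
qed

text \<open>
  A smooth hat with support in \<open>[-L, L]\<close>, made of a rising and a falling step so that its \<open>L\<close>-translates sum to 1. Hence
  those of its derivative, which is \<open>cutoff'\<close>, sum to 0.
\<close>

definition cutoff :: "real => real => real" where
  "cutoff L s = smooth_step (s / L + 1) - smooth_step (s / L)"

definition cutoff' :: "real => real => real" where
  "cutoff' L s = (mollifier 1 (s / L + 1) - mollifier 1 (s / L)) / L"

lemma cutoff:
  assumes L: "0 < L"
  shows "(cutoff L has_real_derivative cutoff' L s) (at s)" "Ck k (cutoff L)"
    "s < - L \<or> L \<le> s ==> cutoff L s = 0" "s < - L \<or> L \<le> s ==> cutoff' L s = 0"
    "0 \<le> s ==> s < L ==> cutoff L (s - L) + cutoff L s = 1"
    "0 \<le> s ==> s < L ==> cutoff' L (s - L) + cutoff' L s = 0"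
    "\<bar>cutoff L s\<bar> \<le> 1" "cutoff L \<in> borel_measurable borel" "cutoff' L \<in> borel_measurable borel"
proof -
  have 1: "((%s. smooth_step (s / L + 1)) has_real_derivative mollifier 1 (s / L + 1) * (1 / L)) (at s)"
    using L by (intro DERIV_chain2[OF smooth_step(1)]) (auto intro!: derivative_eq_intros)
  have 2: "((%s. smooth_step (s / L)) has_real_derivative mollifier 1 (s / L) * (1 / L)) (at s)"
    using L by (intro DERIV_chain2[OF smooth_step(1)]) (auto intro!: derivative_eq_intros)
  show "(cutoff L has_real_derivative cutoff' L s) (at s)" using DERIV_diff[OF 1 2] by (simp add: cutoff_def[abs_def] cutoff'_def diff_divide_distrib)
  have "cutoff L = (%s. smooth_step ((1/L) *\<^sub>R s + 1) - smooth_step ((1/L) *\<^sub>R s + 0))" by (simp add: cutoff_def[abs_def])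
  then show C: "Ck k (cutoff L)" for k by (simp only:) (intro Ck_diff Ck_affine Ck_smooth_step)
  show "cutoff L s = 0" "cutoff' L s = 0" if "s < - L \<or> L \<le> s"
    using that L by (auto simp: cutoff_def cutoff'_def smooth_step mollifier_real_eq_0 field_simps)
  show "cutoff L (s - L) + cutoff L s = 1" "cutoff' L (s - L) + cutoff' L s = 0" if "0 \<le> s" "s < L"
    using that L by (auto simp: cutoff_def cutoff'_def smooth_step mollifier_real_eq_0 diff_divide_distrib)
  show "\<bar>cutoff L s\<bar> \<le> 1" using smooth_step_bounds[of "s / L + 1"] smooth_step_bounds[of "s / L"] by (auto simp: cutoff_def)
  show "cutoff L \<in> borel_measurable borel" by (rule borel_measurable_continuous_onI[OF continuous_on_Ck[OF C[of 0]]])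
  show "cutoff' L \<in> borel_measurable borel" unfolding cutoff'_def[abs_def] by measurable
qed

text \<open>
  Tested against the product of hats, whose lattice translates sum to 1, the weak divergence gives by unfolding the integral
  of \<open>h\<close> over the cell. On the other side stands \<open>U\<close> against the gradient of that product, whose translates sum to
  0, because each component contains the factor \<open>cutoff'\<close>.
\<close>

lemma integral_cell_divergence:
  assumes L: "0 < L" and div: "weak_div U h" and U: "loc_int U" "AE_periodic L U" and h: "loc_int h" "AE_periodic L h"
  shows "(LINT x:cell L|lborel. h x) = 0"
proof -
  define X where "X x = (\<Prod>i\<in>UNIV. cutoff L (x $ i))" for x :: "real^3"
  have Xax: "X = (%x. \<Prod>i\<in>UNIV. cutoff L (x \<bullet> axis i 1))" by (auto simp: X_def inner_axis)
  have t: "test_function UNIV X"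
  proof (rule test_functionI)
    show "Ck k X" for k unfolding Xax by (intro Ck_prod Ck_ridge cutoff(2)[OF L])
    show "X x = 0" if xn: "x \<notin> cbox (\<chi> i. - L) (\<chi> i. L)" for x
    proof -
      obtain i where "x $ i < - L \<or> L < x $ i" using xn unfolding mem_box_cart by (auto simp: not_le)
      then have "cutoff L (x $ i) = 0" by (intro cutoff(3)[OF L]) auto
      then show ?thesis unfolding X_def by (intro prod_zero) auto
    qed
  qed (auto intro: compact_cbox)
  define f where "f j i = (if i = j then cutoff' L else cutoff L)" for i j :: 3
  have gr: "grad X x = (\<chi> j. \<Prod>i\<in>UNIV. f j i (x $ i))" for x
  proof (rule grad_eqI)
    have "(X has_derivative (%v. \<Sum>j\<in>UNIV. cutoff' L (x $ j) * (v $ j) * (\<Prod>i\<in>UNIV - {j}. cutoff L (x $ i)))) (at x)"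
      unfolding X_def[abs_def]
    proof (rule has_derivative_prod)
      fix i :: 3
      have 1: "((%x. x $ i) has_derivative (%v. v $ i)) (at x)" by (rule bounded_linear_imp_has_derivative[OF bounded_linear_vec_nth])
      have 2: "(cutoff L has_derivative (%s. cutoff' L (x $ i) * s)) (at (x $ i))" using cutoff(1)[OF L] by (simp add: has_field_derivative_def)
      show "((%x. cutoff L (x $ i)) has_derivative (%v. cutoff' L (x $ i) * v $ i)) (at x)" by (rule has_derivative_compose[OF 1 2])
    qed
    moreover have "cutoff' L (x $ j) * (\<Prod>i\<in>UNIV - {j}. cutoff L (x $ i)) = (\<Prod>i\<in>UNIV. f j i (x $ i))" for j
      by (subst prod.remove[of UNIV j]) (auto simp: f_def intro!: prod.cong)
    ultimately show "(X has_derivative (%v. (\<chi> j. \<Prod>i\<in>UNIV. f j i (x $ i)) \<bullet> v)) (at x)"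
      by (simp add: inner_vec_def mult_ac flip: mult.assoc) (simp add: mult_ac)
  qed
  obtain M where M: "\<And>x::real. mollifier 1 x \<le> M" using mollifier_bounded[of 1] by metis
  have ms[measurable]: "f j i \<in> borel_measurable borel" for i j using cutoff(8,9)[OF L] by (simp add: f_def)
  have c'B: "\<bar>cutoff' L s\<bar> \<le> 2 * M / L" for s
  proof -
    have "\<bar>mollifier 1 (s / L + 1) - mollifier 1 (s / L)\<bar> \<le> 2 * M"
      using M[of "s / L + 1"] M[of "s / L"] mollifier_nonneg[of 1 "s / L + 1"] mollifier_nonneg[of 1 "s / L"] by (simp add: abs_le_iff)
    then show ?thesis using L by (simp add: cutoff'_def abs_divide divide_right_mono)
  qed
  have fB: "\<bar>f j i s\<bar> \<le> max 1 (2 * M / L)" for i j s using cutoff(7)[OF L, of s] c'B[of s] by (auto simp: f_def)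
  have f0: "f j i s = 0" if "s < - real 1 * L \<or> real 1 * L \<le> s" for i j s using that cutoff(3,4)[OF L, of s] by (auto simp: f_def)
  have I: "{- int 1..<int 1} = {- 1, 0 :: int}" by auto
  have fs: "(\<Sum>k\<in>{- int 1..<int 1}. f j i (s + L * of_int k)) = (if i = j then 0 else 1)" if "0 \<le> s" "s < L" for i j s
    unfolding I using cutoff(5,6)[OF L that] by (auto simp: f_def)
  have LU: "loc_int (%x. U x $ j)" for j unfolding loc_int_def set_integrable_def
  proof (intro conjI allI impI)
    note [measurable] = loc_intD(1)[OF U(1)]
    show "(%x. U x $ j) \<in> borel_measurable borel" by measurable
    fix K :: "(real^3) set" assume K: "compact K"
    have "integrable lborel (%x. (indicator K x *\<^sub>R U x) \<bullet> axis j 1)"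
      using loc_intD(2)[OF U(1) K] unfolding set_integrable_def by (intro integrable_inner_left)
    then show "integrable lborel (%x. indicator K x *\<^sub>R U x $ j)" by (simp add: inner_axis)
  qed
  have z: "(LINT x|lborel. (grad X x $ j) *\<^sub>R (U x $ j)) = 0" and zi: "integrable lborel (%x. (grad X x $ j) *\<^sub>R (U x $ j))" for j
  proof -
    note unf = unfold_product[where f="f j" and m=1 and c="%i. if i = j then 0 else 1" and B="max 1 (2 * M / L)",
        OF L LU[of j] AE_periodic_comp[OF U(2), of "%v. v $ j"] ms fB f0 fs]
    have "(\<Prod>i\<in>UNIV. (if i = j then 0 else 1)) = (0::real)" by (rule prod_zero) auto
    with unf show "(LINT x|lborel. (grad X x $ j) *\<^sub>R (U x $ j)) = 0" "integrable lborel (%x. (grad X x $ j) *\<^sub>R (U x $ j))"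
      unfolding gr by simp_all
  qed
  have "(LINT x|lborel. grad X x \<bullet> U x) = (\<Sum>j\<in>UNIV. LINT x|lborel. (grad X x $ j) *\<^sub>R (U x $ j))"
    using zi by (simp add: inner_vec_def)
  then have "(LINT x|lborel. X x * h x) = 0" using div t z by (simp add: weak_div_def)
  moreover have "(LINT x|lborel. X x * h x) = (LINT x:cell L|lborel. h x)"
    using unfold_product(2)[OF L h, of "%_. cutoff L" 1 1 "%_. 1"] cutoff[OF L] unfolding I by (simp add: X_def)
  ultimately show ?thesis by simp
qed

lemma loc_sq_bounded_mult:
  fixes w :: "'a::euclidean_space => 'b::euclidean_space" and F :: "'a => 'c::euclidean_space"
  assumes w: "loc_sq w" and [measurable]: "F \<in> borel_measurable borel" and B: "AE x in lborel. norm (F x) \<le> B * norm (w x)"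
  shows "loc_sq F"
  unfolding loc_sq_def
proof (intro conjI allI impI)
  fix K :: "'a set" assume K: "compact K"
  then have [measurable]: "K \<in> sets borel" by (simp add: borel_compact)
  show "set_integrable lborel K (%x. (norm (F x))^2)" unfolding set_integrable_def
  proof (rule integrable_dominated)
    show "integrable lborel (%x. B^2 * (indicator K x *\<^sub>R (norm (w x))^2))"
      using loc_sqD(2)[OF w K] unfolding set_integrable_def by (rule integrable_mult_right)
    show "AE x in lborel. norm (indicator K x *\<^sub>R (norm (F x))^2) \<le> norm (B^2 * (indicator K x *\<^sub>R (norm (w x))^2))" using B
    proof eventually_elim
      case (elim x)
      then have "(norm (F x))^2 \<le> (B * norm (w x))^2" by (intro power_mono) auto
      then show ?case by (auto simp: indicator_def power_mult_distrib)
    qed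
  qed measurable
qed fact

lemma loc_int_scaleR:
  fixes f :: "'a::euclidean_space => real" and g :: "'a => 'b::euclidean_space"
  assumes f: "loc_sq f" and g: "loc_sq g"
  shows "loc_int (%x. f x *\<^sub>R g x)"
  unfolding loc_int_def
proof (intro conjI allI impI)
  note [measurable] = loc_sqD(1)[OF f] loc_sqD(1)[OF g]
  show "(%x. f x *\<^sub>R g x) \<in> borel_measurable borel" by measurable
  fix K :: "'a set" assume K: "compact K"
  then have [measurable]: "K \<in> sets borel" by (simp add: borel_compact)
  show "set_integrable lborel K (%x. f x *\<^sub>R g x)" unfolding set_integrable_def
  proof (rule integrable_dominated)
    show "integrable lborel (%x. indicator K x *\<^sub>R (norm (f x))^2 + indicator K x *\<^sub>R (norm (g x))^2)"
      using loc_sqD(2)[OF f K] loc_sqD(2)[OF g K] unfolding set_integrable_def by (rule Bochner_Integration.integrable_add)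
    show "AE x in lborel. norm (indicator K x *\<^sub>R f x *\<^sub>R g x) \<le> norm (indicator K x *\<^sub>R (norm (f x))^2 + indicator K x *\<^sub>R (norm (g x))^2)"
      using mult_le_weighted_squares[of 1 "norm (f _)" "norm (g _)"] by (intro AE_I2) (auto simp: indicator_def)
  qed measurable
qed

lemma set_integral_sum:
  fixes f :: "'i => 'a => 'b::{banach, second_countable_topology}"
  assumes "\<And>i. i \<in> I ==> set_integrable M A (f i)"
  shows "(LINT x:A|M. (\<Sum>i\<in>I. f i x)) = (\<Sum>i\<in>I. LINT x:A|M. f i x)"
    "set_integrable M A (%x. \<Sum>i\<in>I. f i x)"
  unfolding set_lebesgue_integral_def set_integrable_def scaleR_sum_right
proof -
  show "(LINT x|M. (\<Sum>i\<in>I. indicat_real A x *\<^sub>R f i x)) = (\<Sum>i\<in>I. LINT x|M. indicat_real A x *\<^sub>R f i x)"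
    by (rule Bochner_Integration.integral_sum) (rule assms[unfolded set_integrable_def])
  show "integrable M (%x. \<Sum>i\<in>I. indicat_real A x *\<^sub>R f i x)"
    by (rule Bochner_Integration.integrable_sum) (rule assms[unfolded set_integrable_def])
qed

text \<open>
  For each component \<open>i\<close> the product rule is used twice: \<open>div (v\<^sub>i u) = u \<bullet> \<nabla>v\<^sub>i\<close> since \<open>u\<close> is divergence-free, and then
  \<open>div (w\<^sub>i v\<^sub>i u) = w\<^sub>i u \<bullet> \<nabla>v\<^sub>i + v\<^sub>i u \<bullet> \<nabla>w\<^sub>i\<close>. The integral of the left-hand side over a cell is 0. The pointwise bound of
  \<open>u\<close> keeps all factors square integrable.
\<close>

lemma trilinear_antisym:
  assumes L: "0 < L" and u: "u \<in> V_space L" and v: "v \<in> V_space L" and w: "w \<in> V_space L"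
    and B: "AE x in lborel. norm (u x) \<le> B"
  shows "trilinear L u v w = - trilinear L u w v"
proof -
  note U = V_spaceD[OF u] and V = V_spaceD[OF v] and W = V_spaceD[OF w]
  define D where "D f i x = (\<chi> j. wD j f x $ i)" for f :: field and i x
  note GV = weak_grad_component[OF v, folded D_def] and GW = weak_grad_component[OF w, folded D_def]
  note m[measurable] = loc_sqD(1)[OF U(2)] loc_sqD(1)[OF V(2)] loc_sqD(1)[OF W(2)] loc_sqD(1)[OF V(4)] loc_sqD(1)[OF W(4)] loc_sqD(1)[OF GV(3)] loc_sqD(1)[OF GW(3)]
  have Bd: "AE x in lborel. norm (u x \<bullet> D f i x) \<le> B * norm (D f i x)" for f i using B
  proof eventually_elim
    case (elim x)
    have "norm (u x \<bullet> D f i x) \<le> norm (u x) * norm (D f i x)" unfolding real_norm_def by (rule Cauchy_Schwarz_ineq2)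
    also have "... \<le> B * norm (D f i x)" using elim by (rule mult_right_mono) simp
    finally show ?case .
  qed
  have suV: "loc_sq (%x. u x \<bullet> D v i x)" for i by (rule loc_sq_bounded_mult[OF GV(3)[of i] _ Bd]) measurable
  have suW: "loc_sq (%x. u x \<bullet> D w i x)" for i by (rule loc_sq_bounded_mult[OF GW(3)[of i] _ Bd]) measurable
  have svu: "loc_sq (%x. (v x $ i) *\<^sub>R u x)" for i
  proof (rule loc_sq_bounded_mult[OF GV(2)[of i]])
    show "AE x in lborel. norm ((v x $ i) *\<^sub>R u x) \<le> B * norm (v x $ i)" using B by eventually_elim (simp add: mult.commute mult_right_mono)
  qed measurable
  have perD: "AE_periodic L (D f i)" if "\<And>j. AE_periodic L (wD j f)" for f i unfolding AE_periodic_def AE_periods_def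
  proof (intro allI CollectI)
    fix k
    have "AE x in lborel. \<forall>j. wD j f (x + L *\<^sub>R axis k 1) = wD j f x"
      unfolding AE_all_countable using that by (auto simp: AE_periodic_def AE_periods_def)
    then show "AE x in lborel. D f i (x + L *\<^sub>R axis k 1) = D f i x" by eventually_elim (simp add: D_def)
  qed
  note perV = perD[OF V(5)] and perW = perD[OF W(5)] and pu = solenoidalD(2)[OF U(1)] and pv = solenoidalD(2)[OF V(1)] and pw = solenoidalD(2)[OF W(1)]
  have key: "(LINT x:cell L|lborel. (w x $ i) * (u x \<bullet> D v i x) + (v x $ i) * (u x \<bullet> D w i x)) = 0" for i
  proof -
    have z: "loc_sq (%_::real^3. 0::real)" by (auto simp: loc_sq_def set_integrable_def)
    have 1: "weak_div (%x. (v x $ i) *\<^sub>R u x) (%x. u x \<bullet> D v i x)"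
      using weak_div_mult[OF solenoidalD(3)[OF U(1)] GV(1)[of i] U(2) z GV(2,3)] by simp
    have 2: "weak_div (%x. (w x $ i) *\<^sub>R ((v x $ i) *\<^sub>R u x)) (%x. (w x $ i) * (u x \<bullet> D v i x) + ((v x $ i) *\<^sub>R u x) \<bullet> D w i x)"
      by (rule weak_div_mult[OF 1 GW(1)[of i] svu suV GW(2,3)])
    have "(LINT x:cell L|lborel. (w x $ i) * (u x \<bullet> D v i x) + ((v x $ i) *\<^sub>R u x) \<bullet> D w i x) = 0"
    proof (rule integral_cell_divergence[OF L 2])
      show "loc_int (%x. (w x $ i) *\<^sub>R ((v x $ i) *\<^sub>R u x))" by (rule loc_int_scaleR[OF GW(2) svu])
      have li: "loc_int (%x. f x + g x)" if "loc_int f" "loc_int g" for f g :: "real^3 => real"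
        using that by (auto simp: loc_int_def intro: set_integral_add)
      show "loc_int (%x. (w x $ i) * (u x \<bullet> D v i x) + ((v x $ i) *\<^sub>R u x) \<bullet> D w i x)"
        by (rule li[OF loc_int_mult[OF GW(2) suV] loc_int_inner[OF svu GW(3)]])
      have pvu: "AE_periodic L (%x. (v x $ i) *\<^sub>R u x)" by (rule AE_periodic_comp2[OF pv pu, of "%a b. (a $ i) *\<^sub>R b"])
      show "AE_periodic L (%x. (w x $ i) *\<^sub>R ((v x $ i) *\<^sub>R u x))" by (rule AE_periodic_comp2[OF pw pvu, of "%a b. (a $ i) *\<^sub>R b"])
      have p1: "AE_periodic L (%x. u x \<bullet> D v i x)" by (rule AE_periodic_comp2[OF pu perV])
      have p2: "AE_periodic L (%x. (w x $ i) * (u x \<bullet> D v i x))" by (rule AE_periodic_comp2[OF pw p1, of "%a b. (a $ i) * b"])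
      have p3: "AE_periodic L (%x. ((v x $ i) *\<^sub>R u x) \<bullet> D w i x)" by (rule AE_periodic_comp2[OF pvu perW])
      show "AE_periodic L (%x. (w x $ i) * (u x \<bullet> D v i x) + ((v x $ i) *\<^sub>R u x) \<bullet> D w i x)"
        by (rule AE_periodic_comp2[OF p2 p3])
    qed
    then show ?thesis by simp
  qed
  have i1: "set_integrable lborel (cell L) (%x. (w x $ i) * (u x \<bullet> D v i x))" for i
    by (rule loc_intD(2)[OF loc_int_mult[OF GW(2) suV] compact_cell])
  have i2: "set_integrable lborel (cell L) (%x. (v x $ i) * (u x \<bullet> D w i x))" for i
    by (rule loc_intD(2)[OF loc_int_mult[OF GV(2) suW] compact_cell])
  have eq: "(\<Sum>j\<in>UNIV. (u x $ j) *\<^sub>R wD j f x) \<bullet> g x = (\<Sum>i\<in>UNIV. (g x $ i) * (u x \<bullet> D f i x))" for f g x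
    by (simp add: inner_vec_def D_def sum_distrib_left mult_ac)
  have "trilinear L u v w + trilinear L u w v = (\<Sum>i\<in>UNIV. (LINT x:cell L|lborel. (w x $ i) * (u x \<bullet> D v i x)) + (LINT x:cell L|lborel. (v x $ i) * (u x \<bullet> D w i x)))"
    unfolding trilinear_def ip_def eq sum.distrib using i1 i2 by (simp add: set_integral_sum)
  also have "... = (\<Sum>i\<in>UNIV. (LINT x:cell L|lborel. (w x $ i) * (u x \<bullet> D v i x) + (v x $ i) * (u x \<bullet> D w i x)))"
    by (intro sum.cong refl set_integral_add(2)[symmetric] i1 i2)
  also have "... = 0" using key by simp
  finally show ?thesis by simp
qed

section \<open>Mollification of solenoidal fields\<close>

lemma pair_kernel_integrable:
  fixes a f :: "'a::euclidean_space => 'b::euclidean_space" and \<kappa> :: "'a => real"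
  assumes k[measurable]: "\<kappa> \<in> borel_measurable borel" and C: "compact C" "\<And>x. x \<notin> C ==> \<kappa> x = 0" "\<And>x. \<bar>\<kappa> x\<bar> \<le> M"
    and a[measurable]: "a \<in> borel_measurable borel" and K: "compact K" "\<And>x. x \<notin> K ==> a x = 0" "\<And>x. norm (a x) \<le> B"
    and f: "loc_int f"
  shows "integrable lborel2 (%(x, y). \<kappa> (x - y) * (a x \<bullet> f y))"
proof (rule integrable_dominated)
  note [measurable] = loc_intD(1)[OF f]
  define K' where "K' = {x - y | x y. x \<in> K \<and> y \<in> C}"
  have K': "compact K'" unfolding K'_def by (rule compact_differences[OF K(1) C(1)])
  then have [measurable]: "K' \<in> sets borel" by (simp add: borel_compact)
  have [measurable]: "K \<in> sets borel" using K by (simp add: borel_compact)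
  have K'z: "y \<in> K'" if "x \<in> K" "x - y \<in> C" for x y
    unfolding K'_def mem_Collect_eq by (rule exI[of _ x], rule exI[of _ "x - y"]) (use that in auto)
  have M: "0 \<le> M" using C(3)[of 0] by linarith
  have iw: "integrable lborel (%y. indicator K' y * norm (f y))"
  proof -
    have "integrable lborel (%y. norm (indicator K' y *\<^sub>R f y))"
      using loc_intD(2)[OF f K'] unfolding set_integrable_def by (rule integrable_norm)
    then show ?thesis by simp
  qed
  have ik: "integrable lborel (%x. M * (B * indicator K x))"
    using compact_finite_lborel[OF K(1)] by (intro integrable_mult_right integrable_real_indicator) auto
  show "integrable lborel2 (%(x, y). (M * (B * indicator K x)) * (indicator K' y * norm (f y)))" by (rule integrable_pair_mult[OF ik iw])
  show "AE p in lborel2. norm (case p of (x, y) => \<kappa> (x - y) * (a x \<bullet> f y))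
      \<le> norm (case p of (x, y) => (M * (B * indicator K x)) * (indicator K' y * norm (f y)))"
  proof (rule AE_I2, clarify)
    fix x y
    show "norm (\<kappa> (x - y) * (a x \<bullet> f y)) \<le> norm ((M * (B * indicator K x)) * (indicator K' y * norm (f y)))"
    proof (cases "x \<in> K \<and> x - y \<in> C")
      case True
      have "norm (\<kappa> (x - y) * (a x \<bullet> f y)) \<le> M * (norm (a x) * norm (f y))"
        unfolding real_norm_def abs_mult by (intro mult_mono C(3) Cauchy_Schwarz_ineq2 M) auto
      also have "... \<le> M * (B * norm (f y))" by (intro mult_left_mono mult_right_mono K M) auto
      finally show ?thesis using True K'z[of x y] by simp
    next
      case False
      then have "\<kappa> (x - y) = 0 \<or> a x = 0" using C(2) K(2) by blast
      then show ?thesis by auto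
    qed
  qed
  show "(%(x, y). \<kappa> (x - y) * (a x \<bullet> f y)) \<in> borel_measurable lborel2" by measurable
qed

text \<open>
  Mollification is an average of translations. A property that each translate inherits through an integral, such as a
  vanishing divergence or mean, is inherited by the mollification.
\<close>

lemma inner_mollify_Fubini:
  fixes a f :: "'a::euclidean_space => 'b::euclidean_space"
  assumes e: "0 < e" and a[measurable]: "a \<in> borel_measurable borel"
    and K: "compact K" "\<And>x. x \<notin> K ==> a x = 0" "\<And>x. norm (a x) \<le> B" and f: "loc_int f"
  shows "(LINT x|lborel. a x \<bullet> mollify e f x) = (LINT z|lborel. mollifier e z * (LINT x|lborel. a x \<bullet> f (x - z)))"
    and "integrable lborel (%x. a x \<bullet> mollify e f x)"
proof -
  note [measurable] = loc_intD(1)[OF f]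
  let ?m = "mollifier e :: 'a => real"
  obtain C M where C: "compact C" "\<And>x. x \<notin> C ==> ?m x = 0" "\<And>x. \<bar>?m x\<bar> \<le> M"
    using test_function_bounds[OF test_function_mollifier_self[OF e, where 'a='a]] by metis
  have P: "integrable lborel2 (%(x, y). ?m (x - y) * (a x \<bullet> f y))" by (rule pair_kernel_integrable[OF _ C a K f]) measurable
  have iy: "integrable lborel (%y. ?m (x - y) * (a x \<bullet> f y))" for x
    using integrable_inner_right[OF integrable_mollifier_mult[OF f e, of x], of "a x"] by simp
  have sub: "integrable lborel (%z. ?m z * (a x \<bullet> f (x - z)))"
    "(LINT z|lborel. norm (?m z * (a x \<bullet> f (x - z)))) = (LINT y|lborel. norm (?m (x - y) * (a x \<bullet> f y)))"
    "(LINT z|lborel. ?m z * (a x \<bullet> f (x - z))) = (LINT y|lborel. ?m (x - y) * (a x \<bullet> f y))" for x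
    using lborel_integral_affine(2)[of "-1" "%y. ?m (x - y) * (a x \<bullet> f y)" x] iy[of x]
      lborel_integral_affine(1)[of "-1" "%y. norm (?m (x - y) * (a x \<bullet> f y))" x]
      lborel_integral_affine(1)[of "-1" "%y. ?m (x - y) * (a x \<bullet> f y)" x] by simp_all
  have Q: "integrable lborel2 (%(x, z). ?m z * (a x \<bullet> f (x - z)))"
  proof (rule lborel_pair.Fubini_integrable)
    have "integrable lborel (%x. LINT y|lborel. norm (?m (x - y) * (a x \<bullet> f y)))"
      using lborel_pair.integrable_fst[of "%x y. norm (?m (x - y) * (a x \<bullet> f y))"] integrable_norm[OF P] by (simp add: case_prod_unfold)
    then show "integrable lborel (%x. LINT z|lborel. norm (case (x, z) of (x, z) => ?m z * (a x \<bullet> f (x - z))))" using sub(2) by simp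
    show "AE x in lborel. integrable lborel (%z. case (x, z) of (x, z) => ?m z * (a x \<bullet> f (x - z)))" using sub(1) by simp
  qed measurable
  have eq: "a x \<bullet> mollify e f x = (LINT y|lborel. ?m (x - y) * (a x \<bullet> f y))" for x
    unfolding mollify_def by (subst integral_inner_right[OF integrable_mollifier_mult[OF f e, of x], symmetric]) simp
  show "integrable lborel (%x. a x \<bullet> mollify e f x)" unfolding eq using lborel_pair.integrable_fst[OF P] .
  have "(LINT x|lborel. a x \<bullet> mollify e f x) = (LINT x|lborel. (LINT z|lborel. ?m z * (a x \<bullet> f (x - z))))" unfolding eq sub(3) ..
  also have "... = (LINT z|lborel. (LINT x|lborel. ?m z * (a x \<bullet> f (x - z))))" by (rule lborel_pair.Fubini_integral[OF Q, symmetric])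
  finally show "(LINT x|lborel. a x \<bullet> mollify e f x) = (LINT z|lborel. mollifier e z * (LINT x|lborel. a x \<bullet> f (x - z)))" by simp
qed

lemma euclidean_eq_leftI:
  fixes x y :: "'a::euclidean_space"
  shows "(\<And>b. b \<in> Basis ==> b \<bullet> x = b \<bullet> y) ==> x = y"
  by (rule euclidean_eqI) (simp add: inner_commute)

text \<open>
  The mean of a translate over the cell is the mean over the shifted cell, which by unfolding equals the mean over the cell:
  the indicator of the shifted cell is a product weight with translates summing to 1. For \<open>e \<le> L\<close> two shifts per
  coordinate are enough.
\<close>

lemma solenoidal_mollify:
  assumes L: "0 < L" and s: "solenoidal L v" and v: "loc_int v" and e: "0 < e" "e \<le> L"
  shows "solenoidal L (mollify e v)"
proof (rule solenoidalI)
  note [measurable] = loc_intD(1)[OF v]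
  show "mollify e v (x + L *\<^sub>R axis i 1) = mollify e v x" for x i
  proof -
    have "v (x + L *\<^sub>R axis i 1 - z) = v (x - z)" for z
    proof -
      have "x + L *\<^sub>R axis i 1 - z = (x - z) + L *\<^sub>R axis i 1" by simp
      then show ?thesis by (simp only: solenoidalD(1)[OF s])
    qed
    then show ?thesis unfolding mollify_shifted by simp
  qed
  show "weak_div (mollify e v) (%_. 0)" unfolding weak_div_def
  proof (intro allI impI)
    fix psi :: "real^3 => real" assume t: "test_function UNIV psi"
    obtain K B where K: "compact K" "\<And>x. x \<notin> K ==> grad psi x = 0" "\<And>x. norm (grad psi x) \<le> B" using test_function_bounds[OF t] by metis
    note [measurable] = test_functionD(5,6)[OF t]
    have z: "(LINT x|lborel. grad psi x \<bullet> v (x - z)) = 0" for z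
    proof -
      have "(LINT x|lborel. grad psi (x + z) \<bullet> v x) = 0"
        using solenoidalD(3)[OF s] test_function_translate[OF t, of z] unfolding weak_div_def by auto
      then show ?thesis using integral_translate(1)[of "%x. grad psi (x + z) \<bullet> v x" z] by simp
    qed
    have "(LINT x|lborel. grad psi x \<bullet> mollify e v x) = (LINT z|lborel. mollifier e z * (LINT x|lborel. grad psi x \<bullet> v (x - z)))"
      by (rule inner_mollify_Fubini(1)[OF e(1) _ K v]) measurable
    then show "(LINT x|lborel. grad psi x \<bullet> mollify e v x) = - (LINT x|lborel. psi x * 0)" unfolding z by simp
  qed
  show "(LINT x:cell L|lborel. mollify e v x) = 0"
  proof (rule euclidean_eq_leftI)
    fix b :: "real^3" assume b: "b \<in> Basis"
    have nb: "norm b = 1" using b by simp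
    have im: "integrable lborel (%x. indicator (cell L) x *\<^sub>R mollify e v x)"
      using loc_intD(2)[OF loc_int_mollify(3)[OF v e(1)] compact_cell] by (simp add: set_integrable_def)
    have "b \<bullet> (LINT x:cell L|lborel. mollify e v x) = (LINT x|lborel. (indicator (cell L) x *\<^sub>R b) \<bullet> mollify e v x)"
      unfolding set_lebesgue_integral_def using integral_inner_right[OF im, of b] by simp
    also have "... = (LINT z|lborel. mollifier e z * (LINT x|lborel. (indicator (cell L) x *\<^sub>R b) \<bullet> v (x - z)))"
      by (rule inner_mollify_Fubini(1)[OF e(1) _ compact_cell[of L] _ _ v, where B=1]) (use nb in \<open>auto simp: indicator_def\<close>)
    also have "... = (LINT z::real^3|lborel. 0)"
    proof (rule Bochner_Integration.integral_cong[OF refl])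
      fix z :: "real^3"
      show "mollifier e z * (LINT x|lborel. (indicator (cell L) x *\<^sub>R b) \<bullet> v (x - z)) = 0"
      proof (cases "z \<in> cbox 0 (e *\<^sub>R One)")
        case False
        then show ?thesis using mollifier_eq_0[OF e(1), of z] by simp
      next
        case True
        have zi: "0 \<le> z $ i \<and> z $ i \<le> L" for i
        proof -
          have "0 \<le> z \<bullet> axis i 1 \<and> z \<bullet> axis i 1 \<le> (e *\<^sub>R One) \<bullet> (axis i 1 :: real^3)"
            using True unfolding mem_box by (auto simp: axis_in_Basis_iff)
          moreover have "One \<bullet> (axis i 1 :: real^3) = 1" by (simp add: inner_sum_left axis_in_Basis_iff inner_Basis if_distrib cong: if_cong)
          ultimately show ?thesis using e(2) by (simp add: inner_axis)
        qed
        define f where "f i s = (indicator {0..<L} (s + z $ i) :: real)" for i s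
        have I: "{- int 1..<int 1} = {- 1, 0 :: int}" by auto
        have unf: "(LINT x|lborel. (\<Prod>i\<in>UNIV. f i (x $ i)) *\<^sub>R v x) = (\<Prod>i\<in>(UNIV::3 set). 1) *\<^sub>R (LINT x:cell L|lborel. v x)"
        proof (rule unfold_product(2)[OF L v solenoidalD(2)[OF s], where m=1 and B=1])
          show "f i s = 0" if "s < - real 1 * L \<or> real 1 * L \<le> s" for i s using that zi[of i] by (auto simp: f_def indicator_def)
          show "(\<Sum>k\<in>{- int 1..<int 1}. f i (s + L * of_int k)) = 1" if "0 \<le> s" "s < L" for i s
          proof -
            have "(\<Sum>k\<in>{- int 1..<int 1}. f i (s + L * of_int k)) = f i (s - L) + f i s" unfolding I by simp
            also have "... = 1" using that zi[of i] by (auto simp: f_def indicator_def)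
            finally show ?thesis .
          qed
        qed (auto simp: f_def indicator_def)
        have fh: "(\<Prod>i\<in>UNIV. f i (x $ i)) = indicator (hcell L) (x + z)" for x by (simp add: f_def indicator_hcell)
        have "(LINT x|lborel. (indicator (cell L) x *\<^sub>R b) \<bullet> v (x - z)) = (LINT x|lborel. b \<bullet> (indicator (hcell L) (x + z) *\<^sub>R v x))"
        proof -
          have "(LINT x|lborel. (indicator (cell L) x *\<^sub>R b) \<bullet> v (x - z)) = (LINT x|lborel. (indicator (cell L) (x + z) *\<^sub>R b) \<bullet> v x)"
            using integral_translate(1)[of "%x. (indicator (cell L) (x + z) *\<^sub>R b) \<bullet> v x" z] by simp
          also have "... = (LINT x|lborel. b \<bullet> (indicator (hcell L) (x + z) *\<^sub>R v x))"
          proof (rule integral_cong_AE)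
            show "AE x in lborel. (indicator (cell L) (x + z) *\<^sub>R b) \<bullet> v x = b \<bullet> (indicator (hcell L) (x + z) *\<^sub>R v x)"
              using AE_translate[OF AE_hcell_cell[of L], of z] by eventually_elim (auto simp: indicator_def)
          qed measurable
          finally show ?thesis .
        qed
        also have "... = b \<bullet> (LINT x|lborel. (\<Prod>i\<in>UNIV. f i (x $ i)) *\<^sub>R v x)"
        proof -
          have "integrable lborel (%x. (\<Prod>i\<in>UNIV. f i (x $ i)) *\<^sub>R v x)" unfolding fh
          proof (rule integrable_bounded_support_mult[OF v])
            show "compact ((%x. x - z) ` cell L)" by (auto intro!: compact_continuous_image continuous_intros compact_cell)
            show "indicator (hcell L) (x + z) = (0::real)" if "x \<notin> (%x. x - z) ` cell L" for x
              using that image_eqI[of x "%x. x - z" "x + z" "cell L"] hcell_subset[of L] by (auto simp: indicator_def)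
            show "\<bar>indicator (hcell L) (x + z)\<bar> \<le> (1::real)" for x by (auto simp: indicator_def)
          qed measurable
          then show ?thesis unfolding fh by (rule integral_inner_right)
        qed
        also have "... = 0" unfolding unf solenoidalD(4)[OF s] by simp
        finally show ?thesis by simp
      qed
    qed
    finally show "b \<bullet> (LINT x:cell L|lborel. mollify e v x) = b \<bullet> 0" by simp
  qed
qed

text \<open>
  Here \<open>f\<close> has no weak derivative; the kernel is differentiated. Componentwise the mollification is smooth, and
  \<open>psi\<close> times a component is a test function, whose gradient integrates to 0.
\<close>

lemma weak_partial_mollify_grad:
  assumes f: "loc_int f" and e: "0 < e"
  shows "weak_partial j (mollify e f) (%x. LINT y|lborel. (grad (mollifier e) (x - y) $ j) *\<^sub>R f y)" (is "weak_partial j _ ?G")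
    and "loc_sq (%x. LINT y|lborel. (grad (mollifier e) (x - y) $ j) *\<^sub>R f y)"
proof -
  note fm[measurable] = loc_intD(1)[OF f]
  note tm = test_function_mollifier_self[OF e, where 'a="real^3"]
  note mk[measurable] = test_functionD(5,6)[OF tm]
  obtain K M where K: "compact K" "\<And>x::real^3. x \<notin> K ==> grad (mollifier e) x = 0" "\<And>x::real^3. norm (grad (mollifier e) x) \<le> M"
    by (rule test_function_bounds[OF tm]) (rule that)
  have g: "x \<notin> K ==> grad (mollifier e) x $ j = 0" "\<bar>grad (mollifier e) x $ j\<bar> \<le> M" for x :: "real^3"
    using K(2)[of x] K(3)[of x] component_le_norm_cart[of "grad (mollifier e) x" j] by auto
  have gm: "(%x::real^3. grad (mollifier e) x $ j) \<in> borel_measurable borel" by measurable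
  note cb = convolution_locally_bounded[OF gm K(1) g f] and iG = integrable_convolution[OF gm K(1) g f]
  show sG: "loc_sq ?G" unfolding locally_Lp_2_iff[symmetric] by (rule locally_bounded_locally_Lp[OF cb(2) cb(1)]) auto
  show "weak_partial j (mollify e f) ?G"
  proof (rule weak_partialI)
    show lf: "loc_int (mollify e f)" by (rule loc_int_mollify(3)[OF f e])
    show lG: "loc_int ?G" by (rule loc_sq_imp_loc_int[OF sG])
    fix psi :: "real^3 => real" assume t: "test_function UNIV psi"
    show "(LINT x|lborel. (grad psi x $ j) *\<^sub>R mollify e f x) = - (LINT x|lborel. psi x *\<^sub>R ?G x)"
    proof (rule euclidean_eq_leftI)
      fix b :: "real^3" assume b: "b \<in> Basis"
      have bf: "loc_int (%x. b \<bullet> f x)"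
        using loc_intD[OF f] integrable_inner_right[of b lborel "%x. indicator _ x *\<^sub>R f x"] unfolding loc_int_def set_integrable_def by auto
      have F: "mollify e (%x. b \<bullet> f x) x = b \<bullet> mollify e f x" for x
        unfolding mollify_def by (subst integral_inner_right[OF integrable_mollifier_mult[OF f e], symmetric]) simp
      note tp = test_function_mult[OF t mollify_smooth(1)[OF bf e]]
      have eq: "(grad (mollifier e) (x - y) \<bullet> axis j 1) * (b \<bullet> f y) = b \<bullet> ((grad (mollifier e) (x - y) $ j) *\<^sub>R f y)" for x y
        by (simp add: inner_axis)
      have gF: "grad (mollify e (%x. b \<bullet> f x)) x \<bullet> axis j 1 = b \<bullet> ?G x" for x
        unfolding mollify_smooth(2)[OF bf e] eq by (rule integral_inner_right[OF iG])
      note I = integrable_inner_right[OF test_mult_integrable(2)[OF t lf, of j], of b] integrable_inner_right[OF test_mult_integrable(1)[OF t lG], of b]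
      have "(LINT x|lborel. b \<bullet> ((grad psi x $ j) *\<^sub>R mollify e f x) + b \<bullet> (psi x *\<^sub>R ?G x)) = 0"
        using test_function_integral_grad_zero[OF tp(1), of "axis j 1"] unfolding tp(2) inner_add_left inner_scaleR_left gF unfolding F
        by (simp add: inner_axis mult.commute)
      then show "b \<bullet> (LINT x|lborel. (grad psi x $ j) *\<^sub>R mollify e f x) = b \<bullet> - (LINT x|lborel. psi x *\<^sub>R ?G x)"
        unfolding Bochner_Integration.integral_add[OF I] inner_minus_right
          integral_inner_right[OF test_mult_integrable(2)[OF t lf]] integral_inner_right[OF test_mult_integrable(1)[OF t lG]] by simp
    qed
  qed
qed

text \<open>
  The weak derivative of \<open>f\<close>, tested with the kernel, identifies the derivative of the mollification.
\<close>

lemma weak_partial_mollify: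
  assumes w: "weak_partial j f g" and e: "0 < e"
  shows "weak_partial j (mollify e f) (mollify e g)"
proof -
  have "(LINT y|lborel. (grad (mollifier e) (x - y) $ j) *\<^sub>R f y) = mollify e g x" for x
    using weak_partialD(3)[OF w test_function_mollifier[OF e, of x]] by (simp add: grad_mollifier_reflect(1)[OF e] mollify_def)
  then show ?thesis using weak_partial_mollify_grad(1)[OF weak_partialD(1)[OF w] e, of j] by simp
qed

lemma mollify_in_V_space:
  assumes L: "0 < L" and v: "solenoidal L v" "loc_sq v" and e: "0 < e" "e \<le> L"
  shows "mollify e v \<in> V_space L" "0 < p ==> mollify e v \<in> Lp_space L p"
proof -
  note li = loc_sq_imp_loc_int[OF v(2)]
  note s = solenoidal_mollify[OF L v(1) li e]
  show "mollify e v \<in> V_space L" by (rule V_spaceI[OF s loc_int_mollify(2)[OF li e(1)] weak_partial_mollify_grad[OF li e(1)]])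
  show "0 < p ==> mollify e v \<in> Lp_space L p" using s loc_int_mollify(1)[OF li e(1)] by (simp add: Lp_space_def)
qed

section \<open>Inner products, the embedding and the trilinear form\<close>

lemma integral_Cauchy_Schwarz:
  fixes f g :: "'c => 'b::euclidean_space"
  assumes m: "f \<in> borel_measurable M" "g \<in> borel_measurable M"
    and f2: "integrable M (%x. (norm (f x))^2)" and g2: "integrable M (%x. (norm (g x))^2)"
  shows "\<bar>LINT x|M. f x \<bullet> g x\<bar> \<le> sqrt (LINT x|M. (norm (f x))^2) * sqrt (LINT x|M. (norm (g x))^2)"
proof -
  note [measurable] = m
  define A B I where "A = (LINT x|M. (norm (f x))^2)" and "B = (LINT x|M. (norm (g x))^2)" and "I = (LINT x|M. f x \<bullet> g x)"
  have A0: "0 \<le> A" unfolding A_def by (rule integral_nonneg_AE) simp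
  have B0: "0 \<le> B" unfolding B_def by (rule integral_nonneg_AE) simp
  have i: "integrable M (%x. f x \<bullet> g x)" by (rule integrable_inner_sq(1)[OF m f2 g2])
  have "I^2 \<le> A * B"
  proof (cases "A = 0")
    case True
    then have "AE x in M. (norm (f x))^2 = 0" using f2 by (simp add: A_def integral_nonneg_eq_0_iff_AE)
    then have "I = (LINT x|M. 0)" unfolding I_def by (intro integral_cong_AE) (auto elim: eventually_mono)
    then show ?thesis using A0 B0 by simp
  next
    case False
    then have A: "0 < A" using A0 by simp
    define t where "t = I / A"
    have "0 \<le> (LINT x|M. (norm (g x - t *\<^sub>R f x))^2)" by (rule integral_nonneg_AE) simp
    also have "... = (LINT x|M. (norm (g x))^2 - 2 * t * (f x \<bullet> g x) + t^2 * (norm (f x))^2)"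
    proof (rule Bochner_Integration.integral_cong[OF refl])
      show "(norm (g x - t *\<^sub>R f x))^2 = (norm (g x))^2 - 2 * t * (f x \<bullet> g x) + t^2 * (norm (f x))^2" for x
        unfolding power2_norm_eq_inner by (simp add: inner_diff_left inner_diff_right inner_commute power2_eq_square algebra_simps)
    qed
    also have "... = B - 2 * t * I + t^2 * A" using i f2 g2 by (simp add: A_def B_def I_def)
    also have "... = B - I^2 / A" using A by (simp add: t_def power2_eq_square field_simps)
    finally show ?thesis using A by (simp add: field_simps)
  qed
  then have "sqrt (I^2) \<le> sqrt (A * B)" by (rule real_sqrt_le_mono)
  then show ?thesis by (simp add: real_sqrt_mult A_def B_def I_def)
qed

lemma ip_indicator: "ip L f g = (LINT x|lborel. (indicator (cell L) x *\<^sub>R f x) \<bullet> (indicator (cell L) x *\<^sub>R g x))"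
  unfolding ip_def set_lebesgue_integral_def by (rule Bochner_Integration.integral_cong) (auto simp: indicator_def)

lemma loc_sq_indicator:
  fixes f :: "real^3 => 'b::euclidean_space"
  assumes "loc_sq f"
  shows "(%x. indicator (cell L) x *\<^sub>R f x) \<in> borel_measurable lborel"
    "integrable lborel (%x. (norm (indicator (cell L) x *\<^sub>R f x))^2)"
proof -
  note [measurable] = loc_sqD(1)[OF assms]
  show "(%x. indicator (cell L) x *\<^sub>R f x) \<in> borel_measurable lborel" by measurable
  have "(%x. (norm (indicator (cell L) x *\<^sub>R f x))^2) = (%x. indicator (cell L) x *\<^sub>R (norm (f x))^2)"
    by (auto simp: fun_eq_iff indicator_def)
  then show "integrable lborel (%x. (norm (indicator (cell L) x *\<^sub>R f x))^2)"
    using loc_sqD(2)[OF assms compact_cell[of L]] by (simp only: set_integrable_def)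
qed

lemma ip_integrable: "loc_sq f ==> loc_sq g ==> set_integrable lborel (cell L) (%x. f x \<bullet> g x)"
  by (rule loc_intD(2)[OF loc_int_inner compact_cell])

lemma ip_commute: "ip L f g = ip L g f"
  by (simp add: ip_def inner_commute)

lemma ip_diff_right: "loc_sq f ==> loc_sq g ==> loc_sq h ==> ip L f (%x. g x - h x) = ip L f g - ip L f h"
  unfolding ip_def inner_diff_right by (intro set_integral_diff ip_integrable)

lemma ip_diff_left: "loc_sq f ==> loc_sq g ==> loc_sq h ==> ip L (%x. g x - h x) f = ip L g f - ip L h f"
  using ip_diff_right[of f g h L] by (simp add: ip_commute)

lemma ip_cong_AE:
  assumes "f \<in> borel_measurable borel" "g \<in> borel_measurable borel" "f' \<in> borel_measurable borel" "g' \<in> borel_measurable borel"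
    "AE x in lborel. f x = f' x" "AE x in lborel. g x = g' x"
  shows "ip L f g = ip L f' g'"
  unfolding ip_def set_lebesgue_integral_def
proof (rule integral_cong_AE)
  note [measurable] = assms(1-4)
  show "(%x. indicator (cell L) x *\<^sub>R (f x \<bullet> g x)) \<in> borel_measurable lborel" by measurable
  show "(%x. indicator (cell L) x *\<^sub>R (f' x \<bullet> g' x)) \<in> borel_measurable lborel" by measurable
  show "AE x in lborel. indicator (cell L) x *\<^sub>R (f x \<bullet> g x) = indicator (cell L) x *\<^sub>R (f' x \<bullet> g' x)"
    using assms(5,6) by eventually_elim simp
qed

lemma ip_nonneg: "0 \<le> ip L f f"
  unfolding ip_indicator by (rule integral_nonneg_AE) simp

lemma H_norm_sq: "(H_norm L f)^2 = ip L f f" and H_norm_nonneg: "0 \<le> H_norm L f"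
  by (simp_all add: H_norm_def ip_nonneg)

lemma ip_Cauchy_Schwarz: "loc_sq f ==> loc_sq g ==> \<bar>ip L f g\<bar> \<le> H_norm L f * H_norm L g"
  using integral_Cauchy_Schwarz[OF loc_sq_indicator(1) loc_sq_indicator(1) loc_sq_indicator(2) loc_sq_indicator(2), of f g L]
  unfolding H_norm_def ip_indicator power2_norm_eq_inner by simp

lemma grad_ip_commute: "grad_ip L f g = grad_ip L g f"
  by (simp add: grad_ip_def ip_commute)

lemma grad_ip_nonneg: "0 \<le> grad_ip L f f"
  unfolding grad_ip_def by (intro sum_nonneg ip_nonneg)

lemma V_norm_sq: "(V_norm L f)^2 = grad_ip L f f" and V_norm_nonneg: "0 \<le> V_norm L f"
  by (simp_all add: V_norm_def grad_ip_nonneg)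

lemma grad_ip_diff_right:
  assumes "f \<in> V_space L" "g \<in> V_space L" "h \<in> V_space L"
  shows "grad_ip L f (%x. g x - h x) = grad_ip L f g - grad_ip L f h"
proof -
  note F = V_spaceD[OF assms(1)] and G = V_spaceD[OF assms(2)] and H = V_spaceD[OF assms(3)]
  note D = V_spaceD[OF V_space_diff(1)[OF assms(2,3)]]
  have "ip L (wD j f) (wD j (%x. g x - h x)) = ip L (wD j f) (wD j g) - ip L (wD j f) (wD j h)" for j
  proof -
    have "ip L (wD j f) (wD j (%x. g x - h x)) = ip L (wD j f) (%x. wD j g x - wD j h x)" by (rule ip_cong_AE)
        (use V_space_diff(2)[OF assms(2,3)] loc_sqD(1)[OF F(4)] loc_sqD(1)[OF G(4)] loc_sqD(1)[OF H(4)] loc_sqD(1)[OF D(4)] in simp_all)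
    also have "... = ip L (wD j f) (wD j g) - ip L (wD j f) (wD j h)" by (rule ip_diff_right[OF F(4) G(4) H(4)])
    finally show ?thesis .
  qed
  then show ?thesis by (simp add: grad_ip_def sum_subtractf)
qed

lemma grad_ip_diff_left:
  "f \<in> V_space L ==> g \<in> V_space L ==> h \<in> V_space L ==> grad_ip L (%x. g x - h x) f = grad_ip L g f - grad_ip L h f"
  using grad_ip_diff_right[of f L g h] by (simp add: grad_ip_commute)

lemma grad_ip_Cauchy_Schwarz:
  assumes "f \<in> V_space L" "g \<in> V_space L"
  shows "\<bar>grad_ip L f g\<bar> \<le> V_norm L f * V_norm L g"
proof -
  have "\<bar>grad_ip L f g\<bar> \<le> (\<Sum>j\<in>UNIV. \<bar>ip L (wD j f) (wD j g)\<bar>)" unfolding grad_ip_def by (rule sum_abs)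
  also have "... \<le> (\<Sum>j\<in>UNIV. \<bar>H_norm L (wD j f)\<bar> * \<bar>H_norm L (wD j g)\<bar>)"
    using V_spaceD(4)[OF assms(1)] V_spaceD(4)[OF assms(2)] H_norm_nonneg by (intro sum_mono) (simp add: ip_Cauchy_Schwarz)
  also have "... \<le> L2_set (%j. H_norm L (wD j f)) UNIV * L2_set (%j. H_norm L (wD j g)) UNIV" by (rule L2_set_mult_ineq)
  also have "... = V_norm L f * V_norm L g" by (simp add: L2_set_def V_norm_def grad_ip_def H_norm_sq)
  finally show ?thesis .
qed

lemma mollify_ip_limit:
  assumes F: "loc_sq F" and v: "loc_sq v"
  shows "((%e. ip L F (mollify e v)) \<longlongrightarrow> ip L F v) (at_right 0)"
proof -
  have eq: "ip L F g = (LINT x|lborel. (indicator (cell L) x *\<^sub>R F x) \<bullet> g x)" for g unfolding ip_def set_lebesgue_integral_def by simp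
  show ?thesis unfolding eq by (rule mollify_weak_limit_sq[OF v _ loc_sq_indicator(2)[OF F] compact_cell[of L]])
      (use loc_sq_indicator(1)[OF F] in auto)
qed

lemma mollify_grad_ip_limit:
  assumes L: "0 < L" and u: "u \<in> V_space L" and v: "v \<in> V_space L"
  shows "((%e. grad_ip L u (mollify e v)) \<longlongrightarrow> grad_ip L u v) (at_right 0)"
  unfolding grad_ip_def
proof (rule tendsto_sum)
  fix j
  note U = V_spaceD[OF u] and V = V_spaceD[OF v]
  show "((%e. ip L (wD j u) (wD j (mollify e v))) \<longlongrightarrow> ip L (wD j u) (wD j v)) (at_right 0)"
  proof (rule Lim_transform_eventually[OF mollify_ip_limit[OF U(4) V(4)] eventually_mono[OF eventually_at_right_less]])
    fix e :: real assume e: "0 < e"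
    note w = wD_eq[OF weak_partial_mollify[OF V(3)[of j] e]]
    have m: "wD j (mollify e v) \<in> borel_measurable borel" "mollify e (wD j v) \<in> borel_measurable borel"
      using loc_intD(1)[OF weak_partialD(2)[OF w(1)]] measurable_mollify[OF loc_sqD(1)[OF V(4)]] by auto
    show "ip L (wD j u) (mollify e (wD j v)) = ip L (wD j u) (wD j (mollify e v))"
      by (rule ip_cong_AE) (use AE_symmetric[OF w(2)] m loc_sqD(1)[OF U(4)] in simp_all)
  qed
qed

text \<open>
  The Cauchy--Schwarz inequality for the squares.
\<close>

lemma L4_inner_bound:
  assumes u: "u \<in> borel_measurable borel" "set_integrable lborel (cell L) (%x. norm (u x) powr 4)"
    and w: "w \<in> borel_measurable borel" "set_integrable lborel (cell L) (%x. norm (w x) powr 4)"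
  shows "set_integrable lborel (cell L) (%x. (norm (u x) * norm (w x))^2)"
    "(LINT x:cell L|lborel. (norm (u x) * norm (w x))^2) \<le> (Lp_norm L 4 u)^2 * (Lp_norm L 4 w)^2"
proof -
  note [measurable] = u(1) w(1)
  have p4: "y powr 4 = (y^2)^2" if "0 \<le> y" for y :: real by (cases "y = 0") (use that in \<open>simp_all flip: power_mult\<close>)
  define f where "f v x = indicator (cell L) x *\<^sub>R (norm (v x))^2" for v :: field and x
  have f2: "(norm (f v x))^2 = indicator (cell L) x *\<^sub>R (norm (v x) powr 4)" for v x by (auto simp: f_def p4 indicator_def)
  have [measurable]: "f u \<in> borel_measurable lborel" "f w \<in> borel_measurable lborel" unfolding f_def[abs_def] by measurable
  have iu: "integrable lborel (%x. (norm (f u x))^2)" and iw: "integrable lborel (%x. (norm (f w x))^2)"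
    using u(2) w(2) unfolding f2 set_integrable_def by auto
  have eq: "indicator (cell L) x *\<^sub>R (norm (u x) * norm (w x))^2 = f u x \<bullet> f w x" for x
    by (auto simp: f_def indicator_def power_mult_distrib)
  show "set_integrable lborel (cell L) (%x. (norm (u x) * norm (w x))^2)"
    unfolding set_integrable_def eq by (rule integrable_inner_sq(1)[OF _ _ iu iw]) measurable
  have sq: "sqrt (LINT x|lborel. (norm (f v x))^2) = (Lp_norm L 4 v)^2" for v
  proof -
    define I where "I = (LINT x:cell L|lborel. norm (v x) powr 4)"
    have I: "(LINT x|lborel. (norm (f v x))^2) = I" unfolding f2 I_def set_lebesgue_integral_def ..
    have "0 \<le> I" unfolding I[symmetric] by (rule integral_nonneg_AE) simp
    then have "sqrt I = (I powr (1/4))^2" using powr_half_sqrt[of I] by (simp add: power2_eq_square powr_add[symmetric])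
    then show ?thesis unfolding I by (simp add: Lp_norm_def I_def)
  qed
  have "(LINT x:cell L|lborel. (norm (u x) * norm (w x))^2) \<le> \<bar>LINT x|lborel. f u x \<bullet> f w x\<bar>"
    unfolding set_lebesgue_integral_def eq by simp
  also have "... \<le> sqrt (LINT x|lborel. (norm (f u x))^2) * sqrt (LINT x|lborel. (norm (f w x))^2)"
    by (rule integral_Cauchy_Schwarz[OF _ _ iu iw]) measurable
  finally show "(LINT x:cell L|lborel. (norm (u x) * norm (w x))^2) \<le> (Lp_norm L 4 u)^2 * (Lp_norm L 4 w)^2" unfolding sq .
qed

text \<open>
  The hypothesis on the constant \<open>C\<close>. On a cell of finite measure it also yields a Poincare inequality.
\<close>

definition sobolev_embedding :: "real => real => bool" where
  "sobolev_embedding L C \<longleftrightarrow> 0 < L \<and> 0 < C \<and>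
     (\<forall>v\<in>V_space L. v \<in> Lp_space L 4 \<and> Lp_norm L 4 v \<le> sqrt C * V_norm L v)"

lemma sobolev_product_bound:
  assumes S: "sobolev_embedding L C" and u: "u \<in> V_space L" and w: "w \<in> V_space L"
  shows "set_integrable lborel (cell L) (%x. (norm (u x) * norm (w x))^2)"
    "(LINT x:cell L|lborel. (norm (u x) * norm (w x))^2) \<le> (C * V_norm L u * V_norm L w)^2"
proof -
  have L4: "set_integrable lborel (cell L) (%x. norm (v x) powr 4)" "v \<in> borel_measurable borel"
    "(Lp_norm L 4 v)^2 \<le> C * (V_norm L v)^2" if v: "v \<in> V_space L" for v
  proof -
    have *: "v \<in> Lp_space L 4" "Lp_norm L 4 v \<le> sqrt C * V_norm L v" using S v by (auto simp: sobolev_embedding_def)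
    then show "set_integrable lborel (cell L) (%x. norm (v x) powr 4)" "v \<in> borel_measurable borel"
      using compact_cell[of L] by (auto simp: Lp_space_def locally_Lp_def)
    have "0 \<le> Lp_norm L 4 v" by (simp add: Lp_norm_def)
    then have "(Lp_norm L 4 v)^2 \<le> (sqrt C * V_norm L v)^2" using * by (intro power_mono)
    then show "(Lp_norm L 4 v)^2 \<le> C * (V_norm L v)^2" using S by (simp add: power_mult_distrib sobolev_embedding_def)
  qed
  note b = L4_inner_bound[OF L4(2,1)[OF u] L4(2,1)[OF w]]
  show "set_integrable lborel (cell L) (%x. (norm (u x) * norm (w x))^2)" by (rule b)
  have "(Lp_norm L 4 u)^2 * (Lp_norm L 4 w)^2 \<le> (C * (V_norm L u)^2) * (C * (V_norm L w)^2)"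
    using S by (intro mult_mono L4 u w) (auto simp: sobolev_embedding_def)
  then show "(LINT x:cell L|lborel. (norm (u x) * norm (w x))^2) \<le> (C * V_norm L u * V_norm L w)^2"
    using b(2) by (simp add: power_mult_distrib power2_eq_square mult_ac)
qed

text \<open>
  On a cell of finite measure the \<open>L\<^sup>2\<close> norm is bounded by the \<open>L\<^sup>4\<close> norm, and the latter by the embedding.
\<close>

lemma poincare:
  assumes S: "sobolev_embedding L C"
  shows "\<exists>c\<ge>0. \<forall>v\<in>V_space L. H_norm L v \<le> c * V_norm L v"
proof -
  have C: "0 < C" using S by (simp add: sobolev_embedding_def)
  define m where "m = sqrt (LINT x:cell L|lborel. (1::real))"
  have m0: "0 \<le> m" unfolding m_def set_lebesgue_integral_def by (intro real_sqrt_ge_zero integral_nonneg_AE) simp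
  show ?thesis
  proof (intro exI[of _ "sqrt (m * C)"] conjI ballI)
    show "0 \<le> sqrt (m * C)" using m0 C by simp
    fix v assume v: "v \<in> V_space L"
    note V = V_spaceD[OF v]
    note [measurable] = loc_sqD(1)[OF V(2)]
    let ?f = "%x. indicator (cell L) x :: real" and ?g = "%x. indicator (cell L) x * (norm (v x) * norm (v x))"
    have f: "integrable lborel (%x. (norm (?f x))^2)" "(LINT x|lborel. (norm (?f x))^2) = (LINT x:cell L|lborel. 1)"
    proof -
      have "(norm (?f x))^2 = ?f x" for x by (simp add: indicator_def)
      then show "integrable lborel (%x. (norm (?f x))^2)" "(LINT x|lborel. (norm (?f x))^2) = (LINT x:cell L|lborel. 1)"
        using compact_finite_lborel[OF compact_cell[of L]] unfolding set_lebesgue_integral_def by (auto intro!: integrable_real_indicator)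
    qed
    have gg: "(norm (?g x))^2 = indicator (cell L) x *\<^sub>R (norm (v x) * norm (v x))^2" for x by (auto simp: indicator_def)
    note pb = sobolev_product_bound[OF S v v]
    have g: "integrable lborel (%x. (norm (?g x))^2)" "(LINT x|lborel. (norm (?g x))^2) = (LINT x:cell L|lborel. (norm (v x) * norm (v x))^2)"
      using pb(1) unfolding gg set_integrable_def set_lebesgue_integral_def by auto
    have "(H_norm L v)^2 = (LINT x|lborel. ?f x \<bullet> ?g x)" unfolding H_norm_sq ip_def set_lebesgue_integral_def
      by (rule Bochner_Integration.integral_cong) (auto simp: indicator_def power2_norm_eq_inner[symmetric] power2_eq_square)
    also have "... \<le> \<bar>LINT x|lborel. ?f x \<bullet> ?g x\<bar>" by simp
    also have "... \<le> sqrt (LINT x|lborel. (norm (?f x))^2) * sqrt (LINT x|lborel. (norm (?g x))^2)"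
      by (rule integral_Cauchy_Schwarz[OF _ _ f(1) g(1)]) measurable
    also have "... \<le> m * (C * V_norm L v * V_norm L v)"
    proof -
      have "sqrt (LINT x|lborel. (norm (?g x))^2) \<le> sqrt ((C * V_norm L v * V_norm L v)^2)" unfolding g(2) by (rule real_sqrt_le_mono[OF pb(2)])
      also have "... = C * V_norm L v * V_norm L v" using C V_norm_nonneg[of L v] by (simp add: abs_mult)
      finally show ?thesis unfolding f(2) m_def[symmetric] using m0 by (rule mult_left_mono)
    qed
    also have "... = (sqrt (m * C) * V_norm L v)^2"
    proof -
      have mC: "0 \<le> m * C" using m0 C by simp
      show ?thesis unfolding power_mult_distrib real_sqrt_pow2[OF mC] by (simp add: power2_eq_square)
    qed
    finally have "(H_norm L v)^2 \<le> (sqrt (m * C) * V_norm L v)^2" .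
    then show "H_norm L v \<le> sqrt (m * C) * V_norm L v" by (rule power2_le_imp_le) (use m0 C V_norm_nonneg[of L v] in simp)
  qed
qed

lemma convection_pointwise:
  fixes a w :: "real^3" and D :: "3 => real^3"
  shows "\<bar>(\<Sum>j\<in>UNIV. (a $ j) *\<^sub>R D j) \<bullet> w\<bar> \<le> sqrt (\<Sum>j\<in>UNIV. (norm (D j))^2) * (norm a * norm w)"
    "norm (\<Sum>j\<in>UNIV. (a $ j) *\<^sub>R D j) \<le> norm a * sqrt (\<Sum>j\<in>UNIV. (norm (D j))^2)"
proof -
  have "norm (\<Sum>j\<in>UNIV. (a $ j) *\<^sub>R D j) \<le> (\<Sum>j\<in>UNIV. \<bar>a $ j\<bar> * \<bar>norm (D j)\<bar>)"
    by (rule order_trans[OF norm_sum]) simp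
  also have "... \<le> L2_set (%j. a $ j) UNIV * L2_set (%j. norm (D j)) UNIV" by (rule L2_set_mult_ineq)
  also have "... = norm a * sqrt (\<Sum>j\<in>UNIV. (norm (D j))^2)" by (simp add: L2_set_def norm_vec_def)
  finally show 2: "norm (\<Sum>j\<in>UNIV. (a $ j) *\<^sub>R D j) \<le> norm a * sqrt (\<Sum>j\<in>UNIV. (norm (D j))^2)" .
  have "\<bar>(\<Sum>j\<in>UNIV. (a $ j) *\<^sub>R D j) \<bullet> w\<bar> \<le> norm (\<Sum>j\<in>UNIV. (a $ j) *\<^sub>R D j) * norm w" by (rule Cauchy_Schwarz_ineq2)
  also have "... \<le> (norm a * sqrt (\<Sum>j\<in>UNIV. (norm (D j))^2)) * norm w" by (rule mult_right_mono[OF 2]) simp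
  finally show "\<bar>(\<Sum>j\<in>UNIV. (a $ j) *\<^sub>R D j) \<bullet> w\<bar> \<le> sqrt (\<Sum>j\<in>UNIV. (norm (D j))^2) * (norm a * norm w)"
    by (simp add: mult_ac)
qed

text \<open>
  Cauchy--Schwarz with the factor \<open>|u| |w|\<close> in \<open>L\<^sup>2\<close>, which the embedding controls by the two \<open>V\<close> norms.
\<close>

lemma trilinear_bound:
  assumes S: "sobolev_embedding L C" and u: "u \<in> V_space L" and v: "v \<in> V_space L" and w: "w \<in> V_space L"
  shows "set_integrable lborel (cell L) (%x. (\<Sum>j\<in>UNIV. (u x $ j) *\<^sub>R wD j v x) \<bullet> w x)"
    "\<bar>trilinear L u v w\<bar> \<le> C * V_norm L u * V_norm L v * V_norm L w"
proof -
  have C: "0 < C" using S by (simp add: sobolev_embedding_def)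
  note U = V_spaceD[OF u] and V = V_spaceD[OF v] and W = V_spaceD[OF w]
  note [measurable] = loc_sqD(1)[OF U(2)] loc_sqD(1)[OF W(2)] loc_sqD(1)[OF V(4)]
  define d where "d x = sqrt (\<Sum>j\<in>UNIV. (norm (wD j v x))^2)" for x
  have d0: "0 \<le> d x" for x by (simp add: d_def sum_nonneg)
  let ?f = "%x. indicator (cell L) x * d x" and ?g = "%x. indicator (cell L) x * (norm (u x) * norm (w x))"
  have [measurable]: "d \<in> borel_measurable borel" unfolding d_def[abs_def] by measurable
  have ff: "(norm (?f x))^2 = (\<Sum>j\<in>UNIV. (norm (indicator (cell L) x *\<^sub>R wD j v x))^2)" for x
    by (cases "x \<in> cell L") (auto simp: d_def sum_nonneg)
  have f: "integrable lborel (%x. (norm (?f x))^2)" "(LINT x|lborel. (norm (?f x))^2) = (V_norm L v)^2"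
  proof -
    show "integrable lborel (%x. (norm (?f x))^2)" unfolding ff by (intro Bochner_Integration.integrable_sum loc_sq_indicator(2)[OF V(4)])
    have "(LINT x|lborel. (norm (?f x))^2) = (\<Sum>j\<in>UNIV. LINT x|lborel. (norm (indicator (cell L) x *\<^sub>R wD j v x))^2)"
      unfolding ff by (intro Bochner_Integration.integral_sum loc_sq_indicator(2)[OF V(4)])
    then show "(LINT x|lborel. (norm (?f x))^2) = (V_norm L v)^2" unfolding V_norm_sq grad_ip_def ip_indicator power2_norm_eq_inner .
  qed
  have gg: "(norm (?g x))^2 = indicator (cell L) x *\<^sub>R (norm (u x) * norm (w x))^2" for x by (auto simp: indicator_def)
  note pb = sobolev_product_bound[OF S u w]
  have g: "integrable lborel (%x. (norm (?g x))^2)" "(LINT x|lborel. (norm (?g x))^2) = (LINT x:cell L|lborel. (norm (u x) * norm (w x))^2)"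
    using pb(1) unfolding gg set_integrable_def set_lebesgue_integral_def by auto
  have ifg: "integrable lborel (%x. ?f x \<bullet> ?g x)" by (rule integrable_inner_sq(1)[OF _ _ f(1) g(1)]) measurable
  let ?h = "%x. indicator (cell L) x *\<^sub>R ((\<Sum>j\<in>UNIV. (u x $ j) *\<^sub>R wD j v x) \<bullet> w x)"
  have le: "norm (?h x) \<le> ?f x \<bullet> ?g x" for x
    using convection_pointwise(1)[of "u x" "%j. wD j v x" "w x"] by (auto simp: d_def indicator_def)
  have ih: "integrable lborel ?h"
    by (rule integrable_dominated[OF ifg]) (use le in \<open>auto intro!: AE_I2 intro: order_trans[OF _ abs_ge_self]\<close>)
  then show "set_integrable lborel (cell L) (%x. (\<Sum>j\<in>UNIV. (u x $ j) *\<^sub>R wD j v x) \<bullet> w x)" by (simp add: set_integrable_def)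
  have "\<bar>trilinear L u v w\<bar> = norm (LINT x|lborel. ?h x)" by (simp add: trilinear_def ip_def set_lebesgue_integral_def)
  also have "... \<le> (LINT x|lborel. ?f x \<bullet> ?g x)" by (rule Bochner_Integration.integral_norm_bound_integral[OF ih ifg le])
  also have "... \<le> \<bar>LINT x|lborel. ?f x \<bullet> ?g x\<bar>" by simp
  also have "... \<le> sqrt (LINT x|lborel. (norm (?f x))^2) * sqrt (LINT x|lborel. (norm (?g x))^2)"
    by (rule integral_Cauchy_Schwarz[OF _ _ f(1) g(1)]) measurable
  also have "... \<le> V_norm L v * (C * V_norm L u * V_norm L w)"
  proof (rule mult_mono)
    show "sqrt (LINT x|lborel. (norm (?f x))^2) \<le> V_norm L v" unfolding f(2) using V_norm_nonneg by simp
    have "sqrt (LINT x|lborel. (norm (?g x))^2) \<le> sqrt ((C * V_norm L u * V_norm L w)^2)" unfolding g(2) by (rule real_sqrt_le_mono[OF pb(2)])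
    then show "sqrt (LINT x|lborel. (norm (?g x))^2) \<le> C * V_norm L u * V_norm L w"
      using C V_norm_nonneg[of L u] V_norm_nonneg[of L w] by (simp add: abs_mult)
  qed (auto simp: V_norm_nonneg intro!: real_sqrt_ge_zero integral_nonneg_AE)
  finally show "\<bar>trilinear L u v w\<bar> \<le> C * V_norm L u * V_norm L v * V_norm L w" by (simp add: mult_ac)
qed

lemma trilinear_diff:
  assumes S: "sobolev_embedding L C" and V: "u \<in> V_space L" "v \<in> V_space L" "w \<in> V_space L" "z \<in> V_space L"
  shows "trilinear L (%x. u x - z x) v w = trilinear L u v w - trilinear L z v w"
    "trilinear L u (%x. v x - z x) w = trilinear L u v w - trilinear L u z w"
    "trilinear L u v (%x. w x - z x) = trilinear L u v w - trilinear L u v z"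
proof -
  note ti = trilinear_bound(1)[OF S]
  have "trilinear L (%x. u x - z x) v w = (LINT x:cell L|lborel. (\<Sum>j\<in>UNIV. (u x $ j) *\<^sub>R wD j v x) \<bullet> w x - (\<Sum>j\<in>UNIV. (z x $ j) *\<^sub>R wD j v x) \<bullet> w x)"
    by (simp add: trilinear_def ip_def scaleR_diff_left sum_subtractf inner_diff_left)
  then show "trilinear L (%x. u x - z x) v w = trilinear L u v w - trilinear L z v w"
    using ti[OF V(1,2,3)] ti[OF V(4,2,3)] by (simp add: trilinear_def ip_def)
  have "trilinear L u v (%x. w x - z x) = (LINT x:cell L|lborel. (\<Sum>j\<in>UNIV. (u x $ j) *\<^sub>R wD j v x) \<bullet> w x - (\<Sum>j\<in>UNIV. (u x $ j) *\<^sub>R wD j v x) \<bullet> z x)"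
    by (simp add: trilinear_def ip_def inner_diff_right)
  then show "trilinear L u v (%x. w x - z x) = trilinear L u v w - trilinear L u v z"
    using ti[OF V(1,2,3)] ti[OF V(1,2,4)] by (simp add: trilinear_def ip_def)
  have AEj: "AE x in lborel. \<forall>j. wD j (%x. v x - z x) x = wD j v x - wD j z x"
    unfolding AE_all_countable using V_space_diff(2)[OF V(2,4)] by blast
  note [measurable] = loc_sqD(1)[OF V_spaceD(2)[OF V(1)]] loc_sqD(1)[OF V_spaceD(2)[OF V(3)]]
    loc_sqD(1)[OF V_spaceD(4)[OF V(2)]] loc_sqD(1)[OF V_spaceD(4)[OF V(4)]] loc_sqD(1)[OF V_spaceD(4)[OF V_space_diff(1)[OF V(2,4)]]]
  have "trilinear L u (%x. v x - z x) w = (LINT x:cell L|lborel. (\<Sum>j\<in>UNIV. (u x $ j) *\<^sub>R wD j v x) \<bullet> w x - (\<Sum>j\<in>UNIV. (u x $ j) *\<^sub>R wD j z x) \<bullet> w x)"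
    unfolding trilinear_def ip_def set_lebesgue_integral_def
  proof (rule integral_cong_AE)
    show "AE x in lborel. indicat_real (cell L) x *\<^sub>R ((\<Sum>j\<in>UNIV. (u x $ j) *\<^sub>R wD j (%x. v x - z x) x) \<bullet> w x)
      = indicat_real (cell L) x *\<^sub>R ((\<Sum>j\<in>UNIV. (u x $ j) *\<^sub>R wD j v x) \<bullet> w x - (\<Sum>j\<in>UNIV. (u x $ j) *\<^sub>R wD j z x) \<bullet> w x)"
      using AEj by eventually_elim (simp add: scaleR_diff_right sum_subtractf inner_diff_left)
  qed measurable
  then show "trilinear L u (%x. v x - z x) w = trilinear L u v w - trilinear L u z w"
    using ti[OF V(1,2,3)] ti[OF V(1,4,3)] by (simp add: trilinear_def ip_def)
qed

section \<open>Taylor remainder of the damping\<close>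

text \<open>
  The mean value theorem; the intermediate point stays positive even if \<open>x\<close> or \<open>y\<close> is 0, where the derivative need not
  exist.
\<close>

lemma powr_MVT:
  fixes s :: real
  assumes s: "1 \<le> s" and x: "0 \<le> x" "x \<le> M" and y: "0 \<le> y" "y \<le> M" and ne: "x \<noteq> y"
  shows "\<exists>\<xi>. 0 < \<xi> \<and> \<xi> \<le> M \<and> \<bar>\<xi> - y\<bar> \<le> \<bar>x - y\<bar> \<and> x powr s - y powr s = s * \<xi> powr (s - 1) * (x - y)"
proof -
  have *: "\<exists>\<xi>. a < \<xi> \<and> \<xi> < b \<and> b powr s - a powr s = (b - a) * (s * \<xi> powr (s - 1))" if "0 \<le> a" "a < b" for a b :: real
  proof -
    have "continuous_on {a..b} (%t. t powr s)" using that s by (intro continuous_on_powr') (auto intro!: continuous_intros)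
    moreover have "((%t. t powr s) has_real_derivative s * t powr (s - 1)) (at t)" if "a < t" for t
      using that \<open>0 \<le> a\<close> by (intro has_real_derivative_powr) auto
    ultimately obtain l z where z: "a < z" "z < b" "DERIV (%t. t powr s) z :> l" "b powr s - a powr s = (b - a) * l"
      using MVT[OF \<open>a < b\<close>, of "%t. t powr s"] by (auto simp: real_differentiable_def)
    moreover have "l = s * z powr (s - 1)"
      using DERIV_unique[OF z(3)] \<open>\<And>t. a < t ==> ((%t. t powr s) has_real_derivative s * t powr (s - 1)) (at t)\<close> z(1) by blast
    ultimately show ?thesis by blast
  qed
  show ?thesis
  proof (cases "x < y")
    case True
    then obtain z where "x < z" "z < y" "y powr s - x powr s = (y - x) * (s * z powr (s - 1))" using *[OF x(1)] by blast
    then show ?thesis using x y by (intro exI[of _ z]) (auto simp: algebra_simps)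
  next
    case False
    then have "y < x" using ne by simp
    then obtain z where "y < z" "z < x" "x powr s - y powr s = (x - y) * (s * z powr (s - 1))" using *[OF y(1)] by blast
    then show ?thesis using x y by (intro exI[of _ z]) (auto simp: algebra_simps)
  qed
qed

lemma powr_diff_bound:
  fixes s :: real
  assumes s: "1 \<le> s" and x: "0 \<le> x" "x \<le> M" and y: "0 \<le> y" "y \<le> M"
  shows "\<bar>x powr s - y powr s\<bar> \<le> s * M powr (s - 1) * \<bar>x - y\<bar>"
proof (cases "x = y")
  case False
  from powr_MVT[OF s x y False] obtain z where z: "0 < z" "z \<le> M" "x powr s - y powr s = s * z powr (s - 1) * (x - y)" by blast
  have "\<bar>x powr s - y powr s\<bar> = s * z powr (s - 1) * \<bar>x - y\<bar>" using z s by (simp add: abs_mult)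
  also have "... \<le> s * M powr (s - 1) * \<bar>x - y\<bar>" using z s by (intro mult_right_mono mult_left_mono powr_mono2) auto
  finally show ?thesis .
qed simp

text \<open>
  With \<open>x = |a|\<close>, \<open>y = |b|\<close> and \<open>p = r - 1\<close> the remainder is
  \<open>(x\<^sup>p - y\<^sup>p) w + (x\<^sup>p - y\<^sup>p - p y\<^bsup>p-2\<^esup> (b \<bullet> w)) b\<close>. The first term costs \<open>p\<close> by the mean value theorem. In the second
  \<open>b \<bullet> w\<close> equals \<open>y (x - y)\<close> up to \<open>|w|^2\<close>, which costs another \<open>p\<close>, and the remaining scalar Taylor remainder costs
  \<open>p (p + 1)\<close>. This also covers \<open>2 \<le> r < 3\<close>, where the derivative is not Lipschitz in \<open>b\<close> but the factor
  \<open>y\<close> compensates \<open>y\<^bsup>p-2\<^esup>\<close>.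
\<close>

lemma damping_remainder:
  fixes a b :: "real^3"
  assumes r: "2 \<le> r" and a: "norm a \<le> M" and b: "norm b \<le> M"
  shows "norm (damping r a - damping r b - damping_deriv r b (a - b)) \<le> ((r - 1)^2 + 3 * (r - 1)) * M powr (r - 2) * (norm (a - b))^2"
proof -
  define p x y w where "p = r - 1" and "x = norm a" and "y = norm b" and "w = a - b"
  define Q where "Q = M powr (p - 1)"
  have p: "1 \<le> p" and r2: "r - 2 = p - 1" using r by (auto simp: p_def)
  have x: "0 \<le> x" "x \<le> M" and y: "0 \<le> y" "y \<le> M" using a b by (auto simp: x_def y_def)
  have Q0: "0 \<le> Q" by (simp add: Q_def)
  have xw: "\<bar>x - y\<bar> \<le> norm w" unfolding x_def y_def w_def by (rule norm_triangle_ineq3)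
  have xw2: "(x - y)^2 \<le> (norm w)^2" using power_mono[OF xw, of 2] by simp
  have pw1: "t powr p = t * t powr (p - 1)" if "0 \<le> t" for t
  proof (cases "t = 0")
    case False
    then show ?thesis using that powr_add[of t 1 "p - 1"] by simp
  qed (use p in simp)
  have "norm (damping r a - damping r b - damping_deriv r b (a - b)) \<le> (p^2 + 3 * p) * Q * (norm w)^2"
  proof (cases "b = 0")
    case True
    have "damping_deriv r b (a - b) = 0" "damping r b = 0" using True r by (auto simp: damping_deriv_def damping_def)
    then have "norm (damping r a - damping r b - damping_deriv r b (a - b)) = x powr p * x" by (simp add: damping_def x_def p_def)
    also have "... = x powr (p - 1) * (norm w)^2" using x True by (simp add: pw1 w_def x_def power2_eq_square)
    also have "... \<le> Q * (norm w)^2" unfolding Q_def using x p by (intro mult_right_mono powr_mono2) auto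
    also have "... \<le> (p^2 + 3 * p) * (Q * (norm w)^2)"
    proof -
      have "1 \<le> p^2 + 3 * p" using p by (simp add: add_increasing)
      from mult_right_mono[OF this, of "Q * (norm w)^2"] Q0 show ?thesis by simp
    qed
    finally show ?thesis by (simp add: mult.assoc)
  next
    case False
    then have y0: "0 < y" by (simp add: y_def)
    have dd: "damping_deriv r b w = (p * y powr (p - 2) * (b \<bullet> w)) *\<^sub>R b + y powr p *\<^sub>R w"
      using False r by (simp add: damping_deriv_def p_def y_def)
    have "damping r a - damping r b - damping_deriv r b w = (x powr p - y powr p) *\<^sub>R w + (x powr p - y powr p - p * y powr (p - 2) * (b \<bullet> w)) *\<^sub>R b"
    proof -
      have "a = b + w" by (simp add: w_def)
      then have "damping r a = x powr p *\<^sub>R b + x powr p *\<^sub>R w" by (metis damping_def scaleR_add_right x_def p_def)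
      then show ?thesis unfolding dd by (simp add: damping_def y_def p_def algebra_simps)
    qed
    then have "norm (damping r a - damping r b - damping_deriv r b w)
      \<le> \<bar>x powr p - y powr p\<bar> * norm w + \<bar>x powr p - y powr p - p * y powr (p - 2) * (b \<bullet> w)\<bar> * y"
      using norm_triangle_ineq[of "(x powr p - y powr p) *\<^sub>R w" "(x powr p - y powr p - p * y powr (p - 2) * (b \<bullet> w)) *\<^sub>R b"]
      by (simp add: y_def)
    moreover have "\<bar>x powr p - y powr p\<bar> * norm w \<le> p * Q * (norm w)^2"
    proof -
      have "\<bar>x powr p - y powr p\<bar> \<le> p * Q * \<bar>x - y\<bar>" unfolding Q_def by (rule powr_diff_bound[OF p x y])
      also have "... \<le> p * Q * norm w" using xw p Q0 by (intro mult_left_mono) auto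
      finally have "\<bar>x powr p - y powr p\<bar> * norm w \<le> (p * Q * norm w) * norm w" by (rule mult_right_mono) simp
      then show ?thesis by (simp add: power2_eq_square mult_ac)
    qed
    moreover have "\<bar>x powr p - y powr p - p * y powr (p - 2) * (b \<bullet> w)\<bar> * y \<le> (p^2 + 2 * p) * Q * (norm w)^2"
    proof -
      let ?q = "y powr (p - 1)"
      have q: "0 \<le> ?q" "?q \<le> Q" unfolding Q_def using y p by (auto intro!: powr_mono2)
      have yq: "y powr (p - 2) * y = ?q" using y0 powr_add[of y "p - 2" 1] by simp
      have bw: "b \<bullet> w = y * (x - y) + (x - y)^2 / 2 - (norm w)^2 / 2"
      proof -
        have "x^2 = y^2 + 2 * (b \<bullet> w) + (norm w)^2"
          unfolding x_def y_def w_def power2_norm_eq_inner by (simp add: inner_diff_left inner_diff_right inner_commute)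
        moreover have "y * (x - y) + (x - y)^2 / 2 = (x^2 - y^2) / 2" by (simp add: power2_eq_square field_simps)
        ultimately show ?thesis by argo
      qed
      define A where "A = y * (x powr p - y powr p) - p * ?q * (y * (x - y))"
      have "(x powr p - y powr p - p * y powr (p - 2) * (b \<bullet> w)) * y = y * (x powr p - y powr p) - p * (y powr (p - 2) * y) * (b \<bullet> w)"
        by (simp add: algebra_simps)
      also have "... = A - p * ?q * ((x - y)^2 / 2) + p * ?q * ((norm w)^2 / 2)" unfolding yq bw A_def by (simp add: algebra_simps)
      finally have e: "(x powr p - y powr p - p * y powr (p - 2) * (b \<bullet> w)) * y = A - p * ?q * ((x - y)^2 / 2) + p * ?q * ((norm w)^2 / 2)" .
      have A: "\<bar>A\<bar> \<le> p * (p + 1) * Q * (norm w)^2"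
      proof (cases "x = y")
        case True
        then show ?thesis using p Q0 by (simp add: A_def)
      next
        case False
        from powr_MVT[OF p x y False] obtain z where z: "0 < z" "z \<le> M" "\<bar>z - y\<bar> \<le> \<bar>x - y\<bar>"
          "x powr p - y powr p = p * z powr (p - 1) * (x - y)" by blast
        let ?zq = "z powr (p - 1)"
        have zq: "0 \<le> ?zq" "?zq \<le> Q" unfolding Q_def using z p by (auto intro!: powr_mono2)
        have "A = p * (y * ?zq - y * ?q) * (x - y)" unfolding A_def z(4) by (simp add: algebra_simps)
        moreover have "y * ?zq - y * ?q = (z powr p - y powr p) - ?zq * (z - y)" using z(1) y by (simp add: pw1 algebra_simps)
        ultimately have "\<bar>A\<bar> = p * \<bar>(z powr p - y powr p) - ?zq * (z - y)\<bar> * \<bar>x - y\<bar>" using p by (simp add: abs_mult)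
        also have "... \<le> p * ((p + 1) * Q * \<bar>x - y\<bar>) * \<bar>x - y\<bar>"
        proof (intro mult_right_mono mult_left_mono)
          have "\<bar>(z powr p - y powr p) - ?zq * (z - y)\<bar> \<le> \<bar>z powr p - y powr p\<bar> + ?zq * \<bar>z - y\<bar>"
            using abs_triangle_ineq4[of "z powr p - y powr p" "?zq * (z - y)"] zq by (simp add: abs_mult)
          also have "... \<le> p * Q * \<bar>z - y\<bar> + Q * \<bar>z - y\<bar>"
          proof (rule add_mono)
            show "\<bar>z powr p - y powr p\<bar> \<le> p * Q * \<bar>z - y\<bar>" unfolding Q_def by (rule powr_diff_bound[OF p _ z(2) y]) (use z in simp)
            show "?zq * \<bar>z - y\<bar> \<le> Q * \<bar>z - y\<bar>" using zq by (intro mult_right_mono) auto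
          qed
          also have "... = (p + 1) * Q * \<bar>z - y\<bar>" by (simp add: algebra_simps)
          also have "... \<le> (p + 1) * Q * \<bar>x - y\<bar>" using z(3) p Q0 by (intro mult_left_mono) auto
          finally show "\<bar>(z powr p - y powr p) - ?zq * (z - y)\<bar> \<le> (p + 1) * Q * \<bar>x - y\<bar>" .
        qed (use p in auto)
        also have "... = p * (p + 1) * Q * (x - y)^2" using power2_abs[of "x - y"] by (simp add: power2_eq_square mult_ac)
        also have "... \<le> p * (p + 1) * Q * (norm w)^2" using xw2 p Q0 by (intro mult_left_mono) auto
        finally show ?thesis .
      qed
      have h1: "0 \<le> p * ?q * ((x - y)^2 / 2)" "p * ?q * ((x - y)^2 / 2) \<le> p * Q * ((norm w)^2 / 2)"
        using p q Q0 xw2 by (auto intro!: mult_mono)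
      have h2: "0 \<le> p * ?q * ((norm w)^2 / 2)" "p * ?q * ((norm w)^2 / 2) \<le> p * Q * ((norm w)^2 / 2)" using p q Q0 by (auto intro!: mult_mono)
      have "\<bar>x powr p - y powr p - p * y powr (p - 2) * (b \<bullet> w)\<bar> * y = \<bar>A - p * ?q * ((x - y)^2 / 2) + p * ?q * ((norm w)^2 / 2)\<bar>"
        unfolding e[symmetric] using y by (simp add: abs_mult)
      also have "... \<le> p * (p + 1) * Q * (norm w)^2 + p * Q * ((norm w)^2 / 2) + p * Q * ((norm w)^2 / 2)" using A h1 h2 by linarith
      also have "... = (p^2 + 2 * p) * Q * (norm w)^2" by (simp add: power2_eq_square algebra_simps)
      finally show ?thesis .
    qed
    ultimately have "norm (damping r a - damping r b - damping_deriv r b w) \<le> p * Q * (norm w)^2 + (p^2 + 2 * p) * Q * (norm w)^2" by linarith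
    also have "... = (p^2 + 3 * p) * Q * (norm w)^2" by (simp add: algebra_simps)
    finally show ?thesis unfolding w_def .
  qed
  then show ?thesis unfolding Q_def r2 by (simp add: p_def w_def)
qed

lemma damping_deriv_symmetric: "damping_deriv r z v \<bullet> w = damping_deriv r z w \<bullet> v"
  by (auto simp: damping_deriv_def inner_add_left inner_commute[of z] inner_commute[of v w])

text \<open>
  The summand 1 accounts for \<open>r = 1\<close> and \<open>z = 0\<close>, where the power 0 to 0 is 0.
\<close>

lemma damping_bounds:
  fixes z w :: "real^3"
  assumes r: "1 \<le> r" and z: "norm z \<le> M"
  shows "norm (damping r z) \<le> M powr (r - 1) * norm z"
    "norm (damping_deriv r z w) \<le> ((r - 1) * M powr (r - 1) + M powr (r - 1) + 1) * norm w"
proof -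
  have Q: "norm z powr (r - 1) \<le> M powr (r - 1)" using r z by (intro powr_mono2) auto
  show "norm (damping r z) \<le> M powr (r - 1) * norm z" using Q by (simp add: damping_def mult_right_mono)
  have Q0: "0 \<le> M powr (r - 1)" by simp
  show "norm (damping_deriv r z w) \<le> ((r - 1) * M powr (r - 1) + M powr (r - 1) + 1) * norm w"
  proof (cases "r = 1")
    case True
    then show ?thesis by (simp add: damping_deriv_def mult_right_mono[of 1 _ "norm w"])
  next
    case False
    show ?thesis
    proof (cases "z = 0")
      case True
      then have "damping_deriv r z w = 0" using False r by (auto simp: damping_deriv_def)
      then show ?thesis using r Q0 by simp
    next
      case z0: False
      have "norm (damping_deriv r z w) \<le> (r - 1) * norm z powr (r - 3) * \<bar>z \<bullet> w\<bar> * norm z + norm z powr (r - 1) * norm w"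
      proof -
        have "damping_deriv r z w = ((r - 1) * norm z powr (r - 3) * (z \<bullet> w)) *\<^sub>R z + (norm z powr (r - 1)) *\<^sub>R w"
          using False z0 by (simp add: damping_deriv_def)
        then show ?thesis
          using norm_triangle_ineq[of "((r - 1) * norm z powr (r - 3) * (z \<bullet> w)) *\<^sub>R z" "(norm z powr (r - 1)) *\<^sub>R w"] r by (simp add: abs_mult)
      qed
      also have "... \<le> (r - 1) * norm z powr (r - 3) * (norm z * norm w) * norm z + norm z powr (r - 1) * norm w"
        using r Cauchy_Schwarz_ineq2[of z w] by (intro add_right_mono mult_right_mono mult_left_mono) auto
      also have "(r - 1) * norm z powr (r - 3) * (norm z * norm w) * norm z = (r - 1) * norm z powr (r - 1) * norm w"
      proof -
        have "norm z powr (r - 3) * norm z * norm z = norm z powr (r - 1)"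
          using z0 powr_add[of "norm z" "r - 3" 1] powr_add[of "norm z" "r - 2" 1] by simp
        then show ?thesis by (simp add: mult_ac)
      qed
      also have "(r - 1) * norm z powr (r - 1) * norm w + norm z powr (r - 1) * norm w \<le> ((r - 1) * M powr (r - 1) + M powr (r - 1) + 1) * norm w"
        unfolding distrib_right[symmetric] using Q mult_left_mono[OF Q, of "r - 1"] r by (intro mult_right_mono) auto
      finally show ?thesis .
    qed
  qed
qed

lemma measurable_damping[measurable]: "damping r \<in> borel_measurable borel"
  unfolding damping_def[abs_def] by measurable

lemma measurable_damping_deriv:
  assumes [measurable]: "u \<in> borel_measurable borel" "v \<in> borel_measurable borel"
  shows "(%x. damping_deriv r (u x) (v x)) \<in> borel_measurable borel"
  unfolding damping_deriv_def by measurable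

section \<open>Space-time integrability\<close>

text \<open>
  Open or closed interval, Lebesgue or Borel completion: null sets are the same. All statements that hold almost
  everywhere in time are phrased from here on as on the right.
\<close>

lemma AE_time_iff:
  fixes T :: real
  shows "(AE t\<in>{0<..<T} in lebesgue. P t) \<longleftrightarrow> (AE t\<in>{0..T} in lborel. P t)"
proof -
  have e: "AE t in lborel. t \<noteq> 0 \<and> t \<noteq> (T::real)"
    using AE_lborel_singleton[of "0::real"] AE_lborel_singleton[of T] by eventually_elim simp
  show ?thesis unfolding AE_completion_iff
  proof
    assume "AE t in lborel. t \<in> {0<..<T} \<longrightarrow> P t"
    then show "AE t in lborel. t \<in> {0..T} \<longrightarrow> P t" using e by eventually_elim auto
  next
    assume "AE t in lborel. t \<in> {0..T} \<longrightarrow> P t"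
    then show "AE t in lborel. t \<in> {0<..<T} \<longrightarrow> P t" by eventually_elim auto
  qed
qed

text \<open>
  Joint measurability is known on \<open>[0,T]\<close> only, so that fields are extended by 0 in time.
\<close>

definition tcut :: "real => tfield => tfield" where
  "tcut T f t x = indicator {0..T} t *\<^sub>R f t x"

lemma measurable_cut:
  assumes "jointly_measurable T f"
  shows "(%(t, x). tcut T f t x) \<in> borel_measurable lborel2"
proof -
  have "(%(t, x). tcut T f t x) = (%z. indicator ({0..T} \<times> UNIV) z *\<^sub>R (case z of (t, x) => f t x))"
    by (auto simp: fun_eq_iff tcut_def indicator_def)
  then show ?thesis using assms by (simp add: jointly_measurable_def set_borel_measurable_def lborel_prod)
qed

lemma measurable_cut2[measurable_dest]:
  assumes "jointly_measurable T f"
  shows "(%z. tcut T f (fst z) (snd z)) \<in> borel_measurable lborel2"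
  using measurable_cut[OF assms] by (simp add: case_prod_unfold)

lemma measurable_cut_section:
  assumes "jointly_measurable T f"
  shows "(%x. tcut T f t x) \<in> borel_measurable borel" "(%t. tcut T f t x) \<in> borel_measurable borel"
  using measurable_compose_Pair1[OF _ measurable_cut2[OF assms], of t] measurable_compose_Pair1[OF _ measurable_cut2[OF assms]]
    measurable_compose[OF measurable_Pair2' measurable_cut2[OF assms]] by auto

text \<open>
  Square integrability over the space-time cylinder.
\<close>

definition st_sq :: "real => real => tfield => bool" where
  "st_sq L T f \<longleftrightarrow> jointly_measurable T f \<and>
     integrable lborel2 (%z. (norm (indicator (cell L) (snd z) *\<^sub>R tcut T f (fst z) (snd z)))^2)"

lemma st_sqI:
  assumes jm: "jointly_measurable T f" and sq: "AE t\<in>{0..T} in lborel. loc_sq (f t)"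
    and le: "AE t\<in>{0..T} in lborel. ip L (f t) (f t) \<le> h t" and h: "set_integrable lebesgue {0..T} h"
  shows "st_sq L T f"
  unfolding st_sq_def
proof (intro conjI jm integrableI_bounded)
  note [measurable] = measurable_cut2[OF jm]
  show "(%z. (norm (indicator (cell L) (snd z) *\<^sub>R tcut T f (fst z) (snd z)))^2) \<in> borel_measurable lborel2" by measurable
  have "(\<integral>\<^sup>+ z. ennreal (norm ((norm (indicator (cell L) (snd z) *\<^sub>R tcut T f (fst z) (snd z)))^2)) \<partial>lborel2)
    = (\<integral>\<^sup>+ t. \<integral>\<^sup>+ x. ennreal ((norm (indicator (cell L) x *\<^sub>R tcut T f t x))^2) \<partial>lborel \<partial>lborel)"
    by (subst lborel.nn_integral_fst[symmetric]) auto
  also have "... \<le> (\<integral>\<^sup>+ t. ennreal (norm (indicator {0..T} t *\<^sub>R h t)) \<partial>lborel)"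
  proof (rule nn_integral_mono_AE)
    show "AE t in lborel. (\<integral>\<^sup>+ x. ennreal ((norm (indicator (cell L) x *\<^sub>R tcut T f t x))^2) \<partial>lborel) \<le> ennreal (norm (indicator {0..T} t *\<^sub>R h t))"
      using sq le
    proof eventually_elim
      case (elim t)
      show ?case
      proof (cases "t \<in> {0..T}")
        case True
        then have l: "loc_sq (f t)" using elim by simp
        have "(\<integral>\<^sup>+ x. ennreal ((norm (indicator (cell L) x *\<^sub>R tcut T f t x))^2) \<partial>lborel) = ennreal (ip L (f t) (f t))"
        proof -
          have "(\<integral>\<^sup>+ x. ennreal ((norm (indicator (cell L) x *\<^sub>R tcut T f t x))^2) \<partial>lborel) = (\<integral>\<^sup>+ x. ennreal ((norm (indicator (cell L) x *\<^sub>R f t x))^2) \<partial>lborel)"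
            using True by (simp add: tcut_def)
          also have "... = ennreal (LINT x|lborel. (norm (indicator (cell L) x *\<^sub>R f t x))^2)"
            by (rule nn_integral_eq_integral[OF loc_sq_indicator(2)[OF l]]) simp
          finally show ?thesis unfolding ip_indicator power2_norm_eq_inner .
        qed
        also have "... \<le> ennreal (norm (indicator {0..T} t *\<^sub>R h t))" using elim True by (intro ennreal_leI) auto
        finally show ?thesis .
      next
        case False
        then show ?thesis by (simp add: tcut_def)
      qed
    qed
  qed
  also have "... < \<infinity>" using h unfolding set_integrable_def integrable_iff_bounded nn_integral_completion by simp
  finally show "(\<integral>\<^sup>+ z. ennreal (norm ((norm (indicator (cell L) (snd z) *\<^sub>R tcut T f (fst z) (snd z)))^2)) \<partial>lborel2) < \<infinity>" .
qed

text \<open>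
  The link between integrals in time of spatial inner products and integrals over the cylinder.
\<close>

lemma st_sq_ip:
  assumes f: "st_sq L T f" and g: "st_sq L T g"
  shows "integrable lborel2 (%z. indicator (cell L) (snd z) * (tcut T f (fst z) (snd z) \<bullet> tcut T g (fst z) (snd z)))"
    "integrable lborel (%t. indicator {0..T} t * ip L (f t) (g t))"
    "(LINT t|lborel. indicator {0..T} t * ip L (f t) (g t)) = (LINT z|lborel2. indicator (cell L) (snd z) * (tcut T f (fst z) (snd z) \<bullet> tcut T g (fst z) (snd z)))"
proof -
  note jm = f[unfolded st_sq_def, THEN conjunct1] g[unfolded st_sq_def, THEN conjunct1]
  note [measurable] = measurable_cut2[OF jm(1)] measurable_cut2[OF jm(2)]
  let ?F = "%z. indicator (cell L) (snd z) * (tcut T f (fst z) (snd z) \<bullet> tcut T g (fst z) (snd z))"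
  have "integrable lborel2 (%z. (indicator (cell L) (snd z) *\<^sub>R tcut T f (fst z) (snd z)) \<bullet> (indicator (cell L) (snd z) *\<^sub>R tcut T g (fst z) (snd z)))"
    by (rule integrable_inner_sq(1)) (use f g in \<open>auto simp: st_sq_def\<close>)
  also have "(%z. (indicator (cell L) (snd z) *\<^sub>R tcut T f (fst z) (snd z)) \<bullet> (indicator (cell L) (snd z) *\<^sub>R tcut T g (fst z) (snd z))) = ?F"
    by (auto simp: fun_eq_iff indicator_def)
  finally show I: "integrable lborel2 ?F" .
  have eq: "(LINT x|lborel. ?F (t, x)) = indicator {0..T} t * ip L (f t) (g t)" for t
    by (cases "t \<in> {0..T}") (auto simp: tcut_def ip_def set_lebesgue_integral_def)
  show "integrable lborel (%t. indicator {0..T} t * ip L (f t) (g t))" using lborel_pair.integrable_fst'[OF I] unfolding eq .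
  show "(LINT t|lborel. indicator {0..T} t * ip L (f t) (g t)) = (LINT z|lborel2. ?F z)" using lborel_pair.integral_fst'[OF I] unfolding eq .
qed

lemma jointly_measurable_const: "v \<in> borel_measurable borel ==> jointly_measurable T (%t. v)"
proof -
  assume [measurable]: "v \<in> borel_measurable borel"
  have "(%z. indicator ({0..T} \<times> UNIV) z *\<^sub>R (case z of (t, x) => v x)) = (%z. indicator {0..T} (fst z) *\<^sub>R v (snd z))"
    by (auto simp: fun_eq_iff indicator_def)
  moreover have "(%z. indicator {0..T} (fst z) *\<^sub>R v (snd z)) \<in> borel_measurable lborel2" by measurable
  ultimately show ?thesis by (simp add: jointly_measurable_def set_borel_measurable_def lborel_prod)
qed

lemma jointly_measurable_diff:
  "jointly_measurable T u ==> jointly_measurable T v ==> jointly_measurable T (%t x. u t x - v t x)"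
proof -
  assume *: "jointly_measurable T u" "jointly_measurable T v"
  have "(%z. indicator ({0..T} \<times> UNIV) z *\<^sub>R (case z of (t, x) => u t x - v t x))
    = (%z. indicator ({0..T} \<times> UNIV) z *\<^sub>R (case z of (t, x) => u t x) - indicator ({0..T} \<times> UNIV) z *\<^sub>R (case z of (t, x) => v t x))"
    by (auto simp: fun_eq_iff indicator_def)
  then show ?thesis using * unfolding jointly_measurable_def set_borel_measurable_def by (simp add: borel_measurable_diff)
qed

lemma st_sq_const:
  assumes v: "loc_sq v" shows "st_sq L T (%t. v)"
proof (rule st_sqI[where h="%t. ip L v v"])
  show "jointly_measurable T (%t. v)" by (rule jointly_measurable_const[OF loc_sqD(1)[OF v]])
  have "integrable lborel (%t. indicator {0..T} t * ip L v v)"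
    by (intro integrable_mult_left integrable_real_indicator) (auto simp: emeasure_lborel_Icc_eq)
  then show "set_integrable lebesgue {0..T} (%t. ip L v v)" by (simp add: set_integrable_def integrable_completion)
qed (use v in auto)

lemma st_sq_diff:
  assumes f: "st_sq L T f" and g: "st_sq L T g" shows "st_sq L T (%t x. f t x - g t x)"
  unfolding st_sq_def
proof (intro conjI)
  note jm = f[unfolded st_sq_def, THEN conjunct1] g[unfolded st_sq_def, THEN conjunct1]
  show jd: "jointly_measurable T (%t x. f t x - g t x)" by (rule jointly_measurable_diff[OF jm])
  note [measurable] = measurable_cut2[OF jm(1)] measurable_cut2[OF jm(2)] measurable_cut2[OF jd]
  show "integrable lborel2 (%z. (norm (indicator (cell L) (snd z) *\<^sub>R tcut T (%t x. f t x - g t x) (fst z) (snd z)))^2)"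
  proof (rule integrable_dominated)
    show "integrable lborel2 (%z. 2 * (norm (indicator (cell L) (snd z) *\<^sub>R tcut T f (fst z) (snd z)))^2 + 2 * (norm (indicator (cell L) (snd z) *\<^sub>R tcut T g (fst z) (snd z)))^2)"
      using f g by (intro Bochner_Integration.integrable_add integrable_mult_right) (auto simp: st_sq_def)
    show "AE z in lborel2. norm ((norm (indicator (cell L) (snd z) *\<^sub>R tcut T (%t x. f t x - g t x) (fst z) (snd z)))^2)
      \<le> norm (2 * (norm (indicator (cell L) (snd z) *\<^sub>R tcut T f (fst z) (snd z)))^2 + 2 * (norm (indicator (cell L) (snd z) *\<^sub>R tcut T g (fst z) (snd z)))^2)"
      using norm_diff_sq_le by (intro AE_I2) (auto simp: tcut_def indicator_def)
  qed measurable
qed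

text \<open>
  A compact set of space meets finitely many cells, at almost every time with the same multiplicity.
\<close>

lemma st_sq_local:
  assumes L: "0 < L" and f: "st_sq L T f" and per: "AE t\<in>{0..T} in lborel. AE_periodic L (f t)" and K: "compact K"
  shows "integrable lborel2 (%z. (norm (indicator K (snd z) *\<^sub>R tcut T f (fst z) (snd z)))^2)"
    "integrable lborel2 (%z. indicator K (snd z) *\<^sub>R tcut T f (fst z) (snd z))"
proof -
  note jm = f[unfolded st_sq_def, THEN conjunct1]
  note [measurable] = measurable_cut2[OF jm] measurable_cut_section(1)[OF jm]
  have [measurable]: "K \<in> sets borel" using K by (simp add: borel_compact)
  obtain N :: nat where N: "\<And>h. h \<in> borel_measurable borel ==> AE_periodic L h ==>
    (\<integral>\<^sup>+x\<in>K. h x \<partial>lborel) \<le> of_nat N * (\<integral>\<^sup>+x\<in>cell L. h x \<partial>lborel)"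
    using nn_integral_periodic_compact[OF L K] by blast
  have sqi: "ennreal ((norm (indicator A x *\<^sub>R y))^2) = ennreal ((norm y)^2) * indicator A x" for A and x y :: "real^3"
    by (auto simp: indicator_def)
  show I: "integrable lborel2 (%z. (norm (indicator K (snd z) *\<^sub>R tcut T f (fst z) (snd z)))^2)"
  proof (rule integrableI_bounded)
    have "(\<integral>\<^sup>+ z. ennreal (norm ((norm (indicator K (snd z) *\<^sub>R tcut T f (fst z) (snd z)))^2)) \<partial>lborel2)
      = (\<integral>\<^sup>+ t. (\<integral>\<^sup>+ x\<in>K. ennreal ((norm (tcut T f t x))^2) \<partial>lborel) \<partial>lborel)"
      by (subst lborel.nn_integral_fst[symmetric]) (auto simp: sqi[symmetric] simp del: norm_scaleR)
    also have "... \<le> (\<integral>\<^sup>+ t. of_nat N * (\<integral>\<^sup>+ x\<in>cell L. ennreal ((norm (tcut T f t x))^2) \<partial>lborel) \<partial>lborel)"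
    proof (rule nn_integral_mono_AE)
      show "AE t in lborel. (\<integral>\<^sup>+ x\<in>K. ennreal ((norm (tcut T f t x))^2) \<partial>lborel) \<le> of_nat N * (\<integral>\<^sup>+ x\<in>cell L. ennreal ((norm (tcut T f t x))^2) \<partial>lborel)"
        using per
      proof eventually_elim
        case (elim t)
        have "AE_periodic L (%x. ennreal ((norm (tcut T f t x))^2))"
        proof (cases "t \<in> {0..T}")
          case True
          then have "AE_periodic L (f t)" using elim by simp
          from AE_periodic_comp[OF this, of "%y. ennreal ((norm (indicator {0..T} t *\<^sub>R y))^2)"] show ?thesis by (simp add: tcut_def)
        qed (simp add: tcut_def AE_periodic_def AE_periods_def)
        then show ?case by (intro N) measurable
      qed
    qed
    also have "... = of_nat N * (\<integral>\<^sup>+ t. (\<integral>\<^sup>+ x\<in>cell L. ennreal ((norm (tcut T f t x))^2) \<partial>lborel) \<partial>lborel)"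
      by (rule nn_integral_cmult) measurable
    also have "(\<integral>\<^sup>+ t. (\<integral>\<^sup>+ x\<in>cell L. ennreal ((norm (tcut T f t x))^2) \<partial>lborel) \<partial>lborel)
      = (\<integral>\<^sup>+ z. ennreal (norm ((norm (indicator (cell L) (snd z) *\<^sub>R tcut T f (fst z) (snd z)))^2)) \<partial>lborel2)"
      by (subst lborel.nn_integral_fst[symmetric]) (auto simp: sqi[symmetric] simp del: norm_scaleR)
    also have "of_nat N * ... < \<infinity>" using f unfolding st_sq_def integrable_iff_bounded by (auto simp: ennreal_mult_less_top of_nat_less_top)
    finally show "(\<integral>\<^sup>+ z. ennreal (norm ((norm (indicator K (snd z) *\<^sub>R tcut T f (fst z) (snd z)))^2)) \<partial>lborel2) < \<infinity>" .
  qed measurable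
  have i1: "integrable lborel2 (%z. indicator {0..T} (fst z) * indicator K (snd z) :: real)"
  proof -
    have "integrable lborel (indicator {0..T} :: real => real)" "integrable lborel (indicator K :: real^3 => real)"
      using compact_finite_lborel[OF K] by (auto intro!: integrable_real_indicator simp: emeasure_lborel_Icc_eq)
    from integrable_pair_mult[OF this] show ?thesis by (simp add: case_prod_unfold)
  qed
  show "integrable lborel2 (%z. indicator K (snd z) *\<^sub>R tcut T f (fst z) (snd z))"
  proof (rule integrable_dominated[OF Bochner_Integration.integrable_add[OF i1 I]])
    have y: "norm y \<le> 1 + (norm y)^2" for y :: "real^3" using sum_squares_bound[of "norm y" 1] norm_ge_zero[of y] unfolding power_one by linarith
    show "AE z in lborel2. norm (indicator K (snd z) *\<^sub>R tcut T f (fst z) (snd z))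
      \<le> norm (indicator {0..T} (fst z) * indicator K (snd z) + (norm (indicator K (snd z) *\<^sub>R tcut T f (fst z) (snd z)))^2)"
      using y by (intro AE_I2) (auto simp: tcut_def indicator_def)
  qed measurable
qed

text \<open>
  The weighted time integral \<open>\<integral> c(t) f(t, x) dt\<close> as a field in \<open>x\<close>; it turns statements about the time derivative
  into statements about fields.
\<close>

definition ti :: "real => (real => real) => tfield => field" where
  "ti T c f x = (LINT t:{0..T}|lborel. c t *\<^sub>R f t x)"

lemma ti_cut: "ti T c f x = (LINT t|lborel. c t *\<^sub>R tcut T f t x)"
  unfolding ti_def set_lebesgue_integral_def tcut_def by (simp add: mult.commute)

text \<open>
  The time integral is defined pointwise in \<open>x\<close>, and only for almost every \<open>x\<close> is the integrand integrable in time.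
\<close>

lemma ti_Fubini:
  assumes jm: "jointly_measurable T f" and a[measurable]: "a \<in> borel_measurable borel" and c[measurable]: "c \<in> borel_measurable borel"
    and B: "\<And>t. \<bar>c t\<bar> \<le> B" and H: "integrable lborel2 (%z. norm (a (snd z)) *\<^sub>R tcut T f (fst z) (snd z))"
  shows "integrable lborel (%x. a x \<bullet> ti T c f x)"
    "(LINT x|lborel. a x \<bullet> ti T c f x) = (LINT t|lborel. indicator {0..T} t * (c t * (LINT x|lborel. a x \<bullet> f t x)))"
proof -
  note [measurable] = measurable_cut2[OF jm] measurable_cut_section[OF jm]
  have B0: "0 \<le> B" using B[of 0] by linarith
  have G: "integrable lborel2 (%(t, x). c t * (a x \<bullet> tcut T f t x))"
  proof (rule integrable_dominated)
    show "integrable lborel2 (%z. B * norm (norm (a (snd z)) *\<^sub>R tcut T f (fst z) (snd z)))"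
      using H by (intro integrable_mult_right integrable_norm)
    show "AE z in lborel2. norm (case z of (t, x) => c t * (a x \<bullet> tcut T f t x)) \<le> norm (B * norm (norm (a (snd z)) *\<^sub>R tcut T f (fst z) (snd z)))"
    proof (rule AE_I2, clarify)
      fix t x
      have "norm (c t * (a x \<bullet> tcut T f t x)) \<le> B * (norm (a x) * norm (tcut T f t x))"
        unfolding real_norm_def abs_mult by (intro mult_mono B Cauchy_Schwarz_ineq2 B0) auto
      then show "norm (c t * (a x \<bullet> tcut T f t x)) \<le> norm (B * norm (norm (a (snd (t, x))) *\<^sub>R tcut T f (fst (t, x)) (snd (t, x))))"
        using B0 by simp
    qed
    show "(%(t, x). c t * (a x \<bullet> tcut T f t x)) \<in> borel_measurable lborel2" unfolding case_prod_unfold by measurable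
  qed
  have AEx: "AE x in lborel. (LINT t|lborel. c t * (a x \<bullet> tcut T f t x)) = a x \<bullet> ti T c f x"
  proof -
    have "AE x in lborel. integrable lborel (%t. norm (a x) *\<^sub>R tcut T f t x)"
      using lborel_pair.AE_integrable_snd[of "%t x. norm (a x) *\<^sub>R tcut T f t x"] H by (simp add: case_prod_unfold)
    then show ?thesis
    proof eventually_elim
      case (elim x)
      show ?case
      proof (cases "a x = 0")
        case False
        then have i: "integrable lborel (%t. tcut T f t x)" using integrable_scaleR_right[OF elim, of "1 / norm (a x)"] by simp
        have "integrable lborel (%t. c t *\<^sub>R tcut T f t x)"
        proof (rule integrable_dominated)
          show "integrable lborel (%t. B * norm (tcut T f t x))" using i by (intro integrable_mult_right integrable_norm)
          show "AE t in lborel. norm (c t *\<^sub>R tcut T f t x) \<le> norm (B * norm (tcut T f t x))"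
            using B B0 by (intro AE_I2) (simp add: mult_right_mono)
        qed measurable
        from integral_inner_right[OF this, of "a x"] show ?thesis unfolding ti_cut by simp
      qed simp
    qed
  qed
  have m1: "(%x. LINT t|lborel. c t * (a x \<bullet> tcut T f t x)) \<in> borel_measurable lborel" using lborel_pair.integrable_snd[OF G] by auto
  have m2: "(%x. a x \<bullet> ti T c f x) \<in> borel_measurable lborel"
  proof -
    have "(%p. c (snd p) *\<^sub>R tcut T f (snd p) (fst p)) \<in> borel_measurable lborel2"
    proof -
      have "(%p::(real^3) \<times> real. tcut T f (snd p) (fst p)) \<in> borel_measurable lborel2"
        using measurable_compose[OF measurable_pair_swap' measurable_cut[OF jm]] by (simp add: case_prod_unfold)
      then show ?thesis by measurable
    qed
    then have "(%x. ti T c f x) \<in> borel_measurable borel" unfolding ti_cut by (intro lborel.borel_measurable_lebesgue_integral) (simp add: case_prod_unfold)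
    then show ?thesis by measurable
  qed
  show "integrable lborel (%x. a x \<bullet> ti T c f x)"
    by (rule integrable_cong_AE_imp[OF lborel_pair.integrable_snd[OF G] m2]) (use AE_symmetric[OF AEx] AEx in auto)
  have "(LINT x|lborel. a x \<bullet> ti T c f x) = (LINT x|lborel. (LINT t|lborel. c t * (a x \<bullet> tcut T f t x)))"
    by (rule integral_cong_AE[OF m2 m1 AE_symmetric[OF AEx]])
  also have "... = (LINT t|lborel. (LINT x|lborel. c t * (a x \<bullet> tcut T f t x)))" by (rule lborel_pair.Fubini_integral[OF G])
  also have "... = (LINT t|lborel. indicator {0..T} t * (c t * (LINT x|lborel. a x \<bullet> f t x)))" by (simp add: tcut_def mult_ac)
  finally show "(LINT x|lborel. a x \<bullet> ti T c f x) = (LINT t|lborel. indicator {0..T} t * (c t * (LINT x|lborel. a x \<bullet> f t x)))" .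
qed

lemma measurable_ti:
  assumes jm: "jointly_measurable T f" and c[measurable]: "c \<in> borel_measurable borel"
  shows "ti T c f \<in> borel_measurable borel"
proof -
  have "(%p::(real^3) \<times> real. tcut T f (snd p) (fst p)) \<in> borel_measurable lborel2"
    using measurable_compose[OF measurable_pair_swap' measurable_cut[OF jm]] by (simp add: case_prod_unfold)
  then have "(%p. c (snd p) *\<^sub>R tcut T f (snd p) (fst p)) \<in> borel_measurable lborel2" by measurable
  then have "(%x. ti T c f x) \<in> borel_measurable borel" unfolding ti_cut by (intro lborel.borel_measurable_lebesgue_integral) (simp add: case_prod_unfold)
  then show ?thesis .
qed

section \<open>Fundamental theorem of calculus for weak time derivatives\<close>

lemma lebesgue_integral_AE_eq:
  fixes f g :: "real => real"
  assumes f: "integrable lborel f" and eq: "AE t in lborel. f t = g t"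
  shows "integrable lebesgue g" "integral\<^sup>L lebesgue g = integral\<^sup>L lborel f"
proof -
  have fm: "f \<in> borel_measurable lborel" using f by auto
  have eq': "AE t in lebesgue. f t = g t" using eq by (simp add: AE_completion_iff)
  have f': "integrable lebesgue f" using f fm by (simp add: integrable_completion)
  have gm: "g \<in> borel_measurable lebesgue" by (rule borel_measurable_AE[OF _ eq']) (use f' in auto)
  show "integrable lebesgue g" by (rule integrable_cong_AE_imp[OF f' gm eq'])
  have "integral\<^sup>L lebesgue g = integral\<^sup>L lebesgue f" by (rule integral_cong_AE) (use gm f' AE_symmetric[OF eq'] in auto)
  then show "integral\<^sup>L lebesgue g = integral\<^sup>L lborel f" using fm by (simp add: integral_completion)
qed

lemma deriv_eq_grad:
  fixes psi :: "real => real"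
  assumes "test_function S psi" shows "deriv psi = grad psi"
proof
  fix t
  have "(psi has_real_derivative grad psi t) (at t)"
    by (rule has_derivative_imp_has_field_derivative[OF has_derivative_grad[OF test_functionD(2)[OF assms]]]) simp
  then show "deriv psi t = grad psi t" by (rule DERIV_imp_deriv)
qed

text \<open>
  Test functions that increase from 0 to 1 right after \<open>a\<close> and decrease right before \<open>b\<close> converge to the indicator
  of the interval, whereas their derivatives concentrate unit mass at \<open>a\<close> and at \<open>b\<close>, where the continuous \<open>g\<close> is
  evaluated. The shifts 1 and 2 in their definition keep the support inside \<open>(0,T)\<close> even if \<open>a = 0\<close> or \<open>b = T\<close>.
\<close>

lemma weak_derivative_FTC:
  fixes g h :: "real => real"
  assumes T: "0 < T" and g: "continuous_on {0..T} g" and h: "set_integrable lebesgue {0..T} h"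
    and weak: "\<And>psi. test_function {0<..<T} psi ==>
      (LINT t:{0..T}|lebesgue. deriv psi t * g t) = - (LINT t:{0..T}|lebesgue. psi t * h t)"
    and ab: "0 \<le> a" "a < b" "b \<le> T"
  shows "g b - g a = (LINT t:{a<..b}|lebesgue. h t)"
proof -
  \<comment> \<open>large enough that the second step has not begun at a + 1 / n, and the first is complete at b - 1 / n\<close>
  obtain N :: nat where N: "3 / (b - a) < real N" using reals_Archimedean2 by blast
  define n where "n k = real (N + k)" for k
  have Nn: "3 < n k * (b - a)" for k
  proof -
    have "3 / (b - a) < n k" using N by (simp add: n_def)
    then show ?thesis using ab by (simp add: field_simps)
  qed
  have n0: "0 < n k" for k
  proof -
    have "0 < 3 / (b - a)" using ab by simp
    then have "0 < real N" using N by linarith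
    then show ?thesis by (simp add: n_def)
  qed
  let ?eta = "mollifier 1 :: real => real"
  define psi where "psi k t = smooth_step (n k * (t - a) - 1) - smooth_step (n k * (t - b) + 2)" for k t
  have z1: "psi k t = 0" if "t \<le> a + 1 / n k" for k t
  proof -
    have "n k * (t - a) \<le> 1" using that n0[of k] by (simp add: field_simps)
    moreover have "n k * (t - b) \<le> - 2"
    proof -
      have "n k * (t - b) = n k * (t - a) - n k * (b - a)" by (simp add: algebra_simps)
      then show ?thesis using calculation Nn[of k] by linarith
    qed
    ultimately show ?thesis by (simp add: psi_def smooth_step)
  qed
  have z2: "psi k t = 0" if "b - 1 / n k \<le> t" for k t
  proof -
    have "- 1 \<le> n k * (t - b)" using that n0[of k] by (simp add: field_simps)
    moreover have "2 \<le> n k * (t - a)"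
    proof -
      have "n k * (t - a) = n k * (t - b) + n k * (b - a)" by (simp add: algebra_simps)
      then show ?thesis using calculation Nn[of k] by linarith
    qed
    ultimately show ?thesis by (simp add: psi_def smooth_step)
  qed
  have t: "test_function {0<..<T} (psi k)" for k
  proof (rule test_functionI)
    have "psi k = (%t. smooth_step (n k *\<^sub>R t + (- n k * a - 1)) - smooth_step (n k *\<^sub>R t + (- n k * b + 2)))"
      by (simp add: psi_def fun_eq_iff algebra_simps)
    then show "Ck j (psi k)" for j by (simp only:) (intro Ck_diff Ck_affine Ck_smooth_step)
    show "psi k t = 0" if "t \<notin> {a + 1 / n k..b - 1 / n k}" for t using that z1[of t k] z2[of k t] by force
    have p: "0 < 1 / n k" using n0[of k] by simp
    show "{a + 1 / n k..b - 1 / n k} \<subseteq> {0<..<T}"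
    proof
      fix x assume "x \<in> {a + 1 / n k..b - 1 / n k}"
      then have "a + 1 / n k \<le> x" "x \<le> b - 1 / n k" by auto
      then have "0 < x" "x < T" using ab p by linarith+
      then show "x \<in> {0<..<T}" by simp
    qed
  qed simp
  have d: "deriv (psi k) t = n k * ?eta (n k * (t - a) - 1) - n k * ?eta (n k * (t - b) + 2)" for k t
  proof (rule DERIV_imp_deriv)
    have 1: "((%t. smooth_step (n k * (t - a) - 1)) has_real_derivative ?eta (n k * (t - a) - 1) * n k) (at t)"
      by (rule DERIV_chain2[OF smooth_step(1)]) (auto intro!: derivative_eq_intros)
    have 2: "((%t. smooth_step (n k * (t - b) + 2)) has_real_derivative ?eta (n k * (t - b) + 2) * n k) (at t)"
      by (rule DERIV_chain2[OF smooth_step(1)]) (auto intro!: derivative_eq_intros)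
    show "(psi k has_real_derivative n k * ?eta (n k * (t - a) - 1) - n k * ?eta (n k * (t - b) + 2)) (at t)"
      using DERIV_diff[OF 1 2] by (simp add: psi_def[abs_def] mult.commute)
  qed
  \<comment> \<open>a bounded continuous extension, since the substitution below leaves the interval\<close>
  define G where "G t = g (max 0 (min T t))" for t
  have Gc: "continuous_on UNIV G" unfolding G_def by (rule continuous_on_compose2[OF g]) (use T in \<open>auto intro!: continuous_intros\<close>)
  have Gg: "G t = g t" if "t \<in> {0..T}" for t using that by (simp add: G_def)
  have [measurable]: "G \<in> borel_measurable borel" using Gc by (rule borel_measurable_continuous_onI)
  obtain M where M: "\<And>t. \<bar>G t\<bar> \<le> M"
  proof -
    have "compact (g ` {0..T})" by (intro compact_continuous_image g compact_Icc)
    from compact_imp_bounded[OF this] obtain M where M: "\<forall>y\<in>g ` {0..T}. norm y \<le> M" unfolding bounded_iff by blast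
    show ?thesis
    proof (rule that[of M])
      fix t
      have "max 0 (min T t) \<in> {0..T}" using T by auto
      then have "g (max 0 (min T t)) \<in> g ` {0..T}" by (rule imageI)
      from bspec[OF M this] show "\<bar>G t\<bar> \<le> M" by (simp only: G_def real_norm_def)
    qed
  qed
  have bm: "(%k. LINT s|lborel. ?eta s * G (x + (s + y) / n k)) \<longlonglongrightarrow> G x" for x y
  proof -
    have "(%k. LINT s|lborel. ?eta s * G (x + (s + y) / n k)) \<longlonglongrightarrow> (LINT s|lborel. ?eta s * G x)"
    proof (rule integral_dominated_convergence)
      show "integrable lborel (%s. ?eta s * M)" using integrable_mollifier[of 1, where 'a=real] by auto
      show "AE s in lborel. (%k. ?eta s * G (x + (s + y) / n k)) \<longlonglongrightarrow> ?eta s * G x"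
      proof (rule AE_I2)
        fix s
        have nt: "filterlim n at_top sequentially" by (rule filterlim_at_top_mono[OF filterlim_real_sequentially]) (simp add: n_def)
        have "(%k. (s + y) / n k) \<longlonglongrightarrow> 0" by (rule real_tendsto_divide_at_top[OF tendsto_const nt])
        from tendsto_add[OF tendsto_const this, of x] have "(%k. x + (s + y) / n k) \<longlonglongrightarrow> x" by simp
        then have "(%k. G (x + (s + y) / n k)) \<longlonglongrightarrow> G x"
          using continuous_on_tendsto_compose[OF Gc, of "%k. x + (s + y) / n k" x] by simp
        then show "(%k. ?eta s * G (x + (s + y) / n k)) \<longlonglongrightarrow> ?eta s * G x" by (intro tendsto_mult tendsto_const)
      qed
      show "AE s in lborel. norm (?eta s * G (x + (s + y) / n k)) \<le> ?eta s * M" for k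
        using M mollifier_nonneg[of 1, where 'a=real] by (intro AE_I2) (simp add: abs_mult mult_left_mono)
    qed measurable
    then show ?thesis using integral_mollifier[of 1, where 'a=real] by simp
  qed
  have sub: "(LINT t|lborel. n k * ?eta (n k * (t - x) - y) * G t) = (LINT s|lborel. ?eta s * G (x + (s + y) / n k))"
    "integrable lborel (%t. n k * ?eta (n k * (t - x) - y) * G t)" for k x y
  proof -
    have e: "n k * (x + y / n k + (1 / n k) * s - x) - y = s" for s using n0[of k] by (simp add: field_simps)
    have e2: "x + y / n k + (1 / n k) * s = x + (s + y) / n k" for s using n0[of k] by (simp add: field_simps)
    show "(LINT t|lborel. n k * ?eta (n k * (t - x) - y) * G t) = (LINT s|lborel. ?eta s * G (x + (s + y) / n k))"
      using lborel_integral_real_affine[of "1 / n k" "%t. n k * ?eta (n k * (t - x) - y) * G t" "x + y / n k"] n0[of k]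
      unfolding e e2 by (simp add: mult.assoc)
    have "integrable lborel (%s. ?eta s * G (x + (s + y) / n k))"
    proof (rule integrable_dominated)
      show "integrable lborel (%s. ?eta s * M)" using integrable_mollifier[of 1, where 'a=real] by auto
      show "AE s in lborel. norm (?eta s * G (x + (s + y) / n k)) \<le> norm (?eta s * M)"
        using M mollifier_nonneg[of 1, where 'a=real] by (intro AE_I2) (auto simp: abs_mult intro!: mult_left_mono order_trans[OF M abs_ge_self])
    qed measurable
    then have "integrable lborel (%s. n k * (?eta s * G (x + (s + y) / n k)))" by simp
    then show "integrable lborel (%t. n k * ?eta (n k * (t - x) - y) * G t)"
      using lborel_integrable_real_affine_iff[of "1 / n k" "%t. n k * ?eta (n k * (t - x) - y) * G t" "x + y / n k"] n0[of k]
      unfolding e e2 by (simp add: mult.assoc)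
  qed
  have lhs: "(LINT t:{0..T}|lebesgue. deriv (psi k) t * g t)
    = (LINT s|lborel. ?eta s * G (a + (s + 1) / n k)) - (LINT s|lborel. ?eta s * G (b + (s + (- 2)) / n k))" for k
  proof -
    have "deriv (psi k) t = 0" if "t \<notin> {0..T}" for t
    proof -
      have "grad (psi k) t = 0"
      proof -
        obtain K where "\<And>x. x \<notin> K ==> grad (psi k) x = 0" "K \<subseteq> {0<..<T}" using test_function_bounds[OF t[of k]] by metis
        then show ?thesis using that by force
      qed
      then show ?thesis using deriv_eq_grad[OF t] by simp
    qed
    then have "(LINT t:{0..T}|lebesgue. deriv (psi k) t * g t) = (LINT t|lebesgue. n k * ?eta (n k * (t - a) - 1) * G t - n k * ?eta (n k * (t - b) - (-2)) * G t)"
      unfolding set_lebesgue_integral_def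
    proof (intro Bochner_Integration.integral_cong refl)
      fix t
      have "deriv (psi k) t * G t = n k * ?eta (n k * (t - a) - 1) * G t - n k * ?eta (n k * (t - b) - (-2)) * G t"
        unfolding d by (simp add: algebra_simps)
      then show "indicat_real {0..T} t *\<^sub>R (deriv (psi k) t * g t) = n k * ?eta (n k * (t - a) - 1) * G t - n k * ?eta (n k * (t - b) - (-2)) * G t"
        using \<open>\<And>t. t \<notin> {0..T} ==> deriv (psi k) t = 0\<close>[of t] Gg[of t] by (cases "t \<in> {0..T}") auto
    qed
    also have "... = (LINT t|lborel. n k * ?eta (n k * (t - a) - 1) * G t - n k * ?eta (n k * (t - b) - (-2)) * G t)"
      by (rule integral_completion) measurable
    also have "... = (LINT t|lborel. n k * ?eta (n k * (t - a) - 1) * G t) - (LINT t|lborel. n k * ?eta (n k * (t - b) - (-2)) * G t)"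
      by (rule Bochner_Integration.integral_diff[OF sub(2) sub(2)])
    finally show ?thesis unfolding sub(1) .
  qed
  have l1: "(%k. LINT t:{0..T}|lebesgue. deriv (psi k) t * g t) \<longlonglongrightarrow> G a - G b" unfolding lhs by (intro tendsto_diff bm)
  have psim: "psi k \<in> borel_measurable lebesgue" for k using test_functionD(5)[OF t[of k]] by (auto intro: measurable_completion)
  have l2: "(%k. LINT t:{0..T}|lebesgue. psi k t * h t) \<longlonglongrightarrow> (LINT t:{a<..b}|lebesgue. h t)" unfolding set_lebesgue_integral_def
  proof (rule integral_dominated_convergence)
    have hm: "(%t. indicat_real {0..T} t *\<^sub>R h t) \<in> borel_measurable lebesgue" and hi: "integrable lebesgue (%t. indicat_real {0..T} t *\<^sub>R h t)"
      using h by (auto simp: set_integrable_def)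
    show "integrable lebesgue (%t. norm (indicat_real {0..T} t *\<^sub>R h t))" using hi by (rule integrable_norm)
    have "(%t. indicat_real {a<..b} t * (indicat_real {0..T} t *\<^sub>R h t)) \<in> borel_measurable lebesgue"
      by (intro borel_measurable_times hm borel_measurable_indicator) auto
    moreover have "(%t. indicat_real {a<..b} t * (indicat_real {0..T} t *\<^sub>R h t)) = (%t. indicat_real {a<..b} t *\<^sub>R h t)"
      using ab by (auto simp: fun_eq_iff indicator_def)
    ultimately show "(%t. indicat_real {a<..b} t *\<^sub>R h t) \<in> borel_measurable lebesgue" by simp
    have "(%t. psi k t * (indicat_real {0..T} t *\<^sub>R h t)) \<in> borel_measurable lebesgue" for k by (intro borel_measurable_times hm psim)
    then show "(%t. indicat_real {0..T} t *\<^sub>R (psi k t * h t)) \<in> borel_measurable lebesgue" for k by (simp add: mult_ac)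
    show "AE t in lebesgue. norm (indicat_real {0..T} t *\<^sub>R (psi k t * h t)) \<le> norm (indicat_real {0..T} t *\<^sub>R h t)" for k
    proof (rule AE_I2)
      fix t
      have "\<bar>psi k t\<bar> \<le> 1"
        using smooth_step_bounds[of "n k * (t - a) - 1"] smooth_step_bounds[of "n k * (t - b) + 2"] unfolding psi_def by linarith
      then show "norm (indicat_real {0..T} t *\<^sub>R (psi k t * h t)) \<le> norm (indicat_real {0..T} t *\<^sub>R h t)"
        using mult_right_mono[of "\<bar>psi k t\<bar>" 1 "\<bar>h t\<bar>"] by (auto simp: indicator_def abs_mult)
    qed
    have nb: "AE t in lebesgue. t \<noteq> b" unfolding AE_completion_iff by (rule AE_lborel_singleton)
    show "AE t in lebesgue. (%k. indicat_real {0..T} t *\<^sub>R (psi k t * h t)) \<longlonglongrightarrow> indicat_real {a<..b} t *\<^sub>R h t"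
      using nb
    proof eventually_elim
      case (elim t)
      have "eventually (%k. psi k t = indicat_real {a<..b} t) sequentially"
      proof (cases "a < t \<and> t < b")
        case True
        obtain k0 :: nat where k0: "2 / (t - a) + 2 / (b - t) < real k0" using reals_Archimedean2 by blast
        show ?thesis
        proof (rule eventually_sequentiallyI[of k0])
          fix k assume "k0 \<le> k"
          then have nk: "2 / (t - a) + 2 / (b - t) < n k" using k0 by (simp add: n_def)
          have p: "0 < 2 / (t - a)" "0 < 2 / (b - t)" using True by auto
          then have "2 / (t - a) < n k" "2 / (b - t) < n k" using nk by linarith+
          then have "2 \<le> n k * (t - a)" "n k * (t - b) \<le> - 2" using True by (auto simp: field_simps)
          then show "psi k t = indicat_real {a<..b} t" using True by (simp add: psi_def smooth_step)
        qed
      next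
        case False
        have "psi k t = 0" for k
        proof -
          have "0 < 1 / n k" using n0[of k] by simp
          then show ?thesis using False elim z1[of t k] z2[of k t] by linarith
        qed
        then show ?thesis using False elim by (auto simp: indicator_def)
      qed
      then show ?case
      proof (rule tendsto_eventually[OF eventually_mono])
        fix k assume "psi k t = indicat_real {a<..b} t"
        then show "indicat_real {0..T} t *\<^sub>R (psi k t * h t) = indicat_real {a<..b} t *\<^sub>R h t" using ab by (auto simp: indicator_def)
      qed
    qed
  qed
  have "(%k. - (LINT t:{0..T}|lebesgue. psi k t * h t)) \<longlonglongrightarrow> G a - G b" using l1 unfolding weak[OF t] .
  from LIMSEQ_unique[OF this tendsto_minus[OF l2]] show ?thesis using ab Gg[of a] Gg[of b] by simp
qed

section \<open>Evolutions and the product formula\<close>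

text \<open>
  The bilinear form of the pseudo-parabolic operator \<open>1 - \<mu>\<Delta>\<close> under the time derivative.
\<close>

definition energy :: "real => real => field => field => real" where
  "energy \<mu> L u v = ip L u v + \<mu> * grad_ip L u v"

text \<open>
  Square integrability in time with values in \<open>V\<close>: the derivatives also have jointly measurable versions, which
  makes the integrals of \<^const>\<open>grad_ip\<close> in time meaningful.
\<close>

definition stV :: "real => real => tfield => bool" where
  "stV L T f \<longleftrightarrow> st_sq L T f \<and> (AE t\<in>{0..T} in lborel. f t \<in> V_space L) \<and>
     (\<forall>j. \<exists>G. st_sq L T G \<and> (AE t\<in>{0..T} in lborel. weak_partial j (f t) (G t)))"

lemma stV_gradient:
  assumes "stV L T f"
  obtains G where "\<And>j. st_sq L T (G j)" "AE t\<in>{0..T} in lborel. \<forall>j. weak_partial j (f t) (G j t)"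
proof -
  obtain G where G: "\<forall>j. st_sq L T (G j) \<and> (AE t\<in>{0..T} in lborel. weak_partial j (f t) (G j t))"
    using assms unfolding stV_def by metis
  then have "AE t in lborel. \<forall>j. t \<in> {0..T} \<longrightarrow> weak_partial j (f t) (G j t)" unfolding AE_all_countable by blast
  then show ?thesis using that[of G] G by (auto elim: eventually_mono)
qed

lemma ip_wD_eq:
  assumes "weak_partial j f g" "weak_partial j f' g'"
  shows "ip L (wD j f) (wD j f') = ip L g g'"
  by (rule ip_cong_AE)
    (use wD_eq[OF assms(1)] wD_eq[OF assms(2)] weak_partialD(2)[OF assms(1)] weak_partialD(2)[OF assms(2)] in
      \<open>auto dest: weak_partialD(2) loc_intD(1)\<close>)

lemma stV_const: assumes "v \<in> V_space L" shows "stV L T (%t. v)"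
  unfolding stV_def using assms V_spaceD[OF assms] by (auto intro!: st_sq_const exI[of _ "%t. wD _ v"])

lemma stV_energy:
  assumes f: "stV L T f" and g: "stV L T g"
  shows "set_integrable lebesgue {0..T} (%t. energy \<mu> L (f t) (g t))"
    "set_integrable lebesgue {0..T} (%t. grad_ip L (f t) (g t))"
    "set_integrable lebesgue {0..T} (%t. ip L (f t) (g t))"
proof -
  obtain F where F: "\<And>j. st_sq L T (F j)" "AE t\<in>{0..T} in lborel. \<forall>j. weak_partial j (f t) (F j t)" by (rule stV_gradient[OF f]) (rule that)
  obtain G where G: "\<And>j. st_sq L T (G j)" "AE t\<in>{0..T} in lborel. \<forall>j. weak_partial j (g t) (G j t)" by (rule stV_gradient[OF g]) (rule that)
  have fg: "st_sq L T f" "st_sq L T g" using f g by (auto simp: stV_def)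
  have eq: "AE t in lborel. t \<in> {0..T} \<longrightarrow> (\<Sum>j\<in>UNIV. ip L (F j t) (G j t)) = grad_ip L (f t) (g t)"
    using F(2) G(2) by eventually_elim (auto simp: grad_ip_def intro!: sum.cong ip_wD_eq[symmetric])
  have i: "integrable lborel (%t. \<Sum>j\<in>UNIV. indicator {0..T} t * ip L (F j t) (G j t))"
    by (intro Bochner_Integration.integrable_sum st_sq_ip(2) F G)
  have "integrable lebesgue (%t. indicator {0..T} t * grad_ip L (f t) (g t))"
    by (rule lebesgue_integral_AE_eq(1)[OF i]) (use eq in \<open>eventually_elim, auto simp: sum_distrib_left[symmetric] indicator_def\<close>)
  moreover have "integrable lebesgue (%t. indicator {0..T} t * ip L (f t) (g t))" by (rule lebesgue_integral_AE_eq(1)[OF st_sq_ip(2)[OF fg]]) simp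
  ultimately show "set_integrable lebesgue {0..T} (%t. grad_ip L (f t) (g t))" "set_integrable lebesgue {0..T} (%t. ip L (f t) (g t))"
    by (simp_all add: set_integrable_def)
  then show "set_integrable lebesgue {0..T} (%t. energy \<mu> L (f t) (g t))"
    unfolding energy_def by (intro set_integral_add set_integrable_mult_right) auto
qed

lemma energy_diff:
  assumes "f \<in> V_space L" "g \<in> V_space L" "h \<in> V_space L"
  shows "energy \<mu> L f (%x. g x - h x) = energy \<mu> L f g - energy \<mu> L f h"
    "energy \<mu> L (%x. g x - h x) f = energy \<mu> L g f - energy \<mu> L h f"
    "energy \<mu> L f g = energy \<mu> L g f"
  using assms V_spaceD(2)
  by (simp_all add: energy_def ip_diff_right ip_diff_left grad_ip_diff_right grad_ip_diff_left ip_commute[of L f] grad_ip_commute[of L f] algebra_simps)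

lemma energy_bound:
  assumes S: "sobolev_embedding L C" and mu: "0 \<le> \<mu>"
  shows "\<exists>c\<ge>0. \<forall>f\<in>V_space L. \<forall>g\<in>V_space L. \<bar>energy \<mu> L f g\<bar> \<le> c * V_norm L f * V_norm L g"
proof -
  obtain c where c: "0 \<le> c" "\<And>v. v \<in> V_space L ==> H_norm L v \<le> c * V_norm L v" using poincare[OF S] by blast
  show ?thesis
  proof (intro exI[of _ "c * c + \<mu>"] conjI ballI)
    show "0 \<le> c * c + \<mu>" using mu by simp
    fix f g assume fg: "f \<in> V_space L" "g \<in> V_space L"
    have "\<bar>ip L f g\<bar> \<le> H_norm L f * H_norm L g" using fg by (intro ip_Cauchy_Schwarz V_spaceD)
    also have "... \<le> (c * V_norm L f) * (c * V_norm L g)" using c fg by (intro mult_mono c(2)) (auto simp: H_norm_nonneg V_norm_nonneg)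
    finally have 1: "\<bar>ip L f g\<bar> \<le> c * c * V_norm L f * V_norm L g" by (simp add: mult_ac)
    have 2: "\<bar>\<mu> * grad_ip L f g\<bar> \<le> \<mu> * (V_norm L f * V_norm L g)"
      using grad_ip_Cauchy_Schwarz[OF fg] mu by (simp add: abs_mult mult_left_mono)
    show "\<bar>energy \<mu> L f g\<bar> \<le> (c * c + \<mu>) * V_norm L f * V_norm L g"
      using 1 2 abs_triangle_ineq[of "ip L f g" "\<mu> * grad_ip L f g"] by (simp add: energy_def algebra_simps)
  qed
qed

text \<open>
  What \<^const>\<open>H1_time\<close> provides when only the \<open>V\<close> norm is used. States and adjoint states come with different spaces and norms, and
  this is their common part.
\<close>

definition evolution :: "real => real => tfield => tfield => bool" where
  "evolution L T u ut \<longleftrightarrow> stV L T u \<and> stV L T ut \<and> (\<forall>t\<in>{0..T}. u t \<in> V_space L) \<and>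
     (\<forall>s\<in>{0..T}. ((%t. V_norm L (%x. u t x - u s x)) \<longlongrightarrow> 0) (at s within {0..T})) \<and>
     (\<forall>psi. test_function {0<..<T} psi \<longrightarrow> (AE x in lborel. ti T (deriv psi) u x = - ti T psi ut x)) \<and>
     (\<exists>h. set_integrable lebesgue {0..T} h \<and> (AE t\<in>{0..T} in lborel. V_norm L (ut t) \<le> h t))"

lemma stV_periodic: "stV L T f ==> AE t\<in>{0..T} in lborel. AE_periodic L (f t)"
  unfolding stV_def by (auto elim!: eventually_mono dest: V_spaceD(1) solenoidalD(2))

lemma weighted_support_integrable:
  assumes jm: "jointly_measurable T f" and K: "compact K" "\<And>x. x \<notin> K ==> a x = 0" "\<And>x. norm (a x :: real^3) \<le> B"
    and [measurable]: "a \<in> borel_measurable borel"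
    and I: "integrable lborel2 (%z. indicator K (snd z) *\<^sub>R tcut T f (fst z) (snd z))"
  shows "integrable lborel2 (%z. norm (a (snd z)) *\<^sub>R tcut T f (fst z) (snd z))"
proof (rule integrable_dominated)
  note [measurable] = measurable_cut2[OF jm]
  have B0: "0 \<le> B" using K(3)[of 0] norm_ge_zero order_trans by blast
  show "integrable lborel2 (%z. B * norm (indicator K (snd z) *\<^sub>R tcut T f (fst z) (snd z)))"
    using I by (intro integrable_mult_right integrable_norm)
  show "AE z in lborel2. norm (norm (a (snd z)) *\<^sub>R tcut T f (fst z) (snd z)) \<le> norm (B * norm (indicator K (snd z) *\<^sub>R tcut T f (fst z) (snd z)))"
  proof (rule AE_I2)
    fix z
    show "norm (norm (a (snd z)) *\<^sub>R tcut T f (fst z) (snd z)) \<le> norm (B * norm (indicator K (snd z) *\<^sub>R tcut T f (fst z) (snd z)))"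
      using K(2)[of "snd z"] K(3)[of "snd z"] B0 by (cases "snd z \<in> K") (auto intro: mult_right_mono)
  qed
  have "(%z::real \<times> (real^3). norm (a (snd z))) \<in> borel_measurable lborel2" by measurable
  then show "(%z. norm (a (snd z)) *\<^sub>R tcut T f (fst z) (snd z)) \<in> borel_measurable lborel2"
    by (rule borel_measurable_scaleR[OF _ measurable_cut2[OF jm]])
qed

lemma loc_int_ti:
  assumes jm: "jointly_measurable T f" and c[measurable]: "c \<in> borel_measurable borel" and B: "\<And>t. \<bar>c t\<bar> \<le> B"
    and I: "\<And>K. compact K ==> integrable lborel2 (%z. indicator K (snd z) *\<^sub>R tcut T f (fst z) (snd z))"
  shows "loc_int (ti T c f)"
  unfolding loc_int_def set_integrable_def
proof (intro conjI allI impI)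
  show "ti T c f \<in> borel_measurable borel" by (rule measurable_ti[OF jm c])
  fix K :: "(real^3) set" assume K: "compact K"
  note [measurable] = measurable_cut2[OF jm]
  have [measurable]: "K \<in> sets borel" using K by (simp add: borel_compact)
  have B0: "0 \<le> B" using B[of 0] by linarith
  have "integrable lborel2 (%(t, x). c t *\<^sub>R (indicator K x *\<^sub>R tcut T f t x))"
  proof (rule integrable_dominated)
    show "integrable lborel2 (%z. B * norm (indicator K (snd z) *\<^sub>R tcut T f (fst z) (snd z)))"
      using I[OF K] by (intro integrable_mult_right integrable_norm)
    show "AE z in lborel2. norm (case z of (t, x) => c t *\<^sub>R (indicator K x *\<^sub>R tcut T f t x)) \<le> norm (B * norm (indicator K (snd z) *\<^sub>R tcut T f (fst z) (snd z)))"
    proof (rule AE_I2, clarify)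
      fix t and x :: "real^3"
      show "norm (c t *\<^sub>R (indicator K x *\<^sub>R tcut T f t x)) \<le> norm (B * norm (indicator K (snd (t, x)) *\<^sub>R tcut T f (fst (t, x)) (snd (t, x))))"
        using mult_right_mono[OF B[of t], of "norm (indicator K x *\<^sub>R tcut T f t x)"] B0 by (simp add: abs_mult)
    qed
    show "(%(t, x). c t *\<^sub>R (indicator K x *\<^sub>R tcut T f t x)) \<in> borel_measurable lborel2" unfolding case_prod_unfold by measurable
  qed
  from lborel_pair.integrable_snd[OF this]
  have i: "integrable lborel (%x. LINT t|lborel. c t *\<^sub>R (indicator K x *\<^sub>R tcut T f t x))" .
  have "(LINT t|lborel. c t *\<^sub>R (indicator K x *\<^sub>R tcut T f t x)) = indicator K x *\<^sub>R ti T c f x" for x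
    unfolding ti_cut integral_scaleR_right[symmetric] by (simp add: mult.commute)
  then show "integrable lborel (%x. indicator K x *\<^sub>R ti T c f x)" using i by simp
qed

text \<open>
  Weak differentiation in space commutes with integration in time, by Fubini against a test function.
\<close>

lemma weak_partial_ti:
  assumes jm: "jointly_measurable T f" "jointly_measurable T g" and c: "c \<in> borel_measurable borel" "\<And>t. \<bar>c t\<bar> \<le> B"
    and I: "\<And>K. compact K ==> integrable lborel2 (%z. indicator K (snd z) *\<^sub>R tcut T f (fst z) (snd z))"
      "\<And>K. compact K ==> integrable lborel2 (%z. indicator K (snd z) *\<^sub>R tcut T g (fst z) (snd z))"
    and w: "AE t\<in>{0..T} in lborel. weak_partial j (f t) (g t)"
  shows "weak_partial j (ti T c f) (ti T c g)"
proof (rule weak_partialI)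
  show lf: "loc_int (ti T c f)" and lg: "loc_int (ti T c g)" using loc_int_ti jm c I by blast+
  fix psi :: "real^3 => real" assume t: "test_function UNIV psi"
  obtain K M where K: "compact K" "\<And>x. x \<notin> K ==> psi x = 0" "\<And>x. x \<notin> K ==> grad psi x = 0"
    "0 \<le> M" "\<And>x. \<bar>psi x\<bar> \<le> M" "\<And>x. norm (grad psi x) \<le> M" using test_function_bounds[OF t] by metis
  note [measurable] = test_functionD(5,6)[OF t]
  show "(LINT x|lborel. (grad psi x $ j) *\<^sub>R ti T c f x) = - (LINT x|lborel. psi x *\<^sub>R ti T c g x)"
  proof (rule euclidean_eq_leftI)
    fix b :: "real^3" assume b: "b \<in> Basis"
    have nb: "norm b = 1" using b by simp
    have n1: "norm ((grad psi x $ j) *\<^sub>R b) \<le> M" for x using component_le_norm_cart[of "grad psi x" j] K(6)[of x] nb by simp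
    have h1: "integrable lborel2 (%z. norm ((grad psi (snd z) $ j) *\<^sub>R b) *\<^sub>R tcut T f (fst z) (snd z))"
      by (rule weighted_support_integrable[OF jm(1) K(1) _ n1 _ I(1)[OF K(1)]]) (use K in auto)
    have h2: "integrable lborel2 (%z. norm (psi (snd z) *\<^sub>R b) *\<^sub>R tcut T g (fst z) (snd z))"
      by (rule weighted_support_integrable[OF jm(2) K(1) _ _ _ I(2)[OF K(1)], where B=M]) (use K nb in auto)
    have "b \<bullet> (LINT x|lborel. (grad psi x $ j) *\<^sub>R ti T c f x) = (LINT x|lborel. ((grad psi x $ j) *\<^sub>R b) \<bullet> ti T c f x)"
      using integral_inner_right[OF test_mult_integrable(2)[OF t lf, of j], of b] by simp
    also have "... = (LINT t|lborel. indicator {0..T} t * (c t * (LINT x|lborel. ((grad psi x $ j) *\<^sub>R b) \<bullet> f t x)))"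
      by (rule ti_Fubini(2)[OF jm(1) _ c h1]) measurable
    also have "... = (LINT t|lborel. - (indicator {0..T} t * (c t * (LINT x|lborel. (psi x *\<^sub>R b) \<bullet> g t x))))"
    proof -
      have AEt: "AE t in lborel. indicator {0..T} t * (c t * (LINT x|lborel. ((grad psi x $ j) *\<^sub>R b) \<bullet> f t x)) = - (indicator {0..T} t * (c t * (LINT x|lborel. (psi x *\<^sub>R b) \<bullet> g t x)))"
        using w
      proof eventually_elim
        case (elim t)
        show ?case
        proof (cases "t \<in> {0..T}")
          case True
          then have D: "weak_partial j (f t) (g t)" using elim by simp
          note D' = weak_partialD[OF D]
          have "(LINT x|lborel. ((grad psi x $ j) *\<^sub>R b) \<bullet> f t x) = b \<bullet> (LINT x|lborel. (grad psi x $ j) *\<^sub>R f t x)"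
            using integral_inner_right[OF test_mult_integrable(2)[OF t D'(1), of j], of b] by simp
          also have "... = - (b \<bullet> (LINT x|lborel. psi x *\<^sub>R g t x))" using D'(3)[OF t] by simp
          also have "b \<bullet> (LINT x|lborel. psi x *\<^sub>R g t x) = (LINT x|lborel. (psi x *\<^sub>R b) \<bullet> g t x)"
            using integral_inner_right[OF test_mult_integrable(1)[OF t D'(2)], of b] by simp
          finally show ?thesis by simp
        qed simp
      qed
      have m: "(%t. indicator {0..T} t * (c t * (LINT x|lborel. a x \<bullet> f t x))) \<in> borel_measurable lborel"
        if jm: "jointly_measurable T f" and [measurable]: "a \<in> borel_measurable borel" for f and a :: field
      proof -
        note [measurable] = measurable_cut2[OF jm] c(1)
        have "(%t. c t * (LINT x|lborel. a x \<bullet> tcut T f t x)) \<in> borel_measurable lborel" by measurable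
        moreover have "(%t. c t * (LINT x|lborel. a x \<bullet> tcut T f t x)) = (%t. indicator {0..T} t * (c t * (LINT x|lborel. a x \<bullet> f t x)))"
          by (auto simp: tcut_def fun_eq_iff indicator_def)
        ultimately show ?thesis by simp
      qed
      show ?thesis by (rule integral_cong_AE[OF m[OF jm(1)] borel_measurable_uminus[OF m[OF jm(2)]] AEt]) measurable
    qed
    also have "... = - (LINT t|lborel. indicator {0..T} t * (c t * (LINT x|lborel. (psi x *\<^sub>R b) \<bullet> g t x)))" by simp
    also have "(LINT t|lborel. indicator {0..T} t * (c t * (LINT x|lborel. (psi x *\<^sub>R b) \<bullet> g t x))) = (LINT x|lborel. (psi x *\<^sub>R b) \<bullet> ti T c g x)"
      by (rule ti_Fubini(2)[OF jm(2) _ c h2, symmetric]) measurable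
    also have "... = b \<bullet> (LINT x|lborel. psi x *\<^sub>R ti T c g x)"
      using integral_inner_right[OF test_mult_integrable(1)[OF t lg], of b] by simp
    finally show "b \<bullet> (LINT x|lborel. (grad psi x $ j) *\<^sub>R ti T c f x) = b \<bullet> - (LINT x|lborel. psi x *\<^sub>R ti T c g x)" by simp
  qed
qed

lemma ti_ip_Fubini:
  assumes f: "st_sq L T f" and v: "loc_sq v" and c: "c \<in> borel_measurable borel" "\<And>t. \<bar>c t\<bar> \<le> B"
  shows "(LINT x|lborel. (indicator (cell L) x *\<^sub>R v x) \<bullet> ti T c f x) = (LINT t|lborel. indicator {0..T} t * (c t * ip L (f t) v))"
    "integrable lborel (%t. indicator {0..T} t * (c t * ip L (f t) v))"
proof -
  note jm = f[unfolded st_sq_def, THEN conjunct1] and jv = st_sq_const[OF v, unfolded st_sq_def, THEN conjunct1]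
  note [measurable] = measurable_cut2[OF jm] loc_sqD(1)[OF v] measurable_cut2[OF jv] c(1)
  have eq: "(LINT x|lborel. (indicator (cell L) x *\<^sub>R v x) \<bullet> f t x) = ip L (f t) v" for t
    unfolding ip_def set_lebesgue_integral_def by (simp add: inner_commute)
  have "integrable lborel2 (%z. norm (indicator (cell L) (snd z) *\<^sub>R tcut T (%t. v) (fst z) (snd z)) * norm (indicator (cell L) (snd z) *\<^sub>R tcut T f (fst z) (snd z)))"
    by (rule integrable_inner_sq(2)) (use f st_sq_const[OF v, of L T] in \<open>auto simp: st_sq_def\<close>)
  then have H: "integrable lborel2 (%z. norm (indicator (cell L) (snd z) *\<^sub>R v (snd z)) *\<^sub>R tcut T f (fst z) (snd z))"
  proof (rule integrable_dominated)
    have "(%z::real \<times> (real^3). norm (indicator (cell L) (snd z) *\<^sub>R v (snd z))) \<in> borel_measurable lborel2" by measurable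
    then show "(%z. norm (indicator (cell L) (snd z) *\<^sub>R v (snd z)) *\<^sub>R tcut T f (fst z) (snd z)) \<in> borel_measurable lborel2"
      by (rule borel_measurable_scaleR[OF _ measurable_cut2[OF jm]])
  qed (auto intro!: AE_I2 simp: tcut_def indicator_def)
  have m: "(%x. indicator (cell L) x *\<^sub>R v x) \<in> borel_measurable borel" by measurable
  show "(LINT x|lborel. (indicator (cell L) x *\<^sub>R v x) \<bullet> ti T c f x) = (LINT t|lborel. indicator {0..T} t * (c t * ip L (f t) v))"
    using ti_Fubini(2)[OF jm m c H] unfolding eq .
  have i: "integrable lborel (%t. indicator {0..T} t * ip L (f t) v)" by (rule st_sq_ip(2)[OF f st_sq_const[OF v]])
  then have im: "(%t. indicator {0..T} t * ip L (f t) v) \<in> borel_measurable lborel" by auto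
  have "integrable lborel (%t. c t * (indicator {0..T} t * ip L (f t) v))"
  proof (rule integrable_dominated)
    show "integrable lborel (%t. B * norm (indicator {0..T} t * ip L (f t) v))" using i by (intro integrable_mult_right integrable_norm)
    show "(%t. c t * (indicator {0..T} t * ip L (f t) v)) \<in> borel_measurable lborel" by (intro borel_measurable_times im) (simp add: c(1))
    show "AE t in lborel. norm (c t * (indicator {0..T} t * ip L (f t) v)) \<le> norm (B * norm (indicator {0..T} t * ip L (f t) v))"
    proof (rule AE_I2)
      fix t
      have "0 \<le> B" using c(2)[of 0] by linarith
      then show "norm (c t * (indicator {0..T} t * ip L (f t) v)) \<le> norm (B * norm (indicator {0..T} t * ip L (f t) v))"
        using mult_right_mono[OF c(2)[of t], of "\<bar>indicator {0..T} t * ip L (f t) v\<bar>"] by (simp add: abs_mult)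
    qed
  qed
  then show "integrable lborel (%t. indicator {0..T} t * (c t * ip L (f t) v))" by (simp add: mult_ac)
qed

text \<open>
  The weak time derivative is given for almost every point \<open>x\<close>. Differentiating the identity between time integrals in
  space and pairing it with \<open>v\<close> gives the weak derivative of the scalar function \<open>t \<mapsto> energy (u t) v\<close>.
\<close>

lemma evolution_test:
  assumes L: "0 < L" and ev: "evolution L T u ut" and v: "v \<in> V_space L" and t: "test_function {0<..<T} psi"
  shows "(LINT t:{0..T}|lebesgue. deriv psi t * energy \<mu> L (u t) v) = - (LINT t:{0..T}|lebesgue. psi t * energy \<mu> L (ut t) v)"
proof -
  note V = V_spaceD[OF v]
  have sV: "stV L T u" "stV L T ut" using ev by (auto simp: evolution_def)
  obtain K M where K: "0 \<le> M" "\<And>x. \<bar>psi x\<bar> \<le> M" "\<And>x. norm (grad psi x) \<le> M" using test_function_bounds[OF t] by metis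
  note dg = deriv_eq_grad[OF t]
  have c1: "deriv psi \<in> borel_measurable borel" "\<And>t. \<bar>deriv psi t\<bar> \<le> M" using test_functionD(6)[OF t] K(3) by (auto simp: dg)
  have c2: "psi \<in> borel_measurable borel" "\<And>t. \<bar>psi t\<bar> \<le> M" using test_functionD(5)[OF t] K(2) by auto
  obtain F where F: "\<And>j. st_sq L T (F j)" "AE t\<in>{0..T} in lborel. \<forall>j. weak_partial j (u t) (F j t)" by (rule stV_gradient[OF sV(1)]) (rule that)
  obtain G where G: "\<And>j. st_sq L T (G j)" "AE t\<in>{0..T} in lborel. \<forall>j. weak_partial j (ut t) (G j t)" by (rule stV_gradient[OF sV(2)]) (rule that)
  have jm: "jointly_measurable T f" if "st_sq L T f" for f using that by (simp add: st_sq_def)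
  have su: "st_sq L T u" "st_sq L T ut" using sV by (auto simp: stV_def)
  have pF: "AE t\<in>{0..T} in lborel. AE_periodic L (F j t)" for j
    using F(2) stV_periodic[OF sV(1)] by eventually_elim (auto intro: weak_partial_AE_periodic)
  have pG: "AE t\<in>{0..T} in lborel. AE_periodic L (G j t)" for j
    using G(2) stV_periodic[OF sV(2)] by eventually_elim (auto intro: weak_partial_AE_periodic)
  have PQ: "AE x in lborel. ti T (deriv psi) u x = - ti T psi ut x" using ev t by (auto simp: evolution_def)
  have wF: "weak_partial j (ti T (deriv psi) u) (ti T (deriv psi) (F j))" for j
    by (rule weak_partial_ti[OF jm[OF su(1)] jm[OF F(1)] c1 st_sq_local(2)[OF L su(1) stV_periodic[OF sV(1)]] st_sq_local(2)[OF L F(1) pF]])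
      (use F(2) in \<open>auto elim: eventually_mono\<close>)
  have wG: "weak_partial j (ti T psi ut) (ti T psi (G j))" for j
    by (rule weak_partial_ti[OF jm[OF su(2)] jm[OF G(1)] c2 st_sq_local(2)[OF L su(2) stV_periodic[OF sV(2)]] st_sq_local(2)[OF L G(1) pG]])
      (use G(2) in \<open>auto elim: eventually_mono\<close>)
  have PQj: "AE x in lborel. ti T (deriv psi) (F j) x = - ti T psi (G j) x" for j
  proof -
    have z: "weak_partial j (%x. 0) (%x. 0)" using weak_partial_diff[OF wG[of j] wG[of j]] by simp
    have "weak_partial j (%x. - ti T psi ut x) (%x. - ti T psi (G j) x)" using weak_partial_diff[OF z wG] by simp
    then have "weak_partial j (ti T (deriv psi) u) (%x. - ti T psi (G j) x)"
      by (rule weak_partial_cong_AE) (use AE_symmetric[OF PQ] weak_partialD(1,2)[OF wF[of j]] weak_partialD(1,2)[OF wG[of j]] in \<open>auto dest: loc_intD(1)\<close>)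
    from weak_partial_unique[OF wF this] show ?thesis .
  qed
  have tr: "(LINT t|lborel. indicator {0..T} t * (deriv psi t * ip L (f t) w)) = - (LINT t|lborel. indicator {0..T} t * (psi t * ip L (g t) w))"
    if f: "st_sq L T f" and g: "st_sq L T g" and w: "loc_sq w" and eq: "AE x in lborel. ti T (deriv psi) f x = - ti T psi g x" for f g w
  proof -
    note [measurable] = measurable_ti[OF jm[OF f] c1(1)] measurable_ti[OF jm[OF g] c2(1)] loc_sqD(1)[OF w]
    have "(LINT x|lborel. (indicator (cell L) x *\<^sub>R w x) \<bullet> ti T (deriv psi) f x) = (LINT x|lborel. - ((indicator (cell L) x *\<^sub>R w x) \<bullet> ti T psi g x))"
      by (rule integral_cong_AE) (use eq in \<open>auto elim!: eventually_mono\<close>)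
    then show ?thesis unfolding ti_ip_Fubini(1)[OF f w c1, symmetric] ti_ip_Fubini(1)[OF g w c2, symmetric] by simp
  qed
  have conv: "(LINT t:{0..T}|lebesgue. c t * energy \<mu> L (f t) v) = (LINT t|lborel. indicator {0..T} t * (c t * ip L (f t) v)) + \<mu> * (\<Sum>j\<in>UNIV. LINT t|lborel. indicator {0..T} t * (c t * ip L (H j t) (wD j v)))"
    if f: "st_sq L T f" and H: "\<And>j. st_sq L T (H j)" "AE t\<in>{0..T} in lborel. \<forall>j. weak_partial j (f t) (H j t)"
      and c: "c \<in> borel_measurable borel" "\<And>t. \<bar>c t\<bar> \<le> M" for f H c
  proof -
    let ?R = "%t. indicator {0..T} t * (c t * ip L (f t) v) + \<mu> * (\<Sum>j\<in>UNIV. indicator {0..T} t * (c t * ip L (H j t) (wD j v)))"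
    note i = ti_ip_Fubini(2)[OF f V(2) c] ti_ip_Fubini(2)[OF H(1) V(4) c]
    have iR: "integrable lborel ?R" by (intro Bochner_Integration.integrable_add integrable_mult_right Bochner_Integration.integrable_sum i)
    have "integral\<^sup>L lebesgue (%t. indicator {0..T} t * (c t * energy \<mu> L (f t) v)) = integral\<^sup>L lborel ?R"
    proof (rule lebesgue_integral_AE_eq(2)[OF iR])
      show "AE t in lborel. ?R t = indicator {0..T} t * (c t * energy \<mu> L (f t) v)" using H(2)
      proof eventually_elim
        case (elim t)
        show ?case
        proof (cases "t \<in> {0..T}")
          case True
          then have "ip L (wD j (f t)) (wD j v) = ip L (H j t) (wD j v)" for j using elim ip_wD_eq[of j "f t" "H j t" v "wD j v"] V(3) by auto
          then show ?thesis using True by (simp add: energy_def grad_ip_def sum_distrib_left algebra_simps)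
        qed simp
      qed
    qed
    also have "... = (LINT t|lborel. indicator {0..T} t * (c t * ip L (f t) v)) + (LINT t|lborel. \<mu> * (\<Sum>j\<in>UNIV. indicator {0..T} t * (c t * ip L (H j t) (wD j v))))"
      by (intro Bochner_Integration.integral_add integrable_mult_right Bochner_Integration.integrable_sum i)
    also have "(LINT t|lborel. \<mu> * (\<Sum>j\<in>UNIV. indicator {0..T} t * (c t * ip L (H j t) (wD j v)))) = \<mu> * (\<Sum>j\<in>UNIV. LINT t|lborel. indicator {0..T} t * (c t * ip L (H j t) (wD j v)))"
      unfolding integral_mult_right_zero by (intro arg_cong2[where f="(*)"] refl Bochner_Integration.integral_sum i)
    finally show ?thesis by (simp add: set_lebesgue_integral_def)
  qed
  show ?thesis unfolding conv[OF su(1) F c1] conv[OF su(2) G c2] tr[OF su V(2) PQ] tr[OF F(1) G(1) V(4) PQj] by (simp add: sum_negf)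
qed

lemma evolution_energy_continuous:
  assumes S: "sobolev_embedding L C" and mu: "0 \<le> \<mu>" and ev: "evolution L T u ut" and v: "v \<in> V_space L"
  shows "continuous_on {0..T} (%t. energy \<mu> L (u t) v)"
  unfolding continuous_on_def
proof
  fix s assume s: "s \<in> {0..T}"
  obtain c where c: "0 \<le> c" "\<And>f g. f \<in> V_space L ==> g \<in> V_space L ==> \<bar>energy \<mu> L f g\<bar> \<le> c * V_norm L f * V_norm L g"
    using energy_bound[OF S mu] by blast
  have uV: "u t \<in> V_space L" if "t \<in> {0..T}" for t using ev that by (auto simp: evolution_def)
  have "((%t. c * V_norm L (%x. u t x - u s x) * V_norm L v) \<longlongrightarrow> c * 0 * V_norm L v) (at s within {0..T})"
    using ev s by (intro tendsto_intros) (auto simp: evolution_def)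
  then have lim: "((%t. c * V_norm L (%x. u t x - u s x) * V_norm L v) \<longlongrightarrow> 0) (at s within {0..T})" by simp
    have ev1: "\<forall>\<^sub>F t in at s within {0..T}. norm (energy \<mu> L (u t) v - energy \<mu> L (u s) v) \<le> c * V_norm L (%x. u t x - u s x) * V_norm L v"
      unfolding eventually_at_filter
    proof (rule always_eventually, intro allI impI)
      fix t assume "t \<in> {0..T}"
      then show "norm (energy \<mu> L (u t) v - energy \<mu> L (u s) v) \<le> c * V_norm L (%x. u t x - u s x) * V_norm L v"
        using c(2)[OF V_space_diff(1)[OF uV uV[OF s]] v, of t] energy_diff(2)[OF v uV uV[OF s], of t] by simp
    qed
  have "((%t. energy \<mu> L (u t) v - energy \<mu> L (u s) v) \<longlongrightarrow> 0) (at s within {0..T})"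
    by (rule Lim_null_comparison[OF ev1 lim])
  then show "((%t. energy \<mu> L (u t) v) \<longlongrightarrow> energy \<mu> L (u s) v) (at s within {0..T})" by (simp add: LIM_zero_iff)
qed

lemma evolution_FTC:
  assumes S: "sobolev_embedding L C" and mu: "0 \<le> \<mu>" and T: "0 < T" and ev: "evolution L T u ut" and v: "v \<in> V_space L"
    and ab: "0 \<le> a" "a < b" "b \<le> T"
  shows "energy \<mu> L (u b) v - energy \<mu> L (u a) v = (LINT t:{a<..b}|lebesgue. energy \<mu> L (ut t) v)"
proof -
  have L: "0 < L" using S by (simp add: sobolev_embedding_def)
  have "stV L T ut" using ev by (simp add: evolution_def)
  then have "set_integrable lebesgue {0..T} (%t. energy \<mu> L (ut t) v)" by (intro stV_energy stV_const v)
  from weak_derivative_FTC[OF T evolution_energy_continuous[OF S mu ev v] this evolution_test[OF L ev v] ab]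
  show ?thesis .
qed

lemma V_norm_triangle:
  assumes f: "f \<in> V_space L" and g: "g \<in> V_space L"
  shows "V_norm L f \<le> V_norm L (%x. f x - g x) + V_norm L g"
proof (rule power2_le_imp_le)
  let ?d = "%x. f x - g x"
  have d: "?d \<in> V_space L" by (rule V_space_diff(1)[OF f g])
  have "(V_norm L f)^2 = (V_norm L ?d)^2 + 2 * grad_ip L ?d g + (V_norm L g)^2"
    unfolding V_norm_sq grad_ip_diff_right[OF d f g] grad_ip_diff_left[OF f f g] grad_ip_diff_left[OF g f g] using grad_ip_commute[of L f g] by simp
  also have "... \<le> (V_norm L ?d)^2 + 2 * (V_norm L ?d * V_norm L g) + (V_norm L g)^2" using grad_ip_Cauchy_Schwarz[OF d g] by simp
  also have "... = (V_norm L ?d + V_norm L g)^2" by (simp add: power2_sum)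
  finally show "(V_norm L f)^2 \<le> (V_norm L ?d + V_norm L g)^2" .
qed (simp add: V_norm_nonneg)

lemma V_norm_diff_commute:
  assumes f: "f \<in> V_space L" and g: "g \<in> V_space L"
  shows "V_norm L (%x. f x - g x) = V_norm L (%x. g x - f x)" "V_norm L (%x. f x - f x) = 0"
proof -
  have "grad_ip L (%x. f x - g x) (%x. f x - g x) = grad_ip L (%x. g x - f x) (%x. g x - f x)"
    unfolding grad_ip_diff_right[OF V_space_diff(1)[OF f g] f g] grad_ip_diff_right[OF V_space_diff(1)[OF g f] g f]
      grad_ip_diff_left[OF f f g] grad_ip_diff_left[OF g f g] grad_ip_diff_left[OF f g f] grad_ip_diff_left[OF g g f]
    using grad_ip_commute[of L f g] by simp
  then show "V_norm L (%x. f x - g x) = V_norm L (%x. g x - f x)" by (simp add: V_norm_def)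
  have "grad_ip L (%x. f x - f x) (%x. f x - f x) = 0" unfolding grad_ip_diff_right[OF V_space_diff(1)[OF f f] f f] by simp
  then show "V_norm L (%x. f x - f x) = 0" unfolding V_norm_def by simp
qed

lemma evolution_V: "evolution L T u ut ==> t \<in> {0..T} ==> u t \<in> V_space L"
  by (simp add: evolution_def)

lemma evolution_sequence:
  assumes ev: "evolution L T u ut" and t: "t \<in> {0..T}" and s: "\<And>n. s n \<in> {0..T}" "s \<longlonglongrightarrow> t"
  shows "(%n. V_norm L (%x. u (s n) x - u t x)) \<longlonglongrightarrow> 0"
proof -
  have lim: "((%s. V_norm L (%x. u s x - u t x)) \<longlongrightarrow> 0) (at t within {0..T})" using ev t by (auto simp: evolution_def)
  have z: "V_norm L (%x. u t x - u t x) = 0" using V_norm_diff_commute(2) evolution_V[OF ev t] by blast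
  have "continuous (at t within {0..T}) (%s. V_norm L (%x. u s x - u t x))" using lim unfolding continuous_within z .
  from continuous_within_tendsto_compose'[OF this s] show ?thesis unfolding z .
qed

lemma evolution_bounded:
  assumes ev: "evolution L T u ut" and T: "0 < T"
  obtains M where "0 \<le> M" "\<And>t. t \<in> {0..T} ==> V_norm L (u t) \<le> M"
proof -
  have "continuous_on {0..T} (%t. V_norm L (u t))" unfolding continuous_on_def
  proof
    fix s assume s: "s \<in> {0..T}"
    have lim: "((%t. V_norm L (%x. u t x - u s x)) \<longlongrightarrow> 0) (at s within {0..T})" using ev s by (auto simp: evolution_def)
    have ev1: "\<forall>\<^sub>F t in at s within {0..T}. norm (V_norm L (u t) - V_norm L (u s)) \<le> V_norm L (%x. u t x - u s x)"
      unfolding eventually_at_filter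
    proof (rule always_eventually, intro allI impI)
      fix t assume t: "t \<in> {0..T}"
      note V = evolution_V[OF ev t] evolution_V[OF ev s]
      show "norm (V_norm L (u t) - V_norm L (u s)) \<le> V_norm L (%x. u t x - u s x)"
        using V_norm_triangle[OF V] V_norm_triangle[OF V(2,1)] V_norm_diff_commute(1)[OF V] by simp
    qed
    have "((%t. V_norm L (u t) - V_norm L (u s)) \<longlongrightarrow> 0) (at s within {0..T})" by (rule Lim_null_comparison[OF ev1 lim])
    then show "((%t. V_norm L (u t)) \<longlongrightarrow> V_norm L (u s)) (at s within {0..T})" by (simp add: LIM_zero_iff)
  qed
  then have "compact ((%t. V_norm L (u t)) ` {0..T})" by (intro compact_continuous_image) auto
  from compact_imp_bounded[OF this] obtain M where M: "\<forall>y\<in>(%t. V_norm L (u t)) ` {0..T}. norm y \<le> M" unfolding bounded_iff by blast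
  have "V_norm L (u t) \<le> M" if "t \<in> {0..T}" for t using bspec[OF M imageI[OF that]] V_norm_nonneg[of L "u t"] by simp
  moreover from this[of 0] have "0 \<le> M" using T V_norm_nonneg[of L "u 0"] by simp
  ultimately show ?thesis using that by blast
qed

text \<open>
  For a fixed second argument this is the fundamental theorem of calculus. On a grid of step \<open>h\<close> it is applied to \<open>u\<close>
  against the right end value of \<open>w\<close> and to \<open>w\<close> against the left end value of \<open>u\<close>; then the sum telescopes. By the continuity of both in
  \<open>V\<close>, the integrands converge as \<open>h \<rightarrow> 0\<close>, dominated by the norms of \<open>ut\<close> and \<open>wt\<close>.
\<close>

lemma evolution_product:
  assumes S: "sobolev_embedding L C" and mu: "0 \<le> \<mu>" and T: "0 < T"
    and u: "evolution L T u ut" and w: "evolution L T w wt"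
  shows "(LINT t:{0..T}|lebesgue. energy \<mu> L (ut t) (w t) + energy \<mu> L (wt t) (u t)) = energy \<mu> L (u T) (w T) - energy \<mu> L (u 0) (w 0)"
proof -
  let ?E = "energy \<mu> L"
  have sV: "stV L T u" "stV L T ut" "stV L T w" "stV L T wt" using u w by (auto simp: evolution_def)
  note uV = evolution_V[OF u] and wV = evolution_V[OF w]
  \<comment> \<open>grid points up and lo are the ends of the grid interval that contains t\<close>
  define h where "h n = T / real (Suc n)" for n
  have h0: "0 < h n" for n using T by (simp add: h_def)
  have hT: "h n * real (Suc n) = T" for n by (simp add: h_def)
  define up where "up n t = h n * of_int \<lceil>t / h n\<rceil>" for n t
  define lo where "lo n t = up n t - h n" for n t
  define K where "K n t = ?E (ut t) (w (up n t)) + ?E (wt t) (u (lo n t))" for n t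
  have up_eq: "up n t = h n * real (Suc k)" "lo n t = h n * real k" if "h n * real k < t" "t \<le> h n * real (Suc k)" for n k t
  proof -
    have "\<lceil>t / h n\<rceil> = int (Suc k)" using that h0[of n] by (auto simp: ceiling_eq_iff field_simps)
    then show "up n t = h n * real (Suc k)" by (simp add: up_def)
    then show "lo n t = h n * real k" by (simp add: lo_def algebra_simps)
  qed
  have step: "k \<le> Suc n ==> set_integrable lebesgue {0<..h n * real k} (K n) \<and>
    (LINT t:{0<..h n * real k}|lebesgue. K n t) = ?E (u (h n * real k)) (w (h n * real k)) - ?E (u 0) (w 0)" for n k
  proof (induction k)
    case 0
    then show ?case by (simp add: set_integrable_def set_lebesgue_integral_def)
  next
    case (Suc k)
    let ?a = "h n * real k" and ?b = "h n * real (Suc k)"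
    have ab: "0 \<le> ?a" "?a < ?b" using h0[of n] by auto
    have "?b \<le> h n * real (Suc n)" using Suc.prems h0[of n] by (intro mult_left_mono) auto
    then have bT: "?b \<le> T" using hT by simp
    have a: "?a \<in> {0..T}" and b: "?b \<in> {0..T}" using ab bT by auto
    have Keq: "K n t = ?E (ut t) (w ?b) + ?E (wt t) (u ?a)" if "t \<in> {?a<..?b}" for t using up_eq[of n k t] that by (simp add: K_def)
    have sub: "{?a<..?b} \<subseteq> {0..T}" using ab bT by auto
    have i1: "set_integrable lebesgue {?a<..?b} (%t. ?E (ut t) (w ?b))"
      by (rule set_integrable_subset[OF stV_energy(1)[OF sV(2) stV_const[OF wV[OF b]]] _ sub]) simp
    have i2: "set_integrable lebesgue {?a<..?b} (%t. ?E (wt t) (u ?a))"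
      by (rule set_integrable_subset[OF stV_energy(1)[OF sV(4) stV_const[OF uV[OF a]]] _ sub]) simp
    have iK: "set_integrable lebesgue {?a<..?b} (K n)" using set_integral_add(1)[OF i1 i2] by (subst set_integrable_cong[OF refl refl Keq])
    have vK: "(LINT t:{?a<..?b}|lebesgue. K n t) = ?E (u ?b) (w ?b) - ?E (u ?a) (w ?a)"
    proof -
      have "(LINT t:{?a<..?b}|lebesgue. K n t) = (LINT t:{?a<..?b}|lebesgue. ?E (ut t) (w ?b) + ?E (wt t) (u ?a))"
        by (rule set_lebesgue_integral_cong) (use Keq in auto)
      also have "... = (?E (u ?b) (w ?b) - ?E (u ?a) (w ?b)) + (?E (w ?b) (u ?a) - ?E (w ?a) (u ?a))"
        unfolding set_integral_add(2)[OF i1 i2] evolution_FTC[OF S mu T u wV[OF b] ab bT] evolution_FTC[OF S mu T w uV[OF a] ab bT] ..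
      also have "... = ?E (u ?b) (w ?b) - ?E (u ?a) (w ?a)"
        using energy_diff(3)[OF uV[OF a] wV[OF b] wV[OF b]] energy_diff(3)[OF uV[OF a] wV[OF a] wV[OF a]] by simp
      finally show ?thesis .
    qed
    have un: "{0<..?b} = {0<..?a} \<union> {?a<..?b}" using ab by auto
    have IH: "set_integrable lebesgue {0<..?a} (K n)" "(LINT t:{0<..?a}|lebesgue. K n t) = ?E (u ?a) (w ?a) - ?E (u 0) (w 0)" using Suc by auto
    show ?case
    proof
      show "set_integrable lebesgue {0<..?b} (K n)" unfolding un by (rule set_integrable_Un[OF IH(1) iK]) simp_all
      have "(LINT t:{0<..?a} \<union> {?a<..?b}|lebesgue. K n t) = (LINT t:{0<..?a}|lebesgue. K n t) + (LINT t:{?a<..?b}|lebesgue. K n t)"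
        by (rule set_integral_Un[OF _ IH(1) iK]) (auto simp del: of_nat_Suc)
      then show "(LINT t:{0<..?b}|lebesgue. K n t) = ?E (u ?b) (w ?b) - ?E (u 0) (w 0)" unfolding un IH(2) vK by simp
    qed
  qed
  have KT: "set_integrable lebesgue {0<..T} (K n)" "(LINT t:{0<..T}|lebesgue. K n t) = ?E (u T) (w T) - ?E (u 0) (w 0)" for n
    using step[of "Suc n" n] unfolding hT by auto
  obtain c where c: "0 \<le> c" "\<And>f g. f \<in> V_space L ==> g \<in> V_space L ==> \<bar>?E f g\<bar> \<le> c * V_norm L f * V_norm L g"
    using energy_bound[OF S mu] by blast
  obtain Mu where Mu: "0 \<le> Mu" "\<And>t. t \<in> {0..T} ==> V_norm L (u t) \<le> Mu" using evolution_bounded[OF u T] by blast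
  obtain Mw where Mw: "0 \<le> Mw" "\<And>t. t \<in> {0..T} ==> V_norm L (w t) \<le> Mw" using evolution_bounded[OF w T] by blast
  obtain h1 where h1: "set_integrable lebesgue {0..T} h1" "AE t\<in>{0..T} in lborel. V_norm L (ut t) \<le> h1 t" using u by (auto simp: evolution_def)
  obtain h2 where h2: "set_integrable lebesgue {0..T} h2" "AE t\<in>{0..T} in lborel. V_norm L (wt t) \<le> h2 t" using w by (auto simp: evolution_def)
  have utV: "AE t\<in>{0..T} in lborel. ut t \<in> V_space L" "AE t\<in>{0..T} in lborel. wt t \<in> V_space L" using sV by (auto simp: stV_def)
  have grid: "up n t \<in> {0..T} \<and> lo n t \<in> {0..T} \<and> t \<le> up n t \<and> up n t < t + h n" if "t \<in> {0<..T}" for n t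
  proof -
    define j where "j = nat (\<lceil>t / h n\<rceil> - 1)"
    have t: "0 < t" "t \<le> T" using that by auto
    then have cp: "0 < t / h n" using h0[of n] by simp
    then have ce: "0 < \<lceil>t / h n\<rceil>" by (simp add: zero_less_ceiling)
    then have jj: "\<lceil>t / h n\<rceil> = int (Suc j)" by (simp add: j_def)
    then have u1: "up n t = h n * real (Suc j)" "lo n t = h n * real j" by (simp_all add: up_def lo_def algebra_simps)
    have b1: "t / h n \<le> real (Suc j)" "real j < t / h n" using jj by (auto simp: ceiling_eq_iff)
    have "real j < real (Suc n)"
    proof -
      have "t / h n \<le> T / h n" using t h0[of n] by (simp add: divide_right_mono)
      also have "T / h n = real (Suc n)" using T by (simp add: h_def)
      finally show ?thesis using b1 by linarith
    qed
    then have "real (Suc j) \<le> real (Suc n)" by simp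
    then have "h n * real (Suc j) \<le> T" using h0[of n] hT[of n] mult_left_mono[of "real (Suc j)" "real (Suc n)" "h n"] by simp
    moreover have "t \<le> h n * real (Suc j)" "h n * real j < t" using b1 h0[of n] by (simp_all add: field_simps)
    ultimately show ?thesis unfolding u1 using h0[of n] t by (auto simp: algebra_simps)
  qed
  have hlim: "h \<longlonglongrightarrow> 0" unfolding h_def using lim_const_over_n[of T] LIMSEQ_Suc by fast
  have "(%n. LINT t:{0<..T}|lebesgue. K n t) \<longlonglongrightarrow> (LINT t:{0<..T}|lebesgue. ?E (ut t) (w t) + ?E (wt t) (u t))"
    unfolding set_lebesgue_integral_def
  proof (rule integral_dominated_convergence)
    have "set_integrable lebesgue {0<..T} (%t. ?E (ut t) (w t) + ?E (wt t) (u t))"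
      by (rule set_integrable_subset[OF set_integral_add(1)[OF stV_energy(1)[OF sV(2,3)] stV_energy(1)[OF sV(4,1)]]]) auto
    then show "(%t. indicat_real {0<..T} t *\<^sub>R (?E (ut t) (w t) + ?E (wt t) (u t))) \<in> borel_measurable lebesgue"
      by (auto simp: set_integrable_def)
    show "(%t. indicat_real {0<..T} t *\<^sub>R K n t) \<in> borel_measurable lebesgue" for n using KT(1)[of n] by (auto simp: set_integrable_def)
    show "integrable lebesgue (%t. c * Mw * (indicator {0..T} t *\<^sub>R h1 t) + c * Mu * (indicator {0..T} t *\<^sub>R h2 t))"
      using h1(1) h2(1) unfolding set_integrable_def by (intro Bochner_Integration.integrable_add integrable_mult_right)
    show "AE t in lebesgue. norm (indicat_real {0<..T} t *\<^sub>R K n t) \<le> c * Mw * (indicator {0..T} t *\<^sub>R h1 t) + c * Mu * (indicator {0..T} t *\<^sub>R h2 t)" for n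
      unfolding AE_completion_iff using h1(2) h2(2) utV
    proof eventually_elim
      case (elim t)
      show ?case
      proof (cases "t \<in> {0<..T}")
        case True
        then have t: "t \<in> {0..T}" by auto
        note g = grid[OF True, of n]
        have "\<bar>?E (ut t) (w (up n t))\<bar> \<le> c * V_norm L (ut t) * V_norm L (w (up n t))" using elim t g by (intro c wV) auto
        also have "... \<le> c * h1 t * Mw" using elim t g c(1) Mw V_norm_nonneg[of L "ut t"] V_norm_nonneg[of L "w (up n t)"]
          by (intro mult_mono) (auto intro: order_trans)
        finally have 1: "\<bar>?E (ut t) (w (up n t))\<bar> \<le> c * Mw * h1 t" by (simp add: mult_ac)
        have "\<bar>?E (wt t) (u (lo n t))\<bar> \<le> c * V_norm L (wt t) * V_norm L (u (lo n t))" using elim t g by (intro c uV) auto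
        also have "... \<le> c * h2 t * Mu" using elim t g c(1) Mu V_norm_nonneg[of L "wt t"] V_norm_nonneg[of L "u (lo n t)"]
          by (intro mult_mono) (auto intro: order_trans)
        finally have 2: "\<bar>?E (wt t) (u (lo n t))\<bar> \<le> c * Mu * h2 t" by (simp add: mult_ac)
        show ?thesis using 1 2 True t by (simp add: K_def)
      next
        case False
        have "0 \<le> c * Mw * h1 t" "0 \<le> c * Mu * h2 t" if "t \<in> {0..T}"
          using elim that c Mw Mu V_norm_nonneg[of L "ut t"] V_norm_nonneg[of L "wt t"] by (auto intro!: mult_nonneg_nonneg intro: order_trans)
        then show ?thesis using False by (auto simp: indicator_def)
      qed
    qed
    show "AE t in lebesgue. (%n. indicat_real {0<..T} t *\<^sub>R K n t) \<longlonglongrightarrow> indicat_real {0<..T} t *\<^sub>R (?E (ut t) (w t) + ?E (wt t) (u t))"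
      unfolding AE_completion_iff using utV
    proof eventually_elim
      case (elim t)
      show ?case
      proof (cases "t \<in> {0<..T}")
        case True
        then have t: "t \<in> {0..T}" by auto
        note g = grid[OF True]
        have uplim: "(%n. up n t) \<longlonglongrightarrow> t"
        proof (rule tendsto_sandwich[of "%_. t" _ _ "%n. t + h n"])
          show "(%n. t + h n) \<longlonglongrightarrow> t" using tendsto_add[OF tendsto_const[of t] hlim] by simp
        qed (use g in \<open>auto intro!: always_eventually less_imp_le\<close>)
        have lolim: "(%n. lo n t) \<longlonglongrightarrow> t" unfolding lo_def using tendsto_diff[OF uplim hlim] by simp
        have E: "(%n. ?E f (v (s n))) \<longlonglongrightarrow> ?E f (v t)" if f: "f \<in> V_space L" and v: "evolution L T v vt" and s: "\<And>n. s n \<in> {0..T}" "s \<longlonglongrightarrow> t" for f v vt s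
        proof -
          have lim: "(%n. c * V_norm L f * V_norm L (%x. v (s n) x - v t x)) \<longlonglongrightarrow> 0"
            using tendsto_mult[OF tendsto_const evolution_sequence[OF v t s], of "c * V_norm L f"] by simp
          have "(%n. ?E f (v (s n)) - ?E f (v t)) \<longlonglongrightarrow> 0"
          proof (rule Lim_null_comparison[OF always_eventually lim], rule allI)
            fix n
            note V = evolution_V[OF v s(1)[of n]] evolution_V[OF v t]
            show "norm (?E f (v (s n)) - ?E f (v t)) \<le> c * V_norm L f * V_norm L (%x. v (s n) x - v t x)"
              using c(2)[OF f V_space_diff(1)[OF V]] energy_diff(1)[OF f V, of \<mu>] by simp
          qed
          then show ?thesis by (simp add: LIM_zero_iff)
        qed
        have "(%n. K n t) \<longlonglongrightarrow> ?E (ut t) (w t) + ?E (wt t) (u t)"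
          unfolding K_def using elim t g by (intro tendsto_add E[OF _ w] E[OF _ u] uplim lolim) auto
        then show ?thesis by (intro tendsto_scaleR tendsto_const)
      qed simp
    qed
  qed
  then have "(LINT t:{0<..T}|lebesgue. ?E (ut t) (w t) + ?E (wt t) (u t)) = ?E (u T) (w T) - ?E (u 0) (w 0)"
    unfolding KT(2) by (simp add: LIMSEQ_const_iff)
  moreover have "(LINT t:{0..T}|lebesgue. ?E (ut t) (w t) + ?E (wt t) (u t)) = (LINT t:{0<..T}|lebesgue. ?E (ut t) (w t) + ?E (wt t) (u t))"
  proof -
    have n0: "AE t in lebesgue. t \<noteq> (0::real)" unfolding AE_completion_iff by (rule AE_lborel_singleton)
    have i: "set_integrable lebesgue {0..T} (%t. ?E (ut t) (w t) + ?E (wt t) (u t))"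
      by (rule set_integral_add(1)[OF stV_energy(1)[OF sV(2,3)] stV_energy(1)[OF sV(4,1)]])
    have i': "set_integrable lebesgue {0<..T} (%t. ?E (ut t) (w t) + ?E (wt t) (u t))" by (rule set_integrable_subset[OF i]) auto
    show ?thesis unfolding set_lebesgue_integral_def
      by (rule integral_cong_AE) (use i i' n0 in \<open>auto simp: set_integrable_def indicator_def elim: eventually_mono\<close>)
  qed
  ultimately show ?thesis by simp
qed

lemma L2_time_stV:
  assumes S: "sobolev_embedding L C" and f: "f \<in> L2_time T (Suc k) X N" and X: "X \<subseteq> V_space L"
    and N: "\<And>v. V_norm L v \<le> N v"
  shows "stV L T f"
proof -
  obtain c where c: "0 \<le> c" "\<And>v. v \<in> V_space L ==> H_norm L v \<le> c * V_norm L v" using poincare[OF S] by blast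
  have m: "jointly_measurable T f" "\<And>j. \<exists>g. meas_Hk T k g \<and> (AE t\<in>{0<..<T} in lebesgue. weak_partial j (f t) (g t))"
    and i: "set_integrable lebesgue {0..T} (%t. (N (f t))^2)"
    using f unfolding L2_time_def by auto
  have "AE t\<in>{0..T} in lborel. f t \<in> X" using f unfolding L2_time_def AE_time_iff by auto
  then have fX: "AE t\<in>{0..T} in lborel. f t \<in> V_space L" by eventually_elim (use X in auto)
  have VN: "(V_norm L v)^2 \<le> (N v)^2" for v using N V_norm_nonneg by (intro power_mono) auto
  have "st_sq L T f"
  proof (rule st_sqI[OF m(1)])
    show "AE t\<in>{0..T} in lborel. loc_sq (f t)" using fX by eventually_elim (auto dest: V_spaceD(2))
    show "AE t\<in>{0..T} in lborel. ip L (f t) (f t) \<le> c^2 * (N (f t))^2" using fX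
    proof eventually_elim
      case (elim t)
      show ?case
      proof
        assume "t \<in> {0..T}"
        then have v: "f t \<in> V_space L" using elim by simp
        have "ip L (f t) (f t) = (H_norm L (f t))^2" by (simp add: H_norm_sq)
        also have "... \<le> (c * V_norm L (f t))^2" using c(2)[OF v] H_norm_nonneg by (intro power_mono)
        also have "... \<le> c^2 * (N (f t))^2" unfolding power_mult_distrib by (intro mult_left_mono VN) simp
        finally show "ip L (f t) (f t) \<le> c^2 * (N (f t))^2" .
      qed
    qed
    show "set_integrable lebesgue {0..T} (%t. c^2 * (N (f t))^2)" using i by (intro set_integrable_mult_right) auto
  qed
  moreover have "\<exists>G. st_sq L T G \<and> (AE t\<in>{0..T} in lborel. weak_partial j (f t) (G t))" for j
  proof -
    obtain G where G: "meas_Hk T k G" "AE t\<in>{0..T} in lborel. weak_partial j (f t) (G t)" using m(2)[of j] unfolding AE_time_iff by blast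
    have jG: "jointly_measurable T G" using G(1) by (cases k) auto
    have "st_sq L T G"
    proof (rule st_sqI[OF jG])
      show "AE t\<in>{0..T} in lborel. loc_sq (G t)" using fX G(2)
      proof eventually_elim
        case (elim t)
        show ?case
        proof
          assume "t \<in> {0..T}"
          then have v: "f t \<in> V_space L" and w: "weak_partial j (f t) (G t)" using elim by auto
          show "loc_sq (G t)" by (rule loc_sq_cong_AE[OF V_spaceD(4)[OF v] _ wD_eq(2)[OF w]]) (rule loc_intD(1)[OF weak_partialD(2)[OF w]])
        qed
      qed
      show "AE t\<in>{0..T} in lborel. ip L (G t) (G t) \<le> (N (f t))^2" using G(2)
      proof eventually_elim
        case (elim t)
        show ?case
        proof
          assume "t \<in> {0..T}"
          then have w: "weak_partial j (f t) (G t)" using elim by auto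
          have "ip L (G t) (G t) = ip L (wD j (f t)) (wD j (f t))" by (rule ip_wD_eq[OF w w, symmetric])
          also have "... \<le> grad_ip L (f t) (f t)" unfolding grad_ip_def by (rule member_le_sum) (auto simp: ip_nonneg)
          also have "... \<le> (N (f t))^2" using VN[of "f t"] by (simp add: V_norm_sq)
          finally show "ip L (G t) (G t) \<le> (N (f t))^2" .
        qed
      qed
    qed (rule i)
    then show ?thesis using G(2) by blast
  qed
  ultimately show ?thesis using fX unfolding stV_def by blast
qed

lemma H1_time_evolution:
  assumes S: "sobolev_embedding L C" and H: "H1_time T (Suc k) X N u ut" and X: "X \<subseteq> V_space L"
    and N: "\<And>v. V_norm L v \<le> N v"
  shows "evolution L T u ut"
proof -
  have N0: "0 \<le> N v" for v using N[of v] V_norm_nonneg[of L v] by linarith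
  have st: "stV L T f" if "f \<in> L2_time T (Suc k) X N" for f by (rule L2_time_stV[OF S that X N])
  have L2: "u \<in> L2_time T (Suc k) X N" "ut \<in> L2_time T (Suc k) X N" using H by (auto simp: H1_time_def)
  have cont: "((%t. V_norm L (%x. u t x - u s x)) \<longlongrightarrow> 0) (at s within {0..T})" if "s \<in> {0..T}" for s
  proof (rule Lim_null_comparison)
    show "((%t. N (%x. u t x - u s x)) \<longlongrightarrow> 0) (at s within {0..T})" using H that by (auto simp: H1_time_def)
    show "\<forall>\<^sub>F t in at s within {0..T}. norm (V_norm L (%x. u t x - u s x)) \<le> N (%x. u t x - u s x)"
      using N by (intro always_eventually allI) (simp add: V_norm_nonneg)
  qed
  have dom: "\<exists>h. set_integrable lebesgue {0..T} h \<and> (AE t\<in>{0..T} in lborel. V_norm L (ut t) \<le> h t)"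
  proof (intro exI conjI)
    have "set_integrable lebesgue {0..T} (%t. (N (ut t))^2)" using L2(2) by (simp add: L2_time_def)
    moreover have "set_integrable lebesgue {0..T} (%t. 1::real)"
      unfolding set_integrable_def by (auto intro!: integrable_real_indicator simp: emeasure_lborel_Icc_eq)
    ultimately show "set_integrable lebesgue {0..T} (%t. 1 + (N (ut t))^2)" by (intro set_integral_add)
    have "V_norm L v \<le> 1 + (N v)^2" for v using N[of v] sum_squares_bound[of "N v" 1] N0[of v] unfolding power_one by linarith
    then show "AE t\<in>{0..T} in lborel. V_norm L (ut t) \<le> 1 + (N (ut t))^2" by simp
  qed
  have "\<forall>t\<in>{0..T}. u t \<in> V_space L" using H X by (auto simp: H1_time_def)
  moreover have "\<forall>psi. test_function {0<..<T} psi \<longrightarrow> (AE x in lborel. ti T (deriv psi) u x = - ti T psi ut x)"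
    using H unfolding H1_time_def ti_def by blast
  ultimately show ?thesis unfolding evolution_def using st[OF L2(1)] st[OF L2(2)] cont dom by blast
qed

lemma V_norm_le_H2_norm: "V_norm L v \<le> H2_norm L v"
  unfolding V_norm_def H2_norm_def by (rule real_sqrt_le_mono) (simp add: ip_nonneg add_nonneg_nonneg sum_nonneg grad_ip_nonneg)

text \<open>
  The exceptional null set depends on the test field. It is common to the countably many fields \<open>c q\<close> with rational \<open>q\<close>, and
  \<open>c t\<close> is a limit of these, on which \<open>\<Phi> t\<close> depends continuously.
\<close>

lemma AE_test_swap:
  assumes T: "0 < T" and c: "evolution L T c ct"
    and cont: "AE t\<in>{0..T} in lborel. \<exists>M. \<forall>v\<in>V_space L. \<forall>v'\<in>V_space L. \<bar>\<Phi> t v - \<Phi> t v'\<bar> \<le> M * V_norm L (%x. v x - v' x)"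
    and zero: "\<And>v. v \<in> V_space L ==> AE t\<in>{0..T} in lborel. \<Phi> t v = 0"
  shows "AE t\<in>{0..T} in lborel. \<Phi> t (c t) = (0::real)"
proof -
  have "AE t in lborel. \<forall>q::rat. of_rat q \<in> {0..T} \<longrightarrow> t \<in> {0..T} \<longrightarrow> \<Phi> t (c (of_rat q)) = 0"
    unfolding AE_all_countable
  proof
    fix q :: rat
    show "AE t in lborel. of_rat q \<in> {0..T} \<longrightarrow> t \<in> {0..T} \<longrightarrow> \<Phi> t (c (of_rat q)) = 0"
      using zero[OF evolution_V[OF c]] by (cases "of_rat q \<in> {0..T}") auto
  qed
  moreover have "AE t in lborel. t \<noteq> T" by (rule AE_lborel_singleton)
  ultimately show ?thesis using cont
  proof eventually_elim
    case (elim t)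
    show ?case
    proof
      assume t: "t \<in> {0..T}"
      obtain M where M: "\<And>v v'. v \<in> V_space L ==> v' \<in> V_space L ==> \<bar>\<Phi> t v - \<Phi> t v'\<bar> \<le> M * V_norm L (%x. v x - v' x)"
        using elim t by blast
      have tT: "t < T" using elim t by auto
      have "\<exists>q::rat. t < of_rat q \<and> of_rat q < min T (t + 1 / real (Suc n))" for n
        using of_rat_dense[of t "min T (t + 1 / real (Suc n))"] tT by auto
      then obtain q :: "nat => rat" where q: "\<And>n. t < of_rat (q n)" "\<And>n. of_rat (q n) < min T (t + 1 / real (Suc n))" by metis
      have qT: "(of_rat (q n) :: real) \<in> {0..T}" for n
      proof -
        have "0 \<le> t" using t by simp
        moreover have "of_rat (q n) < T" using q(2)[of n] by (rule less_le_trans) simp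
        ultimately have "0 \<le> (of_rat (q n) :: real)" "(of_rat (q n) :: real) \<le> T" using q(1)[of n] by linarith+
        then show ?thesis unfolding atLeastAtMost_iff by (rule conjI)
      qed
      have ql: "(%n. of_rat (q n) :: real) \<longlonglongrightarrow> t"
      proof (rule tendsto_sandwich[of "%_. t" _ _ "%n. t + 1 / real (Suc n)"])
        show "(%n. t + 1 / real (Suc n)) \<longlonglongrightarrow> t"
          using tendsto_add[OF tendsto_const[of t] LIMSEQ_inverse_real_of_nat] by (simp add: inverse_eq_divide)
      qed (use q in \<open>auto intro!: always_eventually less_imp_le\<close>)
      have lim: "(%n. M * V_norm L (%x. c (of_rat (q n)) x - c t x)) \<longlonglongrightarrow> 0"
        using tendsto_mult[OF tendsto_const evolution_sequence[OF c t qT ql], of M] by simp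
      have "\<bar>\<Phi> t (c t)\<bar> \<le> M * V_norm L (%x. c (of_rat (q n)) x - c t x)" for n
        using M[OF evolution_V[OF c qT[of n]] evolution_V[OF c t]] elim qT[of n] t by auto
      then have "\<bar>\<Phi> t (c t)\<bar> \<le> 0" by (intro LIMSEQ_le_const[OF lim]) auto
      then show "\<Phi> t (c t) = 0" by simp
    qed
  qed
qed

section \<open>Pointwise bounds and the weight of the adjoint state\<close>

lemma L2V_stV:
  assumes S: "sobolev_embedding L C" and f: "f \<in> L2V L T"
  shows "stV L T f"
  by (rule L2_time_stV[OF S f[unfolded L2V_def One_nat_def]]) auto

lemma L2H_st_sq:
  assumes f: "f \<in> L2H L T"
  shows "st_sq L T f" "AE t\<in>{0..T} in lborel. solenoidal L (f t) \<and> loc_sq (f t)"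
proof -
  have "AE t\<in>{0..T} in lborel. f t \<in> H_space L" using f unfolding L2H_def L2_time_def AE_time_iff by auto
  then show H: "AE t\<in>{0..T} in lborel. solenoidal L (f t) \<and> loc_sq (f t)" by eventually_elim (simp add: H_space_def locally_Lp_2_iff)
  show "st_sq L T f"
  proof (rule st_sqI)
    show "jointly_measurable T f" using f by (simp add: L2H_def L2_time_def)
    show "AE t\<in>{0..T} in lborel. loc_sq (f t)" using H by eventually_elim auto
    show "AE t\<in>{0..T} in lborel. ip L (f t) (f t) \<le> (H_norm L (f t))^2" by (simp add: H_norm_sq)
    show "set_integrable lebesgue {0..T} (%t. (H_norm L (f t))^2)" using f by (simp add: L2H_def L2_time_def)
  qed
qed

lemma AE_lebesgue_on_borel:
  fixes A :: "'a::euclidean_space set"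
  assumes A: "A \<in> sets borel"
  shows "(AE x in lebesgue_on A. P x) \<longleftrightarrow> (AE x in lebesgue. x \<in> A \<longrightarrow> P x)"
  by (rule AE_restrict_space_iff) (use A in auto)

text \<open>
  The \<open>L\<^sup>\<infinity>\<close> norm is taken over the cell; periodicity extends the bound to space.
\<close>

lemma H2_bound_imp_sup_bound:
  assumes L: "0 < L" and v: "v \<in> H2_space L" and c: "0 < Cstar" "Linf_norm L v \<le> ereal (Cstar * H2_norm L v)"
    and b: "(H2_norm L v)^2 \<le> C2"
  shows "AE x in lborel. norm (v x) \<le> Cstar * sqrt C2"
proof -
  have V: "v \<in> V_space L" using v H2_space_subset_V_space by blast
  have "H2_norm L v \<le> sqrt C2" using b by (rule real_le_rsqrt)
  then have "Cstar * H2_norm L v \<le> Cstar * sqrt C2" using c(1) by (intro mult_left_mono) auto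
  then have le: "Linf_norm L v \<le> ereal (Cstar * sqrt C2)" using c(2) order_trans by fastforce
  have "AE x in lebesgue_on (cell L). ereal (norm (v x)) \<le> Linf_norm L v" unfolding Linf_norm_def by (rule esssup_AE)
  then have "AE x in lebesgue_on (cell L). norm (v x) \<le> Cstar * sqrt C2" by eventually_elim (use le order_trans in fastforce)
  then have "AE x in lborel. x \<in> cell L \<longrightarrow> norm (v x) \<le> Cstar * sqrt C2"
    unfolding AE_lebesgue_on_borel[OF cell_measurable] AE_completion_iff .
  then show ?thesis by (rule AE_periodic_bound[OF L solenoidalD(2)[OF V_spaceD(1)[OF V]] loc_sqD(1)[OF V_spaceD(2)[OF V]]])
qed

text \<open>
  For \<open>r = 1\<close> the damping is linear. Otherwise this is \<open>p^2 + 3 p\<close> with \<open>p = r - 1\<close>, which is 4 for \<open>r = 2\<close>.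
\<close>

definition remainder_const :: "real => real" where
  "remainder_const r = (if r = 1 then 0 else (r - 1)^2 + 3 * (r - 1))"

lemma remainder_const_nonneg: "1 \<le> r ==> 0 \<le> remainder_const r"
  by (simp add: remainder_const_def)

lemma damping_remainder_pointwise:
  fixes a b :: "real^3"
  assumes r: "r = 1 \<or> 2 \<le> r" and a: "norm a \<le> M" and b: "norm b \<le> M"
  shows "norm (damping r a - damping r b - damping_deriv r b (a - b)) \<le> remainder_const r * M powr (r - 2) * (norm (a - b))^2"
proof (cases "r = 1")
  case True
  then show ?thesis by (cases "a = 0"; cases "b = 0") (auto simp: damping_def damping_deriv_def remainder_const_def)
next
  case False
  then show ?thesis using damping_remainder[OF _ a b, of r] r by (simp add: remainder_const_def)
qed

text \<open>
  The threshold contains essential suprema in time, which bound the weight at almost every time. Together with \<open>2 Cr = p^2 + 3 p\<close> the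
  three cases of its definition take a common form.
\<close>

lemma adjoint_weight_le_threshold:
  assumes r: "r = 1 \<or> 2 \<le> r" and C: "0 < C" and M: "0 < M" and beta: "0 < \<beta>" and T: "0 < T"
    and Cr: "2 < r ==> 2 * Cr = remainder_const r"
    and q: "threshold L T r \<beta> C Cr M \<phi> \<le> ereal q"
  shows "AE t\<in>{0..T} in lborel. C * (V_norm L (\<phi> t) + \<beta> * (remainder_const r * M powr (r - 2)) * H_norm L (\<phi> t)) \<le> q"
proof -
  let ?c = "\<beta> * (remainder_const r * M powr (r - 2))"
  have c: "0 \<le> ?c" using r beta remainder_const_nonneg[of r] by auto
  have AEs: "AE t in lebesgue_on {0<..<T}. ereal (N (\<phi> t)) \<le> Linf_time_norm T N \<phi>" for N
    unfolding Linf_time_norm_def by (rule esssup_AE)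
  have "AE t in lebesgue_on {0<..<T}. C * (V_norm L (\<phi> t) + ?c * H_norm L (\<phi> t)) \<le> q" using AEs[of "V_norm L"] AEs[of "H_norm L"]
  proof eventually_elim
    case (elim t)
    have eq: "ereal (C * (V_norm L (\<phi> t) + ?c * H_norm L (\<phi> t))) = ereal C * (ereal (V_norm L (\<phi> t)) + ereal ?c * ereal (H_norm L (\<phi> t)))"
      by simp
    have "... \<le> ereal C * (Linf_time_norm T (V_norm L) \<phi> + ereal ?c * Linf_time_norm T (H_norm L) \<phi>)"
      using C c by (intro ereal_mult_left_mono add_mono elim) auto
    also have "... = threshold L T r \<beta> C Cr M \<phi>"
    proof -
      consider "r = 1" | "r = 2" | "2 < r" using r by linarith
      then show ?thesis
      proof cases
        case 1 then show ?thesis by (simp add: threshold_def remainder_const_def flip: zero_ereal_def)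
      next
        case 2
        then have "?c = 4 * \<beta>" using M by (simp add: remainder_const_def)
        then show ?thesis using 2 by (simp only: threshold_def) simp
      next
        case 3
        then have "?c = 2 * \<beta> * Cr * M powr (r - 2)" using Cr[symmetric] by simp
        then show ?thesis using 3 by (simp only: threshold_def) simp
      qed
    qed
    also have "... \<le> ereal q" by (rule q)
    finally show ?case unfolding eq[symmetric] by simp
  qed
  then have "AE t\<in>{0<..<T} in lebesgue. C * (V_norm L (\<phi> t) + ?c * H_norm L (\<phi> t)) \<le> q" by (subst (asm) AE_lebesgue_on_borel) auto
  then show ?thesis unfolding AE_time_iff .
qed

section \<open>State and adjoint equations with time dependent test fields\<close>

text \<open>
  The continuity that \<open>AE_test_swap\<close> asks for. All terms of both equations are linear in the test field, so that a
  bounded functional is Lipschitz.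
\<close>

definition V_lipschitz :: "real => (field => real) => bool" where
  "V_lipschitz L \<Psi> \<longleftrightarrow> (\<exists>M. \<forall>v\<in>V_space L. \<forall>v'\<in>V_space L. \<bar>\<Psi> v - \<Psi> v'\<bar> \<le> M * V_norm L (%x. v x - v' x))"

lemma V_lipschitz_add: "V_lipschitz L \<Psi> ==> V_lipschitz L \<Psi>' ==> V_lipschitz L (%v. \<Psi> v + \<Psi>' v)"
proof -
  assume *: "V_lipschitz L \<Psi>" "V_lipschitz L \<Psi>'"
  obtain M where M: "\<forall>v\<in>V_space L. \<forall>v'\<in>V_space L. \<bar>\<Psi> v - \<Psi> v'\<bar> \<le> M * V_norm L (%x. v x - v' x)"
    using *(1) unfolding V_lipschitz_def by (rule exE)
  obtain M' where M': "\<forall>v\<in>V_space L. \<forall>v'\<in>V_space L. \<bar>\<Psi>' v - \<Psi>' v'\<bar> \<le> M' * V_norm L (%x. v x - v' x)"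
    using *(2) unfolding V_lipschitz_def by (rule exE)
  show ?thesis unfolding V_lipschitz_def
  proof (intro exI[of _ "M + M'"] ballI)
    fix v v' assume v: "v \<in> V_space L" "v' \<in> V_space L"
    show "\<bar>\<Psi> v + \<Psi>' v - (\<Psi> v' + \<Psi>' v')\<bar> \<le> (M + M') * V_norm L (%x. v x - v' x)"
      using M[rule_format, OF v] M'[rule_format, OF v] unfolding distrib_right by linarith
  qed
qed

lemma V_lipschitz_cmult: "V_lipschitz L \<Psi> ==> V_lipschitz L (%v. c * \<Psi> v)"
proof -
  assume "V_lipschitz L \<Psi>"
  then obtain M where M: "\<forall>v\<in>V_space L. \<forall>v'\<in>V_space L. \<bar>\<Psi> v - \<Psi> v'\<bar> \<le> M * V_norm L (%x. v x - v' x)"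
    unfolding V_lipschitz_def by (rule exE)
  show ?thesis unfolding V_lipschitz_def
  proof (intro exI[of _ "\<bar>c\<bar> * M"] ballI)
    fix v v' assume v: "v \<in> V_space L" "v' \<in> V_space L"
    show "\<bar>c * \<Psi> v - c * \<Psi> v'\<bar> \<le> \<bar>c\<bar> * M * V_norm L (%x. v x - v' x)"
      using mult_left_mono[OF M[rule_format, OF v], of "\<bar>c\<bar>"] by (simp add: abs_mult mult.assoc flip: right_diff_distrib)
  qed
qed

lemma V_lipschitz_minus: "V_lipschitz L \<Psi> ==> V_lipschitz L (%v. - \<Psi> v)"
  using V_lipschitz_cmult[of L \<Psi> "-1"] by simp

lemma V_lipschitz_diff: "V_lipschitz L \<Psi> ==> V_lipschitz L \<Psi>' ==> V_lipschitz L (%v. \<Psi> v - \<Psi>' v)"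
  using V_lipschitz_add[OF _ V_lipschitz_minus, of L \<Psi> \<Psi>'] by simp

lemma V_lipschitz_ip:
  assumes S: "sobolev_embedding L C" and F: "loc_sq F"
  shows "V_lipschitz L (ip L F)"
proof -
  obtain c where c: "0 \<le> c" "\<And>v. v \<in> V_space L ==> H_norm L v \<le> c * V_norm L v" using poincare[OF S] by blast
  show ?thesis unfolding V_lipschitz_def
  proof (intro exI[of _ "H_norm L F * c"] ballI)
    fix v v' assume v: "v \<in> V_space L" "v' \<in> V_space L"
    note d = V_space_diff(1)[OF v]
    have "\<bar>ip L F v - ip L F v'\<bar> = \<bar>ip L F (%x. v x - v' x)\<bar>"
      by (simp add: ip_diff_right[OF F V_spaceD(2)[OF v(1)] V_spaceD(2)[OF v(2)]])
    also have "... \<le> H_norm L F * H_norm L (%x. v x - v' x)" by (rule ip_Cauchy_Schwarz[OF F V_spaceD(2)[OF d]])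
    also have "... \<le> H_norm L F * (c * V_norm L (%x. v x - v' x))" by (intro mult_left_mono c d H_norm_nonneg)
    finally show "\<bar>ip L F v - ip L F v'\<bar> \<le> H_norm L F * c * V_norm L (%x. v x - v' x)" by (simp add: mult.assoc)
  qed
qed

lemma V_lipschitz_grad_ip:
  assumes g: "g \<in> V_space L"
  shows "V_lipschitz L (grad_ip L g)"
  unfolding V_lipschitz_def
proof (intro exI[of _ "V_norm L g"] ballI)
  fix v v' assume v: "v \<in> V_space L" "v' \<in> V_space L"
  show "\<bar>grad_ip L g v - grad_ip L g v'\<bar> \<le> V_norm L g * V_norm L (%x. v x - v' x)"
    using grad_ip_Cauchy_Schwarz[OF g V_space_diff(1)[OF v]] unfolding grad_ip_diff_right[OF g v] .
qed

lemma V_lipschitz_trilinear: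
  assumes S: "sobolev_embedding L C" and u: "u \<in> V_space L" and w: "w \<in> V_space L"
  shows "V_lipschitz L (%v. trilinear L v u w)" "V_lipschitz L (trilinear L u w)"
proof -
  have "\<bar>trilinear L v u w - trilinear L v' u w\<bar> \<le> C * V_norm L u * V_norm L w * V_norm L (%x. v x - v' x)"
    "\<bar>trilinear L u w v - trilinear L u w v'\<bar> \<le> C * V_norm L u * V_norm L w * V_norm L (%x. v x - v' x)"
    if v: "v \<in> V_space L" "v' \<in> V_space L" for v v'
    using trilinear_bound(2)[OF S V_space_diff(1)[OF v] u w] trilinear_bound(2)[OF S u w V_space_diff(1)[OF v]]
    unfolding trilinear_diff(1)[OF S v(1) u w v(2)] trilinear_diff(3)[OF S u w v] by (simp_all add: mult_ac)
  then show "V_lipschitz L (%v. trilinear L v u w)" "V_lipschitz L (trilinear L u w)" unfolding V_lipschitz_def by blast+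
qed

lemma loc_sq_damping:
  assumes r: "1 \<le> r" and u: "loc_sq u" and M: "AE x in lborel. norm (u x) \<le> M"
  shows "loc_sq (%x. damping r (u x))" "loc_sq w ==> loc_sq (%x. damping_deriv r (u x) (w x))"
proof -
  have [measurable]: "u \<in> borel_measurable borel" by (rule loc_sqD(1)[OF u])
  show "loc_sq (%x. damping r (u x))" by (rule loc_sq_bounded_mult[OF u, where B="M powr (r - 1)"])
      (measurable, use M in \<open>eventually_elim, auto intro: damping_bounds(1)[OF r]\<close>)
  assume w: "loc_sq w"
  note [measurable] = loc_sqD(1)[OF w]
  show "loc_sq (%x. damping_deriv r (u x) (w x))" by (rule loc_sq_bounded_mult[OF w, where B="(r - 1) * M powr (r - 1) + M powr (r - 1) + 1"])
      (rule measurable_damping_deriv, measurable, use M in \<open>eventually_elim, auto intro: damping_bounds(2)[OF r]\<close>)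
qed

text \<open>
  A pointwise bounded velocity makes \<open>(u \<bullet> \<nabla>) v\<close> square integrable, and \<open>b(u, v, \<cdot>)\<close> an inner product with a fixed field.
\<close>

lemma loc_sq_convection:
  assumes u: "u \<in> V_space L" and M: "AE x in lborel. norm (u x) \<le> M" and v: "v \<in> V_space L"
  shows "loc_sq (%x. \<Sum>j\<in>UNIV. (u x $ j) *\<^sub>R wD j v x)"
proof -
  note [measurable] = loc_sqD(1)[OF V_spaceD(2)[OF u]] loc_sqD(1)[OF V_spaceD(4)[OF v]]
  have D: "loc_sq (%x. sqrt (\<Sum>j\<in>UNIV. (norm (wD j v x))^2))" unfolding loc_sq_def
  proof (intro conjI allI impI)
    show "(%x. sqrt (\<Sum>j\<in>UNIV. (norm (wD j v x))^2)) \<in> borel_measurable borel" by measurable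
    fix K :: "(real^3) set" assume K: "compact K"
    show "set_integrable lborel K (%x. (norm (sqrt (\<Sum>j\<in>UNIV. (norm (wD j v x))^2)))^2)"
      using set_integral_sum(2)[of UNIV lborel K "%j x. (norm (wD j v x))^2"] loc_sqD(2)[OF V_spaceD(4)[OF v] K] by (simp add: sum_nonneg)
  qed
  show ?thesis
  proof (rule loc_sq_bounded_mult[OF D, where B=M])
    show "AE x in lborel. norm (\<Sum>j\<in>UNIV. (u x $ j) *\<^sub>R wD j v x) \<le> M * norm (sqrt (\<Sum>j\<in>UNIV. (norm (wD j v x))^2))" using M
    proof eventually_elim
      case (elim x)
      have "norm (\<Sum>j\<in>UNIV. (u x $ j) *\<^sub>R wD j v x) \<le> norm (u x) * sqrt (\<Sum>j\<in>UNIV. (norm (wD j v x))^2)"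
        by (rule convection_pointwise(2))
      also have "... \<le> M * sqrt (\<Sum>j\<in>UNIV. (norm (wD j v x))^2)" using elim by (intro mult_right_mono) (auto simp: sum_nonneg)
      finally show ?case by (simp add: sum_nonneg)
    qed
  qed measurable
qed

definition state_residual ::
  "real => real => real => real => real => real => field => field => field => field => real" where
  "state_residual L \<mu> \<nu> \<alpha> \<beta> r U u ut v = ip L ut v + \<mu> * grad_ip L ut v + \<nu> * grad_ip L u v
     + trilinear L u u v + \<alpha> * ip L u v + \<beta> * ip L (%x. damping r (u x)) v - ip L U v"

lemma state_residual_continuous:
  assumes S: "sobolev_embedding L C" and r: "1 \<le> r" and u: "u \<in> V_space L" and ut: "ut \<in> V_space L"
    and U: "loc_sq U" and M: "AE x in lborel. norm (u x) \<le> M"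
  shows "V_lipschitz L (state_residual L \<mu> \<nu> \<alpha> \<beta> r U u ut)"
    "v \<in> V_space L ==> ((%e. state_residual L \<mu> \<nu> \<alpha> \<beta> r U u ut (mollify e v)) \<longlongrightarrow> state_residual L \<mu> \<nu> \<alpha> \<beta> r U u ut v) (at_right 0)"
proof -
  note sq = V_spaceD(2)[OF ut] V_spaceD(2)[OF u] loc_sq_damping(1)[OF r V_spaceD(2)[OF u] M] U
  show "V_lipschitz L (state_residual L \<mu> \<nu> \<alpha> \<beta> r U u ut)" unfolding state_residual_def
    by (intro V_lipschitz_diff V_lipschitz_add V_lipschitz_cmult V_lipschitz_ip[OF S] V_lipschitz_grad_ip V_lipschitz_trilinear(2)[OF S] sq u ut)
  assume v: "v \<in> V_space L"
  have L: "0 < L" using S by (simp add: sobolev_embedding_def)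
  note lim = mollify_ip_limit[OF _ V_spaceD(2)[OF v]]
  show "((%e. state_residual L \<mu> \<nu> \<alpha> \<beta> r U u ut (mollify e v)) \<longlongrightarrow> state_residual L \<mu> \<nu> \<alpha> \<beta> r U u ut v) (at_right 0)"
    unfolding state_residual_def trilinear_def by (intro tendsto_intros lim sq mollify_grad_ip_limit[OF L _ v] u ut loc_sq_convection[OF u M])
qed

text \<open>
  Mollified test fields lie in every \<open>L\<^sup>p\<close>. Along a sequence of mollifications the equation passes to the limit at almost
  every time, hence holds for all of \<open>V\<close>, and then also for the time dependent field \<open>c\<close>.
\<close>

lemma strong_solution_tested_by:
  assumes S: "sobolev_embedding L C" and r: "1 \<le> r" and T: "0 < T"
    and u: "evolution L T u ut" and U: "AE t\<in>{0..T} in lborel. loc_sq (U t)"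
    and M: "AE t\<in>{0..T} in lborel. AE x in lborel. norm (u t x) \<le> M"
    and eq: "\<And>v. v \<in> V_space L \<inter> Lp_space L (r + 1) ==> AE t\<in>{0..T} in lborel. state_residual L \<mu> \<nu> \<alpha> \<beta> r (U t) (u t) (ut t) v = 0"
    and c: "evolution L T c ct"
  shows "AE t\<in>{0..T} in lborel. state_residual L \<mu> \<nu> \<alpha> \<beta> r (U t) (u t) (ut t) (c t) = 0"
proof (rule AE_test_swap[OF T c])
  have L: "0 < L" using S by (simp add: sobolev_embedding_def)
  have utV: "AE t\<in>{0..T} in lborel. ut t \<in> V_space L" using u by (simp add: evolution_def stV_def)
  show "AE t\<in>{0..T} in lborel. \<exists>M. \<forall>v\<in>V_space L. \<forall>v'\<in>V_space L.
      \<bar>state_residual L \<mu> \<nu> \<alpha> \<beta> r (U t) (u t) (ut t) v - state_residual L \<mu> \<nu> \<alpha> \<beta> r (U t) (u t) (ut t) v'\<bar> \<le> M * V_norm L (%x. v x - v' x)"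
    using utV U M by eventually_elim (use state_residual_continuous(1)[OF S r] evolution_V[OF u] in \<open>auto simp: V_lipschitz_def\<close>)
  fix v assume v: "v \<in> V_space L"
  define e where "e n = L / real (n + 2)" for n
  have e: "0 < e n" "e n \<le> L" for n using L by (auto simp: e_def field_simps)
  have e0: "filterlim e (at_right 0) sequentially" unfolding filterlim_at
  proof
    show "\<forall>\<^sub>F n in sequentially. e n \<in> {0<..} \<and> e n \<noteq> 0" using e(1) less_imp_neq by (intro always_eventually) fastforce
    show "e \<longlonglongrightarrow> 0" unfolding e_def using LIMSEQ_ignore_initial_segment[OF lim_const_over_n[of L], of 2] by simp
  qed
  have "mollify (e n) v \<in> V_space L \<inter> Lp_space L (r + 1)" for n
    using mollify_in_V_space[OF L V_spaceD(1)[OF v] V_spaceD(2)[OF v] e(1)[of n] e(2)[of n]] r by auto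
  then have "AE t in lborel. \<forall>n. t \<in> {0..T} \<longrightarrow> state_residual L \<mu> \<nu> \<alpha> \<beta> r (U t) (u t) (ut t) (mollify (e n) v) = 0"
    unfolding AE_all_countable using eq by blast
  then show "AE t\<in>{0..T} in lborel. state_residual L \<mu> \<nu> \<alpha> \<beta> r (U t) (u t) (ut t) v = 0" using utV U M
  proof eventually_elim
    case (elim t)
    show ?case
    proof
      assume t: "t \<in> {0..T}"
      have "(%n. state_residual L \<mu> \<nu> \<alpha> \<beta> r (U t) (u t) (ut t) (mollify (e n) v)) \<longlonglongrightarrow> state_residual L \<mu> \<nu> \<alpha> \<beta> r (U t) (u t) (ut t) v"
        by (rule filterlim_compose[OF state_residual_continuous(2)[OF S r _ _ _ _ v] e0]) (use elim t evolution_V[OF u t] in auto)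
      then show "state_residual L \<mu> \<nu> \<alpha> \<beta> r (U t) (u t) (ut t) v = 0" using elim t by (simp add: LIMSEQ_const_iff)
    qed
  qed
qed

definition adjoint_residual ::
  "real => real => real => real => real => real => real => field => field => field => field => field => real" where
  "adjoint_residual L \<mu> \<nu> \<alpha> \<beta> r \<kappa> u g \<phi> \<phi>t v = - ip L \<phi>t v - \<mu> * grad_ip L \<phi>t v + \<nu> * grad_ip L \<phi> v
     + trilinear L v u \<phi> - trilinear L u \<phi> v + \<alpha> * ip L \<phi> v + \<beta> * ip L (%x. damping_deriv r (u x) (\<phi> x)) v
     - \<kappa> * grad_ip L g v"

lemma adjoint_tested_by:
  assumes S: "sobolev_embedding L C" and r: "1 \<le> r" and T: "0 < T"
    and u: "\<And>t. t \<in> {0..T} ==> u t \<in> V_space L" and g: "AE t\<in>{0..T} in lborel. g t \<in> V_space L"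
    and M: "AE t\<in>{0..T} in lborel. AE x in lborel. norm (u t x) \<le> M" and \<phi>: "evolution L T \<phi> \<phi>t"
    and eq: "\<And>v. v \<in> V_space L ==> AE t\<in>{0..T} in lborel. adjoint_residual L \<mu> \<nu> \<alpha> \<beta> r \<kappa> (u t) (g t) (\<phi> t) (\<phi>t t) v = 0"
    and c: "evolution L T c ct"
  shows "AE t\<in>{0..T} in lborel. adjoint_residual L \<mu> \<nu> \<alpha> \<beta> r \<kappa> (u t) (g t) (\<phi> t) (\<phi>t t) (c t) = 0"
proof (rule AE_test_swap[OF T c])
  have "AE t\<in>{0..T} in lborel. \<phi>t t \<in> V_space L" using \<phi> by (simp add: evolution_def stV_def)
  then show "AE t\<in>{0..T} in lborel. \<exists>M. \<forall>v\<in>V_space L. \<forall>v'\<in>V_space L.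
      \<bar>adjoint_residual L \<mu> \<nu> \<alpha> \<beta> r \<kappa> (u t) (g t) (\<phi> t) (\<phi>t t) v - adjoint_residual L \<mu> \<nu> \<alpha> \<beta> r \<kappa> (u t) (g t) (\<phi> t) (\<phi>t t) v'\<bar>
        \<le> M * V_norm L (%x. v x - v' x)" using g M
  proof eventually_elim
    case (elim t)
    show ?case
    proof
      assume t: "t \<in> {0..T}"
      note V = u[OF t] evolution_V[OF \<phi> t] elim[rule_format, OF t]
      have "V_lipschitz L (adjoint_residual L \<mu> \<nu> \<alpha> \<beta> r \<kappa> (u t) (g t) (\<phi> t) (\<phi>t t))"
        unfolding adjoint_residual_def
        by (intro V_lipschitz_diff V_lipschitz_add V_lipschitz_minus V_lipschitz_cmult V_lipschitz_ip[OF S] V_lipschitz_grad_ip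
            V_lipschitz_trilinear[OF S] V V_spaceD(2)[OF V(3)] V_spaceD(2)[OF V(2)] loc_sq_damping(2)[OF r V_spaceD(2)[OF V(1)] V(5)])
      then show "\<exists>M. \<forall>v\<in>V_space L. \<forall>v'\<in>V_space L.
        \<bar>adjoint_residual L \<mu> \<nu> \<alpha> \<beta> r \<kappa> (u t) (g t) (\<phi> t) (\<phi>t t) v - adjoint_residual L \<mu> \<nu> \<alpha> \<beta> r \<kappa> (u t) (g t) (\<phi> t) (\<phi>t t) v'\<bar>
          \<le> M * V_norm L (%x. v x - v' x)" unfolding V_lipschitz_def .
    qed
  qed
qed (rule eq)

section \<open>Growth of the cost\<close>

text \<open>
  By Cauchy--Schwarz the damping term is at most \<open>|R| |\<phi>|\<close> in \<open>L\<^sup>2\<close>, and the \<open>L\<^sup>2\<close> norm of \<open>|w|^2\<close> is the square of the \<open>L\<^sup>4\<close>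
  norm of \<open>w\<close>. This is why \<open>C\<close> multiplies both terms of the threshold.
\<close>

lemma remainder_estimate:
  assumes S: "sobolev_embedding L C" and r: "r = 1 \<or> 2 \<le> r" and beta: "0 \<le> \<beta>"
    and u: "u \<in> V_space L" and v: "v \<in> V_space L" and \<phi>: "\<phi> \<in> V_space L"
    and M: "AE x in lborel. norm (u x) \<le> M" "AE x in lborel. norm (v x) \<le> M"
  defines "w \<equiv> %x. u x - v x" and "R \<equiv> %x. damping r (u x) - damping r (v x) - damping_deriv r (v x) (u x - v x)"
  shows "\<bar>trilinear L w w \<phi> + \<beta> * ip L R \<phi>\<bar>
    \<le> C * (V_norm L \<phi> + \<beta> * (remainder_const r * M powr (r - 2)) * H_norm L \<phi>) * (V_norm L w)^2"
proof -
  let ?k = "remainder_const r * M powr (r - 2)"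
  have r1: "1 \<le> r" using r by linarith
  have k: "0 \<le> ?k" using remainder_const_nonneg[OF r1] by simp
  have w: "w \<in> V_space L" unfolding w_def by (rule V_space_diff(1)[OF u v])
  have R: "loc_sq R" unfolding R_def
    by (intro loc_sq_diff loc_sq_damping[OF r1 V_spaceD(2)[OF u] M(1)] loc_sq_damping[OF r1 V_spaceD(2)[OF v] M(2)] V_spaceD(2)[OF u] V_spaceD(2)[OF v])
  have C: "0 < C" using S by (simp add: sobolev_embedding_def)
  note sp = sobolev_product_bound[OF S w w]
  have "ip L R R \<le> (LINT x:cell L|lborel. ?k^2 * (norm (w x) * norm (w x))^2)" unfolding ip_def
  proof (rule set_integral_mono_AE[OF ip_integrable[OF R R]])
    show "set_integrable lborel (cell L) (%x. ?k^2 * (norm (w x) * norm (w x))^2)" using sp(1) by (intro set_integrable_mult_right)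
    show "AE x\<in>cell L in lborel. R x \<bullet> R x \<le> ?k^2 * (norm (w x) * norm (w x))^2" using M
    proof eventually_elim
      case (elim x)
      have "(norm (R x))^2 \<le> (?k * (norm (w x))^2)^2"
        unfolding R_def w_def using damping_remainder_pointwise[OF r elim] by (intro power_mono) auto
      also have "... = ?k^2 * (norm (w x) * norm (w x))^2" by (simp add: power2_eq_square mult_ac)
      finally show ?case unfolding power2_norm_eq_inner by (rule impI)
    qed
  qed
  also have "... = ?k^2 * (LINT x:cell L|lborel. (norm (w x) * norm (w x))^2)" by simp
  also have "... \<le> ?k^2 * (C * V_norm L w * V_norm L w)^2" by (intro mult_left_mono sp) auto
  also have "... = (?k * (C * (V_norm L w)^2))^2" by (simp add: power2_eq_square mult_ac)
  finally have HR: "H_norm L R \<le> ?k * (C * (V_norm L w)^2)"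
    unfolding H_norm_def using mult_nonneg_nonneg[OF k, of "C * (V_norm L w)^2"] C by (intro real_le_lsqrt) auto
  have "\<bar>\<beta> * ip L R \<phi>\<bar> \<le> \<beta> * (H_norm L R * H_norm L \<phi>)"
    unfolding abs_mult using beta ip_Cauchy_Schwarz[OF R V_spaceD(2)[OF \<phi>], of L] by (simp add: mult_left_mono)
  also have "... \<le> \<beta> * (?k * (C * (V_norm L w)^2) * H_norm L \<phi>)" by (intro mult_left_mono mult_right_mono HR H_norm_nonneg beta)
  finally have "\<bar>\<beta> * ip L R \<phi>\<bar> \<le> \<beta> * (?k * (C * (V_norm L w)^2) * H_norm L \<phi>)" .
  moreover have "\<bar>trilinear L w w \<phi>\<bar> \<le> C * V_norm L w * V_norm L w * V_norm L \<phi>" by (rule trilinear_bound(2)[OF S w w \<phi>])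
  ultimately have "\<bar>trilinear L w w \<phi> + \<beta> * ip L R \<phi>\<bar> \<le> C * V_norm L w * V_norm L w * V_norm L \<phi> + \<beta> * (?k * (C * (V_norm L w)^2) * H_norm L \<phi>)"
    by linarith
  also have "... = C * (V_norm L \<phi> + \<beta> * ?k * H_norm L \<phi>) * (V_norm L w)^2" by (simp add: power2_eq_square algebra_simps)
  finally show ?thesis .
qed

text \<open>
  The difference of the adjoint equation tested with \<open>u\<close> and with \<open>v\<close> is compared with the difference of the two state
  equations tested with \<open>\<phi>\<close>. The viscous and the linear terms cancel; so do the convective ones by
  \<open>b(u,u,\<phi>) - b(v,v,\<phi>) = b(w,v,\<phi>) + b(v,w,\<phi>) + b(w,w,\<phi>)\<close> and \<open>b(v,w,\<phi>) = - b(v,\<phi>,w)\<close>, up to \<open>b(w,w,\<phi>)\<close>; and the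
  damping ones up to \<open>R\<close>, as the derivative of the damping is symmetric.
\<close>

lemma cost_derivative_identity:
  assumes S: "sobolev_embedding L C" and r: "1 \<le> r"
    and u: "u \<in> V_space L" and v: "v \<in> V_space L" and \<phi>: "\<phi> \<in> V_space L" and g: "g \<in> V_space L"
    and sq: "loc_sq U" "loc_sq U'" and M: "AE x in lborel. norm (u x) \<le> M" "AE x in lborel. norm (v x) \<le> M"
    and adj: "adjoint_residual L \<mu> \<nu> \<alpha> \<beta> r \<kappa> v g \<phi> \<phi>t u = 0" "adjoint_residual L \<mu> \<nu> \<alpha> \<beta> r \<kappa> v g \<phi> \<phi>t v = 0"
    and st: "state_residual L \<mu> \<nu> \<alpha> \<beta> r U u ut \<phi> = 0" "state_residual L \<mu> \<nu> \<alpha> \<beta> r U' v vt \<phi> = 0"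
  defines "w \<equiv> %x. u x - v x" and "R \<equiv> %x. damping r (u x) - damping r (v x) - damping_deriv r (v x) (u x - v x)"
  shows "\<kappa> * grad_ip L g w = (energy \<mu> L vt \<phi> + energy \<mu> L \<phi>t v) - (energy \<mu> L ut \<phi> + energy \<mu> L \<phi>t u)
    + ip L (%x. U x - U' x) \<phi> - (trilinear L w w \<phi> + \<beta> * ip L R \<phi>)"
proof -
  have L: "0 < L" using S by (simp add: sobolev_embedding_def)
  have w: "w \<in> V_space L" unfolding w_def by (rule V_space_diff(1)[OF u v])
  note sqs = V_spaceD(2)[OF u] V_spaceD(2)[OF v] V_spaceD(2)[OF w] V_spaceD(2)[OF \<phi>]
  note dsq = loc_sq_damping(1)[OF r sqs(1) M(1)] loc_sq_damping(1)[OF r sqs(2) M(2)] loc_sq_damping(2)[OF r sqs(2) M(2)]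
  have g1: "grad_ip L g w = grad_ip L g u - grad_ip L g v" "grad_ip L \<phi> w = grad_ip L \<phi> u - grad_ip L \<phi> v"
    unfolding w_def by (rule grad_ip_diff_right[OF g u v], rule grad_ip_diff_right[OF \<phi> u v])
  have i1: "ip L \<phi> w = ip L \<phi> u - ip L \<phi> v" unfolding w_def by (rule ip_diff_right[OF sqs(4,1,2)])
  have i2: "ip L (%x. U x - U' x) \<phi> = ip L U \<phi> - ip L U' \<phi>" by (rule ip_diff_left[OF sqs(4) sq])
  have d1: "ip L (%x. damping_deriv r (v x) (\<phi> x)) u - ip L (%x. damping_deriv r (v x) (\<phi> x)) v = ip L (%x. damping_deriv r (v x) (w x)) \<phi>"
  proof -
    have "ip L (%x. damping_deriv r (v x) (\<phi> x)) u - ip L (%x. damping_deriv r (v x) (\<phi> x)) v = ip L (%x. damping_deriv r (v x) (\<phi> x)) w"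
      unfolding w_def by (rule ip_diff_right[OF dsq(3)[OF sqs(4)] sqs(1,2), symmetric])
    also have "... = ip L (%x. damping_deriv r (v x) (w x)) \<phi>" unfolding ip_def damping_deriv_symmetric[of r _ "\<phi> _"] ..
    finally show ?thesis .
  qed
  have R: "ip L R \<phi> = ip L (%x. damping r (u x)) \<phi> - ip L (%x. damping r (v x)) \<phi> - ip L (%x. damping_deriv r (v x) (w x)) \<phi>"
    unfolding R_def w_def
    using ip_diff_left[OF sqs(4) loc_sq_diff[OF dsq(1,2)] dsq(3)[OF sqs(3)]] ip_diff_left[OF sqs(4) dsq(1,2)] by (simp add: w_def)
  have t1: "trilinear L u v \<phi> - trilinear L v v \<phi> = trilinear L w v \<phi>"
    unfolding w_def by (rule trilinear_diff(1)[OF S u v \<phi> v, symmetric])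
  have t2: "trilinear L v \<phi> u - trilinear L v \<phi> v = trilinear L v \<phi> w"
    unfolding w_def by (rule trilinear_diff(3)[OF S v \<phi> u v, symmetric])
  have t3: "trilinear L v \<phi> w = - trilinear L v w \<phi>" by (rule trilinear_antisym[OF L v \<phi> w M(2)])
  have t4: "trilinear L w w \<phi> = trilinear L u u \<phi> - trilinear L u v \<phi> - (trilinear L v u \<phi> - trilinear L v v \<phi>)"
    unfolding w_def trilinear_diff(1)[OF S u V_space_diff(1)[OF u v] \<phi> v] trilinear_diff(2)[OF S u u \<phi> v] trilinear_diff(2)[OF S v u \<phi> v] ..
  have t5: "trilinear L v w \<phi> = trilinear L v u \<phi> - trilinear L v v \<phi>" unfolding w_def by (rule trilinear_diff(2)[OF S v u \<phi> v])
  have A: "\<kappa> * grad_ip L g w = - (energy \<mu> L \<phi>t u) + energy \<mu> L \<phi>t v + \<nu> * grad_ip L \<phi> w + trilinear L w v \<phi> + trilinear L v w \<phi>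
      + \<alpha> * ip L \<phi> w + \<beta> * ip L (%x. damping_deriv r (v x) (w x)) \<phi>"
    using adj unfolding adjoint_residual_def energy_def d1[symmetric] g1 i1 right_diff_distrib distrib_left using t1 t2 t3 by linarith
  have B: "energy \<mu> L ut \<phi> - energy \<mu> L vt \<phi> + \<nu> * grad_ip L \<phi> w + trilinear L u u \<phi> - trilinear L v v \<phi> + \<alpha> * ip L \<phi> w
      + \<beta> * (ip L (%x. damping r (u x)) \<phi> - ip L (%x. damping r (v x)) \<phi>) = ip L (%x. U x - U' x) \<phi>"
    using st unfolding state_residual_def energy_def g1 i1 i2 right_diff_distrib
      ip_commute[of L u \<phi>] ip_commute[of L v \<phi>] grad_ip_commute[of L u \<phi>] grad_ip_commute[of L v \<phi>] by linarith
  show ?thesis unfolding R right_diff_distrib using A B t1 t4 t5 unfolding right_diff_distrib by linarith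
qed

lemma V_space_cong_AE:
  assumes f: "f \<in> V_space L" and f': "f' \<in> V_space L" and eq: "AE x in lborel. f x = f' x"
  shows "AE x in lborel. wD j f x = wD j f' x"
    "h \<in> V_space L ==> ip L f h = ip L f' h" "h \<in> V_space L ==> grad_ip L f h = grad_ip L f' h"
proof -
  have wd: "AE x in lborel. wD j f x = wD j f' x" for j
  proof -
    have "weak_partial j f' (wD j f)" by (rule weak_partial_cong_AE[OF V_spaceD(3)[OF f] eq]) (auto intro: loc_sqD V_spaceD f f')
    from wD_eq(2)[OF this] show ?thesis by eventually_elim simp
  qed
  then show "AE x in lborel. wD j f x = wD j f' x" .
  assume h: "h \<in> V_space L"
  note m = loc_sqD(1)[OF V_spaceD(2)[OF f]] loc_sqD(1)[OF V_spaceD(2)[OF h]] loc_sqD(1)[OF V_spaceD(2)[OF f']]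
  note m' = loc_sqD(1)[OF V_spaceD(4)[OF f]] loc_sqD(1)[OF V_spaceD(4)[OF h]] loc_sqD(1)[OF V_spaceD(4)[OF f']]
  show "ip L f h = ip L f' h" by (rule ip_cong_AE[OF m(1,2,3,2) eq]) simp
  have "ip L (wD j f) (wD j h) = ip L (wD j f') (wD j h)" for j by (rule ip_cong_AE[OF m'(1,2,3,2) wd]) simp
  then show "grad_ip L f h = grad_ip L f' h" unfolding grad_ip_def by simp
qed

lemma H_norm_sq_convex:
  assumes "loc_sq U" "loc_sq U'"
  shows "(H_norm L U')^2 + 2 * ip L U' (%x. U x - U' x) \<le> (H_norm L U)^2"
proof -
  note d = loc_sq_diff[OF assms]
  have "ip L U U = ip L U' U' + 2 * ip L U' (%x. U x - U' x) + ip L (%x. U x - U' x) (%x. U x - U' x)"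
    unfolding ip_diff_left[OF d assms] ip_diff_right[OF assms(1) assms] ip_diff_right[OF assms(2) assms] using ip_commute[of L U U'] by simp
  then show ?thesis unfolding H_norm_sq using ip_nonneg[of L "%x. U x - U' x"] by linarith
qed

lemma V_norm_sq_expand:
  assumes u: "u \<in> V_space L" and v: "v \<in> V_space L" and d: "d \<in> V_space L"
  shows "(V_norm L (%x. u x - d x))^2 = (V_norm L (%x. v x - d x))^2
    + 2 * grad_ip L (%x. v x - d x) (%x. u x - v x) + (V_norm L (%x. u x - v x))^2"
proof -
  note V = V_space_diff(1)[OF u d] V_space_diff(1)[OF v d] V_space_diff(1)[OF u v]
  show ?thesis
    unfolding V_norm_sq grad_ip_diff_left[OF V(1) u d] grad_ip_diff_left[OF V(2) v d] grad_ip_diff_left[OF V(3) v d] grad_ip_diff_left[OF V(3) u v]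
      grad_ip_diff_right[OF u u d] grad_ip_diff_right[OF d u d] grad_ip_diff_right[OF v v d] grad_ip_diff_right[OF d v d]
      grad_ip_diff_right[OF v u v] grad_ip_diff_right[OF d u v] grad_ip_diff_right[OF u u v]
    unfolding grad_ip_commute[of L v u] grad_ip_commute[of L d u] grad_ip_commute[of L d v] by (simp add: algebra_simps)
qed

text \<open>
  The data of the comparison: a competitor \<open>U\<close> with state \<open>u\<close>, the candidate \<open>U'\<close> with state \<open>v\<close>, and the adjoint
  state \<open>\<phi>\<close> of the candidate.
\<close>

locale compared_solutions =
  fixes L C T \<mu> \<nu> \<alpha> \<beta> \<kappa> r M :: real and U U' u ut v vt \<phi> \<phi>t ud :: tfield
  assumes S: "sobolev_embedding L C" and T: "0 < T" and mu: "0 \<le> \<mu>" and beta: "0 \<le> \<beta>" and kappa: "0 \<le> \<kappa>" and r: "r = 1 \<or> 2 \<le> r"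
    and U: "U \<in> L2H L T" and U': "U' \<in> L2H L T" and ud: "ud \<in> L2V L T"
    and u: "evolution L T u ut" and v: "evolution L T v vt" and \<phi>: "evolution L T \<phi> \<phi>t"
    and initial: "AE x in lborel. u 0 x = v 0 x"
    and M: "\<And>t. t \<in> {0<..T} ==> AE x in lborel. norm (u t x) \<le> M" "\<And>t. t \<in> {0<..T} ==> AE x in lborel. norm (v t x) \<le> M"
    and state: "\<And>z. z \<in> V_space L \<inter> Lp_space L (r + 1) ==> AE t\<in>{0..T} in lborel. state_residual L \<mu> \<nu> \<alpha> \<beta> r (U t) (u t) (ut t) z = 0"
      "\<And>z. z \<in> V_space L \<inter> Lp_space L (r + 1) ==> AE t\<in>{0..T} in lborel. state_residual L \<mu> \<nu> \<alpha> \<beta> r (U' t) (v t) (vt t) z = 0"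
    and adjoint: "\<And>z. z \<in> V_space L ==> AE t\<in>{0..T} in lborel. adjoint_residual L \<mu> \<nu> \<alpha> \<beta> r \<kappa> (v t) (%x. v t x - ud t x) (\<phi> t) (\<phi>t t) z = 0"
    and terminal: "\<And>z. z \<in> V_space L ==> energy \<mu> L (\<phi> T) z = 0"
begin

abbreviation "w t \<equiv> %x. u t x - v t x"
abbreviation "D t \<equiv> %x. U t x - U' t x"

lemma r1: "1 \<le> r" using r by linarith

lemma AE_bounds: "AE t\<in>{0..T} in lborel. AE x in lborel. norm (u t x) \<le> M" "AE t\<in>{0..T} in lborel. AE x in lborel. norm (v t x) \<le> M"
  using AE_lborel_singleton[of "0::real"] by (eventually_elim, use M in auto)+

lemma stVs: "stV L T u" "stV L T v" "stV L T \<phi>" "stV L T ut" "stV L T vt" "stV L T \<phi>t"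
  using u v \<phi> by (auto simp: evolution_def)

lemma stV_ud: "stV L T ud" by (rule L2V_stV[OF S ud])

lemma AE_controls: "AE t\<in>{0..T} in lborel. loc_sq (U t)" "AE t\<in>{0..T} in lborel. loc_sq (U' t)"
  using L2H_st_sq(2)[OF U] L2H_st_sq(2)[OF U'] by (auto elim: eventually_mono)

lemma AE_ud: "AE t\<in>{0..T} in lborel. ud t \<in> V_space L" using stV_ud by (simp add: stV_def)

lemma AE_residuals:
  "AE t\<in>{0..T} in lborel. state_residual L \<mu> \<nu> \<alpha> \<beta> r (U t) (u t) (ut t) (\<phi> t) = 0"
  "AE t\<in>{0..T} in lborel. state_residual L \<mu> \<nu> \<alpha> \<beta> r (U' t) (v t) (vt t) (\<phi> t) = 0"
  "AE t\<in>{0..T} in lborel. adjoint_residual L \<mu> \<nu> \<alpha> \<beta> r \<kappa> (v t) (%x. v t x - ud t x) (\<phi> t) (\<phi>t t) (u t) = 0"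
  "AE t\<in>{0..T} in lborel. adjoint_residual L \<mu> \<nu> \<alpha> \<beta> r \<kappa> (v t) (%x. v t x - ud t x) (\<phi> t) (\<phi>t t) (v t) = 0"
proof -
  show "AE t\<in>{0..T} in lborel. state_residual L \<mu> \<nu> \<alpha> \<beta> r (U t) (u t) (ut t) (\<phi> t) = 0"
    by (rule strong_solution_tested_by[OF S r1 T u AE_controls(1) AE_bounds(1) state(1) \<phi>])
  show "AE t\<in>{0..T} in lborel. state_residual L \<mu> \<nu> \<alpha> \<beta> r (U' t) (v t) (vt t) (\<phi> t) = 0"
    by (rule strong_solution_tested_by[OF S r1 T v AE_controls(2) AE_bounds(2) state(2) \<phi>])
  have g: "AE t\<in>{0..T} in lborel. (%x. v t x - ud t x) \<in> V_space L"
    using AE_ud by eventually_elim (use V_space_diff(1) evolution_V[OF v] in auto)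
  show "AE t\<in>{0..T} in lborel. adjoint_residual L \<mu> \<nu> \<alpha> \<beta> r \<kappa> (v t) (%x. v t x - ud t x) (\<phi> t) (\<phi>t t) (u t) = 0"
    by (rule adjoint_tested_by[OF S r1 T evolution_V[OF v] g AE_bounds(2) \<phi> adjoint u])
  show "AE t\<in>{0..T} in lborel. adjoint_residual L \<mu> \<nu> \<alpha> \<beta> r \<kappa> (v t) (%x. v t x - ud t x) (\<phi> t) (\<phi>t t) (v t) = 0"
    by (rule adjoint_tested_by[OF S r1 T evolution_V[OF v] g AE_bounds(2) \<phi> adjoint v])
qed

text \<open>
  Both quadratic parts of the cost are expanded around the candidate, and the linear term in \<open>w\<close> is replaced by the identity
  above. The difference of the energies on the left is a time derivative.
\<close>

lemma AE_cost_density: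
  assumes lam: "0 \<le> lam"
    and q: "AE t\<in>{0..T} in lborel. C * (V_norm L (\<phi> t) + \<beta> * (remainder_const r * M powr (r - 2)) * H_norm L (\<phi> t)) \<le> q"
  shows "AE t\<in>{0..T} in lborel.
    (energy \<mu> L (vt t) (\<phi> t) + energy \<mu> L (\<phi>t t) (v t)) - (energy \<mu> L (ut t) (\<phi> t) + energy \<mu> L (\<phi>t t) (u t))
      + (ip L (\<phi> t) (D t) + lam * ip L (U' t) (D t))
      + \<kappa> / 2 * (V_norm L (%x. v t x - ud t x))^2 + lam / 2 * (H_norm L (U' t))^2 + (\<kappa> / 2 - q) * (V_norm L (w t))^2
    \<le> \<kappa> / 2 * (V_norm L (%x. u t x - ud t x))^2 + lam / 2 * (H_norm L (U t))^2" using q AE_bounds AE_controls AE_ud AE_residuals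
proof eventually_elim
  case (elim t)
  show ?case
  proof
    assume t: "t \<in> {0..T}"
    note e = elim[rule_format, OF t]
    note V = evolution_V[OF u t] evolution_V[OF v t] evolution_V[OF \<phi> t]
    note id = cost_derivative_identity[OF S r1 V(1,2,3) V_space_diff(1)[OF V(2) e(6)] e(4,5) e(2,3) e(9,10,7,8)]
    let ?R = "%x. damping r (u t x) - damping r (v t x) - damping_deriv r (v t x) (u t x - v t x)"
    have "\<bar>trilinear L (w t) (w t) (\<phi> t) + \<beta> * ip L ?R (\<phi> t)\<bar> \<le> C * (V_norm L (\<phi> t) + \<beta> * (remainder_const r * M powr (r - 2)) * H_norm L (\<phi> t)) * (V_norm L (w t))^2"
      by (rule remainder_estimate[OF S r beta V e(2,3)])
    also have "... \<le> q * (V_norm L (w t))^2" using e(1) by (intro mult_right_mono) auto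
    finally have rem: "trilinear L (w t) (w t) (\<phi> t) + \<beta> * ip L ?R (\<phi> t) \<le> q * (V_norm L (w t))^2" by linarith
    have H: "lam / 2 * ((H_norm L (U' t))^2 + 2 * ip L (U' t) (D t)) \<le> lam / 2 * (H_norm L (U t))^2"
      using lam H_norm_sq_convex[OF e(4,5)] by (intro mult_left_mono) auto
    show "(energy \<mu> L (vt t) (\<phi> t) + energy \<mu> L (\<phi>t t) (v t)) - (energy \<mu> L (ut t) (\<phi> t) + energy \<mu> L (\<phi>t t) (u t))
      + (ip L (\<phi> t) (D t) + lam * ip L (U' t) (D t))
      + \<kappa> / 2 * (V_norm L (%x. v t x - ud t x))^2 + lam / 2 * (H_norm L (U' t))^2 + (\<kappa> / 2 - q) * (V_norm L (w t))^2
    \<le> \<kappa> / 2 * (V_norm L (%x. u t x - ud t x))^2 + lam / 2 * (H_norm L (U t))^2"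
      unfolding V_norm_sq_expand[OF V(1,2) e(6)] using id rem H ip_commute[of L "\<phi> t" "D t"] by (simp add: algebra_simps)
  qed
qed

text \<open>
  Both states have the same initial value, and the adjoint state vanishes at time \<open>T\<close> as a functional on \<open>V\<close>.
\<close>

lemma energy_boundary_terms:
  "(LINT t:{0..T}|lebesgue. energy \<mu> L (ut t) (\<phi> t) + energy \<mu> L (\<phi>t t) (u t)) = (LINT t:{0..T}|lebesgue. energy \<mu> L (vt t) (\<phi> t) + energy \<mu> L (\<phi>t t) (v t))"
proof -
  have 0: "0 \<in> {0..T}" "T \<in> {0..T}" using T by auto
  have "energy \<mu> L (u T) (\<phi> T) = 0" "energy \<mu> L (v T) (\<phi> T) = 0"
    using terminal[OF evolution_V[OF u 0(2)]] terminal[OF evolution_V[OF v 0(2)]]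
      energy_diff(3)[OF evolution_V[OF u 0(2)] evolution_V[OF \<phi> 0(2)] evolution_V[OF \<phi> 0(2)]]
      energy_diff(3)[OF evolution_V[OF v 0(2)] evolution_V[OF \<phi> 0(2)] evolution_V[OF \<phi> 0(2)]] by auto
  moreover have "energy \<mu> L (u 0) (\<phi> 0) = energy \<mu> L (v 0) (\<phi> 0)"
    using V_space_cong_AE(2,3)[OF evolution_V[OF u 0(1)] evolution_V[OF v 0(1)] initial evolution_V[OF \<phi> 0(1)]] by (simp add: energy_def)
  ultimately show ?thesis unfolding evolution_product[OF S mu T u \<phi>] evolution_product[OF S mu T v \<phi>] by simp
qed

lemma st_sq_D: "st_sq L T D" by (rule st_sq_diff[OF L2H_st_sq(1)[OF U] L2H_st_sq(1)[OF U']])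

lemma stV_diff: assumes f: "stV L T f" and g: "stV L T g" shows "set_integrable lebesgue {0..T} (%t. (V_norm L (%x. f t x - g t x))^2)"
proof -
  have i: "set_integrable lebesgue {0..T} (%t. grad_ip L (f t) (f t) - 2 * grad_ip L (f t) (g t) + grad_ip L (g t) (g t))"
    by (intro set_integral_add(1) set_integral_diff(1) set_integrable_mult_right stV_energy(2) f g)
  have ae: "AE t in lebesgue. indicat_real {0..T} t *\<^sub>R (grad_ip L (f t) (f t) - 2 * grad_ip L (f t) (g t) + grad_ip L (g t) (g t))
      = indicat_real {0..T} t *\<^sub>R (V_norm L (%x. f t x - g t x))^2"
  proof -
    have "AE t\<in>{0..T} in lborel. f t \<in> V_space L" "AE t\<in>{0..T} in lborel. g t \<in> V_space L" using f g by (auto simp: stV_def)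
    then show ?thesis unfolding AE_completion_iff
    proof eventually_elim
      case (elim t)
      show ?case
      proof (cases "t \<in> {0..T}")
        case True
        then have V: "f t \<in> V_space L" "g t \<in> V_space L" using elim by auto
        show ?thesis unfolding V_norm_sq grad_ip_diff_left[OF V_space_diff(1)[OF V] V] grad_ip_diff_right[OF V(1) V] grad_ip_diff_right[OF V(2) V]
          using grad_ip_commute[of L "f t" "g t"] by simp
      qed simp
    qed
  qed
  note i = i[unfolded set_integrable_def]
  show ?thesis unfolding set_integrable_def by (rule integrable_cong_AE_imp[OF i borel_measurable_AE[OF borel_measurable_integrable[OF i] ae] ae])
qed

lemma variational_integral:
  "(LINT z:OmegaT L T|lborel. (\<phi> (fst z) (snd z) + lam *\<^sub>R U' (fst z) (snd z)) \<bullet> D (fst z) (snd z))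
    = (LINT t:{0..T}|lebesgue. ip L (\<phi> t) (D t) + lam * ip L (U' t) (D t))"
  "set_integrable lebesgue {0..T} (%t. ip L (\<phi> t) (D t) + lam * ip L (U' t) (D t))"
proof -
  have f: "st_sq L T \<phi>" using stVs(3) by (simp add: stV_def)
  note g = L2H_st_sq(1)[OF U']
  note jm = f[unfolded st_sq_def, THEN conjunct1] g[unfolded st_sq_def, THEN conjunct1] st_sq_D[unfolded st_sq_def, THEN conjunct1]
  note [measurable] = measurable_cut2[OF jm(1)] measurable_cut2[OF jm(2)] measurable_cut2[OF jm(3)]
  note i1 = st_sq_ip[OF f st_sq_D] and i2 = st_sq_ip[OF g st_sq_D]
  let ?P = "lborel2 :: (real \<times> (real^3)) measure"
  let ?c = "%f z. tcut T f (fst z) (snd z)"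
  have "{0::real} \<times> (UNIV :: (real^3) set) \<in> null_sets ?P" by (rule null_setsI) (auto simp: lborel.emeasure_pair_measure_Times)
  then have n0: "AE z in ?P. z \<notin> {0} \<times> UNIV" by (rule AE_not_in)
  have "(LINT z:OmegaT L T|lborel. (\<phi> (fst z) (snd z) + lam *\<^sub>R U' (fst z) (snd z)) \<bullet> D (fst z) (snd z))
      = (LINT z|?P. (indicator {0<..T} (fst z) * indicator (cell L) (snd z)) * ((?c \<phi> z + lam *\<^sub>R ?c U' z) \<bullet> ?c D z))"
    unfolding set_lebesgue_integral_def lborel_prod by (rule Bochner_Integration.integral_cong) (auto simp: OmegaT_def indicator_def tcut_def)
  also have "... = (LINT z|?P. indicator (cell L) (snd z) * (?c \<phi> z \<bullet> ?c D z) + lam * (indicator (cell L) (snd z) * (?c U' z \<bullet> ?c D z)))"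
  proof (rule integral_cong_AE)
    show "AE z in ?P. (indicator {0<..T} (fst z) * indicator (cell L) (snd z)) * ((?c \<phi> z + lam *\<^sub>R ?c U' z) \<bullet> ?c D z)
        = indicator (cell L) (snd z) * (?c \<phi> z \<bullet> ?c D z) + lam * (indicator (cell L) (snd z) * (?c U' z \<bullet> ?c D z))"
      using n0 by eventually_elim (auto simp: indicator_def tcut_def algebra_simps inner_add_left)
  qed measurable
  also have "... = (LINT t|lborel. indicator {0..T} t * ip L (\<phi> t) (D t)) + lam * (LINT t|lborel. indicator {0..T} t * ip L (U' t) (D t))"
    unfolding i1(3) i2(3) using i1(1) i2(1) by simp
  also have "... = (LINT t|lborel. indicator {0..T} t * ip L (\<phi> t) (D t) + lam * (indicator {0..T} t * ip L (U' t) (D t)))"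
    using i1(2) i2(2) by simp
  finally have eq: "(LINT z:OmegaT L T|lborel. (\<phi> (fst z) (snd z) + lam *\<^sub>R U' (fst z) (snd z)) \<bullet> D (fst z) (snd z))
    = (LINT t|lborel. indicator {0..T} t * ip L (\<phi> t) (D t) + lam * (indicator {0..T} t * ip L (U' t) (D t)))" .
  have I: "integrable lborel (%t. indicator {0..T} t * ip L (\<phi> t) (D t) + lam * (indicator {0..T} t * ip L (U' t) (D t)))"
    using i1(2) i2(2) by simp
  have e: "indicat_real {0..T} t *\<^sub>R (ip L (\<phi> t) (D t) + lam * ip L (U' t) (D t)) = indicator {0..T} t * ip L (\<phi> t) (D t) + lam * (indicator {0..T} t * ip L (U' t) (D t))" for t
    by (simp add: algebra_simps)
  have "(LINT t:{0..T}|lebesgue. ip L (\<phi> t) (D t) + lam * ip L (U' t) (D t))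
    = (LINT t|lborel. indicator {0..T} t * ip L (\<phi> t) (D t) + lam * (indicator {0..T} t * ip L (U' t) (D t)))"
    unfolding set_lebesgue_integral_def e by (rule lebesgue_integral_AE_eq(2)[OF I AE_I2[OF refl]])
  with eq show "(LINT z:OmegaT L T|lborel. (\<phi> (fst z) (snd z) + lam *\<^sub>R U' (fst z) (snd z)) \<bullet> D (fst z) (snd z))
    = (LINT t:{0..T}|lebesgue. ip L (\<phi> t) (D t) + lam * ip L (U' t) (D t))" by (rule trans[OF _ sym])
  show "set_integrable lebesgue {0..T} (%t. ip L (\<phi> t) (D t) + lam * ip L (U' t) (D t))"
    unfolding set_integrable_def e by (rule lebesgue_integral_AE_eq(1)[OF I AE_I2[OF refl]])
qed

lemma cost_growth:
  assumes lam: "0 \<le> lam"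
    and q: "AE t\<in>{0..T} in lborel. C * (V_norm L (\<phi> t) + \<beta> * (remainder_const r * M powr (r - 2)) * H_norm L (\<phi> t)) \<le> q"
    and vi: "0 \<le> (LINT z:OmegaT L T|lborel. (\<phi> (fst z) (snd z) + lam *\<^sub>R U' (fst z) (snd z)) \<bullet> D (fst z) (snd z))"
  shows "\<kappa> / 2 * (LINT t:{0..T}|lebesgue. (V_norm L (%x. v t x - ud t x))^2) + lam / 2 * (LINT t:{0..T}|lebesgue. (H_norm L (U' t))^2)
      + (\<kappa> / 2 - q) * (LINT t:{0..T}|lebesgue. (V_norm L (w t))^2)
    \<le> \<kappa> / 2 * (LINT t:{0..T}|lebesgue. (V_norm L (%x. u t x - ud t x))^2) + lam / 2 * (LINT t:{0..T}|lebesgue. (H_norm L (U t))^2)"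
    (is "?a + ?b + ?c \<le> ?d")
proof -
  have iu: "set_integrable lebesgue {0..T} (%t. energy \<mu> L (ut t) (\<phi> t) + energy \<mu> L (\<phi>t t) (u t))"
    and iv: "set_integrable lebesgue {0..T} (%t. energy \<mu> L (vt t) (\<phi> t) + energy \<mu> L (\<phi>t t) (v t))"
    using stVs by (auto intro!: set_integral_add(1) stV_energy)
  have lin: "set_integrable N A e1 ==> set_integrable N A e2 ==> set_integrable N A p ==> set_integrable N A f1 ==> set_integrable N A f2 ==> set_integrable N A f3 ==>
      (LINT t:A|N. e1 t - e2 t + p t + x * f1 t + y * f2 t + z * f3 t) = (LINT t:A|N. e1 t) - (LINT t:A|N. e2 t) + (LINT t:A|N. p t)
        + x * (LINT t:A|N. f1 t) + y * (LINT t:A|N. f2 t) + z * (LINT t:A|N. f3 t)"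
    "set_integrable N A f1 ==> set_integrable N A f2 ==> (LINT t:A|N. x * f1 t + y * f2 t) = x * (LINT t:A|N. f1 t) + y * (LINT t:A|N. f2 t)"
    for N :: "real measure" and A e1 e2 p f1 f2 f3 and x y z :: real by (simp_all add: set_integral_add set_integral_diff)
  have iH: "set_integrable lebesgue {0..T} (%t. (H_norm L (U t))^2)" "set_integrable lebesgue {0..T} (%t. (H_norm L (U' t))^2)"
    using U U' by (auto simp: L2H_def L2_time_def)
  note i = stV_diff[OF stVs(1) stV_ud] stV_diff[OF stVs(2) stV_ud] stV_diff[OF stVs(1,2)] variational_integral(2)[of lam] iu iv iH
  have "(LINT t:{0..T}|lebesgue. (energy \<mu> L (vt t) (\<phi> t) + energy \<mu> L (\<phi>t t) (v t)) - (energy \<mu> L (ut t) (\<phi> t) + energy \<mu> L (\<phi>t t) (u t))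
      + (ip L (\<phi> t) (D t) + lam * ip L (U' t) (D t))
      + \<kappa> / 2 * (V_norm L (%x. v t x - ud t x))^2 + lam / 2 * (H_norm L (U' t))^2 + (\<kappa> / 2 - q) * (V_norm L (w t))^2)
    \<le> (LINT t:{0..T}|lebesgue. \<kappa> / 2 * (V_norm L (%x. u t x - ud t x))^2 + lam / 2 * (H_norm L (U t))^2)"
    (is "?l \<le> ?r") by (rule set_integral_mono_AE)
      (use AE_cost_density[OF lam q] in \<open>auto simp only: AE_completion_iff intro!: set_integral_add(1) set_integral_diff(1) set_integrable_mult_right i\<close>)
  moreover have "?l = (LINT t:{0..T}|lebesgue. energy \<mu> L (vt t) (\<phi> t) + energy \<mu> L (\<phi>t t) (v t))
      - (LINT t:{0..T}|lebesgue. energy \<mu> L (ut t) (\<phi> t) + energy \<mu> L (\<phi>t t) (u t))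
      + (LINT t:{0..T}|lebesgue. ip L (\<phi> t) (D t) + lam * ip L (U' t) (D t)) + ?a + ?b + ?c" by (rule lin(1)[OF iv iu i(4,2,8,3)])
  moreover have "?r = ?d" by (rule lin(2)[OF i(1,7)])
  ultimately show ?thesis using vi unfolding variational_integral(1) energy_boundary_terms by linarith
qed

end

section \<open>Fields orthogonal to all solenoidal test fields\<close>

text \<open>
  The kernel is a product over coordinates, up to the normalising factors.
\<close>

lemma mollifier_Pair:
  "\<exists>k. \<forall>s y. mollifier e (s :: 'a::euclidean_space, y :: 'b::euclidean_space) = k * (mollifier e s * mollifier e y)"
proof -
  have box: "box_bump (s, y) = box_bump s * box_bump y" for s :: 'a and y :: 'b unfolding box_bump_def Basis_prod_def
    by (subst prod.union_disjoint) (auto simp: prod.reindex inj_on_def)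
  let ?I = "%f. LINT x|lborel. f x :: real"
  let ?k = "?I (box_bump :: 'a => real) * ?I (box_bump :: 'b => real) / ?I (box_bump :: 'a \<times> 'b => real)"
  have "mollifier e (s, y) = ?k * (mollifier e s * mollifier e y)" for s :: 'a and y :: 'b
    using integral_box_bump_pos[where 'a='a] integral_box_bump_pos[where 'a='b] by (simp add: mollifier_def box power_add)
  then show ?thesis by blast
qed

lemma mollifier_abs_bounded:
  assumes "0 < e" shows "\<exists>B. \<forall>x::'a::euclidean_space. \<bar>mollifier e x\<bar> \<le> B"
proof -
  obtain B where "\<And>x::'a. mollifier e x \<le> B" using mollifier_bounded by metis
  then show ?thesis by (auto intro!: exI[of _ B] simp: abs_of_nonneg[OF mollifier_nonneg[OF assms]])
qed

text \<open>
  Cauchy--Schwarz in time, on the bounded interval.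
\<close>

lemma loc_sq_ti:
  assumes L: "0 < L" and T: "0 < T" and f: "st_sq L T f" and per: "AE t\<in>{0..T} in lborel. AE_periodic L (f t)"
    and c[measurable]: "c \<in> borel_measurable borel" and B: "\<And>t. \<bar>c t\<bar> \<le> B"
  shows "loc_sq (ti T c f)"
  unfolding loc_sq_def
proof (intro conjI allI impI)
  note jm = f[unfolded st_sq_def, THEN conjunct1]
  note [measurable] = measurable_cut2[OF jm] measurable_cut_section[OF jm] measurable_ti[OF jm c]
  show "ti T c f \<in> borel_measurable borel" by measurable
  have B0: "0 \<le> B" using B[of 0] by linarith
  fix K :: "(real^3) set" assume K: "compact K"
  have [measurable]: "K \<in> sets borel" using K by (rule borel_compact)
  let ?h = "%x. LINT t|lborel. (norm (indicat_real K x *\<^sub>R tcut T f t x))^2"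
  have I: "integrable lborel2 (%(t, x). (norm (indicat_real K x *\<^sub>R tcut T f t x))^2)"
    using st_sq_local(1)[OF L f per K] by (simp add: case_prod_unfold)
  show "set_integrable lborel K (%x. (norm (ti T c f x))^2)" unfolding set_integrable_def
  proof (rule integrable_dominated)
    show "integrable lborel (%x. (B^2 * T) * ?h x)" by (intro integrable_mult_right lborel_pair.integrable_snd[OF I])
    show "AE x in lborel. norm (indicat_real K x *\<^sub>R (norm (ti T c f x))^2) \<le> norm (B^2 * T * ?h x)"
      using lborel_pair.AE_integrable_snd[OF I]
    proof eventually_elim
      case (elim x)
      show ?case
      proof (cases "x \<in> K")
        case True
        then have i: "integrable lborel (%t. (norm (tcut T f t x))^2)" using elim by simp
        have ind: "(norm (indicat_real {0..T} t))^2 = indicat_real {0..T} t" for t by (simp add: indicator_def)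
        have ic: "integrable lborel (%t. (norm (indicat_real {0..T} t))^2)"
          unfolding ind by (rule integrable_real_indicator) (auto simp: emeasure_lborel_Icc_eq)
        have "norm (ti T c f x) \<le> (LINT t|lborel. norm (c t *\<^sub>R tcut T f t x))" unfolding ti_cut by (rule integral_norm_bound)
        also have "... \<le> (LINT t|lborel. B * (indicat_real {0..T} t \<bullet> norm (tcut T f t x)))"
        proof (rule integral_mono_AE')
          show "integrable lborel (%t. B * (indicat_real {0..T} t \<bullet> norm (tcut T f t x)))"
            by (intro integrable_mult_right integrable_inner_sq(1) ic) (use i in auto)
          show "AE t in lborel. norm (c t *\<^sub>R tcut T f t x) \<le> B * (indicat_real {0..T} t \<bullet> norm (tcut T f t x))"
            using B by (intro AE_I2) (auto simp: tcut_def indicator_def mult_right_mono)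
        qed (use B0 in simp)
        also have "... = B * (LINT t|lborel. indicat_real {0..T} t \<bullet> norm (tcut T f t x))" by simp
        also have "... \<le> B * (sqrt (LINT t|lborel. (norm (indicat_real {0..T} t))^2) * sqrt (LINT t|lborel. (norm (norm (tcut T f t x)))^2))"
          by (intro mult_left_mono order_trans[OF abs_ge_self integral_Cauchy_Schwarz] ic B0) (use i in auto)
        also have "(LINT t|lborel. (norm (indicat_real {0..T} t))^2) = T" unfolding ind using T by simp
        finally have "norm (ti T c f x) \<le> B * (sqrt T * sqrt (?h x))" using True by simp
        then have "(norm (ti T c f x))^2 \<le> (B * (sqrt T * sqrt (?h x)))^2" by (rule power_mono) simp
        also have "... = B^2 * T * ?h x" using T by (simp add: power_mult_distrib)
        finally show ?thesis using True by simp
      qed simp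
    qed
  qed measurable
qed

lemma solenoidal_ti:
  assumes L: "0 < L" and f: "st_sq L T f" and sol: "AE t\<in>{0..T} in lborel. solenoidal L (f t) \<and> loc_sq (f t)"
    and c[measurable]: "c \<in> borel_measurable borel" and B: "\<And>t. \<bar>c t\<bar> \<le> B"
  shows "solenoidal L (ti T c f)"
proof (rule solenoidalI)
  note jm = f[unfolded st_sq_def, THEN conjunct1]
  note [measurable] = measurable_cut2[OF jm] measurable_cut_section[OF jm]
  have per: "AE t\<in>{0..T} in lborel. AE_periodic L (f t)" using sol by eventually_elim (auto intro: solenoidalD(2))
  note I = st_sq_local(2)[OF L f per]
  show "ti T c f (x + L *\<^sub>R axis i 1) = ti T c f x" for x i unfolding ti_cut
    by (rule integral_cong_AE, measurable, use sol in \<open>eventually_elim, auto simp: tcut_def indicator_def solenoidalD(1)\<close>)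
  show "weak_div (ti T c f) (%_. 0)" unfolding weak_div_def
  proof (intro allI impI)
    fix psi :: "real^3 => real" assume t: "test_function UNIV psi"
    obtain K M where K: "compact K" "\<And>x. x \<notin> K ==> grad psi x = 0" "\<And>x. norm (grad psi x) \<le> M"
      using test_function_bounds[OF t] by metis
    have m: "grad psi \<in> borel_measurable borel" by (rule test_functionD(6)[OF t])
    have "(LINT x|lborel. grad psi x \<bullet> ti T c f x) = (LINT t|lborel. indicator {0..T} t * (c t * (LINT x|lborel. grad psi x \<bullet> f t x)))"
      by (rule ti_Fubini(2)[OF jm m c B weighted_support_integrable[OF jm K m I[OF K(1)]]])
    also have "... = 0"
    proof (rule integral_eq_zero_AE)
      show "AE s in lborel. indicator {0..T} s * (c s * (LINT x|lborel. grad psi x \<bullet> f s x)) = 0"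
        using sol by eventually_elim (use t in \<open>auto dest!: solenoidalD(3) simp: weak_div_def indicator_def\<close>)
    qed
    finally show "(LINT x|lborel. grad psi x \<bullet> ti T c f x) = - (LINT x|lborel. psi x * 0)" by simp
  qed
  have li: "loc_int (ti T c f)" by (rule loc_int_ti[OF jm c B I])
  have li0: "set_integrable lborel (cell L) (ti T c f)" by (rule loc_intD(2)[OF li compact_cell])
  show "(LINT x:cell L|lborel. ti T c f x) = 0"
  proof (rule euclidean_eq_leftI)
    fix b :: "real^3" assume "b \<in> Basis"
    let ?a = "%x. indicator (cell L) x *\<^sub>R b"
    have a: "?a \<in> borel_measurable borel" by measurable
    have K: "x \<notin> cell L ==> ?a x = 0" "norm (?a x) \<le> norm b" for x by (auto simp: indicator_def)
    have e: "(LINT x|lborel. ?a x \<bullet> h x) = b \<bullet> (LINT x:cell L|lborel. h x)" if "set_integrable lborel (cell L) h" for h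
      using integral_inner_right[OF that[unfolded set_integrable_def], of b] by (simp add: set_lebesgue_integral_def inner_commute)
    have "(LINT x|lborel. ?a x \<bullet> ti T c f x) = (LINT t|lborel. indicator {0..T} t * (c t * (LINT x|lborel. ?a x \<bullet> f t x)))"
      by (rule ti_Fubini(2)[OF jm a c B weighted_support_integrable[OF jm compact_cell K a I[OF compact_cell]]])
    also have "... = 0"
    proof (rule integral_eq_zero_AE)
      show "AE s in lborel. indicator {0..T} s * (c s * (LINT x|lborel. ?a x \<bullet> f s x)) = 0" using sol
      proof eventually_elim
        case (elim s)
        show ?case
        proof (cases "s \<in> {0..T}")
          case True
          then have s: "solenoidal L (f s)" "loc_sq (f s)" using elim by auto
          show ?thesis unfolding e[OF loc_intD(2)[OF loc_sq_imp_loc_int[OF s(2)] compact_cell]] solenoidalD(4)[OF s(1)] by simp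
        qed simp
      qed
    qed
    finally show "b \<bullet> (LINT x:cell L|lborel. ti T c f x) = b \<bullet> 0" unfolding e[OF li0] by simp
  qed
qed

lemma ip_self_zero_imp_zero:
  assumes L: "0 < L" and d: "loc_sq d" and per: "AE_periodic L d" and z: "ip L d d = 0"
  shows "AE x in lborel. d x = 0"
proof -
  have "AE x in lborel. indicator (cell L) x *\<^sub>R (d x \<bullet> d x) = 0" using z unfolding ip_def set_lebesgue_integral_def
    by (subst (asm) integral_nonneg_eq_0_iff_AE) (use ip_integrable[OF d d, of L] in \<open>auto simp: set_integrable_def\<close>)
  then have "AE x in lborel. x \<in> cell L \<longrightarrow> norm (d x) \<le> 0" by eventually_elim (auto simp: indicator_def)
  from AE_periodic_bound[OF L per loc_sqD(1)[OF d] this] show ?thesis by eventually_elim simp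
qed

text \<open>
  The time integral \<open>d\<close> is solenoidal, so that its mollifications are admissible test fields. They are orthogonal to \<open>d\<close> and
  converge to \<open>d\<close>; hence \<open>d\<close> is orthogonal to itself.
\<close>

lemma ti_orthogonal_imp_zero:
  assumes L: "0 < L" and T: "0 < T" and p: "0 < p" and f: "st_sq L T f" and sol: "AE t\<in>{0..T} in lborel. solenoidal L (f t) \<and> loc_sq (f t)"
    and c: "c \<in> borel_measurable borel" "\<And>t. \<bar>c t\<bar> \<le> B"
    and orth: "\<And>z. z \<in> V_space L \<inter> Lp_space L p ==> (LINT t|lborel. indicator {0..T} t * (c t * ip L (f t) z)) = 0"
  shows "AE x in lborel. ti T c f x = 0"
proof -
  let ?d = "ti T c f"
  have per: "AE t\<in>{0..T} in lborel. AE_periodic L (f t)" using sol by eventually_elim (auto intro: solenoidalD(2))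
  note d = solenoidal_ti[OF L f sol c] loc_sq_ti[OF L T f per c]
  have "ip L ?d (mollify e ?d) = 0" if e: "0 < e" "e \<le> L" for e
  proof -
    note m = mollify_in_V_space[OF L d e]
    have "ip L ?d (mollify e ?d) = (LINT x|lborel. (indicator (cell L) x *\<^sub>R mollify e ?d x) \<bullet> ti T c f x)"
      unfolding ip_def set_lebesgue_integral_def by (simp add: inner_commute)
    also have "... = (LINT t|lborel. indicator {0..T} t * (c t * ip L (f t) (mollify e ?d)))" by (rule ti_ip_Fubini(1)[OF f V_spaceD(2)[OF m(1)] c])
    also have "... = 0" by (rule orth) (use m p in auto)
    finally show ?thesis .
  qed
  then have "\<forall>\<^sub>F e in at_right 0. ip L ?d (mollify e ?d) = 0" unfolding eventually_at_right_field using L by (intro exI[of _ L]) auto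
  then have "ip L ?d ?d = 0" by (intro tendsto_unique[OF trivial_limit_at_right_real mollify_ip_limit[OF d(2,2)] tendsto_eventually])
  then show ?thesis by (rule ip_self_zero_imp_zero[OF L d(2) solenoidalD(2)[OF d(1)]])
qed

text \<open>
  A space-time mollification factorises: it mollifies in space the time integrals weighted with a mollifier in time, which
  vanish by the previous lemma. This avoids a choice of countably many test fields.
\<close>

lemma time_orthogonal_imp_zero:
  assumes L: "0 < L" and T: "0 < T" and p: "0 < p" and f: "st_sq L T f" and sol: "AE t\<in>{0..T} in lborel. solenoidal L (f t) \<and> loc_sq (f t)"
    and orth: "\<And>z e s. z \<in> V_space L \<inter> Lp_space L p ==> 0 < e ==>
      (LINT t|lborel. indicator {0..T} t * (mollifier e (s - t) * ip L (f t) z)) = 0"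
  shows "AE z in lborel. tcut T f (fst z) (snd z) = 0"
proof (rule mollify_zero_imp_AE_zero)
  note jm = f[unfolded st_sq_def, THEN conjunct1]
  note [measurable] = measurable_cut2[OF jm] measurable_cut_section[OF jm]
  have per: "AE t\<in>{0..T} in lborel. AE_periodic L (f t)" using sol by eventually_elim (auto intro: solenoidalD(2))
  note I = st_sq_local(2)[OF L f per]
  let ?G = "%z. tcut T f (fst z) (snd z)"
  show G: "loc_int ?G" unfolding loc_int_def
  proof (intro conjI allI impI)
    show "?G \<in> borel_measurable borel" using measurable_cut2[OF jm] unfolding lborel_prod by simp
    fix K :: "(real \<times> (real^3)) set" assume K: "compact K"
    have K2: "compact (snd ` K)" by (intro compact_continuous_image continuous_intros K)
    have [measurable]: "K \<in> sets borel" using K by (rule borel_compact)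
    have "integrable lborel (%z. indicator K z *\<^sub>R (indicator (snd ` K) (snd z) *\<^sub>R ?G z))"
      using I[OF K2] unfolding lborel_prod by (intro integrable_mult_indicator[of K lborel]) auto
    moreover have "(%z. indicator K z *\<^sub>R (indicator (snd ` K) (snd z) *\<^sub>R ?G z)) = (%z. indicator K z *\<^sub>R ?G z)"
      by (auto simp: fun_eq_iff indicator_def)
    ultimately show "set_integrable lborel K ?G" by (simp add: set_integrable_def)
  qed
  fix e :: real and w :: "real \<times> (real^3)" assume e: "0 < e"
  obtain s x where w: "w = (s, x)" by (cases w)
  obtain k where k: "\<And>s y. mollifier e (s :: real, y :: real^3) = k * (mollifier e s * mollifier e y)" using mollifier_Pair by metis
  obtain B where B: "\<And>t::real. \<bar>mollifier e t\<bar> \<le> B" using mollifier_abs_bounded[OF e] by metis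
  have cm: "(%t. mollifier e (s - t)) \<in> borel_measurable borel" by measurable
  have zero: "AE y in lborel. ti T (%t. mollifier e (s - t)) f y = 0" by (rule ti_orthogonal_imp_zero[OF L T p f sol cm B]) (rule orth[OF _ e])
  have i: "integrable lborel (%z. mollifier e (w - z) *\<^sub>R ?G z)" by (rule integrable_mollifier_mult[OF G e])
  show "mollify e ?G w = 0"
  proof (rule euclidean_eq_leftI)
    fix b :: "real^3" assume "b \<in> Basis"
    let ?a = "%y. mollifier e (x - y) *\<^sub>R b"
    obtain K M where K: "compact K" "\<And>y. y \<notin> K ==> mollifier e (x - y) = 0" "\<And>y. \<bar>mollifier e (x - y)\<bar> \<le> M"
      using test_function_bounds[OF test_function_mollifier[OF e, of x]] by metis
    have a: "?a \<in> borel_measurable borel" by measurable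
    have Ka: "y \<notin> K ==> ?a y = 0" "norm (?a y) \<le> M * norm b" for y using K(2,3) by (auto intro: mult_right_mono)
    have eq: "b \<bullet> (mollifier e (w - z) *\<^sub>R ?G z) = k * (mollifier e (s - fst z) * (?a (snd z) \<bullet> ?G z))" for z
      by (cases z) (simp add: w k)
    have i': "integrable lborel (%z. k * (mollifier e (s - fst z) * (?a (snd z) \<bullet> ?G z)))"
      using integrable_inner_right[OF i, of b] unfolding eq .
    have "b \<bullet> mollify e ?G w = (LINT z|lborel. k * (mollifier e (s - fst z) * (?a (snd z) \<bullet> ?G z)))"
      unfolding mollify_def using integral_inner_right[OF i, of b] unfolding eq by simp
    also have "... = (LINT t|lborel. LINT y|lborel. k * (mollifier e (s - t) * (?a y \<bullet> tcut T f t y)))"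
      by (rule lborel_pair.integral_fst'[OF i'[folded lborel_prod], unfolded lborel_prod fst_conv snd_conv, symmetric])
    also have "... = k * (LINT t|lborel. indicator {0..T} t * (mollifier e (s - t) * (LINT y|lborel. ?a y \<bullet> f t y)))"
    proof -
      have a: "?a y \<bullet> tcut T f t y = indicator {0..T} t * (?a y \<bullet> f t y)" for t y by (simp add: tcut_def)
      have "(LINT y|lborel. k * (m * (i * h y))) = k * (i * (m * (LINT y|lborel. h y)))" for m i :: real and h :: "real^3 => real"
        by (simp add: mult.left_commute)
      then show ?thesis unfolding a by (simp add: mult.left_commute)
    qed
    also have "(LINT t|lborel. indicator {0..T} t * (mollifier e (s - t) * (LINT y|lborel. ?a y \<bullet> f t y)))
        = (LINT y|lborel. ?a y \<bullet> ti T (%t. mollifier e (s - t)) f y)"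
      by (rule ti_Fubini(2)[OF jm a cm B weighted_support_integrable[OF jm K(1) Ka a I[OF K(1)]], symmetric])
    also have "... = 0" by (rule integral_eq_zero_AE) (use zero in \<open>eventually_elim, auto\<close>)
    finally show "b \<bullet> mollify e ?G w = b \<bullet> 0" by simp
  qed
qed

section \<open>Uniqueness\<close>

lemma V_norm_zero_imp_zero:
  assumes S: "sobolev_embedding L C" and f: "f \<in> V_space L" and z: "V_norm L f = 0"
  shows "AE x in lborel. f x = 0"
proof -
  obtain c where "H_norm L f \<le> c * V_norm L f" using poincare[OF S] f by blast
  then have "ip L f f = 0" using z H_norm_nonneg[of L f] H_norm_sq[of L f] by simp
  then show ?thesis
    using S by (intro ip_self_zero_imp_zero[OF _ V_spaceD(2)[OF f] solenoidalD(2)[OF V_spaceD(1)[OF f]]]) (simp_all add: sobolev_embedding_def)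
qed

lemma set_integrable_bounded_mult:
  fixes e :: "real => real"
  assumes e: "set_integrable lebesgue A e" and c: "c \<in> borel_measurable borel" and B: "\<And>t. \<bar>c t\<bar> \<le> B"
  shows "set_integrable lebesgue A (%t. c t * e t)"
  unfolding set_integrable_def
proof (rule integrable_dominated)
  note e = e[unfolded set_integrable_def]
  show "integrable lebesgue (%t. B * norm (indicat_real A t *\<^sub>R e t))" using e by (intro integrable_mult_right integrable_norm)
  have "(%t. c t * (indicat_real A t *\<^sub>R e t)) \<in> borel_measurable lebesgue"
    using c e by (intro borel_measurable_times) (auto intro: measurable_completion)
  then show "(%t. indicat_real A t *\<^sub>R (c t * e t)) \<in> borel_measurable lebesgue" by (simp add: mult_ac)
  have B0: "0 \<le> B" using B[of 0] by linarith
  show "AE t in lebesgue. norm (indicat_real A t *\<^sub>R (c t * e t)) \<le> norm (B * norm (indicat_real A t *\<^sub>R e t))"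
    using B B0 by (intro AE_I2) (auto simp: abs_mult indicator_def intro: mult_right_mono)
qed

lemma set_integral_cong_AE_time:
  fixes f g :: "real => real"
  assumes f: "set_integrable lebesgue {0..T} f" and g: "set_integrable lebesgue {0..T} g" and eq: "AE t\<in>{0..T} in lborel. f t = g t"
  shows "(LINT t:{0..T}|lebesgue. f t) = (LINT t:{0..T}|lebesgue. g t)"
  unfolding set_lebesgue_integral_def
proof (rule integral_cong_AE)
  show "AE t in lebesgue. indicat_real {0..T} t *\<^sub>R f t = indicat_real {0..T} t *\<^sub>R g t"
    unfolding AE_completion_iff using eq by eventually_elim (auto simp: indicator_def)
qed (use f g in \<open>auto simp: set_integrable_def\<close>)

context compared_solutions
begin

text \<open>
  If the states agree, the state equations differ by \<open>energy (ut - vt) z = ip D z\<close>. The left-hand side is a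
  weak time derivative of 0; multiplied by the smooth weight it has integral 0. The fundamental theorem of calculus is used for
  the zero function, with \<open>psi\<close> times the weight as a test function.
\<close>

lemma states_agree_imp_controls_orthogonal:
  assumes uv: "AE t\<in>{0..T} in lborel. AE x in lborel. u t x = v t x"
    and z: "z \<in> V_space L \<inter> Lp_space L (r + 1)" and e: "0 < e"
  shows "(LINT t|lborel. indicator {0..T} t * (mollifier e (s - t) * ip L (D t) z)) = 0"
proof -
  let ?c = "%t. mollifier e (s - t)"
  have L: "0 < L" using S by (simp add: sobolev_embedding_def)
  have zV: "z \<in> V_space L" using z by simp
  obtain B where B: "\<And>t::real. \<bar>mollifier e t\<bar> \<le> B" using mollifier_abs_bounded[OF e] by metis
  have cm: "?c \<in> borel_measurable borel" by measurable
  have AEeq: "AE t\<in>{0..T} in lborel. energy \<mu> L (u t) z = energy \<mu> L (v t) z \<and> ip L (D t) z = energy \<mu> L (ut t) z - energy \<mu> L (vt t) z"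
    using uv state(1)[OF z] state(2)[OF z] AE_controls
  proof eventually_elim
    case (elim t)
    show ?case
    proof
      assume t: "t \<in> {0..T}"
      note e = elim[rule_format, OF t]
      note V = evolution_V[OF u t] evolution_V[OF v t]
      note eq = V_space_cong_AE[OF V e(1)]
      note [measurable] = loc_sqD(1)[OF V_spaceD(2)[OF V(1)]] loc_sqD(1)[OF V_spaceD(2)[OF V(2)]] loc_sqD(1)[OF V_spaceD(2)[OF zV]]
        loc_sqD(1)[OF V_spaceD(4)[OF V(1)]] loc_sqD(1)[OF V_spaceD(4)[OF V(2)]]
      have "AE x in lborel. \<forall>j. wD j (u t) x = wD j (v t) x" unfolding AE_all_countable using eq(1) by blast
      then have conv: "AE x in lborel. (\<Sum>j\<in>UNIV. (u t x $ j) *\<^sub>R wD j (u t) x) = (\<Sum>j\<in>UNIV. (v t x $ j) *\<^sub>R wD j (v t) x)"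
        using e(1) by eventually_elim simp
      have tri: "trilinear L (u t) (u t) z = trilinear L (v t) (v t) z"
        unfolding trilinear_def by (rule ip_cong_AE[OF _ _ _ _ conv AE_I2[OF refl]]; measurable)
      have damp: "ip L (%x. damping r (u t x)) z = ip L (%x. damping r (v t x)) z"
        by (rule ip_cong_AE, measurable) (use e(1) in \<open>auto elim: eventually_mono\<close>)
      have "ip L (D t) z = ip L (U t) z - ip L (U' t) z" by (rule ip_diff_left[OF V_spaceD(2)[OF zV] e(4,5)])
      then show "energy \<mu> L (u t) z = energy \<mu> L (v t) z \<and> ip L (D t) z = energy \<mu> L (ut t) z - energy \<mu> L (vt t) z"
        using e(2,3) eq(2,3)[OF zV] tri damp unfolding state_residual_def energy_def by simp
    qed
  qed
  have iE: "set_integrable lebesgue {0..T} (%t. energy \<mu> L (f t) z)" if "stV L T f" for f by (rule stV_energy(1)[OF that stV_const[OF zV]])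
  have iD: "set_integrable lebesgue {0..T} (%t. ip L (D t) z)"
    using lebesgue_integral_AE_eq(1)[OF st_sq_ip(2)[OF st_sq_D st_sq_const[OF V_spaceD(2)[OF zV]]] AE_I2[OF refl]] by (simp add: set_integrable_def)
  note ic = set_integrable_bounded_mult[OF iD cm B]
  have "0 - 0 = (LINT t:{0<..T}|lebesgue. ?c t * ip L (D t) z)"
  proof (rule weak_derivative_FTC[OF T _ ic, of "%_. 0"])
    fix psi assume t: "test_function {0<..<T} psi"
    let ?p = "%t. psi t * ?c t"
    have tp: "test_function {0<..<T} ?p" by (rule test_function_mult(1)[OF t test_functionD(1)[OF test_function_mollifier[OF e]]])
    obtain M where M: "\<And>x. \<bar>?p x\<bar> \<le> M" "\<And>x. norm (grad ?p x) \<le> M" using test_function_bounds[OF tp] by metis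
    note pm = test_functionD(5,6)[OF tp]
    have ip: "set_integrable lebesgue {0..T} (%t. ?p t * energy \<mu> L (f t) z)" "set_integrable lebesgue {0..T} (%t. deriv ?p t * energy \<mu> L (f t) z)" if "stV L T f" for f
      unfolding deriv_eq_grad[OF tp] using M by (auto intro!: set_integrable_bounded_mult iE that pm)
    have "(LINT t:{0..T}|lebesgue. ?p t * energy \<mu> L (ut t) z) = (LINT t:{0..T}|lebesgue. ?p t * energy \<mu> L (vt t) z)"
    proof -
      have "(LINT t:{0..T}|lebesgue. deriv ?p t * energy \<mu> L (u t) z) = (LINT t:{0..T}|lebesgue. deriv ?p t * energy \<mu> L (v t) z)"
        by (rule set_integral_cong_AE_time[OF ip(2)[OF stVs(1)] ip(2)[OF stVs(2)]]) (use AEeq in \<open>auto elim: eventually_mono\<close>)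
      then show ?thesis unfolding evolution_test[OF L u zV tp] evolution_test[OF L v zV tp] by simp
    qed
    then have "0 = (LINT t:{0..T}|lebesgue. ?p t * energy \<mu> L (ut t) z - ?p t * energy \<mu> L (vt t) z)"
      unfolding set_integral_diff(2)[OF ip(1)[OF stVs(4)] ip(1)[OF stVs(5)]] by simp
    also have "... = (LINT t:{0..T}|lebesgue. ?p t * ip L (D t) z)"
      by (rule set_integral_cong_AE_time[OF set_integral_diff(1)[OF ip(1)[OF stVs(4)] ip(1)[OF stVs(5)]] set_integrable_bounded_mult[OF iD pm(1) M(1)]])
        (use AEeq in \<open>eventually_elim, auto simp: right_diff_distrib\<close>)
    finally show "(LINT t:{0..T}|lebesgue. deriv psi t * 0) = - (LINT t:{0..T}|lebesgue. psi t * (?c t * ip L (D t) z))" by (simp add: mult.assoc)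
  qed (use T in auto)
  also have "... = (LINT t:{0..T}|lebesgue. ?c t * ip L (D t) z)" unfolding set_lebesgue_integral_def
  proof (rule integral_cong_AE)
    have "AE t in lebesgue. t \<noteq> (0::real)" unfolding AE_completion_iff by (rule AE_lborel_singleton)
    then show "AE t in lebesgue. indicat_real {0<..T} t *\<^sub>R (?c t * ip L (D t) z) = indicat_real {0..T} t *\<^sub>R (?c t * ip L (D t) z)"
      by eventually_elim (auto simp: indicator_def)
    have "set_integrable lebesgue {0<..T} (%t. ?c t * ip L (D t) z)" by (rule set_integrable_subset[OF ic]) auto
    then show "(%t. indicat_real {0<..T} t *\<^sub>R (?c t * ip L (D t) z)) \<in> borel_measurable lebesgue" by (auto simp: set_integrable_def)
  qed (use ic in \<open>auto simp: set_integrable_def\<close>)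
  also have "... = (LINT t|lborel. indicator {0..T} t * (?c t * ip L (D t) z))" unfolding set_lebesgue_integral_def real_scaleR_def
    by (rule lebesgue_integral_AE_eq(2)[OF ti_ip_Fubini(2)[OF st_sq_D V_spaceD(2)[OF zV] cm B] AE_I2[OF refl]])
  finally show ?thesis by simp
qed

lemma states_agree_imp_controls_agree:
  assumes uv: "AE t\<in>{0..T} in lborel. AE x in lborel. u t x = v t x"
  shows "AE y\<in>OmegaT L T in lborel. U (fst y) (snd y) = U' (fst y) (snd y)"
proof -
  have L: "0 < L" using S by (simp add: sobolev_embedding_def)
  have sol: "AE t\<in>{0..T} in lborel. solenoidal L (D t) \<and> loc_sq (D t)"
    using L2H_st_sq(2)[OF U] L2H_st_sq(2)[OF U'] by eventually_elim (auto intro!: solenoidal_diff loc_sq_diff loc_sq_imp_loc_int)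
  have "AE y in lborel. tcut T D (fst y) (snd y) = 0"
    by (rule time_orthogonal_imp_zero[OF L T _ st_sq_D sol states_agree_imp_controls_orthogonal[OF uv]]) (use r1 in auto)
  then show ?thesis by eventually_elim (auto simp: OmegaT_def tcut_def)
qed

text \<open>
  Growth of the cost with a positive factor forces the gradient of \<open>w\<close>, and by the Poincare inequality \<open>w\<close> itself, to vanish.
\<close>

lemma cheaper_control_agrees:
  assumes lam: "0 \<le> lam"
    and q: "AE t\<in>{0..T} in lborel. C * (V_norm L (\<phi> t) + \<beta> * (remainder_const r * M powr (r - 2)) * H_norm L (\<phi> t)) \<le> q" "q < \<kappa> / 2"
    and vi: "0 \<le> (LINT z:OmegaT L T|lborel. (\<phi> (fst z) (snd z) + lam *\<^sub>R U' (fst z) (snd z)) \<bullet> D (fst z) (snd z))"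
    and le: "\<kappa> / 2 * (LINT t:{0..T}|lebesgue. (V_norm L (%x. u t x - ud t x))^2) + lam / 2 * (LINT t:{0..T}|lebesgue. (H_norm L (U t))^2)
      \<le> \<kappa> / 2 * (LINT t:{0..T}|lebesgue. (V_norm L (%x. v t x - ud t x))^2) + lam / 2 * (LINT t:{0..T}|lebesgue. (H_norm L (U' t))^2)"
  shows "AE y\<in>OmegaT L T in lborel. U (fst y) (snd y) = U' (fst y) (snd y)"
proof (rule states_agree_imp_controls_agree)
  have "(\<kappa> / 2 - q) * (LINT t:{0..T}|lebesgue. (V_norm L (w t))^2) \<le> 0" using cost_growth[OF lam q(1) vi] le by linarith
  then have "(LINT t:{0..T}|lebesgue. (V_norm L (w t))^2) \<le> 0" using q(2) by (simp add: mult_le_0_iff)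
  moreover have "0 \<le> (LINT t:{0..T}|lebesgue. (V_norm L (w t))^2)" by (simp add: set_lebesgue_integral_def)
  ultimately have "(LINT t:{0..T}|lebesgue. (V_norm L (w t))^2) = 0" by simp
  then have "AE t in lebesgue. indicat_real {0..T} t *\<^sub>R (V_norm L (w t))^2 = 0" unfolding set_lebesgue_integral_def
    by (subst (asm) integral_nonneg_eq_0_iff_AE) (use stV_diff[OF stVs(1,2)] in \<open>auto simp: set_integrable_def\<close>)
  then show "AE t\<in>{0..T} in lborel. AE x in lborel. u t x = v t x" unfolding AE_completion_iff
  proof eventually_elim
    case (elim t)
    show ?case
    proof
      assume t: "t \<in> {0..T}"
      then have "V_norm L (w t) = 0" using elim by simp
      from V_norm_zero_imp_zero[OF S V_space_diff(1)[OF evolution_V[OF u t] evolution_V[OF v t]] this]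
      show "AE x in lborel. u t x = v t x" by eventually_elim simp
    qed
  qed
qed

end

theorem theorem7p1:
  fixes r :: real
  assumes r: "r = 1 \<or> r \<ge> 2"
  shows "\<exists>Cr::real. Cr > 0 \<and>
    (\<forall>(L::real) (T::real) (\<mu>::real) (\<nu>::real) (\<alpha>::real) (\<beta>::real) (\<kappa>::real) (lam::real)
      (u0::field) (ud::tfield) (Umin::tfield) (Umax::tfield) (Uad::tfield set) (UU::tfield set)
      (S::tfield \<Rightarrow> tfield) (C::real) (Cstar::real) (C2::real) (Ut::tfield) (\<phi>::tfield).
      L > 0 \<and> T > 0 \<and> \<mu> > 0 \<and> \<nu> > 0 \<and> \<alpha> > 0 \<and> \<beta> > 0 \<and> \<kappa> > 0 \<and> lam \<ge> 0 \<and>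
      u0 \<in> H2_space L \<inter> V_space L \<and> ud \<in> L2V L T \<and>
      Umin \<in> Linf_OmegaT L T \<and> Umax \<in> Linf_OmegaT L T \<and>
      (AE z\<in>OmegaT L T in lborel. \<forall>i. Umin (fst z) (snd z) $ i \<le> Umax (fst z) (snd z) $ i) \<and>
      Uad = admissible_controls L T Umin Umax \<and>
      UU \<noteq> {} \<and> open_in_L2H L T UU \<and> bounded_in_L2H L T UU \<and> Uad \<subseteq> UU \<and>
      (\<forall>U\<in>UU. strong_solution L T \<mu> \<nu> \<alpha> \<beta> r u0 U (S U)) \<and>
      C > 0 \<and> (\<forall>v\<in>V_space L. v \<in> Lp_space L 4 \<and> Lp_norm L 4 v \<le> sqrt C * V_norm L v) \<and>
      Cstar > 0 \<and> (\<forall>v\<in>H2_space L. Linf_norm L v \<le> ereal (Cstar * H2_norm L v)) \<and>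
      C2 > 0 \<and> (\<forall>U\<in>UU. \<forall>t\<in>{0<..T}. (H2_norm L (S U t))\<^sup>2 \<le> C2) \<and>
      Ut \<in> Uad \<and> adjoint_state L T \<mu> \<nu> \<alpha> \<beta> r \<kappa> ud (S Ut) \<phi> \<and>
      variational_inequality L T lam Uad Ut \<phi>
      \<longrightarrow>
      (ereal (\<kappa> / 2) \<ge> threshold L T r \<beta> C Cr (Cstar * sqrt C2) \<phi> \<longrightarrow>
         global_optimal Uad (cost L T \<kappa> lam ud S) Ut) \<and>
      (ereal (\<kappa> / 2) > threshold L T r \<beta> C Cr (Cstar * sqrt C2) \<phi> \<longrightarrow>
         (\<forall>U. global_optimal Uad (cost L T \<kappa> lam ud S) U \<longrightarrow>
            (AE z\<in>OmegaT L T in lborel. U (fst z) (snd z) = Ut (fst z) (snd z)))))"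
proof -
  define Cr where "Cr = (if 2 < r then remainder_const r / 2 else 1)"
  have Cr_pos: "0 < Cr"
  proof (cases "2 < r")
    case True
    then have "0 < (r - 1)^2 + 3 * (r - 1)" by (intro add_pos_pos) auto
    then show ?thesis using True by (simp add: Cr_def remainder_const_def)
  qed (simp add: Cr_def)
  have Cr: "2 < r ==> 2 * Cr = remainder_const r" by (simp add: Cr_def)
  show ?thesis
  proof (intro exI[of _ Cr] conjI[OF Cr_pos] allI impI, elim conjE, goal_cases)
    case (1 L T \<mu> \<nu> \<alpha> \<beta> \<kappa> lam u0 ud Umin Umax Uad UU S C Cstar C2 Ut \<phi>)
    note [simp] = \<open>Uad = admissible_controls L T Umin Umax\<close>
    let ?M = "Cstar * sqrt C2"
    have emb: "sobolev_embedding L C" using 1 by (simp add: sobolev_embedding_def)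
    have M: "0 < ?M" using 1 by simp
    have state: "\<exists>ut. evolution L T (S U) ut \<and> (\<forall>t\<in>{0<..T}. AE x in lborel. norm (S U t x) \<le> ?M) \<and> (AE x in lborel. S U 0 x = u0 x) \<and>
        (\<forall>z\<in>V_space L \<inter> Lp_space L (r + 1). AE t\<in>{0..T} in lborel. state_residual L \<mu> \<nu> \<alpha> \<beta> r (U t) (S U t) (ut t) z = 0)"
      if U: "U \<in> Uad" for U
    proof -
      have UU: "U \<in> UU" using U \<open>Uad \<subseteq> UU\<close> by blast
      then have "strong_solution L T \<mu> \<nu> \<alpha> \<beta> r u0 U (S U)" using 1 by blast
      then obtain ut where ut: "H1_time T 2 (H2_space L) (H2_norm L) (S U) ut" "AE x in lborel. S U 0 x = u0 x"
        "\<And>z. z \<in> V_space L \<inter> Lp_space L (r + 1) ==> AE t\<in>{0<..<T} in lebesgue.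
          ip L (ut t) z + \<mu> * grad_ip L (ut t) z + \<nu> * grad_ip L (S U t) z + trilinear L (S U t) (S U t) z + \<alpha> * ip L (S U t) z
            + \<beta> * ip L (%x. damping r (S U t x)) z = ip L (U t) z" unfolding strong_solution_def by blast
      have "evolution L T (S U) ut" by (rule H1_time_evolution[OF emb ut(1)[unfolded numeral_2_eq_2] H2_space_subset_V_space V_norm_le_H2_norm])
      moreover have "AE x in lborel. norm (S U t x) \<le> ?M" if t: "t \<in> {0<..T}" for t
      proof -
        have H2: "S U t \<in> H2_space L" using ut(1) t by (auto simp: H1_time_def)
        show ?thesis by (rule H2_bound_imp_sup_bound[OF _ H2]) (use 1 UU t H2 in blast)+
      qed
      moreover have "AE t\<in>{0..T} in lborel. state_residual L \<mu> \<nu> \<alpha> \<beta> r (U t) (S U t) (ut t) z = 0"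
        if "z \<in> V_space L \<inter> Lp_space L (r + 1)" for z using ut(3)[OF that] unfolding AE_time_iff state_residual_def by eventually_elim simp
      ultimately show ?thesis using ut(2) by blast
    qed
    obtain vt where vt: "evolution L T (S Ut) vt" "\<And>t. t \<in> {0<..T} ==> AE x in lborel. norm (S Ut t x) \<le> ?M" "AE x in lborel. S Ut 0 x = u0 x"
      "\<And>z. z \<in> V_space L \<inter> Lp_space L (r + 1) ==> AE t\<in>{0..T} in lborel. state_residual L \<mu> \<nu> \<alpha> \<beta> r (Ut t) (S Ut t) (vt t) z = 0"
      using state[OF \<open>Ut \<in> Uad\<close>] by blast
    obtain \<phi>t where \<phi>t: "H1_time T 1 (V_space L) (V_norm L) \<phi> \<phi>t"
      "\<And>z. z \<in> V_space L ==> AE t\<in>{0<..<T} in lebesgue.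
          - ip L (\<phi>t t) z - \<mu> * grad_ip L (\<phi>t t) z + \<nu> * grad_ip L (\<phi> t) z
          + trilinear L z (S Ut t) (\<phi> t) - trilinear L (S Ut t) (\<phi> t) z
          + \<alpha> * ip L (\<phi> t) z + \<beta> * ip L (%x. damping_deriv r (S Ut t x) (\<phi> t x)) z
          = \<kappa> * grad_ip L (%x. S Ut t x - ud t x) z"
      "\<And>z. z \<in> V_space L ==> ip L (\<phi> T) z + \<mu> * grad_ip L (\<phi> T) z = 0"
      using \<open>adjoint_state L T \<mu> \<nu> \<alpha> \<beta> r \<kappa> ud (S Ut) \<phi>\<close> unfolding adjoint_state_def by blast
    have \<phi>: "evolution L T \<phi> \<phi>t" by (rule H1_time_evolution[OF emb \<phi>t(1)[unfolded One_nat_def]]) auto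
    have adj: "AE t\<in>{0..T} in lborel. adjoint_residual L \<mu> \<nu> \<alpha> \<beta> r \<kappa> (S Ut t) (%x. S Ut t x - ud t x) (\<phi> t) (\<phi>t t) z = 0"
      if "z \<in> V_space L" for z using \<phi>t(2)[OF that] unfolding AE_time_iff adjoint_residual_def by eventually_elim simp
    have compared: "\<exists>ut. compared_solutions L C T \<mu> \<nu> \<alpha> \<beta> \<kappa> r ?M U Ut (S U) ut (S Ut) vt \<phi> \<phi>t ud" if U: "U \<in> Uad" for U
    proof -
      obtain ut where ut: "evolution L T (S U) ut" "\<And>t. t \<in> {0<..T} ==> AE x in lborel. norm (S U t x) \<le> ?M" "AE x in lborel. S U 0 x = u0 x"
        "\<And>z. z \<in> V_space L \<inter> Lp_space L (r + 1) ==> AE t\<in>{0..T} in lborel. state_residual L \<mu> \<nu> \<alpha> \<beta> r (U t) (S U t) (ut t) z = 0"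
        using state[OF U] by blast
      have "compared_solutions L C T \<mu> \<nu> \<alpha> \<beta> \<kappa> r ?M U Ut (S U) ut (S Ut) vt \<phi> \<phi>t ud"
      proof
        show "AE x in lborel. S U 0 x = S Ut 0 x" using ut(3) vt(3) by eventually_elim simp
        show "U \<in> L2H L T" "Ut \<in> L2H L T" using U \<open>Ut \<in> Uad\<close> by (auto simp: admissible_controls_def)
        show "energy \<mu> L (\<phi> T) z = 0" if "z \<in> V_space L" for z using \<phi>t(3)[OF that] by (simp add: energy_def)
        show "AE t\<in>{0..T} in lborel. state_residual L \<mu> \<nu> \<alpha> \<beta> r (U t) (S U t) (ut t) z = 0"
          "AE t\<in>{0..T} in lborel. state_residual L \<mu> \<nu> \<alpha> \<beta> r (Ut t) (S Ut t) (vt t) z = 0" if "z \<in> V_space L \<inter> Lp_space L (r + 1)" for z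
          by (rule ut(4)[OF that], rule vt(4)[OF that])
        show "AE t\<in>{0..T} in lborel. adjoint_residual L \<mu> \<nu> \<alpha> \<beta> r \<kappa> (S Ut t) (%x. S Ut t x - ud t x) (\<phi> t) (\<phi>t t) z = 0" if "z \<in> V_space L" for z
          by (rule adj[OF that])
        show "AE x in lborel. norm (S U t x) \<le> ?M" "AE x in lborel. norm (S Ut t x) \<le> ?M" if "t \<in> {0<..T}" for t
          by (rule ut(2)[OF that], rule vt(2)[OF that])
        show "0 \<le> \<mu>" "0 \<le> \<beta>" "0 \<le> \<kappa>" using \<open>0 < \<mu>\<close> \<open>0 < \<beta>\<close> \<open>0 < \<kappa>\<close> by auto
      qed (fact emb r ut(1) vt(1) \<phi> \<open>0 < T\<close> \<open>ud \<in> L2V L T\<close>)+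
      then show ?thesis by blast
    qed
    have vi: "0 \<le> (LINT z:OmegaT L T|lborel. (\<phi> (fst z) (snd z) + lam *\<^sub>R Ut (fst z) (snd z)) \<bullet> (U (fst z) (snd z) - Ut (fst z) (snd z)))"
      if "U \<in> Uad" for U using \<open>variational_inequality L T lam Uad Ut \<phi>\<close> that unfolding variational_inequality_def by blast
    have weight: "AE t\<in>{0..T} in lborel. C * (V_norm L (\<phi> t) + \<beta> * (remainder_const r * ?M powr (r - 2)) * H_norm L (\<phi> t)) \<le> q"
      if "threshold L T r \<beta> C Cr ?M \<phi> \<le> ereal q" for q by (rule adjoint_weight_le_threshold[OF r _ M _ _ Cr that]) (use 1 in auto)
    have optimal: "cost L T \<kappa> lam ud S Ut \<le> cost L T \<kappa> lam ud S U" if q: "threshold L T r \<beta> C Cr ?M \<phi> \<le> ereal (\<kappa> / 2)" and U: "U \<in> Uad" for U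
    proof -
      obtain ut where "compared_solutions L C T \<mu> \<nu> \<alpha> \<beta> \<kappa> r ?M U Ut (S U) ut (S Ut) vt \<phi> \<phi>t ud" using compared[OF U] by blast
      from compared_solutions.cost_growth[OF this \<open>0 \<le> lam\<close> weight[OF q] vi[OF U]] show ?thesis unfolding cost_def by simp
    qed
    have unique: "AE z\<in>OmegaT L T in lborel. U (fst z) (snd z) = Ut (fst z) (snd z)"
      if th: "threshold L T r \<beta> C Cr ?M \<phi> < ereal (\<kappa> / 2)" and opt: "global_optimal Uad (cost L T \<kappa> lam ud S) U" for U
    proof -
      obtain q where q: "threshold L T r \<beta> C Cr ?M \<phi> < ereal q" "ereal q < ereal (\<kappa> / 2)" using ereal_dense2[OF th] by blast
      have U: "U \<in> Uad" and le: "cost L T \<kappa> lam ud S U \<le> cost L T \<kappa> lam ud S Ut"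
        using opt \<open>Ut \<in> Uad\<close> by (auto simp: global_optimal_def)
      obtain ut where "compared_solutions L C T \<mu> \<nu> \<alpha> \<beta> \<kappa> r ?M U Ut (S U) ut (S Ut) vt \<phi> \<phi>t ud" using compared[OF U] by blast
      from compared_solutions.cheaper_control_agrees[OF this \<open>0 \<le> lam\<close> weight[OF less_imp_le[OF q(1)]] _ vi[OF U]] q(2) le
      show ?thesis unfolding cost_def by simp
    qed
    show ?case using optimal unique \<open>Ut \<in> Uad\<close> unfolding global_optimal_def by blast
  qed
qed

end
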